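(* Suppose $Q\in\mathscr L^{(\infty)}_0$. (i) Let $2>\varepsilon>0$ and $Q\in\mathscr L^{(0)}_\varepsilon$. Then the family $\{-\frac\varepsilon2\le\Re(m)\}\ni m\mapsto H_m$ is regular. (ii) Let $Q\in\mathscr L^{(0)}_0$. Then the family $\{\Re(m)\ge0,\ m\ne0\}\ni m\mapsto H_m$ is regular. If moreover $Q\in\mathscr L^{(0)}_{0,\ln^2}$, then $m=0$ can be included, i.e. $\{\Re(m)\ge0\}\ni m\mapsto H_m$ is regular.
   Context: $Q:]0,\infty[\to\mathbb C$ locally integrable; $L_{m^2}:=-\partial_x^2+(m^2-\frac14)x^{-2}+Q(x)$ on $AC^1]0,\infty[$ (functions with absolutely continuous derivative). $Q\in\mathscr L^{(\infty)}_0$ iff $\int_1^\infty|Q|<\infty$; $Q\in\mathscr L^{(0)}_\varepsilon$ iff $\int_0^1x^{1-\varepsilon}|Q|<\infty$; $Q\in\mathscr L^{(0)}_{0,\ln^2}$ iff $\int_0^1x(1+|\ln x|^2)|Q|<\infty$. $\mathcal D(L^{\max}_{m^2}):=\{f\in L^2]0,\infty[\cap AC^1]0,\infty[:L_{m^2}f\in L^2]0,\infty[\}$; $\mathscr W(f,g;0):=\lim_{x\to0}(f(x)g'(x)-f'(x)g(x))$. $H_m$ is the closed operator on $L^2]0,\infty[$ given by restricting $L_{m^2}$ to $\mathcal D(H_m):=\{f\in\mathcal D(L^{\max}_{m^2}):\mathscr W(x^{\frac12+m},f;0)=0\}$. A family $z\mapsto H(z)$ of closed operators on an open set is holomorphic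 if for every $z_0$ there are $\lambda\in\mathbb C$ and a neighborhood $\Theta_0$ of $z_0$ such that $\lambda$ is in the resolvent set of $H(z)$ for $z\in\Theta_0$ and $z\mapsto(f|(H(z)-\lambda)^{-1}g)$ is holomorphic on $\Theta_0$ for all $f,g$; continuity is defined in the same way with "holomorphic" replaced by "continuous" (weak resolvent sense). A family on a set $\Omega\subset\mathbb C$ is regular if it is continuous on $\Omega$ and holomorphic on the interior of $\Omega$. *)

theory Defs
  imports "HOL-Analysis.Analysis"
begin

text \<open>Elements of L^2]0,\<infinity>[ are represented by functions real => complex;
  everything below is invariant under a.e. modification on ]0,\<infinity>[.\<close>

definition L2 :: "(real \<Rightarrow> complex) \<Rightarrow> bool" where
  "L2 f \<longleftrightarrow> set_borel_measurable lborel {0<..} f \<and>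
              set_integrable lborel {0<..} (\<lambda>x. (norm (f x))\<^sup>2)"

definition L2norm :: "(real \<Rightarrow> complex) \<Rightarrow> real" where
  "L2norm f = sqrt (LINT x:{0<..}|lborel. (norm (f x))\<^sup>2)"

definition ip :: "(real \<Rightarrow> complex) \<Rightarrow> (real \<Rightarrow> complex) \<Rightarrow> complex" where
  "ip f g = (LINT x:{0<..}|lborel. cnj (f x) * g x)"

definition loc_int :: "(real \<Rightarrow> complex) \<Rightarrow> bool" where
  "loc_int Q \<longleftrightarrow> (\<forall>a b. 0 < a \<longrightarrow> a \<le> b \<longrightarrow> set_integrable lborel {a..b} Q)"

definition Linf0 :: "(real \<Rightarrow> complex) \<Rightarrow> bool" where
  "Linf0 Q \<longleftrightarrow> set_integrable lborel {1..} Q"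

definition L0eps :: "real \<Rightarrow> (real \<Rightarrow> complex) \<Rightarrow> bool" where
  "L0eps \<epsilon> Q \<longleftrightarrow> set_integrable lborel {0<..1} (\<lambda>x. of_real (x powr (1 - \<epsilon>)) * Q x)"

definition L0ln2 :: "(real \<Rightarrow> complex) \<Rightarrow> bool" where
  "L0ln2 Q \<longleftrightarrow> set_integrable lborel {0<..1} (\<lambda>x. of_real (x * (1 + (ln x)\<^sup>2)) * Q x)"

definition AC1_data :: "(real \<Rightarrow> complex) \<Rightarrow> (real \<Rightarrow> complex) \<Rightarrow> (real \<Rightarrow> complex) \<Rightarrow> bool" where
  "AC1_data f f' f'' \<longleftrightarrow>
     (\<forall>x>0. (f has_vector_derivative f' x) (at x)) \<and> loc_int f'' \<and>
     (\<forall>a b. 0 < a \<longrightarrow> a \<le> b \<longrightarrow> f' b - f' a = (LINT x:{a..b}|lborel. f'' x))"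

definition pw :: "complex \<Rightarrow> real \<Rightarrow> complex" where
  "pw m x = (of_real x) powr (1/2 + m)"

definition pw' :: "complex \<Rightarrow> real \<Rightarrow> complex" where
  "pw' m x = (1/2 + m) * (of_real x) powr (m - 1/2)"

text \<open>Graph of H_m: Hm Q m f h means f \<in> D(H_m) and H_m f = h (a.e.).\<close>
definition Hm :: "(real \<Rightarrow> complex) \<Rightarrow> complex \<Rightarrow> (real \<Rightarrow> complex) \<Rightarrow> (real \<Rightarrow> complex) \<Rightarrow> bool" where
  "Hm Q m f h \<longleftrightarrow> L2 f \<and> L2 h \<and>
     (\<exists>f' f''. AC1_data f f' f'' \<and>
        (AE x in lborel. 0 < x \<longrightarrow>
           h x = - f'' x + ((m\<^sup>2 - 1/4) / (of_real x)\<^sup>2) * f x + Q x * f x) \<and>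
        ((\<lambda>x. pw m x * f' x - pw' m x * f x) \<longlongrightarrow> 0) (at_right 0))"

type_synonym graph = "(real \<Rightarrow> complex) \<Rightarrow> (real \<Rightarrow> complex) \<Rightarrow> bool"

definition ae_eq :: "(real \<Rightarrow> complex) \<Rightarrow> (real \<Rightarrow> complex) \<Rightarrow> bool" where
  "ae_eq f g \<longleftrightarrow> (AE x in lborel. 0 < x \<longrightarrow> f x = g x)"

definition in_resolvent :: "graph \<Rightarrow> complex \<Rightarrow> bool" where
  "in_resolvent H lam \<longleftrightarrow>
     (\<forall>g. L2 g \<longrightarrow> (\<exists>f. H f (\<lambda>x. g x + lam * f x))) \<and>
     (\<forall>f1 h1 f2 h2. H f1 h1 \<longrightarrow> H f2 h2 \<longrightarrow>
        ae_eq (\<lambda>x. h1 x - lam * f1 x) (\<lambda>x. h2 x - lam * f2 x) \<longrightarrow> ae_eq f1 f2) \<and>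
     (\<exists>C. \<forall>f h. H f h \<longrightarrow> L2norm f \<le> C * L2norm (\<lambda>x. h x - lam * f x))"

text \<open>(H - \<lambda>)^{-1} g (determined up to a.e. equality when \<lambda> is in the resolvent set).\<close>
definition resolv :: "graph \<Rightarrow> complex \<Rightarrow> (real \<Rightarrow> complex) \<Rightarrow> (real \<Rightarrow> complex)" where
  "resolv H lam g = (SOME f. H f (\<lambda>x. g x + lam * f x))"

definition holomorphic_family :: "(complex \<Rightarrow> graph) \<Rightarrow> complex set \<Rightarrow> bool" where
  "holomorphic_family H \<Theta> \<longleftrightarrow>
     (\<forall>z0\<in>\<Theta>. \<exists>lam \<Theta>0. open \<Theta>0 \<and> z0 \<in> \<Theta>0 \<and> \<Theta>0 \<subseteq> \<Theta> \<and>
        (\<forall>z\<in>\<Theta>0. in_resolvent (H z) lam) \<and>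
        (\<forall>f g. L2 f \<longrightarrow> L2 g \<longrightarrow> (\<lambda>z. ip f (resolv (H z) lam g)) holomorphic_on \<Theta>0))"

definition continuous_family :: "(complex \<Rightarrow> graph) \<Rightarrow> complex set \<Rightarrow> bool" where
  "continuous_family H \<Omega> \<longleftrightarrow>
     (\<forall>z0\<in>\<Omega>. \<exists>lam e. e > 0 \<and>
        (\<forall>z\<in>\<Omega> \<inter> ball z0 e. in_resolvent (H z) lam) \<and>
        (\<forall>f g. L2 f \<longrightarrow> L2 g \<longrightarrow> continuous_on (\<Omega> \<inter> ball z0 e) (\<lambda>z. ip f (resolv (H z) lam g))))"

definition regular_family :: "(complex \<Rightarrow> graph) \<Rightarrow> complex set \<Rightarrow> bool" where
  "regular_family H \<Omega> \<longleftrightarrow> continuous_family H \<Omega> \<and> holomorphic_family H (interior \<Omega>)"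

end

theory Submission
  imports Defs "HOL-Complex_Analysis.Complex_Analysis" "HOL-Real_Asymp.Real_Asymp"
begin

text \<open>
  By a dilation, \<open>H\<^sub>m + k\<^sup>2\<close> becomes \<open>H\<^sub>m + 1\<close> for the potential
  \<open>k\<^sup>-\<^sup>2 Q(x/k)\<close>, whose weighted \<open>L\<^sup>1\<close> norm tends to 0 as \<open>k \<rightarrow> \<infinity>\<close>.
  The equation \<open>y'' = (m\<^sup>2 - 1/4) x\<^sup>-\<^sup>2 y + Q y + y\<close> is a perturbation of the one with
  potential \<open>(m\<^sup>2 - 1/4) x\<^sup>-\<^sup>2\<close> on \<open>]0,1]\<close> and 1 on \<open>]1,\<infinity>[\<close>, which is solved
  by elementary functions. Volterra equations from 0 and from infinity give a solution \<open>u\<close>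
  behaving like \<open>x\<^sup>1\<^sup>/\<^sup>2\<^sup>+\<^sup>m\<close> at 0 and a solution \<open>v\<close> behaving like \<open>e\<^sup>-\<^sup>x\<close>
  at infinity; both are limits of iterated parameter integrals, hence continuous, and holomorphic
  in the interior, as functions of \<open>m\<close>. If the Jost function (the normalized Wronskian of \<open>u\<close> and
  \<open>v\<close>) does not vanish, then \<open>u(x\<^sub><) v(x\<^sub>>)\<close> is, up to a factor, the resolvent kernel; it is bounded
  on \<open>L\<^sup>2\<close> by the Schur test, uniformly for \<open>m\<close> close to a given point. For \<open>Q = 0\<close> the Jost function
  does not vanish: otherwise \<open>u\<close> decays, the ladder operators \<open>m \<mapsto> m + 1\<close> yield decaying solutions
  for all \<open>m + n\<close>, and this is impossible for large \<open>n\<close> since \<open>\<bar>u\<bar>\<^sup>2\<close> becomes convex. For large \<open>k\<close>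
  and \<open>m\<close> close to a given point it then does not vanish either.
\<close>

section \<open>Indefinite Lebesgue integrals on the half-line\<close>

text \<open>Cutting the reference potential at 1 has a price: the perturbation never vanishes. Even
  for \<open>Q = 0\<close> it contains 1 on ]0,1] and \<open>(m^2 - 1/4)/x^2\<close> beyond, so the
  free Jost function is not explicit and its zeros must be excluded by an argument. In exchange, the
  dilation leaves the reference pair fixed, while a spectral parameter \<open>-k^2\<close> would
  change it, and smallness of the dilated \<open>Q\<close> becomes a plain statement about
  integrals. The obstacle is m = 0, where x^(1/2+m) and x^(1/2-m) merge and the second solution
  acquires a logarithm. Hence two parameters run through the proof: \<open>\<eta>\<close> with
  \<open>Re m \<ge> -\<eta>/2\<close>, and \<open>\<sigma>\<close>, which switches a factor 1 + |ln
  x| in the weights. Away from 0 the logarithm is traded for a constant of size 1/|m|; near 0, part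
  (i) pays for it with half of \<open>\<epsilon>\<close>, part (ii) with the logarithmic hypothesis.
  The bound \<open>\<eta> < 2\<close> keeps \<open>Re m > -1\<close>, where the reference Wronskian
  \<open>-(3/2 + m)\<close> stays away from 0 and the ladder argument starts.\<close>

text \<open>\<open>F\<close> is absolutely continuous on \<open>]0,\<infinity>[\<close> with a.e. derivative \<open>f\<close>; the values at
  \<open>x \<le> 0\<close> are arbitrary.\<close>

definition ac :: "(real \<Rightarrow> 'a::{real_normed_field,euclidean_space}) \<Rightarrow> (real \<Rightarrow> 'a) \<Rightarrow> bool" where
  "ac F f \<longleftrightarrow> (\<forall>a b. 0 < a \<longrightarrow> a \<le> b \<longrightarrow>
     set_integrable lborel {a..b} f \<and> F b - F a = (LINT x:{a..b}|lborel. f x))"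

lemma acI:
  assumes "\<And>a b. 0 < a \<Longrightarrow> a \<le> b \<Longrightarrow> set_integrable lborel {a..b} f"
    and "\<And>a b. 0 < a \<Longrightarrow> a \<le> b \<Longrightarrow> F b - F a = (LINT x:{a..b}|lborel. f x)"
  shows "ac F f"
  using assms by (auto simp: ac_def)

lemma ac_integrable: "ac F f \<Longrightarrow> 0 < a \<Longrightarrow> set_integrable lborel {a..b} f"
  by (cases "a \<le> b") (auto simp: ac_def set_integrable_def)

lemma ac_eq: "ac F f \<Longrightarrow> 0 < a \<Longrightarrow> a \<le> b \<Longrightarrow> F b - F a = (LINT x:{a..b}|lborel. f x)"
  by (auto simp: ac_def)

lemma ac_continuous:
  assumes "ac F f" shows "continuous_on {0<..} F"
proof -
  have "continuous (at x) F" if "x > 0" for x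
  proof -
    have int: "set_integrable lborel {x/2..x+1} f"
      using assms that by (intro ac_integrable) auto
    have "continuous_on {x/2..x+1} (\<lambda>y. F (x/2) + integral {x/2..y} f)"
      using set_borel_integral_eq_integral(1)[OF int]
      by (intro continuous_intros indefinite_integral_continuous_1)
    moreover have "F (x/2) + integral {x/2..y} f = F y" if "y \<in> {x/2..x+1}" for y
      using ac_eq[OF assms, of "x/2" y] that \<open>x>0\<close>
        set_borel_integral_eq_integral(2)[OF set_integrable_subset[OF int, of "{x/2..y}"]]
      by (auto simp: algebra_simps)
    ultimately have "continuous_on {x/2..x+1} F"
      by (metis (no_types, lifting) continuous_on_cong)
    then show ?thesis
      using that by (intro continuous_on_interior[of "{x/2..x+1}"]) auto
  qed
  then show ?thesis
    by (intro continuous_at_imp_continuous_on) auto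
qed

lemma ac_continuous_on: "ac F f \<Longrightarrow> A \<subseteq> {0<..} \<Longrightarrow> continuous_on A F"
  by (meson ac_continuous continuous_on_subset)

lemma ac_has_derivative:
  assumes "ac F f" "continuous_on {0<..} f" "x > 0"
  shows "(F has_vector_derivative f x) (at x)"
proof -
  have cont: "continuous_on {x/2..x+1} f"
    using assms by (auto intro: continuous_on_subset)
  have "((\<lambda>y. integral {x/2..y} f) has_vector_derivative f x) (at x within {x/2..x+1})"
    using assms by (intro integral_has_vector_derivative cont) auto
  moreover have "integral {x/2..y} f = F y - F (x/2)" if "y \<in> {x/2..x+1}" for y
    using ac_eq[OF assms(1), of "x/2" y] that assms(3)
      set_borel_integral_eq_integral(2)[OF ac_integrable[OF assms(1), of "x/2" y]] by auto
  ultimately have "((\<lambda>y. F y - F (x/2)) has_vector_derivative f x) (at x within {x/2..x+1})"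
    using assms(3) by (subst has_vector_derivative_cong_ev[where g="\<lambda>y. integral {x/2..y} f"]) auto
  then have "((\<lambda>y. (F y - F (x/2)) + F (x/2)) has_vector_derivative f x + 0) (at x within {x/2..x+1})"
    by (intro derivative_intros)
  moreover have "at x within {x/2..x+1} = at x"
    using assms(3) by (intro at_within_interior) auto
  ultimately show ?thesis by simp
qed

lemma ac_C1:
  assumes "\<And>x. x > 0 \<Longrightarrow> (F has_vector_derivative f x) (at x)" "continuous_on {0<..} f"
  shows "ac F f"
proof (rule acI)
  fix a b :: real assume ab: "0 < a" "a \<le> b"
  have c: "continuous_on {a..b} f"
    using ab assms(2) by (auto intro: continuous_on_subset)
  show int: "set_integrable lborel {a..b} f"
    by (rule borel_integrable_atLeastAtMost'[OF c])
  have "(f has_integral F b - F a) {a..b}"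
    using ab assms by (intro fundamental_theorem_of_calculus) (auto intro: has_vector_derivative_at_within)
  then show "F b - F a = (LINT x:{a..b}|lborel. f x)"
    by (simp add: set_borel_integral_eq_integral(2)[OF int] integral_unique)
qed

lemma ac_cong:
  assumes "ac F f" "\<And>x. x > 0 \<Longrightarrow> F x = G x" "\<And>x. x > 0 \<Longrightarrow> f x = g x"
  shows "ac G g"
proof (rule acI)
  fix a b :: real assume ab: "0 < a" "a \<le> b"
  show "set_integrable lborel {a..b} g"
    using ac_integrable[OF assms(1) ab(1), of b] ab assms(3)
    by (subst set_integrable_cong[of lborel lborel "{a..b}" "{a..b}" g f]) auto
  show "G b - G a = (LINT x:{a..b}|lborel. g x)"
    using ac_eq[OF assms(1) ab] ab assms
    by (subst set_lebesgue_integral_cong[of "{a..b}" lborel g f]) auto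
qed

text \<open>\<open>lborel\<close> is not complete, so a.e. equality does not transfer measurability;
  this is why it is assumed of \<open>g\<close>. The lemma is for the differential equation in
  \<open>Hm\<close>, which holds only a.e.\<close>

lemma ac_cong_AE:
  assumes "ac F f" and "AE x in lborel. 0 < x \<longrightarrow> f x = g x"
    and "\<And>a b. 0 < a \<Longrightarrow> a \<le> b \<Longrightarrow> set_borel_measurable lborel {a..b} g"
  shows "ac F g"
proof (rule acI)
  fix a b :: real assume ab: "0 < a" "a \<le> b"
  have ae: "AE x in lborel. indicat_real {a..b} x *\<^sub>R f x = indicat_real {a..b} x *\<^sub>R g x"
    using assms(2) by eventually_elim (use ab in \<open>auto simp: indicator_def\<close>)
  have m: "(\<lambda>x. indicat_real {a..b} x *\<^sub>R g x) \<in> borel_measurable lborel"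
    using assms(3)[OF ab] by (simp add: set_borel_measurable_def)
  have mf: "(\<lambda>x. indicat_real {a..b} x *\<^sub>R f x) \<in> borel_measurable lborel"
    using ac_integrable[OF assms(1) ab(1), of b] by (auto simp: set_integrable_def)
  show "set_integrable lborel {a..b} g"
    using ac_integrable[OF assms(1) ab(1), of b] unfolding set_integrable_def
    by (rule integrable_cong_AE_imp[OF _ m ae])
  show "F b - F a = (LINT x:{a..b}|lborel. g x)"
    unfolding ac_eq[OF assms(1) ab] set_lebesgue_integral_def
    by (rule integral_cong_AE[OF mf m ae])
qed

lemma ac_const: "ac (\<lambda>x. c) (\<lambda>x. 0)"
  by (rule acI) (auto simp: set_integrable_def)

lemma ac_add:
  assumes "ac F f" "ac G g" shows "ac (\<lambda>x. F x + G x) (\<lambda>x. f x + g x)"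
proof (rule acI)
  fix a b :: real assume ab: "0 < a" "a \<le> b"
  note i = ac_integrable[OF assms(1) ab(1), of b] ac_integrable[OF assms(2) ab(1), of b]
  show "set_integrable lborel {a..b} (\<lambda>x. f x + g x)" using i by (rule set_integral_add(1))
  show "F b + G b - (F a + G a) = (LINT x:{a..b}|lborel. f x + g x)"
    using ac_eq[OF assms(1) ab] ac_eq[OF assms(2) ab] set_integral_add(2)[OF i]
    by (metis add_diff_add)
qed

lemma ac_cmult:
  assumes "ac F f" shows "ac (\<lambda>x. c * F x) (\<lambda>x. c * f x)"
proof (rule acI)
  fix a b :: real assume ab: "0 < a" "a \<le> b"
  show "set_integrable lborel {a..b} (\<lambda>x. c * f x)"
    using ac_integrable[OF assms(1) ab(1), of b] by simp
  show "c * F b - c * F a = (LINT x:{a..b}|lborel. c * f x)"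
    using ac_eq[OF assms(1) ab] by (simp flip: right_diff_distrib)
qed

lemma ac_minus: "ac F f \<Longrightarrow> ac (\<lambda>x. - F x) (\<lambda>x. - f x)"
  using ac_cmult[of F f "-1"] by simp

lemma ac_diff: "ac F f \<Longrightarrow> ac G g \<Longrightarrow> ac (\<lambda>x. F x - G x) (\<lambda>x. f x - g x)"
  using ac_add[of F f "\<lambda>x. - G x" "\<lambda>x. - g x"] ac_minus[of G g] by simp

lemma set_integrable_mult_continuous:
  fixes f g :: "real \<Rightarrow> 'a::{real_normed_field,euclidean_space}"
  assumes "set_integrable lborel {a..b} f" "continuous_on {a..b} g"
  shows "set_integrable lborel {a..b} (\<lambda>x. f x * g x)"
proof -
  have "compact (g ` {a..b})" using assms(2) by (intro compact_continuous_image) auto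
  then obtain B where B: "\<And>x. x \<in> {a..b} \<Longrightarrow> norm (g x) \<le> B"
    by (metis compact_imp_bounded bounded_iff image_eqI)
  have m1: "(\<lambda>x. indicat_real {a..b} x *\<^sub>R f x) \<in> borel_measurable borel"
    using borel_measurable_integrable[OF assms(1)[unfolded set_integrable_def]] by simp
  have m2: "(\<lambda>x. indicat_real {a..b} x *\<^sub>R g x) \<in> borel_measurable borel"
    using set_measurable_continuous_on[of "{a..b}" g] assms(2)
    by (simp add: borel_measurable_continuous_on_indicator)
  have "(\<lambda>x. (indicat_real {a..b} x *\<^sub>R f x) * (indicat_real {a..b} x *\<^sub>R g x)) \<in> borel_measurable borel"
    by (rule borel_measurable_times[OF m1 m2])
  moreover have "(\<lambda>x. (indicat_real {a..b} x *\<^sub>R f x) * (indicat_real {a..b} x *\<^sub>R g x))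
      = (\<lambda>x. indicat_real {a..b} x *\<^sub>R (f x * g x))"
    by (auto simp: fun_eq_iff indicator_def)
  ultimately have m: "set_borel_measurable lborel {a..b} (\<lambda>x. f x * g x)"
    unfolding set_borel_measurable_def by simp
  have i: "set_integrable lborel {a..b} (\<lambda>x. B *\<^sub>R f x)" using assms(1) by simp
  show ?thesis
  proof (rule set_integrable_bound[OF i m], intro AE_I2 impI)
    fix x assume "x \<in> {a..b}"
    then have "norm (g x) \<le> \<bar>B\<bar>" using B[of x] by simp
    then show "norm (f x * g x) \<le> norm (B *\<^sub>R f x)"
      using mult_right_mono[of "norm (g x)" "\<bar>B\<bar>" "norm (f x)"]
      by (simp add: norm_mult mult.commute)
  qed
qed

lemma integrable_product_mult:
  fixes f g :: "real \<Rightarrow> 'a::{real_normed_field,euclidean_space}"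
  assumes "integrable lborel f" "integrable lborel g"
  shows "integrable (lborel \<Otimes>\<^sub>M lborel) (\<lambda>(x,y). f x * g y)"
proof (rule lborel_pair.Fubini_integrable)
  have [measurable]: "f \<in> borel_measurable borel" "g \<in> borel_measurable borel" 
    using assms by auto
  show "(\<lambda>(x, y). f x * g y) \<in> borel_measurable (lborel \<Otimes>\<^sub>M lborel)"
    by measurable
  show "integrable lborel (\<lambda>x. LINT y|lborel. norm (case (x, y) of (x, y) \<Rightarrow> f x * g y))"
    using assms by (simp add: norm_mult)
  show "AE x in lborel. integrable lborel (\<lambda>y. case (x, y) of (x, y) \<Rightarrow> f x * g y)"
    using assms by simp
qed

text \<open>Integration by parts through Fubini: \<open>f x * g y\<close> integrates over the square
  to \<open>(F b - F a) * (G b - G a)\<close>, and its two triangles y \<le> x and x < y give the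
  integrals of \<open>f * (G - G a)\<close> and \<open>(F - F a) * g\<close>.\<close>

lemma ac_mult:
  fixes F G :: "real \<Rightarrow> 'a::{real_normed_field,euclidean_space}"
  assumes "ac F f" "ac G g" shows "ac (\<lambda>x. F x * G x) (\<lambda>x. f x * G x + F x * g x)"
proof (rule acI)
  fix a b :: real assume ab: "0 < a" "a \<le> b"
  have sub: "{a..b} \<subseteq> {0<..}" using ab by auto
  have i1: "set_integrable lborel {a..b} (\<lambda>x. f x * G x)"
    using ac_integrable[OF assms(1) ab(1)] ac_continuous_on[OF assms(2) sub]
    by (intro set_integrable_mult_continuous) auto
  have i2': "set_integrable lborel {a..b} (\<lambda>x. g x * F x)"
    using ac_integrable[OF assms(2) ab(1)] ac_continuous_on[OF assms(1) sub]
    by (intro set_integrable_mult_continuous) auto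
  then have i2: "set_integrable lborel {a..b} (\<lambda>x. F x * g x)" by (simp add: mult.commute)
  show "set_integrable lborel {a..b} (\<lambda>x. f x * G x + F x * g x)"
    using i1 i2 by (rule set_integral_add(1))
  define f1 g1 where "f1 x = indicat_real {a..b} x *\<^sub>R f x"
    and "g1 x = indicat_real {a..b} x *\<^sub>R g x" for x
  have if1: "integrable lborel f1" and ig1: "integrable lborel g1"
    using ac_integrable[OF assms(1) ab(1), of b] ac_integrable[OF assms(2) ab(1), of b]
    unfolding f1_def g1_def set_integrable_def by auto
  have [measurable]: "f1 \<in> borel_measurable borel" "g1 \<in> borel_measurable borel"
    using if1 ig1 by auto
  \<comment> \<open>The open ray \<open>{..<x}\<close> here against the closed \<open>{..x}\<close>
    in \<open>Gx\<close> makes \<open>H1\<close> and \<open>H2\<close> add up to the full product at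
    every point, the diagonal included.\<close>
  have Fx: "F x = F a + (LINT y|lborel. indicat_real {..<x} y *\<^sub>R f1 y)" if "x \<in> {a..b}" for x
  proof -
    have "F x - F a = (LINT y|lborel. indicat_real {a..x} y *\<^sub>R f y)"
      using ac_eq[OF assms(1), of a x] that ab by (simp add: set_lebesgue_integral_def)
    also have "\<dots> = (LINT y|lborel. indicat_real {..x} y *\<^sub>R f1 y)"
      using that by (intro Bochner_Integration.integral_cong) (auto simp: f1_def indicator_def)
    also have "\<dots> = (LINT y|lborel. indicat_real {..<x} y *\<^sub>R f1 y)"
    proof (rule integral_cong_AE)
      have "AE y in lborel. y \<noteq> x" by (rule AE_lborel_singleton)
      then show "AE y in lborel. indicat_real {..x} y *\<^sub>R f1 y = indicat_real {..<x} y *\<^sub>R f1 y"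
        by eventually_elim (auto simp: indicator_def)
    qed auto
    finally show ?thesis by (simp add: algebra_simps)
  qed
  have Gx: "G x = G a + (LINT y|lborel. indicat_real {..x} y *\<^sub>R g1 y)" if "x \<in> {a..b}" for x
  proof -
    have "G x - G a = (LINT y|lborel. indicat_real {a..x} y *\<^sub>R g y)"
      using ac_eq[OF assms(2), of a x] that ab by (simp add: set_lebesgue_integral_def)
    also have "\<dots> = (LINT y|lborel. indicat_real {..x} y *\<^sub>R g1 y)"
      using that by (intro Bochner_Integration.integral_cong) (auto simp: g1_def indicator_def)
    finally show ?thesis by (simp add: algebra_simps)
  qed
  define H1 H2 where "H1 x y = (indicat_real {..x} y *\<^sub>R (f1 x * g1 y))"
    and "H2 x y = (indicat_real {..<y} x *\<^sub>R (f1 x * g1 y))" for x y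
  have iH: "integrable (lborel \<Otimes>\<^sub>M lborel) (\<lambda>(x,y). f1 x * g1 y)"
    by (rule integrable_product_mult[OF if1 ig1])
  have iH1: "integrable (lborel \<Otimes>\<^sub>M lborel) (case_prod H1)"
    by (rule Bochner_Integration.integrable_bound[OF iH])
      (auto simp: H1_def indicator_def split_beta' intro!: AE_I2)
  have iH2: "integrable (lborel \<Otimes>\<^sub>M lborel) (case_prod H2)"
    by (rule Bochner_Integration.integrable_bound[OF iH])
      (auto simp: H2_def indicator_def split_beta' intro!: AE_I2)
  have e1: "(LINT x:{a..b}|lborel. f x * G x) = (LINT x|lborel. f1 x * G a) + (LINT x|lborel. (LINT y|lborel. H1 x y))"
  proof -
    have "(LINT x:{a..b}|lborel. f x * G x) = (LINT x|lborel. f1 x * G a + (LINT y|lborel. H1 x y))"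
      unfolding set_lebesgue_integral_def
    proof (rule Bochner_Integration.integral_cong)
      fix x
      have "(LINT y|lborel. H1 x y) = f1 x * (LINT y|lborel. indicat_real {..x} y *\<^sub>R g1 y)"
        unfolding H1_def by (subst integral_mult_right_zero[symmetric]) simp
      then show "indicat_real {a..b} x *\<^sub>R (f x * G x) = f1 x * G a + (LINT y|lborel. H1 x y)"
        using Gx[of x] by (cases "x \<in> {a..b}") (auto simp: f1_def algebra_simps)
    qed simp
    also have "\<dots> = (LINT x|lborel. f1 x * G a) + (LINT x|lborel. (LINT y|lborel. H1 x y))"
      using if1 lborel_pair.integrable_fst'[OF iH1] by (intro Bochner_Integration.integral_add) auto
    finally show ?thesis .
  qed
  have e2: "(LINT x:{a..b}|lborel. F x * g x) = (LINT x|lborel. F a * g1 x) + (LINT y|lborel. (LINT x|lborel. H2 x y))"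
  proof -
    have "(LINT x:{a..b}|lborel. F x * g x) = (LINT y|lborel. F a * g1 y + (LINT x|lborel. H2 x y))"
      unfolding set_lebesgue_integral_def
    proof (rule Bochner_Integration.integral_cong)
      fix y
      have "(LINT x|lborel. H2 x y) = (LINT x|lborel. indicat_real {..<y} x *\<^sub>R f1 x) * g1 y"
        unfolding H2_def by (subst integral_mult_left_zero[symmetric]) simp
      then show "indicat_real {a..b} y *\<^sub>R (F y * g y) = F a * g1 y + (LINT x|lborel. H2 x y)"
        using Fx[of y] by (cases "y \<in> {a..b}") (auto simp: g1_def algebra_simps)
    qed simp
    also have "\<dots> = (LINT x|lborel. F a * g1 x) + (LINT y|lborel. (LINT x|lborel. H2 x y))"
      using ig1 lborel_pair.integrable_snd[OF iH2] by (intro Bochner_Integration.integral_add) auto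
    finally show ?thesis .
  qed
  have "(LINT x|lborel. (LINT y|lborel. H1 x y)) + (LINT y|lborel. (LINT x|lborel. H2 x y))
      = (LINT x|lborel. (LINT y|lborel. H1 x y)) + (LINT x|lborel. (LINT y|lborel. H2 x y))"
    using lborel_pair.Fubini_integral[OF iH2] by simp
  also have "\<dots> = (LINT p|(lborel \<Otimes>\<^sub>M lborel). case_prod H1 p) + (LINT p|(lborel \<Otimes>\<^sub>M lborel). case_prod H2 p)"
    using lborel_pair.integral_fst'[OF iH1] lborel_pair.integral_fst'[OF iH2] by simp
  also have "\<dots> = (LINT p|(lborel \<Otimes>\<^sub>M lborel). (case p of (x,y) \<Rightarrow> f1 x * g1 y))"
  proof -
    have "(\<lambda>p. case_prod H1 p + case_prod H2 p) = (\<lambda>(x,y). f1 x * g1 y)"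
      by (auto simp: H1_def H2_def indicator_def fun_eq_iff)
    then show ?thesis
      using Bochner_Integration.integral_add[OF iH1 iH2] by simp
  qed
  also have "\<dots> = (LINT x|lborel. (LINT y|lborel. f1 x * g1 y))"
    using lborel_pair.integral_fst'[OF iH] by simp
  also have "\<dots> = (LINT x|lborel. f1 x) * (LINT y|lborel. g1 y)" by simp
  finally have e3: "(LINT x|lborel. (LINT y|lborel. H1 x y)) + (LINT y|lborel. (LINT x|lborel. H2 x y))
      = (LINT x|lborel. f1 x) * (LINT y|lborel. g1 y)" .
  have f1i: "(LINT x|lborel. f1 x) = F b - F a" and g1i: "(LINT x|lborel. g1 x) = G b - G a"
    using ac_eq[OF assms(1) ab] ac_eq[OF assms(2) ab] by (auto simp: f1_def g1_def set_lebesgue_integral_def)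
  have "(LINT x:{a..b}|lborel. f x * G x + F x * g x) = 
      (LINT x|lborel. f1 x * G a) + (LINT x|lborel. F a * g1 x) + (LINT x|lborel. f1 x) * (LINT y|lborel. g1 y)"
    unfolding set_integral_add(2)[OF i1 i2] e1 e2 using e3 by (simp add: algebra_simps)
  also have "\<dots> = F b * G b - F a * G a"
    by (simp add: f1i g1i algebra_simps)
  finally show "F b * G b - F a * G a = (LINT x:{a..b}|lborel. f x * G x + F x * g x)" by simp
qed

text \<open>The products of first derivatives cancel. Thus two solutions of one equation have
  constant Wronskian, and for two potentials its derivative contains only their difference.\<close>

lemma ac_wronskian:
  assumes "ac f f'" "ac f' f2" "ac g g'" "ac g' g2"
  shows "ac (\<lambda>x. f x * g' x - f' x * g x) (\<lambda>x. f x * g2 x - f2 x * g x)"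
  by (rule ac_cong[OF ac_diff[OF ac_mult[OF assms(1,4)] ac_mult[OF assms(2,3)]]]) auto

lemma ac_zero_const: "ac F (\<lambda>x. 0) \<Longrightarrow> x > 0 \<Longrightarrow> y > 0 \<Longrightarrow> F x = F y"
  using ac_eq[of F "\<lambda>x. 0" x y] ac_eq[of F "\<lambda>x. 0" y x] by (cases "x \<le> y") auto

text \<open>Only the primitives have to match at \<open>c\<close>; the densities may jump there, as
  the reference potential does at 1. On the right piece the density is altered at the single point
  \<open>c\<close>, a null set.\<close>

lemma ac_glue:
  fixes F1 :: "real \<Rightarrow> 'a::{real_normed_field,euclidean_space}"
  assumes "ac F1 f1" "ac F2 f2" "F1 c = F2 c" "c > 0"
  shows "ac (\<lambda>x. if x \<le> c then F1 x else F2 x) (\<lambda>x. if x \<le> c then f1 x else f2 x)"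
proof (rule acI)
  fix a b :: real assume ab: "0 < a" "a \<le> b"
  let ?F = "\<lambda>x. if x \<le> c then F1 x else F2 x" and ?f = "\<lambda>x. if x \<le> c then f1 x else f2 x"
  have 1: "set_integrable lborel {a..b} ?f \<and> ?F b - ?F a = (LINT x:{a..b}|lborel. ?f x)" 
    if "0 < a" "a \<le> b" "b \<le> c" for a b
  proof -
    have "set_integrable lborel {a..b} ?f = set_integrable lborel {a..b} f1"
      using that by (intro set_integrable_cong) auto
    moreover have "(LINT x:{a..b}|lborel. ?f x) = (LINT x:{a..b}|lborel. f1 x)"
      using that by (intro set_lebesgue_integral_cong) auto
    ultimately show ?thesis
      using ac_integrable[OF assms(1) that(1), of b] ac_eq[OF assms(1) that(1,2)] that by simp
  qed
  have 2: "set_integrable lborel {a..b} ?f \<and> ?F b - ?F a = (LINT x:{a..b}|lborel. ?f x)" 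
    if "c \<le> a" "a \<le> b" for a b
  proof -
    have a0: "0 < a" using that assms(4) by simp
    have i: "set_integrable lborel {a..b} f2" and e: "F2 b - F2 a = (LINT x:{a..b}|lborel. f2 x)"
      using ac_integrable[OF assms(2) a0, of b] ac_eq[OF assms(2) a0 that(2)] by auto
    have ae: "AE x in lborel. indicat_real {a..b} x *\<^sub>R f2 x = indicat_real {a..b} x *\<^sub>R ?f x"
      using AE_lborel_singleton[of c] by eventually_elim (use that in \<open>auto simp: indicator_def\<close>)
    have m: "(\<lambda>x. indicat_real {a..b} x *\<^sub>R ?f x) \<in> borel_measurable lborel"
    proof -
      have [measurable]: "(\<lambda>x. indicat_real {a..b} x *\<^sub>R f2 x) \<in> borel_measurable borel"
        using borel_measurable_integrable[OF i[unfolded set_integrable_def]] by simp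
      have "(\<lambda>x. if x = c then indicat_real {a..b} x *\<^sub>R f1 c else indicat_real {a..b} x *\<^sub>R f2 x) \<in> borel_measurable lborel"
        by measurable
      then show ?thesis
        by (rule back_subst[where P="\<lambda>f. f \<in> borel_measurable lborel"])
           (use that in \<open>auto simp: indicator_def fun_eq_iff\<close>)
    qed
    have "set_integrable lborel {a..b} ?f"
      using i unfolding set_integrable_def by (rule integrable_cong_AE_imp[OF _ m ae])
    moreover have "(LINT x:{a..b}|lborel. f2 x) = (LINT x:{a..b}|lborel. ?f x)"
      unfolding set_lebesgue_integral_def
      by (rule integral_cong_AE[OF _ m ae]) (use i in \<open>auto simp: set_integrable_def\<close>)
    moreover have "?F b - ?F a = F2 b - F2 a"
    proof -
      have "b \<le> c \<Longrightarrow> b = c" "a \<le> c \<Longrightarrow> a = c" using that by auto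
      then show ?thesis using assms(3) by auto
    qed
    ultimately show ?thesis using e by (simp only: simp_thms)
  qed
  have "set_integrable lborel {a..b} ?f \<and> ?F b - ?F a = (LINT x:{a..b}|lborel. ?f x)"
  proof (cases "b \<le> c \<or> c \<le> a")
    case True then show ?thesis using 1[OF ab] 2[OF _ ab(2)] by (rule disjE)
  next
    case False
    then have c: "a \<le> c" "c \<le> b" by auto
    note h1 = 1[OF ab(1) c(1) order.refl] and h2 = 2[OF order.refl c(2)]
    have un: "{a..b} = {a..c} \<union> {c..b}" using c by auto
    have "set_integrable lborel {a..b} ?f"
      unfolding un using h1 h2 by (intro set_integrable_Un) auto
    moreover have "(LINT x:{a..b}|lborel. ?f x) = (LINT x:{a..c}|lborel. ?f x) + (LINT x:{c..b}|lborel. ?f x)"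
      unfolding un using h1 h2 AE_lborel_singleton[of c]
      by (intro set_integral_Un_AE) (auto elim: eventually_mono)
    moreover have "?F b - ?F a = (?F c - ?F a) + (?F b - ?F c)"
      by (simp add: algebra_simps del: if_split)
    ultimately show ?thesis
      by (simp only: h1[THEN conjunct2] h2[THEN conjunct2] simp_thms)
  qed
  then show "set_integrable lborel {a..b} ?f" "?F b - ?F a = (LINT x:{a..b}|lborel. ?f x)" by auto
qed

lemma ac_integral_left:
  fixes f :: "real \<Rightarrow> 'a::{real_normed_field,euclidean_space}"
  assumes "\<And>x. x > 0 \<Longrightarrow> set_integrable lborel {0<..x} f"
  shows "ac (\<lambda>x. LINT y:{0<..x}|lborel. f y) f"
proof (rule acI)
  fix a b :: real assume ab: "0 < a" "a \<le> b"
  show i: "set_integrable lborel {a..b} f"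
    using assms[of b] ab by (auto intro: set_integrable_subset)
  have un: "{0<..b} = {0<..a} \<union> {a..b}" using ab by auto
  have "(LINT y:{0<..b}|lborel. f y) = (LINT y:{0<..a}|lborel. f y) + (LINT y:{a..b}|lborel. f y)"
    unfolding un using ab AE_lborel_singleton[of a] assms i
    by (intro set_integral_Un_AE) (auto elim: eventually_mono)
  then show "(LINT y:{0<..b}|lborel. f y) - (LINT y:{0<..a}|lborel. f y) = (LINT x:{a..b}|lborel. f x)"
    by simp
qed

lemma ac_integral_right:
  fixes f :: "real \<Rightarrow> 'a::{real_normed_field,euclidean_space}"
  assumes "\<And>x. x > 0 \<Longrightarrow> set_integrable lborel {x..} f"
  shows "ac (\<lambda>x. LINT y:{x..}|lborel. f y) (\<lambda>x. - f x)"
proof (rule acI)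
  fix a b :: real assume ab: "0 < a" "a \<le> b"
  have i: "set_integrable lborel {a..b} f"
    using assms[of a] ab by (auto intro: set_integrable_subset)
  then show "set_integrable lborel {a..b} (\<lambda>x. - f x)" by (simp add: set_integrable_def)
  have un: "{a..} = {b..} \<union> {a..b}" using ab by auto
  have "(LINT y:{a..}|lborel. f y) = (LINT y:{b..}|lborel. f y) + (LINT y:{a..b}|lborel. f y)"
    unfolding un using ab AE_lborel_singleton[of b] assms i
    by (intro set_integral_Un_AE) (auto elim: eventually_mono)
  then show "(LINT y:{b..}|lborel. f y) - (LINT y:{a..}|lborel. f y) = (LINT x:{a..b}|lborel. - f x)"
    using i by (simp add: set_integral_uminus)
qed

lemma ac_limit:
  fixes F :: "real \<Rightarrow> 'a::{real_normed_field,euclidean_space}"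
  assumes "\<And>n. ac (Fn n) (fn n)" "\<And>x. x > 0 \<Longrightarrow> (\<lambda>n. Fn n x) \<longlonglongrightarrow> F x"
    "\<And>x. x > 0 \<Longrightarrow> (\<lambda>n. fn n x) \<longlonglongrightarrow> f x"
    "\<And>n x. x > 0 \<Longrightarrow> norm (fn n x) \<le> g x" "\<And>a b. 0 < a \<Longrightarrow> set_integrable lborel {a..b} (g :: real \<Rightarrow> real)"
  shows "ac F f"
proof (rule acI)
  fix a b :: real assume ab: "0 < a" "a \<le> b"
  let ?i = "indicat_real {a..b}"
  have m: "(\<lambda>x. ?i x *\<^sub>R fn n x) \<in> borel_measurable lborel" for n
    using ac_integrable[OF assms(1) ab(1), of b n] by (auto simp: set_integrable_def)
  have l: "(\<lambda>n. ?i x *\<^sub>R fn n x) \<longlonglongrightarrow> ?i x *\<^sub>R f x" for x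
    using assms(3)[of x] ab by (cases "x \<in> {a..b}") (auto)
  have m': "(\<lambda>x. ?i x *\<^sub>R f x) \<in> borel_measurable lborel"
    by (rule borel_measurable_LIMSEQ_metric[OF m l])
  have gi: "integrable lborel (\<lambda>x. ?i x *\<^sub>R g x)"
    using assms(5)[OF ab(1), of b] by (simp add: set_integrable_def)
  have bd: "norm (?i x *\<^sub>R fn n x) \<le> ?i x *\<^sub>R g x" for n x
    using assms(4)[of x n] ab by (auto simp: indicator_def)
  show "set_integrable lborel {a..b} f"
    unfolding set_integrable_def by (rule integrable_dominated_convergence[OF m' m gi AE_I2[OF l] AE_I2[OF bd]])
  have "(\<lambda>n. LINT x|lborel. ?i x *\<^sub>R fn n x) \<longlonglongrightarrow> (LINT x|lborel. ?i x *\<^sub>R f x)"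
    by (rule integral_dominated_convergence[OF m' m gi AE_I2[OF l] AE_I2[OF bd]])
  moreover have "(LINT x|lborel. ?i x *\<^sub>R fn n x) = Fn n b - Fn n a" for n
    using ac_eq[OF assms(1) ab] by (simp add: set_lebesgue_integral_def)
  ultimately have "(\<lambda>n. Fn n b - Fn n a) \<longlonglongrightarrow> (LINT x:{a..b}|lborel. f x)"
    by (simp add: set_lebesgue_integral_def)
  moreover have "(\<lambda>n. Fn n b - Fn n a) \<longlonglongrightarrow> F b - F a"
    using ab by (intro tendsto_diff assms) auto
  ultimately show "F b - F a = (LINT x:{a..b}|lborel. f x)"
    using LIMSEQ_unique by blast
qed

lemma ac_power:
  fixes G :: "real \<Rightarrow> real"
  assumes "ac G g" shows "ac (\<lambda>x. G x ^ Suc n) (\<lambda>x. real (Suc n) * (g x * G x ^ n))"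
proof (induction n)
  case 0 then show ?case using assms by simp
next
  case (Suc n)
  show ?case
    by (rule ac_cong[OF ac_mult[OF assms Suc]]) (auto simp: algebra_simps)
qed

text \<open>The density is only an a.e. derivative, so instead of a chain rule the Taylor
  polynomials are differentiated by \<open>ac_power\<close> and passed to the limit by dominated
  convergence; the bound on \<open>G\<close> supplies the majorant.\<close>

lemma ac_exp:
  fixes G :: "real \<Rightarrow> real"
  assumes "ac G g" "\<And>x. x > 0 \<Longrightarrow> \<bar>G x\<bar> \<le> B"
  shows "ac (\<lambda>x. exp (G x)) (\<lambda>x. g x * exp (G x))"
proof (rule ac_limit)
  \<comment> \<open>One term more in the primitive than in the density: differentiation kills the
    constant term and shifts the index.\<close>
  show "ac (\<lambda>x. \<Sum>k<Suc n. G x ^ k / fact k) (\<lambda>x. g x * (\<Sum>k<n. G x ^ k / fact k))" for n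
  proof (induction n)
    case 0 then show ?case by (simp add: ac_const)
  next
    case (Suc n)
    have "ac (\<lambda>x. (1 / fact (Suc n)) * G x ^ Suc n) (\<lambda>x. (1 / fact (Suc n)) * (real (Suc n) * (g x * G x ^ n)))"
      by (intro ac_cmult ac_power assms)
    then show ?case
      by (rule ac_cong[OF ac_add[OF Suc]]) (simp_all add: field_simps del: of_nat_Suc)
  qed
  have exps: "(\<lambda>n. \<Sum>k<n. t ^ k / fact k) \<longlonglongrightarrow> exp t" for t :: real
    using exp_converges[of t] by (simp add: sums_def divide_inverse_commute)
  show "(\<lambda>n. \<Sum>k<Suc n. G x ^ k / fact k) \<longlonglongrightarrow> exp (G x)" for x
    by (rule LIMSEQ_Suc[OF exps])
  show "(\<lambda>n. g x * (\<Sum>k<n. G x ^ k / fact k)) \<longlonglongrightarrow> g x * exp (G x)" for x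
    by (intro tendsto_intros exps)
  show "norm (g x * (\<Sum>k<n. G x ^ k / fact k)) \<le> \<bar>g x\<bar> * exp B" if "x > 0" for n x
  proof -
    have "\<bar>\<Sum>k<n. G x ^ k / fact k\<bar> \<le> (\<Sum>k<n. \<bar>G x\<bar> ^ k / fact k)"
      by (rule order.trans[OF sum_abs]) (simp add: power_abs)
    also have "\<dots> \<le> exp \<bar>G x\<bar>"
      using exp_converges[of "\<bar>G x\<bar>"]
      by (intro sum_le_suminf[of "\<lambda>k. \<bar>G x\<bar> ^ k / fact k" "{..<n}", THEN order.trans])
         (auto simp: sums_iff divide_inverse_commute)
    also have "\<dots> \<le> exp B" using assms(2)[OF that] by simp
    finally show ?thesis by (simp add: abs_mult mult_left_mono)
  qed
  show "set_integrable lborel {a..b} (\<lambda>x. \<bar>g x\<bar> * exp B)" if "0 < a" for a b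
    using set_integrable_abs[OF ac_integrable[OF assms(1) that, of b]] by simp
qed

section \<open>Exponentially weighted integrals of an integrable density\<close>

lemma set_integral_nonneg': 
  fixes f :: "'a \<Rightarrow> real"
  assumes "\<And>x. x \<in> A \<Longrightarrow> 0 \<le> f x" shows "0 \<le> (LINT x:A|M. f x)"
  unfolding set_lebesgue_integral_def
  by (rule Bochner_Integration.integral_nonneg) (auto simp: indicator_def assms)

lemma set_integral_mono_set:
  fixes f :: "'a \<Rightarrow> real"
  assumes "set_integrable M B f" "\<And>x. x \<in> B \<Longrightarrow> 0 \<le> f x" "A \<subseteq> B" "A \<in> sets M"
  shows "(LINT x:A|M. f x) \<le> (LINT x:B|M. f x)"
  unfolding set_lebesgue_integral_def
  using assms set_integrable_subset[OF assms(1,4,3)]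
  by (intro integral_mono) (auto simp: set_integrable_def indicator_def)

lemma set_integrable_mult_bounded:
  fixes f g :: "real \<Rightarrow> real"
  assumes "set_integrable lborel A f" "g \<in> borel_measurable borel" "\<And>x. x \<in> A \<Longrightarrow> \<bar>g x\<bar> \<le> B" "A \<in> sets borel"
  shows "set_integrable lborel A (\<lambda>x. f x * g x)"
proof -
  have i: "set_integrable lborel A (\<lambda>x. \<bar>B\<bar> * f x)" using assms(1) by simp
  have [measurable]: "(\<lambda>x. indicat_real A x *\<^sub>R f x) \<in> borel_measurable borel"
    using borel_measurable_integrable[OF assms(1)[unfolded set_integrable_def]] by simp
  have "(\<lambda>x. (indicat_real A x *\<^sub>R f x) * g x) \<in> borel_measurable borel"
    using assms(2) by measurable
  then have m: "set_borel_measurable lborel A (\<lambda>x. f x * g x)"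
    by (simp add: set_borel_measurable_def mult.assoc)
  show ?thesis
  proof (rule set_integrable_bound[OF i m], intro AE_I2 impI)
    fix x assume "x \<in> A"
    then have "\<bar>g x\<bar> \<le> \<bar>B\<bar>" using assms(3)[of x] by simp
    then show "norm (f x * g x) \<le> norm (\<bar>B\<bar> * f x)"
      using mult_right_mono[of "\<bar>g x\<bar>" "\<bar>B\<bar>" "\<bar>f x\<bar>"] by (simp add: abs_mult mult.commute)
  qed
qed

lemma borel_measurable_if_pos:
  fixes F :: "real \<Rightarrow> 'a::{real_normed_vector,second_countable_topology}"
  assumes "continuous_on {0<..} F"
  shows "(\<lambda>x. if x > 0 then F x else 0) \<in> borel_measurable borel"
proof -
  have "(\<lambda>x. indicat_real {0<..} x *\<^sub>R F x) \<in> borel_measurable borel"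
    using assms by (intro borel_measurable_continuous_on_indicator) auto
  then show ?thesis
    by (rule back_subst[where P="\<lambda>f. f \<in> borel_measurable borel"]) (auto simp: indicator_def fun_eq_iff)
qed

text \<open>\<open>\<rho> * exp (2 * P)\<close> is the derivative of \<open>exp (2 * P) / 2\<close>.
  The factor 1/2 is the purpose: in the sup norm weighted by \<open>exp (2 * P)\<close> a Volterra
  operator with density \<open>\<rho>\<close> is a contraction with constant 1/2, however large
  \<open>\<rho>\<close> is.\<close>

lemma exp_weight_left:
  fixes \<rho> :: "real \<Rightarrow> real"
  assumes int: "set_integrable lborel {0<..} \<rho>" and nn: "\<And>x. x > 0 \<Longrightarrow> 0 \<le> \<rho> x"
  defines "P \<equiv> (\<lambda>x. LINT y:{0<..x}|lborel. \<rho> y)"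
  assumes "x > 0"
  shows "set_integrable lborel {0<..x} (\<lambda>y. \<rho> y * exp (2 * P y))"
    and "(LINT y:{0<..x}|lborel. \<rho> y * exp (2 * P y)) \<le> exp (2 * P x) / 2"
proof -
  let ?B = "LINT y:{0<..}|lborel. \<rho> y"
  have acP: "ac P \<rho>" unfolding P_def
    by (intro ac_integral_left set_integrable_subset[OF int]) auto
  have Pnn: "0 \<le> P y" for y
    unfolding P_def using nn by (intro set_integral_nonneg') auto
  have PB: "P y \<le> ?B" for y
    unfolding P_def using nn by (intro set_integral_mono_set int) auto
  have b: "\<bar>2 * P y\<bar> \<le> 2 * ?B" for y using Pnn[of y] PB[of y] by simp
  have ace: "ac (\<lambda>x. exp (2 * P x)) (\<lambda>x. (2 * \<rho> x) * exp (2 * P x))"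
    by (rule ac_exp[OF ac_cmult[OF acP]]) (rule b)
  have m: "(\<lambda>y. if y > 0 then exp (2 * P y) else 0) \<in> borel_measurable borel"
    by (intro borel_measurable_if_pos continuous_intros ac_continuous[OF acP])
  have "set_integrable lborel {0<..x} (\<lambda>y. \<rho> y * (if y > 0 then exp (2 * P y) else 0))"
    using PB by (intro set_integrable_mult_bounded[OF _ m, where B="exp (2 * ?B)"] set_integrable_subset[OF int]) auto
  then show i: "set_integrable lborel {0<..x} (\<lambda>y. \<rho> y * exp (2 * P y))"
    by (subst set_integrable_cong[of lborel lborel "{0<..x}" "{0<..x}" _ "\<lambda>y. \<rho> y * (if y > 0 then exp (2 * P y) else 0)"]) auto
  \<comment> \<open>\<open>ac\<close> speaks of compact intervals in the open half-line only, so the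
    left end 0 is reached as a limit.\<close>
  have "((\<lambda>a. LINT y:{a..x}|lborel. \<rho> y * exp (2 * P y)) \<longlongrightarrow> (LINT y:{0<..x}|lborel. \<rho> y * exp (2 * P y))) (at_right 0)"
    using assms by (intro tendsto_set_lebesgue_integral_at_right i) auto
  then show "(LINT y:{0<..x}|lborel. \<rho> y * exp (2 * P y)) \<le> exp (2 * P x) / 2"
  proof (rule tendsto_upperbound)
    have "(LINT y:{a..x}|lborel. \<rho> y * exp (2 * P y)) \<le> exp (2 * P x) / 2" if "0 < a" "a < x" for a
          proof -
      have "2 * (LINT y:{a..x}|lborel. \<rho> y * exp (2 * P y)) = exp (2 * P x) - exp (2 * P a)"
        using ac_eq[OF ace, of a x] that by (simp add: mult.assoc)
      then show ?thesis using exp_ge_zero[of "2 * P a"] by linarith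
    qed
    then have *: "\<And>a. a \<in> {0<..<x} \<Longrightarrow> (LINT y:{a..x}|lborel. \<rho> y * exp (2 * P y)) \<le> exp (2 * P x) / 2"
      by auto
    show "\<forall>\<^sub>F a in at_right 0. (LINT y:{a..x}|lborel. \<rho> y * exp (2 * P y)) \<le> exp (2 * P x) / 2"
      using eventually_at_right_real[OF \<open>x>0\<close>] by eventually_elim (rule *)
  qed auto
qed

text \<open>Mirror image for integration from x to infinity; now \<open>P\<close> decreases, with
  density \<open>- \<rho>\<close>, and the end at infinity is reached as a limit.\<close>

lemma exp_weight_right:
  fixes \<rho> :: "real \<Rightarrow> real"
  assumes int: "set_integrable lborel {0<..} \<rho>" and nn: "\<And>x. x > 0 \<Longrightarrow> 0 \<le> \<rho> x"
  defines "P \<equiv> (\<lambda>x. LINT y:{x..}|lborel. \<rho> y)"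
  assumes "x > 0"
  shows "set_integrable lborel {x..} (\<lambda>y. \<rho> y * exp (2 * P y))"
    and "(LINT y:{x..}|lborel. \<rho> y * exp (2 * P y)) \<le> exp (2 * P x) / 2"
proof -
  let ?B = "LINT y:{0<..}|lborel. \<rho> y"
  have acP: "ac P (\<lambda>x. - \<rho> x)" unfolding P_def
    by (intro ac_integral_right set_integrable_subset[OF int]) auto
  have Pnn: "0 \<le> P y" if "y > 0" for y
    unfolding P_def using nn that by (intro set_integral_nonneg') auto
  have PB: "P y \<le> ?B" if "y > 0" for y
    unfolding P_def using nn that by (intro set_integral_mono_set int) auto
  have b: "\<bar>2 * P y\<bar> \<le> 2 * ?B" if "y > 0" for y using Pnn[of y] PB[of y] that by simp
  have ace: "ac (\<lambda>x. exp (2 * P x)) (\<lambda>x. (2 * - \<rho> x) * exp (2 * P x))"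
    by (rule ac_exp[OF ac_cmult[OF acP]]) (rule b)
  have m: "(\<lambda>y. if y > 0 then exp (2 * P y) else 0) \<in> borel_measurable borel"
    by (intro borel_measurable_if_pos continuous_intros ac_continuous[OF acP])
  have "set_integrable lborel {x..} (\<lambda>y. \<rho> y * (if y > 0 then exp (2 * P y) else 0))"
    using PB assms by (intro set_integrable_mult_bounded[OF _ m, where B="exp (2 * ?B)"] set_integrable_subset[OF int]) auto
  then show i: "set_integrable lborel {x..} (\<lambda>y. \<rho> y * exp (2 * P y))"
    using assms
    by (subst set_integrable_cong[of lborel lborel "{x..}" "{x..}" _ "\<lambda>y. \<rho> y * (if y > 0 then exp (2 * P y) else 0)"]) auto
  have "((\<lambda>b. LINT y:{x..b}|lborel. \<rho> y * exp (2 * P y)) \<longlongrightarrow> (LINT y:{x..}|lborel. \<rho> y * exp (2 * P y))) at_top"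
    using assms by (intro tendsto_set_lebesgue_integral_at_top i) auto
  then show "(LINT y:{x..}|lborel. \<rho> y * exp (2 * P y)) \<le> exp (2 * P x) / 2"
  proof (rule tendsto_upperbound)
    have *: "(LINT y:{x..b}|lborel. \<rho> y * exp (2 * P y)) \<le> exp (2 * P x) / 2" if "x < b" for b
    proof -
      have "(LINT y:{x..b}|lborel. (2 * - \<rho> y) * exp (2 * P y)) = (-2) * (LINT y:{x..b}|lborel. \<rho> y * exp (2 * P y))"
        by (subst set_integral_mult_right[symmetric]) (simp add: mult.assoc)
      moreover have "(LINT y:{x..b}|lborel. (2 * - \<rho> y) * exp (2 * P y)) = exp (2 * P b) - exp (2 * P x)"
        using ac_eq[OF ace, of x b] that assms by simp
      ultimately show ?thesis using exp_ge_zero[of "2 * P b"] by linarith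
    qed
    show "\<forall>\<^sub>F b in at_top. (LINT y:{x..b}|lborel. \<rho> y * exp (2 * P y)) \<le> exp (2 * P x) / 2"
      using eventually_gt_at_top[of x] by eventually_elim (rule *)
  qed auto
qed

section \<open>Continuous families that are holomorphic in the interior\<close>

definition reg :: "complex set \<Rightarrow> (complex \<Rightarrow> complex) \<Rightarrow> bool" where
  "reg S \<phi> \<longleftrightarrow> continuous_on S \<phi> \<and> \<phi> holomorphic_on interior S"

lemma reg_const [intro]: "reg S (\<lambda>m. c)" and reg_id [intro]: "reg S (\<lambda>m. m)"
  by (auto simp: reg_def)

lemma reg_add: "reg S f \<Longrightarrow> reg S g \<Longrightarrow> reg S (\<lambda>m. f m + g m)"
  and reg_diff: "reg S f \<Longrightarrow> reg S g \<Longrightarrow> reg S (\<lambda>m. f m - g m)"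
  and reg_mult: "reg S f \<Longrightarrow> reg S g \<Longrightarrow> reg S (\<lambda>m. f m * g m)"
  and reg_minus: "reg S f \<Longrightarrow> reg S (\<lambda>m. - f m)"
  by (auto simp: reg_def intro!: continuous_intros holomorphic_intros)

lemma reg_divide: "reg S f \<Longrightarrow> reg S g \<Longrightarrow> (\<And>m. m \<in> S \<Longrightarrow> g m \<noteq> 0) \<Longrightarrow> reg S (\<lambda>m. f m / g m)"
  using interior_subset[of S] by (auto simp: reg_def intro!: continuous_intros holomorphic_intros)

lemma reg_cong: "reg S f \<Longrightarrow> (\<And>m. m \<in> S \<Longrightarrow> f m = g m) \<Longrightarrow> reg S g"
  unfolding reg_def using interior_subset[of S]
  by (auto simp: subset_iff cong: continuous_on_cong holomorphic_cong)

lemma reg_holomorphic: "f holomorphic_on UNIV \<Longrightarrow> reg S f"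
  unfolding reg_def by (meson holomorphic_on_imp_continuous_on holomorphic_on_subset subset_UNIV)

text \<open>Cauchy's inequality turns the domination of the integrand into a domination of its
  difference quotients.\<close>

lemma reg_integral:
  fixes F :: "complex \<Rightarrow> 'a \<Rightarrow> complex"
  assumes reg: "\<And>y. reg S (\<lambda>m. F m y)"
    and meas: "\<And>m. m \<in> S \<Longrightarrow> F m \<in> borel_measurable M"
    and g: "integrable M g" "\<And>m y. m \<in> S \<Longrightarrow> norm (F m y) \<le> g y"
  shows "reg S (\<lambda>m. LINT y|M. F m y)"
  unfolding reg_def
proof
  show "continuous_on S (\<lambda>m. LINT y|M. F m y)"
    unfolding continuous_on_sequentially
  proof (intro allI ballI impI, elim conjE)
    fix w z assume z: "z \<in> S" and w: "\<forall>n. w n \<in> S" "w \<longlonglongrightarrow> z"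
    show "((\<lambda>m. LINT y|M. F m y) \<circ> w) \<longlonglongrightarrow> (LINT y|M. F z y)"
      unfolding comp_def
    proof (rule integral_dominated_convergence[OF _ _ g(1)])
      show "AE y in M. (\<lambda>n. F (w n) y) \<longlonglongrightarrow> F z y"
        using reg w z unfolding reg_def continuous_on_sequentially comp_def by (intro AE_I2) blast
    qed (use w z meas g in auto)
  qed
next
  have "(\<lambda>m. LINT y|M. F m y) field_differentiable (at z within interior S)" if z: "z \<in> interior S" for z
  proof -
    \<comment> \<open>Twice the radius: the Cauchy circles of radius \<open>r\<close> around all
      points of \<open>ball z r\<close> must stay inside the interior of \<open>S\<close>.\<close>
    obtain r where r: "r > 0" "cball z (2*r) \<subseteq> interior S"
    proof -
      obtain e where "e > 0" "cball z e \<subseteq> interior S"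
        using z open_contains_cball[of "interior S"] by auto
      then show ?thesis using that[of "e/2"] by simp
    qed
    have rS: "cball z (2*r) \<subseteq> S" using r interior_subset by blast
    have hol: "(\<lambda>m. F m y) holomorphic_on interior S" for y using reg by (simp add: reg_def)
    have g0: "0 \<le> g y" for y using order.trans[OF norm_ge_zero g(2)[of z y]] z interior_subset by blast
    have dbd: "norm (deriv (\<lambda>m. F m y) w) \<le> g y / r" if "w \<in> ball z r" for w y
    proof -
      have sub: "cball w r \<subseteq> interior S"
        using that r(2) by (smt (verit) dist_triangle mem_ball mem_cball subset_iff)
      have "norm ((deriv ^^ 1) (\<lambda>m. F m y) w) \<le> fact 1 * g y / r ^ 1"
      proof (rule Cauchy_inequality)
        show "(\<lambda>m. F m y) holomorphic_on ball w r" 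
          by (rule holomorphic_on_subset[OF hol]) (use sub ball_subset_cball in blast)
        show "continuous_on (cball w r) (\<lambda>m. F m y)"
          by (rule holomorphic_on_imp_continuous_on[OF holomorphic_on_subset[OF hol sub]])
        show "norm (F x y) \<le> g y" if "norm (w - x) = r" for x
          using sub that interior_subset[of S] by (intro g) (auto simp: dist_norm)
      qed (use r in auto)
      then show ?thesis by simp
    qed
    have lip: "norm (F w y - F z y) \<le> g y / r * norm (w - z)" if "w \<in> ball z r" for w y
    proof (rule field_differentiable_bound[where S="ball z r" and f'="deriv (\<lambda>m. F m y)"])
      fix x assume "x \<in> ball z r"
      then have "x \<in> interior S" using r by auto
      then have "((\<lambda>m. F m y) has_field_derivative deriv (\<lambda>m. F m y) x) (at x)"
        using hol[of y] holomorphic_derivI open_interior by blast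
      then show "((\<lambda>m. F m y) has_field_derivative deriv (\<lambda>m. F m y) x) (at x within ball z r)"
        by (rule has_field_derivative_at_within)
    qed (use dbd that r in auto)
    let ?q = "\<lambda>w y. (F w y - F z y) / (w - z)"
    let ?D = "\<lambda>y. deriv (\<lambda>m. F m y) z"
    have qlim: "((\<lambda>w. ?q w y) \<longlongrightarrow> ?D y) (at z)" for y
      using holomorphic_derivI[OF hol open_interior z, of y] by (simp add: has_field_derivative_iff)
    have conv: "(\<lambda>n. LINT y|M. ?q (w n) y) \<longlonglongrightarrow> (LINT y|M. ?D y)"
      if w: "\<And>n. w n \<in> ball z r - {z}" "w \<longlonglongrightarrow> z" for w
    proof -
      have l: "(\<lambda>n. ?q (w n) y) \<longlonglongrightarrow> ?D y" for y
        using qlim[of y] w unfolding tendsto_at_iff_sequentially comp_def by blast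
      have wS: "w n \<in> S" for n
      proof -
        have "w n \<in> cball z (2*r)" using w(1)[of n] r(1) by auto
        then show ?thesis using rS by blast
      qed
      have zS: "z \<in> S" using z interior_subset by blast
      have m: "?q (w n) \<in> borel_measurable M" for n
        using meas[OF wS] meas[OF zS] by measurable
      show ?thesis
      proof (rule integral_dominated_convergence[where w="\<lambda>y. g y / r"])
        \<comment> \<open>No measurability of the derivative in y is assumed; it is inherited as the
          pointwise limit of measurable difference quotients.\<close>
        show "?D \<in> borel_measurable M" by (rule borel_measurable_LIMSEQ_metric[OF m l])
        show "AE y in M. norm (?q (w n) y) \<le> g y / r" for n
          using lip[of "w n"] w(1)[of n] by (intro AE_I2) (auto simp: norm_divide divide_le_eq)
      qed (use m l g in auto)
    qed
    have "((\<lambda>w. ((LINT y|M. F w y) - (LINT y|M. F z y)) / (w - z)) \<longlongrightarrow> (LINT y|M. ?D y)) (at z within ball z r)"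
      unfolding tendsto_at_iff_sequentially comp_def
    proof (intro allI impI)
      fix w assume w: "\<forall>n. w n \<in> ball z r - {z}" "w \<longlonglongrightarrow> z"
      have i: "integrable M (F m)" if "m \<in> S" for m
        using g(2)[OF that] by (intro Bochner_Integration.integrable_bound[OF g(1) meas[OF that]]) (auto intro!: AE_I2 order.trans[OF _ abs_ge_self])
      have "(LINT y|M. ?q (w n) y) = ((LINT y|M. F (w n) y) - (LINT y|M. F z y)) / (w n - z)" for n
      proof -
        have "w n \<in> ball z r" using w(1) by blast
        then have "w n \<in> cball z (2*r)" "z \<in> cball z (2*r)" using r(1) by auto
        then have "w n \<in> S" "z \<in> S" using rS by blast+
        then show ?thesis using i by (simp add: Bochner_Integration.integral_diff)
      qed
      with conv[of w] w show "(\<lambda>n. ((LINT y|M. F (w n) y) - (LINT y|M. F z y)) / (w n - z)) \<longlonglongrightarrow> (LINT y|M. ?D y)"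
        by simp
    qed
    then have "((\<lambda>m. LINT y|M. F m y) has_field_derivative (LINT y|M. ?D y)) (at z)"
      using r(1) at_within_open[of z "ball z r"] by (simp add: has_field_derivative_iff)
    then show ?thesis
      using field_differentiable_at_within field_differentiable_def by blast
  qed
  then show "(\<lambda>m. LINT y|M. F m y) holomorphic_on interior S"
    by (simp add: holomorphic_on_def)
qed

lemma reg_suminf:
  assumes reg: "\<And>n. reg S (f n)"
    and bd: "\<And>n m. m \<in> S \<Longrightarrow> norm (f n m) \<le> M n" "summable M"
  shows "reg S (\<lambda>m. \<Sum>n. f n m)"
proof -
  have u: "uniform_limit S (\<lambda>n m. \<Sum>k<n. f k m) (\<lambda>m. \<Sum>k. f k m) sequentially"
    by (rule Weierstrass_m_test[OF bd])
  have "continuous_on S (\<lambda>m. \<Sum>k. f k m)"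
    using reg by (intro uniform_limit_theorem[OF _ u] always_eventually allI continuous_on_sum) (auto simp: reg_def)
  moreover have "(\<lambda>m. \<Sum>k. f k m) holomorphic_on interior S"
  proof (rule holomorphic_uniform_sequence[OF open_interior])
    show "(\<lambda>m. \<Sum>k<n. f k m) holomorphic_on interior S" for n
      using reg by (intro holomorphic_on_sum) (auto simp: reg_def)
    fix x assume "x \<in> interior S"
    then obtain d where "d > 0" "cball x d \<subseteq> interior S"
      using open_contains_cball[of "interior S"] by auto
    then show "\<exists>d>0. cball x d \<subseteq> interior S \<and>
        uniform_limit (cball x d) (\<lambda>n m. \<Sum>k<n. f k m) (\<lambda>m. \<Sum>k. f k m) sequentially"
      using uniform_limit_on_subset[OF u] interior_subset by (metis subset_trans)
  qed
  ultimately show ?thesis by (simp add: reg_def)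
qed

section \<open>Neumann series depending on a parameter\<close>

primrec neumann_iter ::
  "(complex \<Rightarrow> real \<Rightarrow> real \<Rightarrow> complex) \<Rightarrow> (complex \<Rightarrow> real \<Rightarrow> complex) \<Rightarrow> nat \<Rightarrow> complex \<Rightarrow> real \<Rightarrow> complex"
where
  "neumann_iter N \<phi> 0 = \<phi>"
| "neumann_iter N \<phi> (Suc n) = (\<lambda>m x. LINT y|lborel. N m x y * neumann_iter N \<phi> n m y)"

text \<open>By \<open>ker\<close> the integral operator halves the sup norm weighted by
  \<open>h\<close>, so the n-th term is at most \<open>C * (1/2)^n * h\<close> and the sum at most
  twice the first bound. \<open>dom\<close> is uniform in \<open>m\<close> so that
  \<open>reg_integral\<close> applies to each term, and \<open>hb\<close> makes the series converge
  uniformly in \<open>m\<close>.\<close>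

lemma neumann_series:
  fixes N :: "complex \<Rightarrow> real \<Rightarrow> real \<Rightarrow> complex" and h :: "complex \<Rightarrow> real \<Rightarrow> real"
  assumes Nm: "\<And>m. m \<in> S \<Longrightarrow> (\<lambda>(x,y). N m x y) \<in> borel_measurable (borel \<Otimes>\<^sub>M borel)"
    and \<phi>m: "\<And>m. m \<in> S \<Longrightarrow> \<phi> m \<in> borel_measurable borel"
    and h0: "\<And>m x. m \<in> S \<Longrightarrow> 0 \<le> h m x"
    and C0: "C \<ge> 0" and \<phi>b: "\<And>m x. m \<in> S \<Longrightarrow> norm (\<phi> m x) \<le> C * h m x"
    and keri: "\<And>m x. m \<in> S \<Longrightarrow> integrable lborel (\<lambda>y. norm (N m x y) * h m y)"
    and ker: "\<And>m x. m \<in> S \<Longrightarrow> (LINT y|lborel. norm (N m x y) * h m y) \<le> h m x / 2"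
    and dom: "\<And>x. \<exists>g. integrable lborel g \<and> (\<forall>m\<in>S. \<forall>y. norm (N m x y) * h m y \<le> g y)"
    and hb: "\<And>x. \<exists>B. \<forall>m\<in>S. h m x \<le> B"
    and regN: "\<And>x y. reg S (\<lambda>m. N m x y)" and reg\<phi>: "\<And>x. reg S (\<lambda>m. \<phi> m x)"
  obtains u where "\<And>m. m \<in> S \<Longrightarrow> u m \<in> borel_measurable borel"
    "\<And>m x. m \<in> S \<Longrightarrow> norm (u m x) \<le> 2 * C * h m x"
    "\<And>m x. m \<in> S \<Longrightarrow> integrable lborel (\<lambda>y. N m x y * u m y)"
    "\<And>m x. m \<in> S \<Longrightarrow> u m x = \<phi> m x + (LINT y|lborel. N m x y * u m y)"
    "\<And>x. reg S (\<lambda>m. u m x)"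
proof -
  let ?U = "neumann_iter N \<phi>"
  have Nx: "(\<lambda>y. N m x y) \<in> borel_measurable borel" if "m \<in> S" for m x
    using measurable_Pair2[OF Nm[OF that], of x] by simp
  have Um: "?U n m \<in> borel_measurable borel" if "m \<in> S" for n m
  proof (induction n)
    case 0 then show ?case using \<phi>m that by simp
  next
    case (Suc n)
    have "(\<lambda>(x,y). N m x y * ?U n m y) \<in> borel_measurable (borel \<Otimes>\<^sub>M borel)"
      using Nm[OF that] Suc by (simp add: split_beta') measurable
    then have "(\<lambda>(x,y). N m x y * ?U n m y) \<in> borel_measurable (borel \<Otimes>\<^sub>M lborel)"
      by (simp add: measurable_cong_sets[OF sets_pair_measure_cong[OF refl sets_lborel]])
    then show ?case by (auto intro!: lborel.borel_measurable_lebesgue_integral)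
  qed
  have intb: "integrable lborel (\<lambda>y. N m x y * f y) \<and> norm (LINT y|lborel. N m x y * f y) \<le> c * h m x / 2"
    if "m \<in> S" "f \<in> borel_measurable borel" "\<And>y. norm (f y) \<le> c * h m y" for m x f c
  proof -
    have bd: "norm (N m x y * f y) \<le> c * (norm (N m x y) * h m y)" for y
      using mult_left_mono[OF that(3)[of y], of "norm (N m x y)"] by (simp add: norm_mult ac_simps)
    have i: "integrable lborel (\<lambda>y. c * (norm (N m x y) * h m y))" using keri[OF that(1)] by simp
    have m: "(\<lambda>y. N m x y * f y) \<in> borel_measurable lborel" using Nx[OF that(1)] that(2) by measurable
    have i2: "integrable lborel (\<lambda>y. N m x y * f y)"
      by (rule Bochner_Integration.integrable_bound[OF i m])
         (use bd in \<open>auto intro!: AE_I2 intro: order.trans[OF _ abs_ge_self]\<close>)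
    show ?thesis
    \<comment> \<open>The sign of \<open>c\<close> follows from the hypothesis on \<open>f\<close>
      only if the weight is positive somewhere; otherwise \<open>f\<close> vanishes.\<close>
    proof (cases "\<exists>y. h m y > 0")
      case True
      then obtain y0 where "h m y0 > 0" by blast
      then have c: "c \<ge> 0" using that(3)[of y0] norm_ge_zero[of "f y0"]
        by (metis linorder_not_less mult_neg_pos order_less_le_trans order_le_less_trans)
      have "norm (LINT y|lborel. N m x y * f y) \<le> (LINT y|lborel. c * (norm (N m x y) * h m y))"
        by (rule Bochner_Integration.integral_norm_bound_integral[OF i2 i]) (rule bd)
      also have "\<dots> \<le> c * h m x / 2"
        using mult_left_mono[OF ker[OF that(1), of x] c] by simp
      finally show ?thesis using i2 by simp
    next
      case False
      then have h: "h m y = 0" for y using h0[OF that(1), of y] by (metis less_eq_real_def)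
      then have "f y = 0" for y using that(3)[of y] by simp
      then show ?thesis using h by simp
    qed
  qed
  have Ub: "norm (?U n m x) \<le> C * (1/2)^n * h m x" if "m \<in> S" for n m x
  proof (induction n arbitrary: x)
    case 0 then show ?case using \<phi>b that by simp
  next
    case (Suc n)
    show ?case using intb[OF that Um[OF that] Suc, of x] by simp
  qed
  have Ui: "integrable lborel (\<lambda>y. N m x y * ?U n m y)" if "m \<in> S" for m n x
    using intb[OF that Um[OF that] Ub[OF that]] by blast
  have regU: "reg S (\<lambda>m. ?U n m x)" for n x
  proof (induction n arbitrary: x)
    case 0 then show ?case using reg\<phi> by simp
  next
    case (Suc n)
    obtain g where g: "integrable lborel g" "\<And>m y. m \<in> S \<Longrightarrow> norm (N m x y) * h m y \<le> g y"
      using dom[of x] by blast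
    show ?case
      unfolding neumann_iter.simps
    proof (rule reg_integral[where g="\<lambda>y. C * (1/2)^n * g y"])
      fix m y assume m: "m \<in> S"
      have "norm (N m x y * ?U n m y) \<le> norm (N m x y) * (C * (1/2)^n * h m y)"
        using mult_left_mono[OF Ub[OF m], of "norm (N m x y)"] by (simp add: norm_mult)
      also have "\<dots> = C * (1/2)^n * (norm (N m x y) * h m y)" by simp
      also have "\<dots> \<le> C * (1/2)^n * g y" using C0 g(2)[OF m] by (intro mult_left_mono) auto
      finally show "norm (N m x y * ?U n m y) \<le> C * (1/2)^n * g y" .
    qed (use g Ui Suc regN in \<open>auto intro!: reg_mult\<close>)
  qed
  have gs: "summable (\<lambda>n. c * (1/2::real)^n)" for c by (intro summable_mult summable_geometric) simp
  have gsum: "(\<Sum>n. c * (1/2::real)^n) = 2 * c" for c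
    by (subst suminf_mult) (auto simp: suminf_geometric)
  define u where "u m x = (\<Sum>n. ?U n m x)" for m x
  have sm: "summable (\<lambda>n. norm (?U n m x))" if "m \<in> S" for m x
    using Ub[OF that, of _ x] by (intro summable_comparison_test'[OF gs[of "C * h m x"]]) (auto simp: ac_simps)
  show ?thesis
  proof
    show um: "u m \<in> borel_measurable borel" if "m \<in> S" for m
      unfolding u_def using Um[OF that] by (intro borel_measurable_suminf)
    show ub: "norm (u m x) \<le> 2 * C * h m x" if "m \<in> S" for m x
    proof -
      have "norm (u m x) \<le> (\<Sum>n. norm (?U n m x))" unfolding u_def by (rule summable_norm[OF sm[OF that]])
      also have "\<dots> \<le> (\<Sum>n. (C * h m x) * (1/2)^n)"
        using Ub[OF that, of _ x] by (intro suminf_le sm that gs) (auto simp: ac_simps)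
      finally show ?thesis by (simp add: gsum)
    qed
    show "integrable lborel (\<lambda>y. N m x y * u m y)" if "m \<in> S" for m x
      using intb[OF that um[OF that] ub[OF that]] by blast
    show "u m x = \<phi> m x + (LINT y|lborel. N m x y * u m y)" if m: "m \<in> S" for m x
    proof -
      have nb: "norm (N m x y * ?U n m y) \<le> (norm (N m x y) * h m y * C) * (1/2)^n" for n y
        using mult_left_mono[OF Ub[OF m, of n y], of "norm (N m x y)"] by (simp add: norm_mult ac_simps)
      have "(LINT y|lborel. N m x y * u m y) = (LINT y|lborel. (\<Sum>n. N m x y * ?U n m y))"
        unfolding u_def using summable_norm_cancel[OF sm[OF m]] by (simp add: suminf_mult)
      also have "\<dots> = (\<Sum>n. LINT y|lborel. N m x y * ?U n m y)"
      proof (rule integral_suminf[OF Ui[OF m]])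
        show "AE y in lborel. summable (\<lambda>n. norm (N m x y * ?U n m y))"
          by (intro AE_I2 summable_comparison_test'[OF gs]) (use nb in auto)
        show "summable (\<lambda>n. LINT y|lborel. norm (N m x y * ?U n m y))"
        proof (rule summable_comparison_test'[OF gs[of "C * (h m x / 2)"]])
          fix n
          have "(LINT y|lborel. norm (N m x y * ?U n m y)) \<le> (LINT y|lborel. (norm (N m x y) * h m y * C) * (1/2)^n)"
            using Ui[OF m] keri[OF m] nb by (intro integral_mono integrable_norm) auto
          also have "\<dots> = (C * (1/2)^n) * (LINT y|lborel. norm (N m x y) * h m y)" by simp
          also have "\<dots> \<le> (C * (1/2)^n) * (h m x / 2)" using ker[OF m] C0 by (intro mult_left_mono) auto
          finally show "norm (LINT y|lborel. norm (N m x y * ?U n m y)) \<le> C * (h m x / 2) * (1/2)^n"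
            by (simp add: ac_simps)
        qed
      qed
      also have "\<dots> = (\<Sum>n. ?U (Suc n) m x)" by simp
      also have "\<dots> = u m x - \<phi> m x"
        unfolding u_def using summable_norm_cancel[OF sm[OF m]] by (subst suminf_split_head) auto
      finally show ?thesis by simp
    qed
    show "reg S (\<lambda>m. u m x)" for x
    proof -
      obtain B where B: "\<And>m. m \<in> S \<Longrightarrow> h m x \<le> B" using hb[of x] by blast
      show ?thesis unfolding u_def
      proof (rule reg_suminf[OF regU _ gs[of "C * B"]])
        fix n m assume "m \<in> S"
        have "C * (1/2)^n * h m x \<le> C * (1/2)^n * B" using B[OF \<open>m \<in> S\<close>] C0 by (intro mult_left_mono) auto
        then show "norm (?U n m x) \<le> C * B * (1/2)^n" using Ub[OF \<open>m \<in> S\<close>, of n x] by (simp add: ac_simps)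
      qed
    qed
  qed
qed

section \<open>The Volterra equations\<close>

lemma set_integrable_boundI:
  fixes f :: "real \<Rightarrow> 'a::{banach,second_countable_topology}" and g :: "real \<Rightarrow> real"
  assumes "set_integrable lborel A g" "(\<lambda>x. indicat_real A x *\<^sub>R f x) \<in> borel_measurable borel"
    and "\<And>x. x \<in> A \<Longrightarrow> norm (f x) \<le> g x"
  shows "set_integrable lborel A f"
  by (rule set_integrable_bound[OF assms(1)])
     (use assms in \<open>auto simp: set_borel_measurable_def intro!: AE_I2 intro: order.trans[OF _ abs_ge_self]\<close>)

lemma set_integral_norm_boundI:
  fixes f :: "real \<Rightarrow> 'a::{banach,second_countable_topology}" and g :: "real \<Rightarrow> real"
  assumes "set_integrable lborel A g" "set_integrable lborel A f" "\<And>x. x \<in> A \<Longrightarrow> norm (f x) \<le> g x"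
  shows "norm (LINT x:A|lborel. f x) \<le> (LINT x:A|lborel. g x)"
  unfolding set_lebesgue_integral_def
  using assms by (intro Bochner_Integration.integral_norm_bound_integral)
    (auto simp: set_integrable_def indicator_def)

lemma reg_if: "(c \<Longrightarrow> reg S f) \<Longrightarrow> reg S (\<lambda>m. if c then f m else 0)"
  by (cases c) (auto simp: reg_const)

text \<open>\<open>a m\<close> and \<open>b m\<close> solve \<open>y'' = V m y\<close>, \<open>R m\<close> is the perturbation of \<open>V m\<close>, and
  \<open>wa\<close>, \<open>wb\<close> are weights for \<open>a\<close>, \<open>b\<close>, respectively. Since \<open>wa/wb\<close> is increasing, the Volterra
  kernels are controlled by \<open>\<omega> Rs\<close> alone.\<close>

locale volterra =
  fixes S :: "complex set" and a a' b b' V R :: "complex \<Rightarrow> real \<Rightarrow> complex"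
    and W :: "complex \<Rightarrow> complex" and wa wb :: "complex \<Rightarrow> real \<Rightarrow> real"
    and \<omega> Rs :: "real \<Rightarrow> real" and C :: real
  assumes aca: "\<And>m. m \<in> S \<Longrightarrow> ac (a m) (a' m)" "\<And>m. m \<in> S \<Longrightarrow> ac (a' m) (\<lambda>x. V m x * a m x)"
    and acb: "\<And>m. m \<in> S \<Longrightarrow> ac (b m) (b' m)" "\<And>m. m \<in> S \<Longrightarrow> ac (b' m) (\<lambda>x. V m x * b m x)"
    and wron: "\<And>m x. m \<in> S \<Longrightarrow> x > 0 \<Longrightarrow> a m x * b' m x - a' m x * b m x = W m"
    and C1: "C \<ge> 1"
    and W0: "\<And>m. m \<in> S \<Longrightarrow> 1 \<le> C * norm (W m)"
    and ab: "\<And>m x. m \<in> S \<Longrightarrow> x > 0 \<Longrightarrow> norm (a m x) \<le> C * wa m x"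
    and bb: "\<And>m x. m \<in> S \<Longrightarrow> x > 0 \<Longrightarrow> norm (b m x) \<le> C * wb m x"
    and wapos: "\<And>m x. m \<in> S \<Longrightarrow> x > 0 \<Longrightarrow> wa m x > 0"
    and wbpos: "\<And>m x. m \<in> S \<Longrightarrow> x > 0 \<Longrightarrow> wb m x > 0"
    and wmono: "\<And>m x y. m \<in> S \<Longrightarrow> 0 < x \<Longrightarrow> x \<le> y \<Longrightarrow> wa m x * wb m y \<le> wb m x * wa m y"
    and wom: "\<And>m x. m \<in> S \<Longrightarrow> x > 0 \<Longrightarrow> wa m x * wb m x \<le> \<omega> x"
    and Rmeas: "\<And>m. m \<in> S \<Longrightarrow> R m \<in> borel_measurable borel"
    and Rb: "\<And>m x. m \<in> S \<Longrightarrow> x > 0 \<Longrightarrow> norm (R m x) \<le> Rs x"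
    and omR: "set_integrable lborel {0<..} (\<lambda>x. \<omega> x * Rs x)"
    and rega: "\<And>x. x > 0 \<Longrightarrow> reg S (\<lambda>m. a m x)" and regb: "\<And>x. x > 0 \<Longrightarrow> reg S (\<lambda>m. b m x)"
    and regR: "\<And>x. x > 0 \<Longrightarrow> reg S (\<lambda>m. R m x)" and regW: "reg S W"
    and wabd: "\<And>x. x > 0 \<Longrightarrow> \<exists>B. \<forall>m\<in>S. wa m x \<le> B"
    and wbbd: "\<And>x. x > 0 \<Longrightarrow> \<exists>B. \<forall>m\<in>S. wb m x \<le> B"
    and adb: "\<And>m x. m \<in> S \<Longrightarrow> x \<ge> 1 \<Longrightarrow> norm (a' m x) \<le> C * wa m x"
      "\<And>m x. m \<in> S \<Longrightarrow> x \<ge> 1 \<Longrightarrow> norm (b' m x) \<le> C * wb m x"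
    and wmeas: "\<And>m. m \<in> S \<Longrightarrow> wa m \<in> borel_measurable borel" "\<And>m. m \<in> S \<Longrightarrow> wb m \<in> borel_measurable borel"
begin

text \<open>Two products in the Volterra kernel, each costing one \<open>C\<close> for
  \<open>a\<close>, one for \<open>b\<close> and one for \<open>1 / W\<close>.\<close>

definition \<rho> :: "real \<Rightarrow> real" where "\<rho> y = 2 * C^3 * (\<omega> y * Rs y)"
text \<open>2 is the sum of the geometric series, \<open>C\<close> bounds the inhomogeneous term,
  and the exponential is the largest value of the contraction weight.\<close>

definition K :: real where "K = 2 * C * exp (2 * (LINT y:{0<..}|lborel. \<rho> y))"
text \<open>Common density for the integrands of the coefficients \<open>uA\<close>,
  \<open>uB\<close>, \<open>vA\<close>, \<open>vB\<close>: one \<open>C\<close> for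
  \<open>1 / W\<close>, one for \<open>a\<close> or \<open>b\<close>, and \<open>K\<close> for the
  perturbed solution.\<close>

definition \<kappa> :: "real \<Rightarrow> real" where "\<kappa> y = C^2 * K * (\<omega> y * Rs y)"

lemma Wnz: "m \<in> S \<Longrightarrow> W m \<noteq> 0" using W0[of m] by auto

lemma invW: "m \<in> S \<Longrightarrow> norm (z / W m) \<le> C * norm z"
  using W0[of m] Wnz[of m] mult_right_mono[of 1 "C * norm (W m)" "norm z"]
  by (simp add: norm_divide divide_le_eq mult.commute mult.left_commute)

text \<open>The signs of \<open>\<omega>\<close> and \<open>Rs\<close> are not assumed but inherited
  from the weights and from a norm. This takes a point of \<open>S\<close>, which is why
  \<open>m \<in> S\<close> or \<open>S \<noteq> {}\<close> occurs in later statements that do not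
  involve \<open>m\<close>.\<close>

lemma omRnn: "m \<in> S \<Longrightarrow> x > 0 \<Longrightarrow> 0 \<le> \<omega> x \<and> 0 \<le> Rs x"
  using wom[of m x] wapos[of m x] wbpos[of m x] Rb[of m x] norm_ge_zero[of "R m x"]
  by (smt (verit) mult_pos_pos)

lemma rho_int: "set_integrable lborel {0<..} \<rho>"
  unfolding \<rho>_def using omR by simp

lemma kappa_int: "set_integrable lborel {0<..} \<kappa>"
  unfolding \<kappa>_def using omR by simp

lemma K_pos: "K > 0" using C1 by (simp add: K_def)

lemma rho_nn: "m \<in> S \<Longrightarrow> x > 0 \<Longrightarrow> 0 \<le> \<rho> x"
  using omRnn[of m x] C1 by (simp add: \<rho>_def)

lemma kappa_nn: "m \<in> S \<Longrightarrow> x > 0 \<Longrightarrow> 0 \<le> \<kappa> x"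
  using omRnn[of m x] C1 K_pos by (simp add: \<kappa>_def)

lemma meas_pos:
  assumes "m \<in> S"
  shows "(\<lambda>x. if x > 0 then a m x else 0) \<in> borel_measurable borel" "(\<lambda>x. if x > 0 then b m x else 0) \<in> borel_measurable borel"
  using ac_continuous[OF aca(1)[OF assms]] ac_continuous[OF acb(1)[OF assms]] by (auto intro: borel_measurable_if_pos)

text \<open>As a function of x, the factor in front of \<open>R m y\<close> is the solution of the
  unperturbed equation with value 0 and slope 1 at x = y.\<close>

definition ker :: "complex \<Rightarrow> real \<Rightarrow> real \<Rightarrow> complex" where
  "ker m x y = (a m y * b m x - a m x * b m y) / W m * R m y"

lemma ker_bound:
  assumes "m \<in> S" "x > 0" "y > 0"
  shows "norm (ker m x y) \<le> C^3 * (wa m y * wb m x + wa m x * wb m y) * Rs y"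
proof -
  have "norm (a m y * b m x - a m x * b m y) \<le> (C * wa m y) * (C * wb m x) + (C * wa m x) * (C * wb m y)"
  proof (intro order.trans[OF norm_triangle_ineq4] add_mono)
    note * = ab[OF assms(1,2)] ab[OF assms(1,3)] bb[OF assms(1,2)] bb[OF assms(1,3)]
    have "0 \<le> C * wa m y" "0 \<le> C * wa m x"
      using order.trans[OF norm_ge_zero *(1)] order.trans[OF norm_ge_zero *(2)] by auto
    then show "norm (a m y * b m x) \<le> (C * wa m y) * (C * wb m x)" "norm (a m x * b m y) \<le> (C * wa m x) * (C * wb m y)"
      unfolding norm_mult by (intro mult_mono *; simp)+
  qed
  then have 1: "norm ((a m y * b m x - a m x * b m y) / W m) \<le> C * ((C * wa m y) * (C * wb m x) + (C * wa m x) * (C * wb m y))"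
    using C1 by (intro order.trans[OF invW[OF assms(1)]] mult_left_mono) auto
  have "norm (ker m x y) \<le> C * ((C * wa m y) * (C * wb m x) + (C * wa m x) * (C * wb m y)) * Rs y"
    unfolding ker_def norm_mult
    by (rule mult_mono[OF 1 Rb]) (use assms norm_ge_zero order.trans[OF norm_ge_zero 1] in auto)
  then show ?thesis by (simp add: algebra_simps power3_eq_cube)
qed

lemma ker_meas:
  assumes m: "m \<in> S" and [measurable]: "Measurable.pred (borel \<Otimes>\<^sub>M borel) (\<lambda>(x,y). T x y)"
  shows "(\<lambda>(x,y). if 0 < x \<and> 0 < y \<and> T x y then ker m x y else 0) \<in> borel_measurable (borel \<Otimes>\<^sub>M borel)"
proof -
  note [measurable] = meas_pos[OF m] Rmeas[OF m]
  have "(\<lambda>(x,y). if 0 < x \<and> 0 < y \<and> T x y then 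
     ((if y > 0 then a m y else 0) * (if x > 0 then b m x else 0) - (if x > 0 then a m x else 0) * (if y > 0 then b m y else 0)) / W m * R m y
     else 0) \<in> borel_measurable (borel \<Otimes>\<^sub>M borel)"
    using assms(2) unfolding split_beta' by measurable
  then show ?thesis
    by (rule back_subst[where P="\<lambda>f. f \<in> _"]) (auto simp: ker_def fun_eq_iff)
qed

definition is_left :: "(complex \<Rightarrow> real \<Rightarrow> complex) \<Rightarrow> bool" where
  "is_left u \<longleftrightarrow> (\<forall>m\<in>S. u m \<in> borel_measurable borel) \<and>
     (\<forall>m\<in>S. \<forall>x>0. norm (u m x) \<le> K * wa m x) \<and>
     (\<forall>m\<in>S. \<forall>x>0. u m x = a m x + (LINT y:{0<..x}|lborel. ker m x y * u m y)) \<and>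
     (\<forall>x. reg S (\<lambda>m. u m x))"

definition is_right :: "(complex \<Rightarrow> real \<Rightarrow> complex) \<Rightarrow> bool" where
  "is_right v \<longleftrightarrow> (\<forall>m\<in>S. v m \<in> borel_measurable borel) \<and>
     (\<forall>m\<in>S. \<forall>x>0. norm (v m x) \<le> K * wb m x) \<and>
     (\<forall>m\<in>S. \<forall>x>0. v m x = b m x - (LINT y:{x..}|lborel. ker m x y * v m y)) \<and>
     (\<forall>x. reg S (\<lambda>m. v m x))"

lemma reg_ker: "x > 0 \<Longrightarrow> y > 0 \<Longrightarrow> reg S (\<lambda>m. ker m x y)"
  unfolding ker_def
  by (intro reg_mult reg_divide reg_diff rega regb regR regW Wnz) auto

text \<open>The two Volterra equations differ in the domain of integration \<open>E x\<close>, the weight \<open>w\<close> and the sign \<open>c\<close>.\<close>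

lemma ex_volterra_solution:
  fixes \<phi> :: "complex \<Rightarrow> real \<Rightarrow> complex" and w :: "complex \<Rightarrow> real \<Rightarrow> real" and P :: "real \<Rightarrow> real"
  assumes Em: "Measurable.pred (borel \<Otimes>\<^sub>M borel) (\<lambda>(x,y). y \<in> E x)" and E: "\<And>x. x > 0 \<Longrightarrow> E x \<subseteq> {0<..}"
    and Pm: "continuous_on {0<..} P" and P: "\<And>x. x > 0 \<Longrightarrow> P x = (LINT y:E x|lborel. \<rho> y)"
    and Ei: "\<And>x. x > 0 \<Longrightarrow> S \<noteq> {} \<Longrightarrow> set_integrable lborel (E x) (\<lambda>y. \<rho> y * exp (2 * P y))"
      "\<And>x. x > 0 \<Longrightarrow> S \<noteq> {} \<Longrightarrow> (LINT y:E x|lborel. \<rho> y * exp (2 * P y)) \<le> exp (2 * P x) / 2"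
    and Es: "\<And>x. E x \<in> sets borel"
    and bd0: "\<And>m x y. m \<in> S \<Longrightarrow> x > 0 \<Longrightarrow> y \<in> E x \<Longrightarrow> norm (ker m x y) * w m y \<le> w m x * \<rho> y"
    and w: "\<And>m x. m \<in> S \<Longrightarrow> x > 0 \<Longrightarrow> w m x > 0" "\<And>m. m \<in> S \<Longrightarrow> w m \<in> borel_measurable borel"
      "\<And>x. x > 0 \<Longrightarrow> \<exists>B. \<forall>m\<in>S. w m x \<le> B"
    and \<phi>: "\<And>m x. m \<in> S \<Longrightarrow> x > 0 \<Longrightarrow> norm (\<phi> m x) \<le> C * w m x" "\<And>x. x > 0 \<Longrightarrow> reg S (\<lambda>m. \<phi> m x)"
      "\<And>m. m \<in> S \<Longrightarrow> (\<lambda>x. if x > 0 then \<phi> m x else 0) \<in> borel_measurable borel"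
    and c: "norm (c::complex) = 1"
  shows "\<exists>u. (\<forall>m\<in>S. u m \<in> borel_measurable borel) \<and> (\<forall>m\<in>S. \<forall>x>0. norm (u m x) \<le> K * w m x) \<and>
     (\<forall>m\<in>S. \<forall>x>0. u m x = \<phi> m x + c * (LINT y:E x|lborel. ker m x y * u m y)) \<and> (\<forall>x. reg S (\<lambda>m. u m x))"
proof -
  \<comment> \<open>Kernel, inhomogeneity and weight are extended by zero to x \<le> 0, so that
    \<open>neumann_series\<close> can work on the whole line. The exponential in \<open>?h\<close>
    is the weight that makes the kernel a contraction.\<close>
  let ?N = "\<lambda>m x y. if 0 < x \<and> 0 < y \<and> y \<in> E x then c * ker m x y else 0"
  let ?h = "\<lambda>m x. if x > 0 then w m x * exp (2 * P x) else 0"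
  let ?g = "\<lambda>x y. indicat_real (E x) y *\<^sub>R (\<rho> y * exp (2 * P y))"
  have Pm': "(\<lambda>x. if x > 0 then exp (2 * P x) else 0) \<in> borel_measurable borel"
    by (intro borel_measurable_if_pos continuous_intros Pm)
  have gi: "integrable lborel (?g x)" and gle: "(LINT y|lborel. ?g x y) \<le> exp (2 * P x) / 2"
    if "m \<in> S" "x > 0" for m x
    using Ei[OF that(2)] that(1) by (auto simp: set_integrable_def set_lebesgue_integral_def)
  have gnn: "0 \<le> ?g x y" if "m \<in> S" "x > 0" for m x y
    using rho_nn[OF that(1), of y] E[OF that(2)] by (auto simp: indicator_def)
  have P0: "0 \<le> P x" "P x \<le> (LINT y:{0<..}|lborel. \<rho> y)" if "m \<in> S" "x > 0" for m x
    unfolding P[OF that(2)] using rho_nn[OF that(1)] E[OF that(2)] Es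
    by (auto intro!: set_integral_nonneg' set_integral_mono_set rho_int)
  have bd: "norm (?N m x y) * ?h m y \<le> w m x * ?g x y" if m: "m \<in> S" and x: "x > 0" for m x y
  proof (cases "y \<in> E x")
    case True
    then have y: "y > 0" using E[OF x] by auto
    have "norm (ker m x y) * w m y * exp (2 * P y) \<le> w m x * \<rho> y * exp (2 * P y)"
      using bd0[OF m x True] by (intro mult_right_mono) auto
    then show ?thesis using True x y c by (simp add: norm_mult ac_simps)
  qed (auto simp: indicator_def)
  have Nm: "(\<lambda>(x,y). ?N m x y) \<in> borel_measurable (borel \<Otimes>\<^sub>M borel)" if "m \<in> S" for m
  proof -
    have "(\<lambda>p. c * (case p of (x,y) \<Rightarrow> if 0 < x \<and> 0 < y \<and> y \<in> E x then ker m x y else 0)) \<in> borel_measurable (borel \<Otimes>\<^sub>M borel)"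
      by (intro borel_measurable_times borel_measurable_const ker_meas[OF that] Em)
    then show ?thesis by (rule back_subst[where P="\<lambda>f. f \<in> _"]) (auto simp: fun_eq_iff)
  qed
  have h0: "0 \<le> ?h m x" if "m \<in> S" for m x using w(1)[OF that, of x] by (auto intro: less_imp_le mult_pos_pos)
  obtain u where u: "\<And>m. m \<in> S \<Longrightarrow> u m \<in> borel_measurable borel"
    "\<And>m x. m \<in> S \<Longrightarrow> norm (u m x) \<le> 2 * C * ?h m x"
    "\<And>m x. m \<in> S \<Longrightarrow> u m x = (if x > 0 then \<phi> m x else 0) + (LINT y|lborel. ?N m x y * u m y)"
    "\<And>x. reg S (\<lambda>m. u m x)"
  proof (rule neumann_series[of S ?N "\<lambda>m x. if x > 0 then \<phi> m x else 0" ?h C])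
    show "norm (if x > 0 then \<phi> m x else 0) \<le> C * ?h m x" if "m \<in> S" for m x
    proof (cases "x > 0")
      case True
      have "C * w m x \<le> C * (w m x * exp (2 * P x))"
        using C1 w(1)[OF that True] P0[OF that True] by (intro mult_left_mono) auto
      then show ?thesis using \<phi>(1)[OF that True] True by simp
    qed simp
    show keri: "integrable lborel (\<lambda>y. norm (?N m x y) * ?h m y)" if "m \<in> S" for m x
    proof (cases "x > 0")
      case True
      have "integrable lborel (\<lambda>y. w m x * ?g x y)"
        using gi[OF that True] by (rule integrable_mult_right)
      then show ?thesis
      proof (rule Bochner_Integration.integrable_bound)
        have [measurable]: "(\<lambda>y. ?N m x y) \<in> borel_measurable borel"
          using measurable_Pair2[OF Nm[OF that], of x] by simp
        have "(\<lambda>y. norm (?N m x y) * (w m y * (if y > 0 then exp (2 * P y) else 0))) \<in> borel_measurable borel"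
          using w(2)[OF that] Pm' by measurable
        then show "(\<lambda>y. norm (?N m x y) * ?h m y) \<in> borel_measurable lborel"
          unfolding measurable_lborel2 by (rule back_subst[where P="\<lambda>f. f \<in> _"]) (auto simp: fun_eq_iff)
        show "AE y in lborel. norm (norm (?N m x y) * ?h m y) \<le> norm (w m x * ?g x y)"
        proof (rule AE_I2)
          fix y
          have "0 \<le> norm (?N m x y) * ?h m y" using h0[OF that, of y] by (intro mult_nonneg_nonneg) auto
          then show "norm (norm (?N m x y) * ?h m y) \<le> norm (w m x * ?g x y)"
            using bd[OF that True, of y] by (smt (verit) real_norm_def)
        qed
      qed
    qed simp
    show "(LINT y|lborel. norm (?N m x y) * ?h m y) \<le> ?h m x / 2" if "m \<in> S" for m x
    proof (cases "x > 0")
      case True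
      have "(LINT y|lborel. norm (?N m x y) * ?h m y) \<le> (LINT y|lborel. w m x * ?g x y)"
        by (intro integral_mono keri[OF that] integrable_mult_right gi[OF that True] bd[OF that True])
      also have "\<dots> = w m x * (LINT y|lborel. ?g x y)" by simp
      also have "\<dots> \<le> w m x * (exp (2 * P x) / 2)"
        using gle[OF that True] w(1)[OF that True] by (intro mult_left_mono) auto
      finally show ?thesis using True by simp
    qed simp
    show "\<exists>g. integrable lborel g \<and> (\<forall>m\<in>S. \<forall>y. norm (?N m x y) * ?h m y \<le> g y)" for x
    proof (cases "x > 0 \<and> S \<noteq> {}")
      case True
      then obtain m0 where m0: "m0 \<in> S" by blast
      obtain B where B: "\<And>m. m \<in> S \<Longrightarrow> w m x \<le> B" using w(3) True by meson
      have "integrable lborel (\<lambda>y. B * ?g x y)"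
        using gi[OF m0] True by (intro integrable_mult_right) blast
      moreover have "norm (?N m x y) * ?h m y \<le> B * ?g x y" if "m \<in> S" for m y
      proof -
        have "x > 0" using True by blast
        then show ?thesis
          using bd[OF that, of x y] mult_right_mono[OF B[OF that] gnn[OF that, of x y]] by linarith
      qed
      ultimately show ?thesis by blast
    qed (auto intro!: exI[of _ "\<lambda>_. 0"])
    show "\<exists>B. \<forall>m\<in>S. ?h m x \<le> B" for x
    proof (cases "x > 0")
      case True
      then obtain B where B: "\<And>m. m \<in> S \<Longrightarrow> w m x \<le> B" using w(3) by meson
      then have "\<forall>m\<in>S. ?h m x \<le> B * exp (2 * P x)" using True by simp
      then show ?thesis by blast
    qed auto
    show "reg S (\<lambda>m. ?N m x y)" for x y by (rule reg_if) (auto intro: reg_ker reg_mult)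
    show "reg S (\<lambda>m. if x > 0 then \<phi> m x else 0)" for x by (rule reg_if) (rule \<phi>(2))
    show "0 \<le> ?h m x" if "m \<in> S" for m x by (rule h0[OF that])
    show "C \<ge> 0" using C1 by simp
    show "(\<lambda>(x, y). ?N m x y) \<in> borel_measurable (borel \<Otimes>\<^sub>M borel)" if "m \<in> S" for m by (rule Nm[OF that])
    show "(\<lambda>x. if x > 0 then \<phi> m x else 0) \<in> borel_measurable borel" if "m \<in> S" for m by (rule \<phi>(3)[OF that])
  qed blast
  have "norm (u m x) \<le> K * w m x" if "m \<in> S" "x > 0" for m x
  proof -
    have "2 * C * (w m x * exp (2 * P x)) \<le> 2 * C * (w m x * exp (2 * (LINT y:{0<..}|lborel. \<rho> y)))"
      using C1 w(1)[OF that] P0[OF that] by (intro mult_left_mono) auto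
    then show ?thesis using u(2)[OF that(1), of x] that(2) by (simp add: K_def ac_simps)
  qed
  moreover have "u m x = \<phi> m x + c * (LINT y:E x|lborel. ker m x y * u m y)" if "m \<in> S" "x > 0" for m x
  proof -
    have "(LINT y|lborel. ?N m x y * u m y) = (LINT y:E x|lborel. c * (ker m x y * u m y))"
      unfolding set_lebesgue_integral_def using E[OF that(2)]
      by (intro Bochner_Integration.integral_cong) (use that in \<open>auto simp: indicator_def\<close>)
    then show ?thesis using u(3)[OF that(1), of x] that by simp
  qed
  ultimately show ?thesis using u(1,4) by blast
qed

text \<open>For y \<le> x, \<open>wmono\<close> turns \<open>wa y * wb x\<close> into
  \<open>wb y * wa x\<close>. Both halves of the kernel bound then carry \<open>wa x * wb y\<close>,
  and the missing \<open>wa y\<close> completes \<open>wa y * wb y\<close>, which is at most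
  \<open>\<omega> y\<close>.\<close>

lemma ex_left: "\<exists>u. is_left u"
proof -
  have "ac (\<lambda>x. LINT y:{0<..x}|lborel. \<rho> y) \<rho>"
    by (intro ac_integral_left set_integrable_subset[OF rho_int]) auto
  note Pc = ac_continuous[OF this]
  have bd: "norm (ker m x y) * wa m y \<le> wa m x * \<rho> y" if m: "m \<in> S" and "x > 0" "y \<in> {0<..x}" for m x y
  proof -
    have xy: "0 < x" "0 < y" "y \<le> x" using that by auto
    have "norm (ker m x y) * wa m y \<le> C^3 * (wa m y * wb m x + wa m x * wb m y) * Rs y * wa m y"
      using ker_bound[OF m xy(1,2)] wapos[OF m xy(2)] by (intro mult_right_mono) auto
    also have "\<dots> \<le> C^3 * (wb m y * wa m x + wa m x * wb m y) * Rs y * wa m y"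
      using wmono[OF m xy(2,3)] omRnn[OF m xy(2)] C1 wapos[OF m xy(2)] wapos[OF m xy(1)] wbpos[OF m xy(2)] wbpos[OF m xy(1)]
      by (intro mult_right_mono mult_left_mono add_mono) auto
    also have "\<dots> = wa m x * (2 * C^3 * Rs y) * (wa m y * wb m y)" by (simp add: algebra_simps)
    also have "\<dots> \<le> wa m x * (2 * C^3 * Rs y) * \<omega> y"
      using wom[OF m xy(2)] omRnn[OF m xy(2)] C1 wapos[OF m xy(1)] by (intro mult_left_mono) auto
    finally show ?thesis by (simp add: \<rho>_def ac_simps)
  qed
  have "\<exists>u. (\<forall>m\<in>S. u m \<in> borel_measurable borel) \<and> (\<forall>m\<in>S. \<forall>x>0. norm (u m x) \<le> K * wa m x) \<and>
     (\<forall>m\<in>S. \<forall>x>0. u m x = a m x + 1 * (LINT y:{0<..x}|lborel. ker m x y * u m y)) \<and> (\<forall>x. reg S (\<lambda>m. u m x))"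
    by (rule ex_volterra_solution[OF _ _ Pc refl])
       (use exp_weight_left[OF rho_int rho_nn] in \<open>auto intro: bd wapos wmeas wabd ab rega meas_pos\<close>)
  then show ?thesis by (simp add: is_left_def)
qed

lemma ex_right: "\<exists>v. is_right v"
proof -
  have "ac (\<lambda>x. LINT y:{x..}|lborel. \<rho> y) (\<lambda>x. - \<rho> x)"
    by (intro ac_integral_right set_integrable_subset[OF rho_int]) auto
  note Pc = ac_continuous[OF this]
  have bd: "norm (ker m x y) * wb m y \<le> wb m x * \<rho> y" if m: "m \<in> S" and "x > 0" "y \<in> {x..}" for m x y
  proof -
    have xy: "0 < x" "0 < y" "x \<le> y" using that by auto
    have "norm (ker m x y) * wb m y \<le> C^3 * (wa m y * wb m x + wa m x * wb m y) * Rs y * wb m y"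
      using ker_bound[OF m xy(1,2)] wbpos[OF m xy(2)] by (intro mult_right_mono) auto
    also have "\<dots> \<le> C^3 * (wa m y * wb m x + wb m x * wa m y) * Rs y * wb m y"
      using wmono[OF m xy(1,3)] omRnn[OF m xy(2)] C1 wapos[OF m xy(2)] wapos[OF m xy(1)] wbpos[OF m xy(2)] wbpos[OF m xy(1)]
      by (intro mult_right_mono mult_left_mono add_mono) auto
    also have "\<dots> = wb m x * (2 * C^3 * Rs y) * (wa m y * wb m y)" by (simp add: algebra_simps)
    also have "\<dots> \<le> wb m x * (2 * C^3 * Rs y) * \<omega> y"
      using wom[OF m xy(2)] omRnn[OF m xy(2)] C1 wbpos[OF m xy(1)] by (intro mult_left_mono) auto
    finally show ?thesis by (simp add: \<rho>_def ac_simps)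
  qed
  have "\<exists>u. (\<forall>m\<in>S. u m \<in> borel_measurable borel) \<and> (\<forall>m\<in>S. \<forall>x>0. norm (u m x) \<le> K * wb m x) \<and>
     (\<forall>m\<in>S. \<forall>x>0. u m x = b m x + (- 1) * (LINT y:{x..}|lborel. ker m x y * u m y)) \<and> (\<forall>x. reg S (\<lambda>m. u m x))"
    by (rule ex_volterra_solution[OF _ _ Pc refl])
       (use exp_weight_right[OF rho_int rho_nn] in \<open>auto intro: bd wbpos wmeas wbbd bb regb meas_pos\<close>)
  then show ?thesis by (simp add: is_right_def)
qed

end

section \<open>Regular and decaying solutions\<close>

text \<open>The densities of \<open>A\<close> and \<open>B\<close> are chosen so that
  \<open>A' a + B' b\<close> vanishes; the derivative then has the same form, and the second
  derivative picks up just the Wronskian times \<open>g\<close>. It serves the two Volterra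
  solutions and the resolvent alike.\<close>

lemma variation_of_constants:
  assumes "ac a a'" "ac a' (\<lambda>x. V x * a x)" "ac b b'" "ac b' (\<lambda>x. V x * b x)"
    "ac A (\<lambda>x. - (b x * g x))" "ac B (\<lambda>x. a x * g x)"
  shows "ac (\<lambda>x. A x * a x + B x * b x) (\<lambda>x. A x * a' x + B x * b' x)"
    and "ac (\<lambda>x. A x * a' x + B x * b' x)
           (\<lambda>x. V x * (A x * a x + B x * b x) + (a x * b' x - a' x * b x) * g x)"
  by (rule ac_cong[OF ac_add[OF ac_mult[OF assms(5,1)] ac_mult[OF assms(6,3)]]]; simp add: algebra_simps)
     (rule ac_cong[OF ac_add[OF ac_mult[OF assms(5,2)] ac_mult[OF assms(6,4)]]]; simp add: algebra_simps)

lemma set_integral_split_pos: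
  fixes f :: "real \<Rightarrow> 'a::{banach,second_countable_topology}"
  assumes "set_integrable lborel {0<..} f" "x > 0"
  shows "(LINT y:{0<..}|lborel. f y) = (LINT y:{0<..x}|lborel. f y) + (LINT y:{x..}|lborel. f y)"
proof -
  have un: "{0<..} = {0<..x} \<union> {x..}" using assms by auto
  show ?thesis
    unfolding un using assms AE_lborel_singleton[of x]
    by (intro set_integral_Un_AE) (auto elim: eventually_mono intro: set_integrable_subset)
qed

lemma set_integral_limits:
  fixes f :: "real \<Rightarrow> 'a::{banach,second_countable_topology}"
  assumes f: "set_integrable lborel {0<..} f"
  shows "((\<lambda>x. LINT y:{x..}|lborel. f y) \<longlongrightarrow> (LINT y:{0<..}|lborel. f y)) (at_right 0)"
    and "((\<lambda>x. LINT y:{0<..x}|lborel. f y) \<longlongrightarrow> 0) (at_right 0)"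
    and "((\<lambda>x. LINT y:{0<..x}|lborel. f y) \<longlongrightarrow> (LINT y:{0<..}|lborel. f y)) at_top"
    and "((\<lambda>x. LINT y:{x..}|lborel. f y) \<longlongrightarrow> 0) at_top"
proof -
  have sub: "set_integrable lborel A f" if "A \<subseteq> {0<..}" "A \<in> sets borel" for A
    using f that by (intro set_integrable_subset[OF f]) auto
  have "((\<lambda>x. LINT y:{x..1}|lborel. f y) \<longlongrightarrow> (LINT y:{0<..1}|lborel. f y)) (at_right 0)"
    by (intro tendsto_set_lebesgue_integral_at_right sub) auto
  then have "((\<lambda>x. (LINT y:{x..1}|lborel. f y) + (LINT y:{1..}|lborel. f y)) \<longlongrightarrow> (LINT y:{0<..1}|lborel. f y) + (LINT y:{1..}|lborel. f y)) (at_right 0)"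
    by (intro tendsto_intros)
  moreover have "\<forall>\<^sub>F x in at_right 0. (LINT y:{x..1}|lborel. f y) + (LINT y:{1..}|lborel. f y) = (LINT y:{x..}|lborel. f y)"
    using eventually_at_right_real[of 0 "1::real", OF zero_less_one]
  proof eventually_elim
    case (elim x)
    then have un: "{x..} = {x..1} \<union> {1..}" by auto
    show ?case
      unfolding un using elim AE_lborel_singleton[of 1]
      by (intro set_integral_Un_AE[symmetric] sub) (auto elim: eventually_mono)
  qed
  ultimately show 1: "((\<lambda>x. LINT y:{x..}|lborel. f y) \<longlongrightarrow> (LINT y:{0<..}|lborel. f y)) (at_right 0)"
    using set_integral_split_pos[OF f zero_less_one] by (simp add: tendsto_cong)
  have "((\<lambda>x. LINT y:{1..x}|lborel. f y) \<longlongrightarrow> (LINT y:{1..}|lborel. f y)) at_top"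
    by (intro tendsto_set_lebesgue_integral_at_top sub) auto
  then have "((\<lambda>x. (LINT y:{0<..1}|lborel. f y) + (LINT y:{1..x}|lborel. f y)) \<longlongrightarrow> (LINT y:{0<..1}|lborel. f y) + (LINT y:{1..}|lborel. f y)) at_top"
    by (intro tendsto_intros)
  moreover have "\<forall>\<^sub>F x in at_top. (LINT y:{0<..1}|lborel. f y) + (LINT y:{1..x}|lborel. f y) = (LINT y:{0<..x}|lborel. f y)"
    using eventually_ge_at_top[of "1::real"]
  proof eventually_elim
    case (elim x)
    then have un: "{0<..x} = {0<..1} \<union> {1..x}" by auto
    show ?case
      unfolding un using elim AE_lborel_singleton[of 1]
      by (intro set_integral_Un_AE[symmetric] sub) (auto elim: eventually_mono)
  qed
  ultimately show 2: "((\<lambda>x. LINT y:{0<..x}|lborel. f y) \<longlongrightarrow> (LINT y:{0<..}|lborel. f y)) at_top"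
    using set_integral_split_pos[OF f zero_less_one] by (simp add: tendsto_cong)
  have "((\<lambda>x. (LINT y:{0<..}|lborel. f y) - (LINT y:{x..}|lborel. f y)) \<longlongrightarrow> (LINT y:{0<..}|lborel. f y) - (LINT y:{0<..}|lborel. f y)) (at_right 0)"
    by (intro tendsto_intros 1)
  moreover have "\<forall>\<^sub>F x in at_right 0. (LINT y:{0<..}|lborel. f y) - (LINT y:{x..}|lborel. f y) = (LINT y:{0<..x}|lborel. f y)"
    using eventually_at_right_less[of "0::real"]
    by eventually_elim (simp add: set_integral_split_pos[OF f])
  ultimately show "((\<lambda>x. LINT y:{0<..x}|lborel. f y) \<longlongrightarrow> 0) (at_right 0)"
    by (simp add: tendsto_cong)
  have "((\<lambda>x. (LINT y:{0<..}|lborel. f y) - (LINT y:{0<..x}|lborel. f y)) \<longlongrightarrow> (LINT y:{0<..}|lborel. f y) - (LINT y:{0<..}|lborel. f y)) at_top"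
    by (intro tendsto_intros 2)
  moreover have "\<forall>\<^sub>F x in at_top. (LINT y:{0<..}|lborel. f y) - (LINT y:{0<..x}|lborel. f y) = (LINT y:{x..}|lborel. f y)"
    using eventually_gt_at_top[of "0::real"]
    by eventually_elim (simp add: set_integral_split_pos[OF f])
  ultimately show "((\<lambda>x. LINT y:{x..}|lborel. f y) \<longlongrightarrow> 0) at_top"
    by (simp add: tendsto_cong)
qed

section \<open>The two solutions, the Jost function and Wronskians\<close>

context volterra
begin

definition uu :: "complex \<Rightarrow> real \<Rightarrow> complex" where "uu = (SOME u. is_left u)"
definition vv :: "complex \<Rightarrow> real \<Rightarrow> complex" where "vv = (SOME v. is_right v)"

lemma is_left_uu: "is_left uu" unfolding uu_def using ex_left by (rule someI_ex)
lemma is_right_vv: "is_right vv" unfolding vv_def using ex_right by (rule someI_ex)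

lemma uu_bound: "m \<in> S \<Longrightarrow> x > 0 \<Longrightarrow> norm (uu m x) \<le> K * wa m x"
  and uu_meas: "m \<in> S \<Longrightarrow> uu m \<in> borel_measurable borel"
  and uu_reg: "reg S (\<lambda>m. uu m x)"
  using is_left_uu by (auto simp: is_left_def)

lemma vv_bound: "m \<in> S \<Longrightarrow> x > 0 \<Longrightarrow> norm (vv m x) \<le> K * wb m x"
  and vv_meas: "m \<in> S \<Longrightarrow> vv m \<in> borel_measurable borel"
  and vv_reg: "reg S (\<lambda>m. vv m x)"
  using is_right_vv by (auto simp: is_right_def)

text \<open>Variation of constants: the solution is \<open>uA a + uB b\<close> with derivative \<open>uA a' + uB b'\<close>,
  and the Jost function is the limit of \<open>uA\<close> at infinity.\<close>

definition "uA m x = 1 - (LINT y:{0<..x}|lborel. b m y * (R m y * uu m y / W m))"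
definition "uB m x = (LINT y:{0<..x}|lborel. a m y * (R m y * uu m y / W m))"
definition "vA m x = (LINT y:{x..}|lborel. b m y * (R m y * vv m y / W m))"
definition "vB m x = 1 - (LINT y:{x..}|lborel. a m y * (R m y * vv m y / W m))"
definition "uu' m x = uA m x * a' m x + uB m x * b' m x"
definition "vv' m x = vA m x * a' m x + vB m x * b' m x"
definition "jost m = 1 - (LINT y:{0<..}|lborel. b m y * (R m y * uu m y / W m))"

text \<open>One estimate for four integrands: \<open>c = 1\<close> if the weights of
  \<open>p\<close> and \<open>q\<close> are opposite, and \<open>c\<close> is a ratio of
  \<open>wa\<close> and \<open>wb\<close> at the end point of integration if they are equal.\<close>

lemma triple_bound:
  assumes "m \<in> S" "x > 0" "norm p \<le> C * wp" "norm q \<le> K * wq" "wp * wq \<le> c * \<omega> x" "c \<ge> 0" "wp \<ge> 0"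
  shows "norm (p * (R m x * q / W m)) \<le> c * \<kappa> x"
proof -
  have "norm (p * (R m x * q / W m)) = norm (p * R m x * q / W m)" by (simp add: mult.assoc)
  also have "\<dots> \<le> C * norm (p * R m x * q)" by (rule invW[OF assms(1)])
  also have "\<dots> = C * (norm p * norm q * norm (R m x))" by (simp add: norm_mult)
  also have "\<dots> \<le> C * ((C * wp) * (K * wq) * Rs x)"
    using C1 Rb[OF assms(1,2)] order.trans[OF norm_ge_zero assms(3)] order.trans[OF norm_ge_zero assms(4)]
    by (intro mult_left_mono mult_mono assms) auto
  also have "\<dots> = C^2 * K * Rs x * (wp * wq)" by (simp add: power2_eq_square)
  also have "\<dots> \<le> C^2 * K * Rs x * (c * \<omega> x)"
    using assms omRnn[OF assms(1,2)] K_pos by (intro mult_left_mono) auto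
  finally show ?thesis by (simp add: \<kappa>_def ac_simps)
qed

lemma bu_bound: "m \<in> S \<Longrightarrow> x > 0 \<Longrightarrow> norm (b m x * (R m x * uu m x / W m)) \<le> \<kappa> x"
  using triple_bound[of m x "b m x" "wb m x" "uu m x" "wa m x" 1] bb[of m x] uu_bound[of m x] wom[of m x]
    wbpos[of m x] by (simp add: mult.commute)

lemma av_bound: "m \<in> S \<Longrightarrow> x > 0 \<Longrightarrow> norm (a m x * (R m x * vv m x / W m)) \<le> \<kappa> x"
  using triple_bound[of m x "a m x" "wa m x" "vv m x" "wb m x" 1] ab[of m x] vv_bound[of m x] wom[of m x]
    wapos[of m x] by (simp add: mult.commute)

text \<open>The square of \<open>wa y\<close> is not controlled by \<open>\<omega> y\<close>. Since
  \<open>wa / wb\<close> increases, one factor \<open>wa y\<close> is at most \<open>wb y\<close>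
  times the ratio at x, and \<open>wa y * wb y\<close> is controlled.\<close>

lemma au_bound:
  assumes "m \<in> S" "0 < y" "y \<le> x"
  shows "norm (a m y * (R m y * uu m y / W m)) \<le> wa m x / wb m x * \<kappa> y"
proof (rule triple_bound[where wp="wa m y" and wq="wa m y"])
  have x: "x > 0" using assms by simp
  have "wa m y * wa m y * wb m x \<le> wa m y * (wb m y * wa m x)"
    using wmono[OF assms] wapos[OF assms(1,2)] by simp
  also have "\<dots> \<le> \<omega> y * wa m x"
    using mult_right_mono[OF wom[OF assms(1,2)], of "wa m x"] wapos[OF assms(1) x] by (simp add: ac_simps)
  finally show "wa m y * wa m y \<le> wa m x / wb m x * \<omega> y"
    using wbpos[OF assms(1) x] by (simp add: field_simps)
  show "0 \<le> wa m x / wb m x" using wbpos[OF assms(1) x] wapos[OF assms(1) x] by simp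
qed (use assms ab uu_bound wapos[of m y] in auto)

lemma bv_bound:
  assumes "m \<in> S" "0 < x" "x \<le> y"
  shows "norm (b m y * (R m y * vv m y / W m)) \<le> wb m x / wa m x * \<kappa> y"
proof (rule triple_bound[where wp="wb m y" and wq="wb m y"])
  have y: "y > 0" using assms by simp
  have "wb m y * wb m y * wa m x \<le> wb m y * (wb m x * wa m y)"
    using wmono[OF assms] wbpos[OF assms(1) y] by (simp add: mult.commute mult.left_commute)
  also have "\<dots> \<le> \<omega> y * wb m x"
    using mult_right_mono[OF wom[OF assms(1) y], of "wb m x"] wbpos[OF assms(1,2)] by (simp add: ac_simps)
  finally show "wb m y * wb m y \<le> wb m x / wa m x * \<omega> y"
    using wapos[OF assms(1,2)] by (simp add: field_simps)
  show "0 \<le> wb m x / wa m x" using wbpos[OF assms(1,2)] wapos[OF assms(1,2)] by simp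
  show "y > 0" by fact
qed (use assms bb[of m y] vv_bound[of m y] wbpos[of m y] in auto)

lemma meas_triple:
  assumes "m \<in> S" "A \<subseteq> {0<..}" "A \<in> sets borel"
    and "(\<lambda>x. if x > 0 then p m x else 0) \<in> borel_measurable borel" "q m \<in> borel_measurable borel"
  shows "(\<lambda>x. indicat_real A x *\<^sub>R (p m x * (R m x * q m x / W m))) \<in> borel_measurable borel"
proof -
  note [measurable] = Rmeas[OF assms(1)] assms(3-5)
  have "(\<lambda>x. indicat_real A x *\<^sub>R ((if x > 0 then p m x else 0) * (R m x * q m x / W m))) \<in> borel_measurable borel"
    by measurable
  then show ?thesis
    by (rule back_subst[where P="\<lambda>f. f \<in> _"]) (use assms(2) in \<open>auto simp: fun_eq_iff indicator_def\<close>)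
qed

lemma kappa_int': "A \<subseteq> {0<..} \<Longrightarrow> A \<in> sets borel \<Longrightarrow> set_integrable lborel A (\<lambda>y. c * \<kappa> y)"
  by (intro set_integrable_mult_right set_integrable_subset[OF kappa_int]) auto

lemma bu_int: "m \<in> S \<Longrightarrow> set_integrable lborel {0<..} (\<lambda>y. b m y * (R m y * uu m y / W m))"
  by (rule set_integrable_boundI[OF kappa_int], rule meas_triple)
     (auto intro: meas_pos uu_meas bu_bound simp del: times_divide_eq_right times_divide_eq_left)

lemma au_int: 
  assumes m: "m \<in> S" shows "set_integrable lborel {0<..x} (\<lambda>y. a m y * (R m y * uu m y / W m))"
proof (rule set_integrable_boundI[where g="\<lambda>y. wa m x / wb m x * \<kappa> y"])
  show "set_integrable lborel {0<..x} (\<lambda>y. wa m x / wb m x * \<kappa> y)" by (rule kappa_int') auto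
qed (use m in \<open>auto intro: meas_pos uu_meas au_bound meas_triple simp del: times_divide_eq_right times_divide_eq_left\<close>)

lemma av_int: 
  assumes m: "m \<in> S" and x: "x > 0" 
  shows "set_integrable lborel {x..} (\<lambda>y. a m y * (R m y * vv m y / W m))"
proof (rule set_integrable_boundI[where g="\<lambda>y. 1 * \<kappa> y"])
  show "set_integrable lborel {x..} (\<lambda>y. 1 * \<kappa> y)" using x by (intro kappa_int') auto
  show "(\<lambda>y. indicat_real {x..} y *\<^sub>R (a m y * (R m y * vv m y / W m))) \<in> borel_measurable borel"
    using m x by (intro meas_triple meas_pos vv_meas) auto
  show "\<And>y. y \<in> {x..} \<Longrightarrow> norm (a m y * (R m y * vv m y / W m)) \<le> 1 * \<kappa> y"
    using m x av_bound by auto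
qed

lemma bv_int: 
  assumes m: "m \<in> S" and x: "x > 0" 
  shows "set_integrable lborel {x..} (\<lambda>y. b m y * (R m y * vv m y / W m))"
proof (rule set_integrable_boundI[where g="\<lambda>y. wb m x / wa m x * \<kappa> y"])
  show "set_integrable lborel {x..} (\<lambda>y. wb m x / wa m x * \<kappa> y)" using x by (intro kappa_int') auto
  show "(\<lambda>y. indicat_real {x..} y *\<^sub>R (b m y * (R m y * vv m y / W m))) \<in> borel_measurable borel"
    using m x by (intro meas_triple meas_pos vv_meas) auto
  show "\<And>y. y \<in> {x..} \<Longrightarrow> norm (b m y * (R m y * vv m y / W m)) \<le> wb m x / wa m x * \<kappa> y"
    using bv_bound[OF m x] by auto
qed

lemma ac_coeffs:
  assumes m: "m \<in> S"
  shows "ac (uA m) (\<lambda>y. - (b m y * (R m y * uu m y / W m)))" "ac (uB m) (\<lambda>y. a m y * (R m y * uu m y / W m))"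
    "ac (vA m) (\<lambda>y. - (b m y * (R m y * vv m y / W m)))" "ac (vB m) (\<lambda>y. a m y * (R m y * vv m y / W m))"
proof -
  have "ac (\<lambda>x. LINT y:{0<..x}|lborel. b m y * (R m y * uu m y / W m)) (\<lambda>y. b m y * (R m y * uu m y / W m))"
    by (intro ac_integral_left set_integrable_subset[OF bu_int[OF m]]) auto
  from ac_diff[OF ac_const[of 1] this]
  show "ac (uA m) (\<lambda>y. - (b m y * (R m y * uu m y / W m)))" by (rule ac_cong) (auto simp: uA_def)
  show "ac (uB m) (\<lambda>y. a m y * (R m y * uu m y / W m))"
    unfolding uB_def by (intro ac_integral_left au_int[OF m])
  show "ac (vA m) (\<lambda>y. - (b m y * (R m y * vv m y / W m)))"
    unfolding vA_def by (intro ac_integral_right bv_int[OF m])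
  have "ac (\<lambda>x. LINT y:{x..}|lborel. a m y * (R m y * vv m y / W m)) (\<lambda>y. - (a m y * (R m y * vv m y / W m)))"
    by (intro ac_integral_right av_int[OF m])
  from ac_diff[OF ac_const[of 1] this]
  show "ac (vB m) (\<lambda>y. a m y * (R m y * vv m y / W m))" by (rule ac_cong) (auto simp: vB_def)
qed

lemma uu_eq:
  assumes m: "m \<in> S" and x: "x > 0"
  shows "uu m x = uA m x * a m x + uB m x * b m x"
proof -
  let ?fa = "\<lambda>y. a m y * (R m y * uu m y / W m)" and ?fb = "\<lambda>y. b m y * (R m y * uu m y / W m)"
  have i1: "set_integrable lborel {0<..x} (\<lambda>y. b m x * ?fa y)" using au_int[OF m] by (intro set_integrable_mult_right)
  have i2: "set_integrable lborel {0<..x} (\<lambda>y. a m x * ?fb y)"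
    by (intro set_integrable_mult_right set_integrable_subset[OF bu_int[OF m]]) auto
  have "(LINT y:{0<..x}|lborel. ker m x y * uu m y) = (LINT y:{0<..x}|lborel. b m x * ?fa y - a m x * ?fb y)"
    by (intro set_lebesgue_integral_cong) (auto simp: ker_def Wnz[OF m] field_simps)
  also have "\<dots> = b m x * uB m x - a m x * (1 - uA m x)"
    unfolding set_integral_diff(2)[OF i1 i2] set_integral_mult_right by (simp add: uB_def uA_def)
  finally have "(LINT y:{0<..x}|lborel. ker m x y * uu m y) = b m x * uB m x - a m x * (1 - uA m x)" .
  moreover have "uu m x = a m x + (LINT y:{0<..x}|lborel. ker m x y * uu m y)"
    using is_left_uu m x unfolding is_left_def by blast
  ultimately show ?thesis by (simp add: algebra_simps)
qed

lemma vv_eq: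
  assumes m: "m \<in> S" and x: "x > 0"
  shows "vv m x = vA m x * a m x + vB m x * b m x"
proof -
  let ?fa = "\<lambda>y. a m y * (R m y * vv m y / W m)" and ?fb = "\<lambda>y. b m y * (R m y * vv m y / W m)"
  have i1: "set_integrable lborel {x..} (\<lambda>y. b m x * ?fa y)" using av_int[OF m x] by (intro set_integrable_mult_right)
  have i2: "set_integrable lborel {x..} (\<lambda>y. a m x * ?fb y)"
    using bv_int[OF m x] by (intro set_integrable_mult_right)
  have "(LINT y:{x..}|lborel. ker m x y * vv m y) = (LINT y:{x..}|lborel. b m x * ?fa y - a m x * ?fb y)"
    by (intro set_lebesgue_integral_cong) (auto simp: ker_def Wnz[OF m] field_simps)
  also have "\<dots> = b m x * (1 - vB m x) - a m x * vA m x"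
    unfolding set_integral_diff(2)[OF i1 i2] set_integral_mult_right by (simp add: vB_def vA_def)
  finally have "(LINT y:{x..}|lborel. ker m x y * vv m y) = b m x * (1 - vB m x) - a m x * vA m x" .
  moreover have "vv m x = b m x - (LINT y:{x..}|lborel. ker m x y * vv m y)"
    using is_right_vv m x unfolding is_right_def by blast
  ultimately have "vv m x = b m x - (b m x * (1 - vB m x) - a m x * vA m x)" by (simp only:)
  then show ?thesis by (simp add: algebra_simps)
qed

lemma ac_uu: assumes m: "m \<in> S"
  shows "ac (uu m) (uu' m)" "ac (uu' m) (\<lambda>x. (V m x + R m x) * uu m x)"
proof -
  note vc = variation_of_constants[OF aca[OF m] acb[OF m] ac_coeffs(1,2)[OF m]]
  show "ac (uu m) (uu' m)"
    by (rule ac_cong[OF vc(1)]) (simp_all add: uu_eq[OF m] uu'_def)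
  show "ac (uu' m) (\<lambda>x. (V m x + R m x) * uu m x)"
    by (rule ac_cong[OF vc(2)]) (simp_all add: uu_eq[OF m] uu'_def wron[OF m] Wnz[OF m] distrib_right)
qed

lemma ac_vv: assumes m: "m \<in> S"
  shows "ac (vv m) (vv' m)" "ac (vv' m) (\<lambda>x. (V m x + R m x) * vv m x)"
proof -
  note vc = variation_of_constants[OF aca[OF m] acb[OF m] ac_coeffs(3,4)[OF m]]
  show "ac (vv m) (vv' m)"
    by (rule ac_cong[OF vc(1)]) (simp_all add: vv_eq[OF m] vv'_def)
  show "ac (vv' m) (\<lambda>x. (V m x + R m x) * vv m x)"
    by (rule ac_cong[OF vc(2)]) (simp_all add: vv_eq[OF m] vv'_def wron[OF m] Wnz[OF m] distrib_right)
qed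

text \<open>Pairing with \<open>a\<close> isolates the coefficient of \<open>b\<close>. Near 0
  \<open>a\<close> will be the power \<open>pw m\<close>, so that this Wronskian is the boundary
  form in the definition of \<open>Hm\<close>.\<close>

lemma wron_a_uu: "m \<in> S \<Longrightarrow> x > 0 \<Longrightarrow> a m x * uu' m x - a' m x * uu m x = uB m x * W m"
  by (simp add: uu_eq uu'_def flip: wron[of m x]) (simp add: algebra_simps)

lemma wron_a_vv: "m \<in> S \<Longrightarrow> x > 0 \<Longrightarrow> a m x * vv' m x - a' m x * vv m x = vB m x * W m"
  by (simp add: vv_eq vv'_def flip: wron[of m x]) (simp add: algebra_simps)

text \<open>The masses of \<open>\<kappa>\<close> on the two sides of x. They measure how far
  \<open>uu\<close> deviates from \<open>a\<close> near 0 and \<open>vv\<close> from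
  \<open>b\<close> near infinity.\<close>

definition "k0 x = (LINT y:{0<..x}|lborel. \<kappa> y)"
definition "k1 x = (LINT y:{x..}|lborel. \<kappa> y)"

lemma k0_lim: "(k0 \<longlongrightarrow> 0) (at_right 0)" and k1_lim: "(k1 \<longlongrightarrow> 0) at_top"
  unfolding k0_def k1_def by (intro set_integral_limits[OF kappa_int])+

lemma k_bounds:
  assumes "m \<in> S" "x > 0"
  shows "0 \<le> k0 x" "0 \<le> k1 x" "k0 x + k1 x = (LINT y:{0<..}|lborel. \<kappa> y)"
  using set_integral_split_pos[OF kappa_int assms(2)] kappa_nn[OF assms(1)] assms
  by (auto simp: k0_def k1_def intro!: set_integral_nonneg')

lemma uB_bound: assumes m: "m \<in> S" and "x > 0" shows "norm (uB m x) \<le> wa m x / wb m x * k0 x"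
proof -
  have "norm (uB m x) \<le> (LINT y:{0<..x}|lborel. wa m x / wb m x * \<kappa> y)"
    unfolding uB_def
  proof (rule set_integral_norm_boundI)
    show "set_integrable lborel {0<..x} (\<lambda>y. wa m x / wb m x * \<kappa> y)" by (intro kappa_int') auto
    show "norm (a m y * (R m y * uu m y / W m)) \<le> wa m x / wb m x * \<kappa> y" if "y \<in> {0<..x}" for y
      using that by (intro au_bound[OF m]) auto
  qed (rule au_int[OF m])
  then show ?thesis by (simp add: k0_def)
qed

lemma vA_bound: assumes m: "m \<in> S" and "x > 0" shows "norm (vA m x) \<le> wb m x / wa m x * k1 x"
proof -
  have "norm (vA m x) \<le> (LINT y:{x..}|lborel. wb m x / wa m x * \<kappa> y)"
    unfolding vA_def
  proof (rule set_integral_norm_boundI)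
    show "set_integrable lborel {x..} (\<lambda>y. wb m x / wa m x * \<kappa> y)" using assms by (intro kappa_int') auto
    show "norm (b m y * (R m y * vv m y / W m)) \<le> wb m x / wa m x * \<kappa> y" if "y \<in> {x..}" for y
      using that by (intro bv_bound[OF assms]) auto
  qed (rule bv_int[OF assms])
  then show ?thesis by (simp add: k1_def)
qed

lemma vB_bound: assumes m: "m \<in> S" and x: "x > 0" shows "norm (1 - vB m x) \<le> k1 x"
proof -
  have "norm (1 - vB m x) \<le> (LINT y:{x..}|lborel. 1 * \<kappa> y)"
  proof -
    have "1 - vB m x = (LINT y:{x..}|lborel. a m y * (R m y * vv m y / W m))" by (simp add: vB_def)
    moreover have "norm (LINT y:{x..}|lborel. a m y * (R m y * vv m y / W m)) \<le> (LINT y:{x..}|lborel. 1 * \<kappa> y)"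
    proof (rule set_integral_norm_boundI)
      show "set_integrable lborel {x..} (\<lambda>y. 1 * \<kappa> y)" using x by (intro kappa_int') auto
      show "norm (a m y * (R m y * vv m y / W m)) \<le> 1 * \<kappa> y" if "y \<in> {x..}" for y
        using av_bound[OF m, of y] that x by simp
    qed (rule av_int[OF assms])
    ultimately show ?thesis by (simp only:)
  qed
  then show ?thesis by (simp add: k1_def)
qed

lemma uA_lim: assumes m: "m \<in> S"
  shows "(uA m \<longlongrightarrow> 1) (at_right 0)" "(uA m \<longlongrightarrow> jost m) at_top"
proof -
  have eq: "uA m = (\<lambda>x. 1 - (LINT y:{0<..x}|lborel. b m y * (R m y * uu m y / W m)))"
    by (rule ext) (simp only: uA_def)
  show "(uA m \<longlongrightarrow> 1) (at_right 0)"
    unfolding eq using tendsto_diff[OF tendsto_const set_integral_limits(2)[OF bu_int[OF m]], of 1] by (simp only: diff_zero)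
  show "(uA m \<longlongrightarrow> jost m) at_top"
    unfolding eq jost_def by (rule tendsto_diff[OF tendsto_const set_integral_limits(3)[OF bu_int[OF m]]])
qed

lemma vB_lim: assumes m: "m \<in> S" shows "(vB m \<longlongrightarrow> 1) at_top"
proof -
  have "((\<lambda>x. 1 - vB m x) \<longlongrightarrow> 0) at_top"
    by (rule Lim_null_comparison[OF _ k1_lim])
       (use eventually_gt_at_top[of 0] in \<open>eventually_elim, auto intro: vB_bound[OF m]\<close>)
  from tendsto_diff[OF tendsto_const[of 1] this] show ?thesis by simp
qed

lemma uu_vv_const: assumes m: "m \<in> S" and x: "x > 0" and y: "y > 0"
  shows "uu m x * vv' m x - uu' m x * vv m x = uu m y * vv' m y - uu' m y * vv m y"
proof -
  have "ac (\<lambda>x. uu m x * vv' m x - uu' m x * vv m x) (\<lambda>x. 0)"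
    by (rule ac_cong[OF ac_wronskian[OF ac_uu[OF m] ac_vv[OF m]]]) (auto simp: algebra_simps)
  from ac_zero_const[OF this x y] show ?thesis .
qed

lemma reg_jost: "reg S jost"
proof (cases "S = {}")
  case True then show ?thesis by (simp add: reg_def holomorphic_on_def)
next
  case False
  then obtain m0 where m0: "m0 \<in> S" by blast
  have "reg S (\<lambda>m. LINT y|lborel. indicat_real {0<..} y *\<^sub>R (b m y * (R m y * uu m y / W m)))"
  proof (rule reg_integral[where g="\<lambda>y. indicat_real {0<..} y *\<^sub>R \<kappa> y"])
    show "reg S (\<lambda>m. indicat_real {0<..} y *\<^sub>R (b m y * (R m y * uu m y / W m)))" for y
    proof (cases "y > 0")
      case True then show ?thesis
        by simp (intro reg_mult reg_divide regb regR uu_reg regW Wnz)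
    qed auto
    show "integrable lborel (\<lambda>y. indicat_real {0<..} y *\<^sub>R \<kappa> y)"
      using kappa_int by (simp add: set_integrable_def)
    show "norm (indicat_real {0<..} y *\<^sub>R (b m y * (R m y * uu m y / W m))) \<le> indicat_real {0<..} y *\<^sub>R \<kappa> y" if "m \<in> S" for m y
      using bu_bound[OF that, of y] by (auto simp: indicator_def)
    show "(\<lambda>y. indicat_real {0<..} y *\<^sub>R (b m y * (R m y * uu m y / W m))) \<in> borel_measurable lborel" if "m \<in> S" for m
      using bu_int[OF that] by (auto simp: set_integrable_def)
  qed
  then show ?thesis
    unfolding jost_def set_lebesgue_integral_def by (intro reg_diff) auto
qed

end

text \<open>The ratios of weights in \<open>uB_bound\<close> and \<open>vA_bound\<close> are
  reciprocal, so the product is at most \<open>k0 x * k1 x\<close>; at each end one factor tends to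
  0 and the other is bounded. Two perturbations of one pair are allowed because
  \<open>jost_diff\<close> needs the mixed product.\<close>

lemma cross_wronskian_limits:
  assumes X: "volterra S a a' b b' V R1 W wa wb \<omega> Rs1 C" and Y: "volterra S' a a' b b' V R2 W wa wb \<omega> Rs2 C"
    and m: "m \<in> S" and m': "m \<in> S'"
  defines "A \<equiv> volterra.uA S a b R1 W wa \<omega> Rs1 C m" and "B \<equiv> volterra.uB S a b R1 W wa \<omega> Rs1 C m"
    and "A2 \<equiv> volterra.vA S' a b R2 W wb \<omega> Rs2 C m" and "B2 \<equiv> volterra.vB S' a b R2 W wb \<omega> Rs2 C m"
  shows "((\<lambda>x. B x * A2 x) \<longlongrightarrow> 0) (at_right 0)" "((\<lambda>x. B x * A2 x) \<longlongrightarrow> 0) at_top"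
proof -
  interpret X: volterra S a a' b b' V R1 W wa wb \<omega> Rs1 C by (rule X)
  interpret Y: volterra S' a a' b b' V R2 W wa wb \<omega> Rs2 C by (rule Y)
  have bd: "norm (B x * A2 x) \<le> X.k0 x * Y.k1 x" if "x > 0" for x
  proof -
    have "norm (B x * A2 x) \<le> (wa m x / wb m x * X.k0 x) * (wb m x / wa m x * Y.k1 x)"
      unfolding norm_mult B_def A2_def using X.uB_bound[OF m that] Y.vA_bound[OF m' that]
      by (intro mult_mono) (auto intro: order.trans[OF norm_ge_zero])
    then show ?thesis using X.wapos[OF m that] X.wbpos[OF m that] by simp
  qed
  have b1: "norm (B x * A2 x) \<le> X.k0 x * (LINT y:{0<..}|lborel. Y.\<kappa> y)" if "x > 0" for x
    using bd[OF that] X.k_bounds[OF m that] Y.k_bounds[OF m' that]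
      mult_left_mono[of "Y.k1 x" "LINT y:{0<..}|lborel. Y.\<kappa> y" "X.k0 x"] by linarith
  have b2: "norm (B x * A2 x) \<le> (LINT y:{0<..}|lborel. X.\<kappa> y) * Y.k1 x" if "x > 0" for x
    using bd[OF that] X.k_bounds[OF m that] Y.k_bounds[OF m' that]
      mult_right_mono[of "X.k0 x" "LINT y:{0<..}|lborel. X.\<kappa> y" "Y.k1 x"] by linarith
  show "((\<lambda>x. B x * A2 x) \<longlongrightarrow> 0) (at_right 0)"
  proof (rule Lim_null_comparison)
    show "\<forall>\<^sub>F x in at_right 0. norm (B x * A2 x) \<le> X.k0 x * (LINT y:{0<..}|lborel. Y.\<kappa> y)"
      using eventually_at_right_less[of "0::real"] by eventually_elim (rule b1)
    show "((\<lambda>x. X.k0 x * (LINT y:{0<..}|lborel. Y.\<kappa> y)) \<longlongrightarrow> 0) (at_right 0)"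
      by (rule tendsto_mult_left_zero[OF X.k0_lim])
  qed
  show "((\<lambda>x. B x * A2 x) \<longlongrightarrow> 0) at_top"
  proof (rule Lim_null_comparison)
    show "\<forall>\<^sub>F x in at_top. norm (B x * A2 x) \<le> (LINT y:{0<..}|lborel. X.\<kappa> y) * Y.k1 x"
      using eventually_gt_at_top[of "0::real"] by eventually_elim (rule b2)
    show "((\<lambda>x. (LINT y:{0<..}|lborel. X.\<kappa> y) * Y.k1 x) \<longlongrightarrow> 0) at_top"
      by (rule tendsto_mult_right_zero[OF Y.k1_lim])
  qed
qed

context volterra
begin

lemma wron_uu_vv_expand: "m \<in> S \<Longrightarrow> x > 0 \<Longrightarrow> uu m x * vv' m x - uu' m x * vv m x = (uA m x * vB m x - uB m x * vA m x) * W m"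
  by (simp add: uu_eq vv_eq uu'_def vv'_def flip: wron[of m x]) (simp add: algebra_simps)

text \<open>The Wronskian is constant and can be read off at infinity, where \<open>uA\<close> tends
  to \<open>jost\<close>, \<open>vB\<close> to 1, and the cross term disappears.\<close>

lemma wron_uu_vv: assumes m: "m \<in> S" and x: "x > 0"
  shows "uu m x * vv' m x - uu' m x * vv m x = jost m * W m"
proof -
  have l: "((\<lambda>x. (uA m x * vB m x - uB m x * vA m x) * W m) \<longlongrightarrow> (jost m * 1 - 0) * W m) at_top"
    by (intro tendsto_intros uA_lim[OF m] vB_lim[OF m] cross_wronskian_limits[OF volterra_axioms volterra_axioms m m])
  have ev: "\<forall>\<^sub>F y in at_top. (uA m y * vB m y - uB m y * vA m y) * W m = uu m x * vv' m x - uu' m x * vv m x"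
    using eventually_gt_at_top[of 0]
  proof eventually_elim
    case (elim y)
    show ?case using uu_vv_const[OF m x elim] wron_uu_vv_expand[OF m elim] by simp
  qed
  have "((\<lambda>y::real. uu m x * vv' m x - uu' m x * vv m x) \<longlongrightarrow> (jost m * 1 - 0) * W m) at_top"
    using l unfolding tendsto_cong[OF ev] .
  then show ?thesis by (simp add: tendsto_const_iff)
qed

text \<open>The same constant read off at 0: \<open>uA\<close> tends to 1 there, so
  \<open>vB\<close> must carry the Jost function. Hence \<open>jost m * W m\<close> is the boundary
  value of \<open>vv\<close> with respect to \<open>a\<close>, and a nonzero Jost function keeps
  \<open>vv\<close> out of the domain of \<open>Hm\<close>.\<close>

lemma vB_lim0: assumes m: "m \<in> S" shows "(vB m \<longlongrightarrow> jost m) (at_right 0)"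
proof -
  have "((\<lambda>x. (jost m + uB m x * vA m x) / uA m x) \<longlongrightarrow> (jost m + 0) / 1) (at_right 0)"
    by (intro tendsto_intros uA_lim[OF m] cross_wronskian_limits[OF volterra_axioms volterra_axioms m m]) auto
  moreover have "\<forall>\<^sub>F x in at_right 0. uA m x \<noteq> 0"
    by (rule tendsto_imp_eventually_ne[OF uA_lim(1)[OF m]]) auto
  then have "\<forall>\<^sub>F x in at_right 0. (jost m + uB m x * vA m x) / uA m x = vB m x"
    using eventually_at_right_less[of "0::real"]
  proof eventually_elim
    case (elim x)
    have "uA m x * vB m x - uB m x * vA m x = jost m"
      using wron_uu_vv[OF m elim(2)] wron_uu_vv_expand[OF m elim(2)] Wnz[OF m] by simp
    then show ?case using elim by (simp add: field_simps)
  qed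
  ultimately show ?thesis by (simp add: tendsto_cong)
qed

lemma vv'_bound: assumes m: "m \<in> S" and x: "x \<ge> 1"
  shows "norm (vv' m x) \<le> C * (1 + 2 * (LINT y:{0<..}|lborel. \<kappa> y)) * wb m x"
proof -
  have x0: "x > 0" using x by simp
  note w = wapos[OF m x0] wbpos[OF m x0] and k = k_bounds[OF m x0]
  have "norm (vB m x) \<le> 1 + k1 x" using vB_bound[OF m x0] norm_triangle_ineq4[of 1 "1 - vB m x"] by simp
  then have "norm (vv' m x) \<le> (wb m x / wa m x * k1 x) * (C * wa m x) + (1 + k1 x) * (C * wb m x)"
    unfolding vv'_def
  proof (intro order.trans[OF norm_triangle_ineq] add_mono)
    assume 1: "norm (vB m x) \<le> 1 + k1 x"
    show "norm (vA m x * a' m x) \<le> (wb m x / wa m x * k1 x) * (C * wa m x)"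
      unfolding norm_mult by (rule mult_mono[OF vA_bound[OF m x0] adb(1)[OF m x]]) (use w k in auto)
    show "norm (vB m x * b' m x) \<le> (1 + k1 x) * (C * wb m x)"
      unfolding norm_mult by (rule mult_mono[OF 1 adb(2)[OF m x]]) (use k in auto)
  qed
  also have "\<dots> = C * (1 + 2 * k1 x) * wb m x" using w by (simp add: field_simps)
  also have "\<dots> \<le> C * (1 + 2 * (LINT y:{0<..}|lborel. \<kappa> y)) * wb m x"
    using w k C1 by (intro mult_right_mono mult_left_mono) auto
  finally show ?thesis .
qed

end

text \<open>The Wronskian of the left solution for \<open>R1\<close> with the right solution for
  \<open>R2\<close> has density \<open>-q u v\<close> and runs from the second Jost function at 0 to
  the first at infinity, both times \<open>W m\<close>. With \<open>q = 0\<close> it compares one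
  perturbation on two parameter sets, which is not trivial because \<open>uu\<close> is picked by
  \<open>SOME\<close> and may depend on the set.\<close>

lemma jost_diff:
  assumes X: "volterra S a a' b b' V R1 W wa wb \<omega> Rs1 C" and Y: "volterra S' a a' b b' V R2 W wa wb \<omega> Rs2 C"
    and m: "m \<in> S" and m': "m \<in> S'" and Q: "\<And>x. x > 0 \<Longrightarrow> R1 m x = R2 m x + q x"
    and qi: "set_integrable lborel {0<..} (\<lambda>x. \<omega> x * norm (q x))"
  shows "norm (volterra.jost S a b R1 W wa \<omega> Rs1 C m - volterra.jost S' a b R2 W wa \<omega> Rs2 C m) * norm (W m)
     \<le> volterra.K \<omega> Rs1 C * volterra.K \<omega> Rs2 C * (LINT x:{0<..}|lborel. \<omega> x * norm (q x))"
proof -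
  interpret X: volterra S a a' b b' V R1 W wa wb \<omega> Rs1 C by (rule X)
  interpret Y: volterra S' a a' b b' V R2 W wa wb \<omega> Rs2 C by (rule Y)
  define w where "w x = X.uu m x * Y.vv' m x - X.uu' m x * Y.vv m x" for x
  let ?I = "LINT x:{0<..}|lborel. \<omega> x * norm (q x)"
  have acw: "ac w (\<lambda>x. - (q x * X.uu m x * Y.vv m x))"
    unfolding w_def
    by (rule ac_cong[OF ac_wronskian[OF X.ac_uu[OF m] Y.ac_vv[OF m']]]) (auto simp: algebra_simps Q)
  have bd: "norm (- (q x * X.uu m x * Y.vv m x)) \<le> X.K * Y.K * (\<omega> x * norm (q x))" if "x > 0" for x
  proof -
    have "norm (- (q x * X.uu m x * Y.vv m x)) = norm (q x) * (norm (X.uu m x) * norm (Y.vv m x))" by (simp add: norm_mult)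
    also have "\<dots> \<le> norm (q x) * ((X.K * wa m x) * (Y.K * wb m x))"
      using X.uu_bound[OF m that] Y.vv_bound[OF m' that]
      by (intro mult_left_mono mult_mono) (auto intro: order.trans[OF norm_ge_zero])
    also have "\<dots> = X.K * Y.K * norm (q x) * (wa m x * wb m x)" by simp
    also have "\<dots> \<le> X.K * Y.K * norm (q x) * \<omega> x"
      using X.wom[OF m that] X.K_pos Y.K_pos by (intro mult_left_mono) auto
    finally show ?thesis by (simp add: ac_simps)
  qed
  have onn: "0 \<le> X.K * Y.K * (\<omega> x * norm (q x))" if "x > 0" for x using order.trans[OF norm_ge_zero bd[OF that]] .
  have inc: "norm (w t - w s) \<le> X.K * Y.K * ?I" if "0 < s" "s \<le> t" for s t
  proof -
    have gi: "set_integrable lborel {0<..} (\<lambda>x. X.K * Y.K * (\<omega> x * norm (q x)))" using qi by (rule set_integrable_mult_right)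
    have gi2: "set_integrable lborel {s..t} (\<lambda>x. X.K * Y.K * (\<omega> x * norm (q x)))"
      using that by (intro set_integrable_subset[OF gi]) auto
    have "norm (w t - w s) \<le> (LINT x:{s..t}|lborel. X.K * Y.K * (\<omega> x * norm (q x)))"
      unfolding ac_eq[OF acw that]
      by (rule set_integral_norm_boundI[OF gi2 ac_integrable[OF acw that(1)]]) (use bd that in auto)
    also have "\<dots> \<le> (LINT x:{0<..}|lborel. X.K * Y.K * (\<omega> x * norm (q x)))"
      by (intro set_integral_mono_set gi) (use onn that in auto)
    finally show ?thesis by (simp only: set_integral_mult_right)
  qed
  have we: "w x = (X.uA m x * Y.vB m x - X.uB m x * Y.vA m x) * W m" if "x > 0" for x
    using that m m' unfolding w_def
    by (simp add: X.uu_eq Y.vv_eq X.uu'_def Y.vv'_def flip: X.wron[of m x]) (simp add: algebra_simps)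
  note cl = cross_wronskian_limits[OF X Y m m']
  have "((\<lambda>x. (X.uA m x * Y.vB m x - X.uB m x * Y.vA m x) * W m) \<longlongrightarrow> (X.jost m * 1 - 0) * W m) at_top"
    by (intro tendsto_intros X.uA_lim[OF m] Y.vB_lim[OF m'] cl)
  moreover have "\<forall>\<^sub>F x in at_top. (X.uA m x * Y.vB m x - X.uB m x * Y.vA m x) * W m = w x"
    using eventually_gt_at_top[of 0] by eventually_elim (simp add: we)
  ultimately have l1: "(w \<longlongrightarrow> X.jost m * W m) at_top" by (simp add: tendsto_cong)
  have "((\<lambda>x. (X.uA m x * Y.vB m x - X.uB m x * Y.vA m x) * W m) \<longlongrightarrow> (1 * Y.jost m - 0) * W m) (at_right 0)"
    by (intro tendsto_intros X.uA_lim[OF m] Y.vB_lim0[OF m'] cl)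
  moreover have "\<forall>\<^sub>F x in at_right 0. (X.uA m x * Y.vB m x - X.uB m x * Y.vA m x) * W m = w x"
    using eventually_at_right_less[of "0::real"] by eventually_elim (simp add: we)
  ultimately have l0: "(w \<longlongrightarrow> Y.jost m * W m) (at_right 0)" by (simp add: tendsto_cong)
  have h: "norm (X.jost m * W m - w s) \<le> X.K * Y.K * ?I" if "0 < s" for s
  proof (rule tendsto_upperbound)
    show "((\<lambda>t. norm (w t - w s)) \<longlongrightarrow> norm (X.jost m * W m - w s)) at_top" by (intro tendsto_intros l1)
    show "\<forall>\<^sub>F t in at_top. norm (w t - w s) \<le> X.K * Y.K * ?I"
      using eventually_ge_at_top[of s] by eventually_elim (rule inc[OF that])
  qed auto
  have "norm (X.jost m * W m - Y.jost m * W m) \<le> X.K * Y.K * ?I"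
  proof (rule tendsto_upperbound)
    show "((\<lambda>s. norm (X.jost m * W m - w s)) \<longlongrightarrow> norm (X.jost m * W m - Y.jost m * W m)) (at_right 0)" by (intro tendsto_intros l0)
    show "\<forall>\<^sub>F s in at_right 0. norm (X.jost m * W m - w s) \<le> X.K * Y.K * ?I"
      using eventually_at_right_less[of "0::real"] by eventually_elim (rule h)
  qed auto
  then show ?thesis by (simp flip: left_diff_distrib norm_mult)
qed

section \<open>Square integrable functions and the resolvent kernel\<close>

text \<open>Elements of \<open>L2\<close> are arbitrary at x \<le> 0. Extension by zero turns them
  into Borel functions on the line and set integrals into plain integrals.\<close>

definition ext0 :: "(real \<Rightarrow> complex) \<Rightarrow> real \<Rightarrow> complex" where
  "ext0 f = (\<lambda>x. if x > 0 then f x else 0)"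

lemma ext0_pos [simp]: "x > 0 \<Longrightarrow> ext0 f x = f x" and ext0_nonpos [simp]: "\<not> x > 0 \<Longrightarrow> ext0 f x = 0"
  by (auto simp: ext0_def)

lemma L2_iff: "L2 f \<longleftrightarrow> (ext0 f) \<in> borel_measurable borel \<and>
    integrable lborel (\<lambda>x. (norm (ext0 f x))\<^sup>2)"
proof -
  have "(\<lambda>x. indicat_real {0<..} x *\<^sub>R f x) = (ext0 f)"
    "(\<lambda>x. indicat_real {0<..} x *\<^sub>R (norm (f x))\<^sup>2) = (\<lambda>x. (norm (ext0 f x))\<^sup>2)"
    by (auto simp: fun_eq_iff indicator_def ext0_def)
  then show ?thesis by (simp add: L2_def set_borel_measurable_def set_integrable_def)
qed

lemma L2_meas: "L2 f \<Longrightarrow> (ext0 f) \<in> borel_measurable borel"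
  and L2_int: "L2 f \<Longrightarrow> integrable lborel (\<lambda>x. (norm (ext0 f x))\<^sup>2)"
  by (auto simp: L2_iff)

lemma L2norm_eq: "L2norm f = sqrt (LINT x|lborel. (norm (ext0 f x))\<^sup>2)"
  unfolding L2norm_def set_lebesgue_integral_def
  by (intro arg_cong[where f=sqrt] Bochner_Integration.integral_cong) (auto simp: indicator_def)

lemma L2_boundI:
  assumes "(ext0 f) \<in> borel_measurable borel"
    "(\<integral>\<^sup>+x. ennreal ((norm (ext0 f x))\<^sup>2) \<partial>lborel) \<le> ennreal B" "B \<ge> 0"
  shows "L2 f" "L2norm f \<le> sqrt B"
proof -
  have i: "integrable lborel (\<lambda>x. (norm (ext0 f x))\<^sup>2)"
  proof (rule integrableI_bounded)
    show "(\<lambda>x. (norm (ext0 f x))\<^sup>2) \<in> borel_measurable lborel"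
      using assms(1) by measurable
    show "(\<integral>\<^sup>+x. ennreal (norm ((norm (ext0 f x))\<^sup>2)) \<partial>lborel) < \<infinity>"
      using order.strict_trans1[OF assms(2) ennreal_less_top] by simp
  qed
  then show "L2 f" using assms(1) by (simp add: L2_iff)
  have "ennreal (LINT x|lborel. (norm (ext0 f x))\<^sup>2) \<le> ennreal B"
    using nn_integral_eq_integral[OF i] assms(2) by simp
  then show "L2norm f \<le> sqrt B"
    unfolding L2norm_eq using assms(3) by (simp add: ennreal_le_iff)
qed

lemma abs_mult_le_squares: "\<bar>p * q\<bar> \<le> \<bar>p\<^sup>2 + q\<^sup>2\<bar>" for p q :: real
proof -
  have "2 * (\<bar>p\<bar> * \<bar>q\<bar>) \<le> p\<^sup>2 + q\<^sup>2" using sum_squares_bound[of "\<bar>p\<bar>" "\<bar>q\<bar>"] by simp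
  moreover have "0 \<le> \<bar>p\<bar> * \<bar>q\<bar>" by simp
  ultimately have "\<bar>p\<bar> * \<bar>q\<bar> \<le> p\<^sup>2 + q\<^sup>2" by linarith
  then show ?thesis by (simp add: abs_mult)
qed

lemma L2_add:
  assumes "L2 f" "L2 g" shows "L2 (\<lambda>x. f x + g x)"
  unfolding L2_iff
proof
  let ?f = "ext0 f" and ?g = "ext0 g"
  note [measurable] = L2_meas[OF assms(1)] L2_meas[OF assms(2)]
  have eq: "(\<lambda>x. ext0 (\<lambda>x. f x + g x) x) = (\<lambda>x. ?f x + ?g x)" by (auto simp: ext0_def)
  show m: "(\<lambda>x. ext0 (\<lambda>x. f x + g x) x) \<in> borel_measurable borel" unfolding eq by measurable
  show "integrable lborel (\<lambda>x. (norm (ext0 (\<lambda>x. f x + g x) x))\<^sup>2)"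
  proof (rule Bochner_Integration.integrable_bound)
    show "integrable lborel (\<lambda>x. 2 * (norm (?f x))\<^sup>2 + 2 * (norm (?g x))\<^sup>2)"
      using L2_int[OF assms(1)] L2_int[OF assms(2)] by simp
    show "(\<lambda>x. (norm (ext0 (\<lambda>x. f x + g x) x))\<^sup>2) \<in> borel_measurable lborel"
      using m by measurable
    have "(norm (z + w))\<^sup>2 \<le> 2 * (norm z)\<^sup>2 + 2 * (norm w)\<^sup>2" for z w :: complex
    proof -
      have "(norm (z + w))\<^sup>2 \<le> (norm z + norm w)\<^sup>2" by (intro power_mono norm_triangle_ineq) auto
      also have "\<dots> \<le> 2 * (norm z)\<^sup>2 + 2 * (norm w)\<^sup>2"
        using zero_le_power2[of "norm z - norm w"] by (simp add: power2_eq_square algebra_simps)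
      finally show ?thesis .
    qed
    then show "AE x in lborel. norm ((norm (ext0 (\<lambda>x. f x + g x) x))\<^sup>2) \<le> norm (2 * (norm (?f x))\<^sup>2 + 2 * (norm (?g x))\<^sup>2)"
      by (intro AE_I2) (auto simp: ext0_def)
  qed
qed

lemma L2_cmult: assumes "L2 f" shows "L2 (\<lambda>x. c * f x)"
proof -
  note [measurable] = L2_meas[OF assms]
  have eq: "ext0 (\<lambda>x. c * f x) = (\<lambda>x. c * (ext0 f x))" by (auto simp: ext0_def)
  have "(\<lambda>x. (norm (ext0 (\<lambda>x. c * f x) x))\<^sup>2) = (\<lambda>x. (norm c)\<^sup>2 * (norm (ext0 f x))\<^sup>2)"
    by (auto simp: norm_mult power_mult_distrib fun_eq_iff ext0_def)
  then show ?thesis unfolding L2_iff using L2_int[OF assms] by (simp add: eq) measurable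
qed

lemma L2_diff: "L2 f \<Longrightarrow> L2 g \<Longrightarrow> L2 (\<lambda>x. f x - g x)"
  using L2_add[of f "\<lambda>x. (-1) * g x"] L2_cmult[of g "-1"] by simp

lemma L2norm_cong_AE:
  assumes "L2 f" "L2 g" "ae_eq f g" shows "L2norm f = L2norm g"
proof -
  note [measurable] = L2_meas[OF assms(1)] L2_meas[OF assms(2)]
  have "AE x in lborel. (norm (ext0 f x))\<^sup>2 = (norm (ext0 g x))\<^sup>2"
    using assms(3) unfolding ae_eq_def by eventually_elim (auto simp: ext0_def)
  then have "(LINT x|lborel. (norm (ext0 f x))\<^sup>2) = (LINT x|lborel. (norm (ext0 g x))\<^sup>2)"
    by (intro integral_cong_AE) auto
  then show ?thesis unfolding L2norm_eq by simp
qed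

lemma ip_cong_AE:
  assumes "L2 f" "L2 g" "L2 h" "ae_eq g h" shows "ip f g = ip f h"
proof -
  note [measurable] = L2_meas[OF assms(1)] L2_meas[OF assms(2)] L2_meas[OF assms(3)]
  have m: "(\<lambda>x. cnj (ext0 f x)) \<in> borel_measurable borel"
    using borel_measurable_continuous_onI[OF continuous_on_cnj[OF continuous_on_id]] measurable_compose[of "ext0 f" borel borel cnj borel]
    by auto
  have "AE x in lborel. cnj (ext0 f x) * ext0 g x = cnj (ext0 f x) * ext0 h x"
    using assms(4) unfolding ae_eq_def by eventually_elim (auto simp: ext0_def)
  then have "(LINT x|lborel. cnj (ext0 f x) * ext0 g x) = (LINT x|lborel. cnj (ext0 f x) * ext0 h x)"
    using m by (intro integral_cong_AE) auto
  moreover have "ip f k = (LINT x|lborel. cnj (ext0 f x) * (ext0 k x))" for k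
    unfolding ip_def set_lebesgue_integral_def
    by (intro Bochner_Integration.integral_cong) (auto simp: ext0_def)
  ultimately show ?thesis by simp
qed

text \<open>Cauchy-Schwarz for the splitting of \<open>k * |g|\<close> into
  \<open>sqrt (k * s)\<close> and \<open>sqrt (k * g^2 / s)\<close>. The hypothesis
  \<open>ks\<close> enters twice: for the first factor, and by symmetry after exchanging the
  integrals.\<close>

lemma schur_test:
  fixes k :: "real \<Rightarrow> real \<Rightarrow> real" and s g :: "real \<Rightarrow> real"
  assumes [measurable]: "(\<lambda>(x,y). k x y) \<in> borel_measurable (borel \<Otimes>\<^sub>M borel)"
    "s \<in> borel_measurable borel" "g \<in> borel_measurable borel"
    and k0: "\<And>x y. k x y \<ge> 0" and sym: "\<And>x y. k x y = k y x" and s0: "\<And>x. s x > 0"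
    and ks: "\<And>x. (\<integral>\<^sup>+y. ennreal (k x y * s y) \<partial>lborel) \<le> ennreal (Cs * s x)" and Cs: "Cs \<ge> 0"
  shows "(\<integral>\<^sup>+x. (\<integral>\<^sup>+y. ennreal (k x y * \<bar>g y\<bar>) \<partial>lborel)\<^sup>2 \<partial>lborel) \<le> ennreal (Cs\<^sup>2) * (\<integral>\<^sup>+y. ennreal ((g y)\<^sup>2) \<partial>lborel)"
proof -
  have [measurable]: "(\<lambda>y. k x y) \<in> borel_measurable borel" for x
    using measurable_Pair2[OF assms(1), of x] by simp
  let ?H = "\<lambda>x. \<integral>\<^sup>+y. ennreal (k x y * (g y)\<^sup>2 / s y) \<partial>lborel"
  have pt: "(\<integral>\<^sup>+y. ennreal (k x y * \<bar>g y\<bar>) \<partial>lborel)\<^sup>2 \<le> ennreal (Cs * s x) * ?H x" for x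
  proof -
    have "(\<integral>\<^sup>+y. ennreal (k x y * \<bar>g y\<bar>) \<partial>lborel) = (\<integral>\<^sup>+y. ennreal (sqrt (k x y * s y)) * ennreal (sqrt (k x y * (g y)\<^sup>2 / s y)) \<partial>lborel)"
    proof (rule nn_integral_cong)
      fix y
      have "sqrt (k x y * s y) * sqrt (k x y * (g y)\<^sup>2 / s y) = sqrt ((k x y * g y)\<^sup>2)"
        using s0[of y] by (simp add: real_sqrt_mult[symmetric] power2_eq_square ac_simps)
      also have "\<dots> = k x y * \<bar>g y\<bar>" using k0[of x y] by (simp add: abs_mult)
      finally show "ennreal (k x y * \<bar>g y\<bar>) = ennreal (sqrt (k x y * s y)) * ennreal (sqrt (k x y * (g y)\<^sup>2 / s y))"
        using k0[of x y] s0[of y] by (simp flip: ennreal_mult)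
    qed
    also have "(\<dots>)\<^sup>2 \<le> (\<integral>\<^sup>+y. (ennreal (sqrt (k x y * s y)))^2 \<partial>lborel) * (\<integral>\<^sup>+y. (ennreal (sqrt (k x y * (g y)\<^sup>2 / s y)))^2 \<partial>lborel)"
      by (rule Cauchy_Schwarz_nn_integral) measurable
    also have "(\<integral>\<^sup>+y. (ennreal (sqrt (k x y * s y)))^2 \<partial>lborel) = (\<integral>\<^sup>+y. ennreal (k x y * s y) \<partial>lborel)"
      using k0 s0 by (intro nn_integral_cong) (simp add: ennreal_power less_imp_le)
    also have "(\<integral>\<^sup>+y. (ennreal (sqrt (k x y * (g y)\<^sup>2 / s y)))^2 \<partial>lborel) = ?H x"
      using k0 s0 by (intro nn_integral_cong) (simp add: ennreal_power less_imp_le)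
    finally show ?thesis using mult_right_mono[OF ks[of x], of "?H x"] by (meson order.trans zero_le)
  qed
  have "(\<integral>\<^sup>+x. (\<integral>\<^sup>+y. ennreal (k x y * \<bar>g y\<bar>) \<partial>lborel)\<^sup>2 \<partial>lborel) \<le> (\<integral>\<^sup>+x. ennreal (Cs * s x) * ?H x \<partial>lborel)"
    by (intro nn_integral_mono pt)
  also have "\<dots> = (\<integral>\<^sup>+x. (\<integral>\<^sup>+y. ennreal (Cs * s x) * ennreal (k x y * (g y)\<^sup>2 / s y) \<partial>lborel) \<partial>lborel)"
    by (intro nn_integral_cong nn_integral_cmult[symmetric]) measurable
  also have "\<dots> = (\<integral>\<^sup>+y. (\<integral>\<^sup>+x. ennreal (Cs * s x) * ennreal (k x y * (g y)\<^sup>2 / s y) \<partial>lborel) \<partial>lborel)"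
    by (rule lborel_pair.Fubini'[symmetric]) measurable
  also have "\<dots> = (\<integral>\<^sup>+y. ennreal (Cs * (g y)\<^sup>2 / s y) * (\<integral>\<^sup>+x. ennreal (k y x * s x) \<partial>lborel) \<partial>lborel)"
  proof (rule nn_integral_cong)
    fix y
    have "(\<integral>\<^sup>+x. ennreal (Cs * s x) * ennreal (k x y * (g y)\<^sup>2 / s y) \<partial>lborel) = (\<integral>\<^sup>+x. ennreal (Cs * (g y)\<^sup>2 / s y) * ennreal (k y x * s x) \<partial>lborel)"
      using s0 Cs k0 by (intro nn_integral_cong) (simp add: sym[of y] less_imp_le ac_simps flip: ennreal_mult)
    then show "(\<integral>\<^sup>+x. ennreal (Cs * s x) * ennreal (k x y * (g y)\<^sup>2 / s y) \<partial>lborel) = ennreal (Cs * (g y)\<^sup>2 / s y) * (\<integral>\<^sup>+x. ennreal (k y x * s x) \<partial>lborel)"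
      by (simp add: nn_integral_cmult)
  qed
  also have "\<dots> \<le> (\<integral>\<^sup>+y. ennreal (Cs * (g y)\<^sup>2 / s y) * ennreal (Cs * s y) \<partial>lborel)"
    by (intro nn_integral_mono mult_left_mono ks) auto
  also have "\<dots> = (\<integral>\<^sup>+y. ennreal (Cs\<^sup>2) * ennreal ((g y)\<^sup>2) \<partial>lborel)"
  proof (rule nn_integral_cong)
    fix y show "ennreal (Cs * (g y)\<^sup>2 / s y) * ennreal (Cs * s y) = ennreal (Cs\<^sup>2) * ennreal ((g y)\<^sup>2)"
      using s0[of y] Cs by (simp add: power2_eq_square ac_simps flip: ennreal_mult)
  qed
  also have "\<dots> = ennreal (Cs\<^sup>2) * (\<integral>\<^sup>+y. ennreal ((g y)\<^sup>2) \<partial>lborel)"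
    by (intro nn_integral_cmult) measurable
  finally show ?thesis .
qed

text \<open>\<open>total\<close> fixes the spectral point -1. The weights \<open>\<alpha>\<close>,
  \<open>\<beta>\<close> are free of \<open>m\<close>: they yield one kernel that dominates the
  Green kernels for all \<open>m\<close> in \<open>S\<close>, for use both in the Schur test with
  weight \<open>s\<close> and in dominated convergence with respect to \<open>m\<close>.\<close>

locale resolvent = volterra S a a' b b' V R W wa wb \<omega> Rs C
  for S a a' b b' V R W wa wb \<omega> Rs C +
  fixes Q :: "real \<Rightarrow> complex" and \<alpha> \<beta> s :: "real \<Rightarrow> real" and Cs :: real
  assumes total: "\<And>m x. m \<in> S \<Longrightarrow> x > 0 \<Longrightarrow> V m x + R m x = (m\<^sup>2 - 1/4) / (of_real x)\<^sup>2 + Q x + 1"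
    and a_pw: "\<And>m x. m \<in> S \<Longrightarrow> 0 < x \<Longrightarrow> x \<le> 1 \<Longrightarrow> a m x = pw m x" "\<And>m x. m \<in> S \<Longrightarrow> 0 < x \<Longrightarrow> x \<le> 1 \<Longrightarrow> a' m x = pw' m x"
    and jost_nz: "\<And>m. m \<in> S \<Longrightarrow> jost m \<noteq> 0"
    and wawb: "\<And>m x y. m \<in> S \<Longrightarrow> 0 < x \<Longrightarrow> x \<le> y \<Longrightarrow> wa m x * wb m y \<le> \<alpha> x * \<beta> y"
    and \<alpha>pos: "\<And>x. x > 0 \<Longrightarrow> \<alpha> x > 0" and \<beta>pos: "\<And>x. x > 0 \<Longrightarrow> \<beta> x > 0"
    and \<alpha>\<beta>m [measurable]: "\<alpha> \<in> borel_measurable borel" "\<beta> \<in> borel_measurable borel"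
    and wa\<alpha>: "\<And>m x. m \<in> S \<Longrightarrow> 0 < x \<Longrightarrow> wa m x \<le> \<alpha> x"
    and wb_exp: "\<And>m x. m \<in> S \<Longrightarrow> x \<ge> 1 \<Longrightarrow> wb m x = exp (1 - x)"
    and \<alpha>2: "\<And>x. x > 0 \<Longrightarrow> set_integrable lborel {0<..x} (\<lambda>y. (\<alpha> y)\<^sup>2)"
    and \<beta>2: "\<And>x. x > 0 \<Longrightarrow> set_integrable lborel {x..} (\<lambda>y. (\<beta> y)\<^sup>2)"
    and spos: "\<And>x. s x > 0" and sm [measurable]: "s \<in> borel_measurable borel" and Cs0: "Cs \<ge> 0"
    and schur: "\<And>x. x > 0 \<Longrightarrow> (\<integral>\<^sup>+y. ennreal (indicat_real {0<..} y * (\<alpha> (min x y) * \<beta> (max x y)) * s y) \<partial>lborel) \<le> ennreal (Cs * s x)"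
begin

section \<open>A dominating kernel common to all parameters\<close>

definition Kk :: "real \<Rightarrow> real \<Rightarrow> real" where
  "Kk x y = (if x > 0 \<and> y > 0 then \<alpha> (min x y) * \<beta> (max x y) else 0)"

lemma Kk_meas [measurable]: "(\<lambda>(x,y). Kk x y) \<in> borel_measurable (borel \<Otimes>\<^sub>M borel)"
  unfolding Kk_def by measurable

lemma Kk_meas2 [measurable]: "Kk x \<in> borel_measurable borel"
  using measurable_Pair2[OF Kk_meas, of x] by simp

lemma Kk_nn: "0 \<le> Kk x y"
  unfolding Kk_def using \<alpha>pos[of "min x y"] \<beta>pos[of "max x y"] by (auto simp: min_def max_def)

lemma Kk_sym: "Kk x y = Kk y x"
  unfolding Kk_def by (auto simp: min.commute max.commute)

text \<open>Because every row is square integrable, \<open>KG g x\<close> is a convergent integral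
  at every x and not only at almost every x.\<close>

lemma Kk_sq_int: "integrable lborel (\<lambda>y. (Kk x y)\<^sup>2)"
proof (cases "x > 0")
  case True
  have "integrable lborel (\<lambda>y. (\<beta> x)\<^sup>2 * (indicat_real {0<..x} y *\<^sub>R (\<alpha> y)\<^sup>2) + (\<alpha> x)\<^sup>2 * (indicat_real {x..} y *\<^sub>R (\<beta> y)\<^sup>2))"
    using \<alpha>2[OF True] \<beta>2[OF True] unfolding set_integrable_def by (intro Bochner_Integration.integrable_add integrable_mult_right)
  then show ?thesis
  proof (rule Bochner_Integration.integrable_bound)
    show "AE y in lborel. norm ((Kk x y)\<^sup>2) \<le> norm ((\<beta> x)\<^sup>2 * (indicat_real {0<..x} y *\<^sub>R (\<alpha> y)\<^sup>2) + (\<alpha> x)\<^sup>2 * (indicat_real {x..} y *\<^sub>R (\<beta> y)\<^sup>2))"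
      using True by (intro AE_I2) (auto simp: Kk_def indicator_def min_def max_def power_mult_distrib)
  qed measurable
qed (simp add: Kk_def)

definition KG :: "(real \<Rightarrow> complex) \<Rightarrow> real \<Rightarrow> real" where
  "KG g x = (LINT y|lborel. Kk x y * norm (ext0 g y))"

lemma Kk_g_int:
  assumes "L2 g" shows "integrable lborel (\<lambda>y. Kk x y * norm (ext0 g y))"
proof (rule Bochner_Integration.integrable_bound)
  note [measurable] = L2_meas[OF assms]
  show "integrable lborel (\<lambda>y. (Kk x y)\<^sup>2 + (norm (ext0 g y))\<^sup>2)"
    using Kk_sq_int L2_int[OF assms] by simp
  show "AE y in lborel. norm (Kk x y * norm (ext0 g y)) \<le> norm ((Kk x y)\<^sup>2 + (norm (ext0 g y))\<^sup>2)"
    unfolding real_norm_def by (intro AE_I2 abs_mult_le_squares)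
qed (use L2_meas[OF assms] in measurable)

lemma KG_nn: "0 \<le> KG g x"
  unfolding KG_def by (intro Bochner_Integration.integral_nonneg mult_nonneg_nonneg Kk_nn) auto

lemma KG_meas: assumes "L2 g" shows "KG g \<in> borel_measurable borel"
proof -
  note [measurable] = L2_meas[OF assms]
  have "(\<lambda>(x,y). Kk x y * norm (ext0 g y)) \<in> borel_measurable (borel \<Otimes>\<^sub>M borel)" by measurable
  then have "(\<lambda>(x,y). Kk x y * norm (ext0 g y)) \<in> borel_measurable (borel \<Otimes>\<^sub>M lborel)"
    by (simp add: measurable_cong_sets[OF sets_pair_measure_cong[OF refl sets_lborel]])
  then show ?thesis unfolding KG_def[abs_def] by (intro lborel.borel_measurable_lebesgue_integral)
qed

lemma KG_sq_bound:
  assumes "L2 g"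
  shows "(\<integral>\<^sup>+x. ennreal ((KG g x)\<^sup>2) \<partial>lborel) \<le> ennreal (Cs\<^sup>2 * (L2norm g)\<^sup>2)"
proof -
  note [measurable] = L2_meas[OF assms]
  let ?g = "\<lambda>y. norm (ext0 g y)"
  have "(\<integral>\<^sup>+x. ennreal ((KG g x)\<^sup>2) \<partial>lborel) = (\<integral>\<^sup>+x. (\<integral>\<^sup>+y. ennreal (Kk x y * \<bar>?g y\<bar>) \<partial>lborel)\<^sup>2 \<partial>lborel)"
  proof (rule nn_integral_cong)
    fix x
    have "(\<integral>\<^sup>+y. ennreal (Kk x y * \<bar>?g y\<bar>) \<partial>lborel) = ennreal (KG g x)"
      unfolding KG_def abs_norm_cancel using Kk_nn by (intro nn_integral_eq_integral Kk_g_int[OF assms] AE_I2) auto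
    then show "ennreal ((KG g x)\<^sup>2) = (\<integral>\<^sup>+y. ennreal (Kk x y * \<bar>?g y\<bar>) \<partial>lborel)\<^sup>2"
      using KG_nn by (simp add: ennreal_power)
  qed
  also have "\<dots> \<le> ennreal (Cs\<^sup>2) * (\<integral>\<^sup>+y. ennreal ((?g y)\<^sup>2) \<partial>lborel)"
  proof (rule schur_test[where s=s])
    fix x
    show "(\<integral>\<^sup>+y. ennreal (Kk x y * s y) \<partial>lborel) \<le> ennreal (Cs * s x)"
    proof (cases "x > 0")
      case True
      have "(\<integral>\<^sup>+y. ennreal (Kk x y * s y) \<partial>lborel) = (\<integral>\<^sup>+y. ennreal (indicat_real {0<..} y * (\<alpha> (min x y) * \<beta> (max x y)) * s y) \<partial>lborel)"
        using True by (intro nn_integral_cong) (auto simp: Kk_def indicator_def)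
      then show ?thesis using schur[OF True] by simp
    qed (simp add: Kk_def)
  qed (use Kk_nn Kk_sym spos Cs0 in \<open>auto\<close>)
  also have "(\<integral>\<^sup>+y. ennreal ((?g y)\<^sup>2) \<partial>lborel) = ennreal ((L2norm g)\<^sup>2)"
    unfolding L2norm_eq using nn_integral_eq_integral[OF L2_int[OF assms]]
    by (simp add: Bochner_Integration.integral_nonneg)
  finally show ?thesis by (simp flip: ennreal_mult)
qed

lemma KG_f_int:
  assumes "L2 f" "L2 g" shows "integrable lborel (\<lambda>x. norm (ext0 f x) * KG g x)"
proof (rule Bochner_Integration.integrable_bound)
  note [measurable] = L2_meas[OF assms(1)] KG_meas[OF assms(2)]
  have "integrable lborel (\<lambda>x. (KG g x)\<^sup>2)"
    using order.strict_trans1[OF KG_sq_bound[OF assms(2)] ennreal_less_top]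
    by (intro integrableI_bounded) auto
  then show "integrable lborel (\<lambda>x. (norm (ext0 f x))\<^sup>2 + (KG g x)\<^sup>2)"
    using L2_int[OF assms(1)] by simp
  show "AE x in lborel. norm (norm (ext0 f x) * KG g x) \<le> norm ((norm (ext0 f x))\<^sup>2 + (KG g x)\<^sup>2)"
    unfolding real_norm_def by (intro AE_I2 abs_mult_le_squares)
qed (use L2_meas[OF assms(1)] KG_meas[OF assms(2)] in measurable)

text \<open>By \<open>wron_uu_vv\<close> this is the Wronskian of \<open>uu m\<close> and
  \<open>vv m\<close>.\<close>

definition "w0 m = jost m * W m"

lemma w0_nz: "m \<in> S \<Longrightarrow> w0 m \<noteq> 0"
  using jost_nz Wnz by (simp add: w0_def)

text \<open>The minus signs come from the equation to be solved, \<open>y'' = (V + R) y - g\<close>.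
  Coefficients are normalized so that \<open>rA\<close> vanishes at infinity and \<open>rB\<close>
  at 0.\<close>

definition "rA m g x = - (LINT y:{x..}|lborel. vv m y * (g y / w0 m))"
definition "rB m g x = - (LINT y:{0<..x}|lborel. uu m y * (g y / w0 m))"
definition "rsol m g x = rA m g x * uu m x + rB m g x * vv m x"
definition "rsol' m g x = rA m g x * uu' m x + rB m g x * vv' m x"

lemma uv_kernel_bound:
  assumes "m \<in> S" "0 < x" "x \<le> y"
  shows "norm (uu m x) * norm (vv m y) \<le> K\<^sup>2 * Kk x y"
proof -
  have y: "y > 0" using assms by simp
  have "norm (uu m x) * norm (vv m y) \<le> (K * wa m x) * (K * wb m y)"
    using uu_bound[OF assms(1,2)] vv_bound[OF assms(1) y]
    by (intro mult_mono) (auto intro: order.trans[OF norm_ge_zero])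
  also have "\<dots> = K\<^sup>2 * (wa m x * wb m y)" by (simp add: power2_eq_square)
  also have "\<dots> \<le> K\<^sup>2 * (\<alpha> x * \<beta> y)" by (intro mult_left_mono wawb assms) auto
  finally show ?thesis using assms y by (simp add: Kk_def)
qed

lemma u_int:
  assumes m: "m \<in> S" and x: "x > 0" and g: "L2 g"
  shows "set_integrable lborel {0<..x} (\<lambda>y. uu m y * (g y / w0 m))"
    "set_integrable lborel {0<..x} (\<lambda>y. wa m y * norm (g y))"
proof -
  note [measurable] = L2_meas[OF g] uu_meas[OF m] wmeas[OF m]
  have "integrable lborel (\<lambda>y. (indicat_real {0<..x} y *\<^sub>R (\<alpha> y)\<^sup>2) + (norm (ext0 g y))\<^sup>2)"
    using \<alpha>2[OF x] L2_int[OF g] unfolding set_integrable_def by (rule Bochner_Integration.integrable_add)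
  then have "integrable lborel (\<lambda>y. indicat_real {0<..x} y *\<^sub>R (wa m y * norm (ext0 g y)))"
  proof (rule Bochner_Integration.integrable_bound)
    show "AE y in lborel. norm (indicat_real {0<..x} y *\<^sub>R (wa m y * norm (ext0 g y)))
       \<le> norm ((indicat_real {0<..x} y *\<^sub>R (\<alpha> y)\<^sup>2) + (norm (ext0 g y))\<^sup>2)"
    proof (rule AE_I2)
      fix y
      show "norm (indicat_real {0<..x} y *\<^sub>R (wa m y * norm (ext0 g y)))
         \<le> norm ((indicat_real {0<..x} y *\<^sub>R (\<alpha> y)\<^sup>2) + (norm (ext0 g y))\<^sup>2)"
      proof (cases "0 < y \<and> y \<le> x")
        case True
        then have y: "y > 0" by simp
        have "wa m y * norm (g y) \<le> \<alpha> y * norm (g y)" using wa\<alpha>[OF m y] by (intro mult_right_mono) auto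
        also have "\<dots> \<le> (\<alpha> y)\<^sup>2 + (norm (g y))\<^sup>2"
          using abs_mult_le_squares[of "\<alpha> y" "norm (g y)"] \<alpha>pos[OF y] by (simp add: abs_mult)
        finally show ?thesis using True wapos[OF m y] by (simp add: abs_mult)
      qed (auto simp: indicator_def)
    qed
  qed measurable
  then have i: "set_integrable lborel {0<..x} (\<lambda>y. wa m y * norm (ext0 g y))" by (simp add: set_integrable_def)
  then show i2: "set_integrable lborel {0<..x} (\<lambda>y. wa m y * norm (g y))"
    by (subst set_integrable_cong[of lborel lborel "{0<..x}" "{0<..x}" _ "\<lambda>y. wa m y * norm (ext0 g y)"]) auto
  show "set_integrable lborel {0<..x} (\<lambda>y. uu m y * (g y / w0 m))"
  proof (rule set_integrable_boundI[where g="\<lambda>y. (K / norm (w0 m)) * (wa m y * norm (g y))"])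
    have "(\<lambda>y. indicat_real {0<..x} y *\<^sub>R (uu m y * ((ext0 g y) / w0 m))) \<in> borel_measurable borel" by measurable
    then show "(\<lambda>y. indicat_real {0<..x} y *\<^sub>R (uu m y * (g y / w0 m))) \<in> borel_measurable borel"
      by (rule back_subst[where P="\<lambda>f. f \<in> _"]) (auto simp: fun_eq_iff indicator_def)
    show "norm (uu m y * (g y / w0 m)) \<le> K / norm (w0 m) * (wa m y * norm (g y))" if "y \<in> {0<..x}" for y
      using mult_right_mono[OF uu_bound[OF m, of y], of "norm (g y) / norm (w0 m)"] that
      by (simp add: norm_mult norm_divide)
  qed (use i2 in \<open>intro set_integrable_mult_right\<close>)
qed

lemma v_int:
  assumes m: "m \<in> S" and x: "x > 0" and g: "L2 g"
  shows "set_integrable lborel {x..} (\<lambda>y. vv m y * (g y / w0 m))"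
    "set_integrable lborel {x..} (\<lambda>y. wb m y * norm (g y))"
proof -
  note [measurable] = L2_meas[OF g] vv_meas[OF m] wmeas[OF m]
  \<comment> \<open>For y \<ge> x, \<open>wawb\<close> bounds \<open>wb m y\<close> by
    \<open>Kk x y / wa m x\<close>; the row of the dominating kernel thus serves as
    majorant.\<close>
  have "integrable lborel (\<lambda>y. 1 / wa m x * (Kk x y * norm (ext0 g y)))"
    by (intro integrable_mult_right Kk_g_int g)
  then have "integrable lborel (\<lambda>y. indicat_real {x..} y *\<^sub>R (wb m y * norm (ext0 g y)))"
  proof (rule Bochner_Integration.integrable_bound)
    show "AE y in lborel. norm (indicat_real {x..} y *\<^sub>R (wb m y * norm (ext0 g y)))
       \<le> norm (1 / wa m x * (Kk x y * norm (ext0 g y)))"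
    proof (rule AE_I2)
      fix y
      show "norm (indicat_real {x..} y *\<^sub>R (wb m y * norm (ext0 g y)))
         \<le> norm (1 / wa m x * (Kk x y * norm (ext0 g y)))"
      proof (cases "x \<le> y")
        case True
        then have y: "y > 0" using x by simp
        have "wb m y \<le> 1 / wa m x * Kk x y"
          using wawb[OF m x True] wapos[OF m x] x y True by (simp add: Kk_def field_simps)
        then have "wb m y * norm (g y) \<le> 1 / wa m x * Kk x y * norm (g y)" by (intro mult_right_mono) auto
        moreover have "0 \<le> 1 / wa m x * (Kk x y * norm (g y))" using wapos[OF m x] Kk_nn by simp
        ultimately show ?thesis using True y wbpos[OF m y] wapos[OF m x] by (simp add: abs_mult mult.assoc Kk_nn)
      qed (auto simp: indicator_def)
    qed
  qed measurable
  then have i: "set_integrable lborel {x..} (\<lambda>y. wb m y * norm (ext0 g y))" by (simp add: set_integrable_def)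
  then show i2: "set_integrable lborel {x..} (\<lambda>y. wb m y * norm (g y))"
    using x by (subst set_integrable_cong[of lborel lborel "{x..}" "{x..}" _ "\<lambda>y. wb m y * norm (ext0 g y)"]) auto
  show "set_integrable lborel {x..} (\<lambda>y. vv m y * (g y / w0 m))"
  proof (rule set_integrable_boundI[where g="\<lambda>y. (K / norm (w0 m)) * (wb m y * norm (g y))"])
    have "(\<lambda>y. indicat_real {x..} y *\<^sub>R (vv m y * ((ext0 g y) / w0 m))) \<in> borel_measurable borel" by measurable
    then show "(\<lambda>y. indicat_real {x..} y *\<^sub>R (vv m y * (g y / w0 m))) \<in> borel_measurable borel"
      by (rule back_subst[where P="\<lambda>f. f \<in> _"]) (use x in \<open>auto simp: fun_eq_iff indicator_def\<close>)
    show "norm (vv m y * (g y / w0 m)) \<le> K / norm (w0 m) * (wb m y * norm (g y))" if "y \<in> {x..}" for y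
      using mult_right_mono[OF vv_bound[OF m, of y], of "norm (g y) / norm (w0 m)"] that x
      by (simp add: norm_mult norm_divide)
  qed (use i2 in \<open>intro set_integrable_mult_right\<close>)
qed

lemma ac_rsol:
  assumes m: "m \<in> S" and g: "L2 g"
  shows "ac (rsol m g) (rsol' m g)" "ac (rsol' m g) (\<lambda>x. (V m x + R m x) * rsol m g x - g x)"
proof -
  have rA: "ac (rA m g) (\<lambda>x. - (vv m x * (- (g x / w0 m))))"
    unfolding rA_def by (rule ac_cong[OF ac_minus[OF ac_integral_right[OF v_int(1)[OF m _ g]]]]) auto
  have rB: "ac (rB m g) (\<lambda>x. uu m x * (- (g x / w0 m)))"
    unfolding rB_def by (rule ac_cong[OF ac_minus[OF ac_integral_left[OF u_int(1)[OF m _ g]]]]) auto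
  note vc = variation_of_constants[OF ac_uu[OF m] ac_vv[OF m] rA rB]
  show "ac (rsol m g) (rsol' m g)" by (rule ac_cong[OF vc(1)]) (simp_all add: rsol_def rsol'_def)
  have w: "uu m x * vv' m x - uu' m x * vv m x = w0 m" if "x > 0" for x
    using wron_uu_vv[OF m that] by (simp add: w0_def)
  show "ac (rsol' m g) (\<lambda>x. (V m x + R m x) * rsol m g x - g x)"
    by (rule ac_cong[OF vc(2)]) (simp_all add: rsol_def rsol'_def w w0_nz[OF m])
qed

lemma rsol_meas: "m \<in> S \<Longrightarrow> L2 g \<Longrightarrow> (ext0 (rsol m g)) \<in> borel_measurable borel"
  unfolding ext0_def by (intro borel_measurable_if_pos ac_continuous[OF ac_rsol(1)])

definition Gk :: "complex \<Rightarrow> real \<Rightarrow> real \<Rightarrow> complex" where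
  "Gk m x y = (if 0 < y then if y \<le> x then uu m y * vv m x else uu m x * vv m y else 0)"

lemma Gk_bound: "m \<in> S \<Longrightarrow> x > 0 \<Longrightarrow> norm (Gk m x y) \<le> K\<^sup>2 * Kk x y"
  using uv_kernel_bound[of m y x] uv_kernel_bound[of m x y] Kk_nn[of x y] Kk_sym[of x y]
  by (auto simp: Gk_def norm_mult)

text \<open>The resolvent before division by \<open>w0 m\<close>. Its bound by
  \<open>K^2 * KG g x\<close> does not depend on \<open>m\<close>, whereas \<open>1 / w0 m\<close>
  need not be bounded on \<open>S\<close>; the division is done after integration.\<close>

definition Top :: "complex \<Rightarrow> (real \<Rightarrow> complex) \<Rightarrow> real \<Rightarrow> complex" where
  "Top m g x = - (LINT y|lborel. Gk m x y * (ext0 g y))"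

lemma Gk_meas: "m \<in> S \<Longrightarrow> Gk m x \<in> borel_measurable borel"
  unfolding Gk_def using uu_meas vv_meas by measurable

lemma Gk_int:
  assumes "m \<in> S" "x > 0" "L2 g"
  shows "integrable lborel (\<lambda>y. Gk m x y * (ext0 g y))"
    and "norm (Top m g x) \<le> K\<^sup>2 * KG g x"
proof -
  note [measurable] = L2_meas[OF assms(3)] Gk_meas[OF assms(1)]
  have i: "integrable lborel (\<lambda>y. K\<^sup>2 * (Kk x y * norm (ext0 g y)))"
    by (intro integrable_mult_right Kk_g_int assms)
  have b: "norm (Gk m x y * (ext0 g y)) \<le> K\<^sup>2 * (Kk x y * norm (ext0 g y))" for y
    using mult_right_mono[OF Gk_bound[OF assms(1,2)], of "norm (ext0 g y)" y] by (simp add: norm_mult mult.assoc)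
  show i2: "integrable lborel (\<lambda>y. Gk m x y * (ext0 g y))"
    by (rule Bochner_Integration.integrable_bound[OF i]) (measurable, intro AE_I2 order.trans[OF b], simp)
  have "norm (Top m g x) \<le> (LINT y|lborel. K\<^sup>2 * (Kk x y * norm (ext0 g y)))"
    unfolding Top_def norm_minus_cancel by (rule Bochner_Integration.integral_norm_bound_integral[OF i2 i]) (rule b)
  then show "norm (Top m g x) \<le> K\<^sup>2 * KG g x" by (simp add: KG_def)
qed

lemma rsol_Top:
  assumes m: "m \<in> S" and x: "x > 0" and g: "L2 g"
  shows "rsol m g x = Top m g x / w0 m"
proof -
  let ?h = "\<lambda>y. Gk m x y * (g y / w0 m)"
  have eqi: "(\<lambda>y. indicat_real {0<..} y *\<^sub>R ?h y) = (\<lambda>y. Gk m x y * (ext0 g y) / w0 m)"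
    by (auto simp: fun_eq_iff indicator_def)
  have i: "set_integrable lborel {0<..} ?h"
    unfolding set_integrable_def eqi by (rule integrable_divide_zero[OF Gk_int(1)[OF assms]])
  have "Top m g x / w0 m = - (LINT y:{0<..}|lborel. ?h y)"
    unfolding set_lebesgue_integral_def eqi Top_def by simp
  also have "\<dots> = - ((LINT y:{0<..x}|lborel. ?h y) + (LINT y:{x..}|lborel. ?h y))"
    using set_integral_split_pos[OF i x] by simp
  also have "(LINT y:{0<..x}|lborel. ?h y) = (LINT y:{0<..x}|lborel. vv m x * (uu m y * (g y / w0 m)))"
    by (intro set_lebesgue_integral_cong) (auto simp: Gk_def)
  also have "\<dots> = - (vv m x * rB m g x)"
    unfolding set_integral_mult_right rB_def by simp
  also have "(LINT y:{x..}|lborel. ?h y) = (LINT y:{x..}|lborel. uu m x * (vv m y * (g y / w0 m)))"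
    using x by (intro set_lebesgue_integral_cong) (auto simp: Gk_def)
  also have "\<dots> = - (uu m x * rA m g x)"
    unfolding set_integral_mult_right rA_def by simp
  finally show ?thesis by (simp add: rsol_def)
qed

lemma rsol_L2:
  assumes m: "m \<in> S" and g: "L2 g"
  shows "L2 (rsol m g)" "L2norm (rsol m g) \<le> K\<^sup>2 / norm (w0 m) * Cs * L2norm g"
proof -
  let ?c = "K\<^sup>2 / norm (w0 m)"
  have c0: "?c \<ge> 0" by simp
  have b: "(norm (ext0 (rsol m g) x))\<^sup>2 \<le> ?c\<^sup>2 * (KG g x)\<^sup>2" for x
  proof (cases "x > 0")
    case True
    have "norm (rsol m g x) \<le> ?c * KG g x"
      using Gk_int(2)[OF m True g] by (simp add: rsol_Top[OF m True g] norm_divide divide_right_mono)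
    then show ?thesis using True by (simp add: power_mono flip: power_mult_distrib)
  qed simp
  have "(\<integral>\<^sup>+x. ennreal ((norm (ext0 (rsol m g) x))\<^sup>2) \<partial>lborel) \<le> (\<integral>\<^sup>+x. ennreal (?c\<^sup>2) * ennreal ((KG g x)\<^sup>2) \<partial>lborel)"
    using b by (intro nn_integral_mono) (simp flip: ennreal_mult)
  also have "\<dots> = ennreal (?c\<^sup>2) * (\<integral>\<^sup>+x. ennreal ((KG g x)\<^sup>2) \<partial>lborel)"
    using KG_meas[OF g] by (intro nn_integral_cmult) measurable
  also have "\<dots> \<le> ennreal (?c\<^sup>2) * ennreal (Cs\<^sup>2 * (L2norm g)\<^sup>2)"
    by (intro mult_left_mono KG_sq_bound g) auto
  also have "\<dots> = ennreal ((?c * Cs * L2norm g)\<^sup>2)" by (simp add: power_mult_distrib power_divide mult.assoc flip: ennreal_mult)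
  finally have fin: "(\<integral>\<^sup>+x. ennreal ((norm (ext0 (rsol m g) x))\<^sup>2) \<partial>lborel) \<le> ennreal ((?c * Cs * L2norm g)\<^sup>2)" .
  show "L2 (rsol m g)" by (rule L2_boundI(1)[OF rsol_meas[OF m g] fin]) simp
  have "L2norm g \<ge> 0" unfolding L2norm_eq by (simp add: Bochner_Integration.integral_nonneg)
  then have "0 \<le> ?c * Cs * L2norm g" using Cs0 c0 by (intro mult_nonneg_nonneg)
  then have "sqrt ((?c * Cs * L2norm g)\<^sup>2) = ?c * Cs * L2norm g" by (simp only: real_sqrt_abs abs_of_nonneg)
  then show "L2norm (rsol m g) \<le> ?c * Cs * L2norm g" using L2_boundI(2)[OF rsol_meas[OF m g] fin] by (simp only: zero_le_power2 simp_thms)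
qed

text \<open>The boundary form equals \<open>rA * uB * W + rB * vB * W\<close>. In the second term
  \<open>rB\<close> tends to 0 and \<open>vB\<close> converges. In the first \<open>rA\<close> may
  blow up, but \<open>uB\<close> carries the factor \<open>wa / wb * k0\<close>, and
  \<open>wa / wb * |rA|\<close> stays bounded.\<close>

lemma rsol_boundary:
  assumes m: "m \<in> S" and g: "L2 g"
  shows "((\<lambda>x. pw m x * rsol' m g x - pw' m x * rsol m g x) \<longlongrightarrow> 0) (at_right 0)"
proof -
  let ?c = "K / norm (w0 m)"
  \<comment> \<open>Bounds \<open>wa x / wb x\<close> times the integral of
    \<open>wb * norm g\<close> over [x, \<infinity>[: up to 1 the increasing ratio turns
    \<open>wb y\<close> into \<open>wa y\<close>, beyond 1 the ratio is replaced by its value at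
    1.\<close>
  define c1 where "c1 = (LINT y:{0<..1}|lborel. wa m y * norm (g y)) + wa m 1 / wb m 1 * (LINT y:{1..}|lborel. wb m y * norm (g y))"
  have rAb: "norm (rA m g x * uB m x) \<le> ?c * c1 * k0 x" if x: "0 < x" "x < 1" for x
  proof -
    have wr: "wa m x / wb m x * wb m y \<le> wa m y" if "x \<le> y" for y
      using wmono[OF m x(1) that] wbpos[OF m x(1)] by (simp add: field_simps)
    have ii: "set_integrable lborel {x..} (\<lambda>y. ?c * (wb m y * norm (g y)))"
      by (intro set_integrable_mult_right v_int(2)[OF m x(1) g])
    have "norm (rA m g x) \<le> (LINT y:{x..}|lborel. ?c * (wb m y * norm (g y)))"
      unfolding rA_def norm_minus_cancel
    proof (rule set_integral_norm_boundI[OF ii v_int(1)[OF m x(1) g]])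
      show "norm (vv m y * (g y / w0 m)) \<le> ?c * (wb m y * norm (g y))" if "y \<in> {x..}" for y
        using mult_right_mono[OF vv_bound[OF m, of y], of "norm (g y) / norm (w0 m)"] that x
        by (simp add: norm_mult norm_divide)
    qed
    also have "\<dots> = ?c * (LINT y:{x..}|lborel. wb m y * norm (g y))" by (rule set_integral_mult_right)
    finally have 1: "norm (rA m g x) \<le> ?c * (LINT y:{x..}|lborel. wb m y * norm (g y))" .
    have un: "{x..} = {x..1} \<union> {1..}" using x by auto
    have sp: "(LINT y:{x..}|lborel. wb m y * norm (g y)) = (LINT y:{x..1}|lborel. wb m y * norm (g y)) + (LINT y:{1..}|lborel. wb m y * norm (g y))"
      unfolding un using x AE_lborel_singleton[of 1]
      by (intro set_integral_Un_AE) (auto elim: eventually_mono intro: set_integrable_subset[OF v_int(2)[OF m x(1) g]])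
    have "wa m x / wb m x * (LINT y:{x..1}|lborel. wb m y * norm (g y)) = (LINT y:{x..1}|lborel. wa m x / wb m x * (wb m y * norm (g y)))"
      by (rule set_integral_mult_right[symmetric])
    also have "\<dots> \<le> (LINT y:{x..1}|lborel. wa m y * norm (g y))"
    proof (rule set_integral_mono)
      show "set_integrable lborel {x..1} (\<lambda>y. wa m x / wb m x * (wb m y * norm (g y)))"
        by (intro set_integrable_mult_right set_integrable_subset[OF v_int(2)[OF m x(1) g]]) auto
      show "set_integrable lborel {x..1} (\<lambda>y. wa m y * norm (g y))"
        using x by (intro set_integrable_subset[OF u_int(2)[OF m zero_less_one g]]) auto
      show "wa m x / wb m x * (wb m y * norm (g y)) \<le> wa m y * norm (g y)" if "y \<in> {x..1}" for y
        using mult_right_mono[OF wr[of y], of "norm (g y)"] that by (simp add: mult.assoc)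
    qed
    also have "\<dots> \<le> (LINT y:{0<..1}|lborel. wa m y * norm (g y))"
    proof (rule set_integral_mono_set[OF u_int(2)[OF m zero_less_one g]])
      show "0 \<le> wa m y * norm (g y)" if "y \<in> {0<..1}" for y
        using wapos[OF m, of y] that by simp
    qed (use x in auto)
    finally have 2: "wa m x / wb m x * (LINT y:{x..1}|lborel. wb m y * norm (g y)) \<le> (LINT y:{0<..1}|lborel. wa m y * norm (g y))" .
    have "wa m x / wb m x \<le> wa m 1 / wb m 1"
      using wmono[OF m x(1), of 1] x wbpos[OF m x(1)] wbpos[OF m zero_less_one] by (simp add: field_simps)
    moreover have "0 \<le> (LINT y:{1..}|lborel. wb m y * norm (g y))"
    proof (rule set_integral_nonneg')
      show "0 \<le> wb m y * norm (g y)" if "y \<in> {1..}" for y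
        using wbpos[OF m, of y] that by simp
    qed
    ultimately have 3: "wa m x / wb m x * (LINT y:{1..}|lborel. wb m y * norm (g y)) \<le> wa m 1 / wb m 1 * (LINT y:{1..}|lborel. wb m y * norm (g y))"
      by (rule mult_right_mono)
    have "wa m x / wb m x * (LINT y:{x..}|lborel. wb m y * norm (g y)) \<le> c1"
      unfolding sp c1_def distrib_left using 2 3 by (rule add_mono)
    then have 4: "?c * (wa m x / wb m x * (LINT y:{x..}|lborel. wb m y * norm (g y))) * k0 x \<le> ?c * c1 * k0 x"
      using K_pos k_bounds[OF m x(1)] by (intro mult_right_mono mult_left_mono) auto
    have "norm (rA m g x * uB m x) \<le> (?c * (LINT y:{x..}|lborel. wb m y * norm (g y))) * (wa m x / wb m x * k0 x)"
      unfolding norm_mult using 1 uB_bound[OF m x(1)]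
      by (intro mult_mono) (auto intro: order.trans[OF norm_ge_zero])
    then show ?thesis using 4 by (simp add: ac_simps)
  qed
  have L1: "((\<lambda>x. rA m g x * uB m x) \<longlongrightarrow> 0) (at_right 0)"
  proof (rule Lim_null_comparison)
    show "\<forall>\<^sub>F x in at_right 0. norm (rA m g x * uB m x) \<le> ?c * c1 * k0 x"
      using eventually_at_right_real[of 0 "1::real", OF zero_less_one] by eventually_elim (rule rAb; simp)
    show "((\<lambda>x. ?c * c1 * k0 x) \<longlongrightarrow> 0) (at_right 0)" by (rule tendsto_mult_right_zero[OF k0_lim])
  qed
  have L2: "(rB m g \<longlongrightarrow> 0) (at_right 0)"
  proof -
    \<comment> \<open>The limit lemma wants integrability on the whole half-line, which the growing
      bound on \<open>uu\<close> does not give; the cut at 1 is invisible for small x.\<close>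
    have "((\<lambda>x. LINT y:{0<..x}|lborel. indicat_real {0<..1} y *\<^sub>R (uu m y * (g y / w0 m))) \<longlongrightarrow> 0) (at_right 0)"
    proof (rule set_integral_limits(2))
      have "(\<lambda>y. indicat_real {0<..} y *\<^sub>R (indicat_real {0<..1} y *\<^sub>R (uu m y * (g y / w0 m)))) = (\<lambda>y. indicat_real {0<..1} y *\<^sub>R (uu m y * (g y / w0 m)))"
        by (auto simp: indicator_def fun_eq_iff)
      then show "set_integrable lborel {0<..} (\<lambda>y. indicat_real {0<..1} y *\<^sub>R (uu m y * (g y / w0 m)))"
        using u_int(1)[OF m zero_less_one g] by (simp add: set_integrable_def)
    qed
    moreover have "\<forall>\<^sub>F x in at_right 0. (LINT y:{0<..x}|lborel. indicat_real {0<..1} y *\<^sub>R (uu m y * (g y / w0 m))) = - rB m g x"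
      using eventually_at_right_real[of 0 "1::real", OF zero_less_one]
    proof eventually_elim
      case (elim x)
      then show ?case unfolding rB_def minus_minus by (intro set_lebesgue_integral_cong) (auto simp: indicator_def)
    qed
    ultimately have "((\<lambda>x. - rB m g x) \<longlongrightarrow> 0) (at_right 0)" by (simp add: tendsto_cong)
    from tendsto_minus[OF this] show ?thesis by simp
  qed
  have "((\<lambda>x. (rA m g x * uB m x) * W m + rB m g x * (vB m x * W m)) \<longlongrightarrow> 0 * W m + 0 * (jost m * W m)) (at_right 0)"
    by (intro tendsto_intros L1 L2 vB_lim0[OF m])
  moreover have "\<forall>\<^sub>F x in at_right 0. (rA m g x * uB m x) * W m + rB m g x * (vB m x * W m) = pw m x * rsol' m g x - pw' m x * rsol m g x"
    using eventually_at_right_real[of 0 "1::real", OF zero_less_one]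
  proof eventually_elim
    case (elim x)
    then have x: "x > 0" "x \<le> 1" by auto
    have "(rA m g x * uB m x) * W m + rB m g x * (vB m x * W m) = rA m g x * (uB m x * W m) + rB m g x * (vB m x * W m)" by simp
    also have "\<dots> = a m x * rsol' m g x - a' m x * rsol m g x"
      unfolding wron_a_uu[OF m x(1), symmetric] wron_a_vv[OF m x(1), symmetric]
      by (simp add: rsol_def rsol'_def algebra_simps)
    finally show ?case using a_pw[OF m x] by simp
  qed
  ultimately show ?thesis by (simp add: tendsto_cong)
qed

lemma rsol_Hm:
  assumes m: "m \<in> S" and g: "L2 g"
  shows "Hm Q m (rsol m g) (\<lambda>x. g x + (-1) * rsol m g x)"
  unfolding Hm_def
proof (intro conjI exI)
  note c = ac_continuous[OF ac_rsol(1)[OF m g]] ac_continuous[OF ac_rsol(2)[OF m g]]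
  show "L2 (rsol m g)" by (rule rsol_L2(1)[OF m g])
  show "L2 (\<lambda>x. g x + (-1) * rsol m g x)" by (intro L2_add L2_cmult g rsol_L2(1)[OF m g])
  show "AC1_data (rsol m g) (rsol' m g) (\<lambda>x. (V m x + R m x) * rsol m g x - g x)"
    unfolding AC1_data_def loc_int_def
    using ac_has_derivative[OF ac_rsol(1)[OF m g] c(2)] ac_integrable[OF ac_rsol(2)[OF m g]] ac_eq[OF ac_rsol(2)[OF m g]]
    by blast
  show "AE x in lborel. 0 < x \<longrightarrow> g x + (-1) * rsol m g x =
     - ((V m x + R m x) * rsol m g x - g x) + (m\<^sup>2 - 1/4) / (of_real x)\<^sup>2 * rsol m g x + Q x * rsol m g x"
    using total[OF m] by (intro AE_I2) (simp add: algebra_simps)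
  show "((\<lambda>x. pw m x * rsol' m g x - pw' m x * rsol m g x) \<longlongrightarrow> 0) (at_right 0)"
    by (rule rsol_boundary[OF m g])
qed

text \<open>The Wronskian \<open>c1\<close> of \<open>f\<close> and \<open>vv\<close> is constant.
  It must vanish since \<open>vv\<close> and \<open>vv'\<close> decay exponentially; but nothing is
  known about \<open>f'\<close> at infinity, so it is averaged over [n, n+1] and \<open>f'\<close>
  is removed by parts. Then \<open>f\<close> is a multiple of \<open>vv\<close>, whose boundary
  value \<open>jost m * W m\<close> is nonzero.\<close>

lemma homogeneous_trivial:
  assumes m: "m \<in> S" and f: "L2 f" and acf: "ac f f'" "ac f' f2"
    and eq: "AE x in lborel. 0 < x \<longrightarrow> f2 x = (V m x + R m x) * f x"
    and bc: "((\<lambda>x. pw m x * f' x - pw' m x * f x) \<longlongrightarrow> 0) (at_right 0)"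
    and x: "x > 0"
  shows "f x = 0"
proof -
  have const: "ac (\<lambda>x. f x * h' x - f' x * h x) (\<lambda>x. 0)"
    if h: "ac h h'" "ac h' (\<lambda>x. (V m x + R m x) * h x)" for h h'
    by (rule ac_cong_AE[OF ac_wronskian[OF acf h]])
       (use eq in \<open>auto simp: set_borel_measurable_def elim: eventually_mono\<close>)
  define c1 where "c1 = f 1 * vv' m 1 - f' 1 * vv m 1"
  have c1: "f x * vv' m x - f' x * vv m x = c1" if "x > 0" for x
    unfolding c1_def by (rule ac_zero_const[OF const[OF ac_vv[OF m]] that]) simp
  define c2 where "c2 = f 1 * uu' m 1 - f' 1 * uu m 1"
  have c2: "f x * uu' m x - f' x * uu m x = c2" if "x > 0" for x
    unfolding c2_def by (rule ac_zero_const[OF const[OF ac_uu[OF m]] that]) simp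
  obtain K' where K': "K' \<ge> 0" "\<And>y. y \<ge> 1 \<Longrightarrow> norm (vv m y) \<le> K' * exp (1 - y)" "\<And>y. y \<ge> 1 \<Longrightarrow> norm (vv' m y) \<le> K' * exp (1 - y)"
  proof
    let ?k = "C * (1 + 2 * (LINT y:{0<..}|lborel. \<kappa> y))"
    show "max K ?k \<ge> 0" using K_pos by simp
    fix y :: real assume y: "y \<ge> 1"
    have "K * exp (1 - y) \<le> max K ?k * exp (1 - y)" by (intro mult_right_mono) auto
    moreover have "norm (vv m y) \<le> K * exp (1 - y)" using vv_bound[OF m, of y] wb_exp[OF m y] y by simp
    ultimately show "norm (vv m y) \<le> max K ?k * exp (1 - y)" by (rule order.trans[rotated])
    have "?k * exp (1 - y) \<le> max K ?k * exp (1 - y)" by (intro mult_right_mono) auto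
    moreover have "norm (vv' m y) \<le> ?k * exp (1 - y)" using vv'_bound[OF m y] wb_exp[OF m y] by simp
    ultimately show "norm (vv' m y) \<le> max K ?k * exp (1 - y)" by (rule order.trans[rotated])
  qed
  let ?N = "LINT y|lborel. (norm (ext0 f y))\<^sup>2"
  have small: "norm c1 / 6 \<le> 3 * K' * (1 + ?N) * exp (1 - n)" if n: "n \<ge> 1" for n :: real
  proof -
    \<comment> \<open>A bump vanishing at n and n+1, with primitive \<open>\<psi>\<close> increasing
      by 1/6 over the interval. In the derivative of \<open>\<phi> * vv * f + c1 * \<psi>\<close>
      the terms with \<open>f'\<close> cancel, because
      \<open>c1 = f * vv' - f' * vv\<close>.\<close>
    define \<phi> where "\<phi> y = complex_of_real ((y - n) * (n + 1 - y))" for y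
    define \<phi>' where "\<phi>' y = complex_of_real (2 * n + 1 - 2 * y)" for y
    define \<psi> where "\<psi> y = complex_of_real ((y - n)^2 / 2 - (y - n)^3 / 3)" for y
    have d\<phi>: "ac \<phi> \<phi>'"
      unfolding \<phi>_def \<phi>'_def
      by (rule ac_C1) (auto intro!: derivative_eq_intros continuous_intros simp: has_vector_derivative_complex_iff algebra_simps)
    have d\<psi>: "ac \<psi> \<phi>"
      unfolding \<phi>_def \<psi>_def
      by (rule ac_C1) (auto intro!: derivative_eq_intros continuous_intros simp: has_vector_derivative_complex_iff power2_eq_square field_simps)
    have acG: "ac (\<lambda>y. \<phi> y * (vv m y * f y) + c1 * \<psi> y) (\<lambda>y. \<phi>' y * (vv m y * f y) + 2 * (\<phi> y * (vv' m y * f y)))"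
    proof (rule ac_cong[OF ac_add[OF ac_mult[OF d\<phi> ac_mult[OF ac_vv(1)[OF m] acf(1)]] ac_cmult[OF d\<psi>, of c1]]])
      fix y :: real assume "y > 0"
      then show "\<phi>' y * (vv m y * f y) + \<phi> y * (vv' m y * f y + vv m y * f' y) + c1 * \<phi> y = \<phi>' y * (vv m y * f y) + 2 * (\<phi> y * (vv' m y * f y))"
        by (simp flip: c1[of y]) (simp add: algebra_simps)
    qed simp
    have n0: "n > 0" using n by simp
    have "c1 / 6 = (LINT y:{n..n+1}|lborel. \<phi>' y * (vv m y * f y) + 2 * (\<phi> y * (vv' m y * f y)))"
      using ac_eq[OF acG n0, of "n+1"] by (simp add: \<phi>_def \<psi>_def)
    then have "norm c1 / 6 = norm (LINT y:{n..n+1}|lborel. \<phi>' y * (vv m y * f y) + 2 * (\<phi> y * (vv' m y * f y)))"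
      by (metis norm_divide norm_numeral)
    also have "\<dots> \<le> (LINT y:{n..n+1}|lborel. 3 * K' * exp (1 - n) * (1 + (norm (ext0 f y))\<^sup>2))"
    proof (rule set_integral_norm_boundI)
      show "set_integrable lborel {n..n+1} (\<lambda>y. \<phi>' y * (vv m y * f y) + 2 * (\<phi> y * (vv' m y * f y)))"
        by (rule ac_integrable[OF acG n0])
      have "set_integrable lborel {n..n+1} (\<lambda>y. (norm (ext0 f y))\<^sup>2)"
        using set_integrable_subset[of lborel UNIV "\<lambda>y. (norm (ext0 f y))\<^sup>2" "{n..n+1}"] L2_int[OF f]
        by (simp add: set_integrable_def)
      then show "set_integrable lborel {n..n+1} (\<lambda>y. 3 * K' * exp (1 - n) * (1 + (norm (ext0 f y))\<^sup>2))"
        by (intro set_integrable_mult_right set_integral_add(1)) (auto intro: borel_integrable_atLeastAtMost')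
      fix y assume y: "y \<in> {n..n+1}"
      then have y1: "y \<ge> 1" using n by simp
      have "(y - n) * (n + 1 - y) \<le> 1 * 1" using y by (intro mult_mono) auto
      then have b: "norm (\<phi> y) \<le> 1" "norm (\<phi>' y) \<le> 1"
        unfolding \<phi>_def \<phi>'_def norm_of_real using y mult_nonneg_nonneg[of "y - n" "n + 1 - y"] by auto
      have e: "exp (1 - y) \<le> exp (1 - n)" using y by simp
      have v: "norm (vv m y) \<le> K' * exp (1 - n)" "norm (vv' m y) \<le> K' * exp (1 - n)"
        using K'(2,3)[OF y1] mult_left_mono[OF e K'(1)] by linarith+
      have "norm (\<phi>' y * (vv m y * f y) + 2 * (\<phi> y * (vv' m y * f y)))
          \<le> norm (\<phi>' y) * (norm (vv m y) * norm (f y)) + 2 * (norm (\<phi> y) * (norm (vv' m y) * norm (f y)))"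
        by (rule order.trans[OF norm_triangle_ineq]) (simp add: norm_mult)
      also have "\<dots> \<le> 1 * (K' * exp (1 - n) * norm (f y)) + 2 * (1 * (K' * exp (1 - n) * norm (f y)))"
        using b v by (intro add_mono mult_mono mult_left_mono mult_right_mono) auto
      also have "\<dots> = 3 * K' * exp (1 - n) * norm (f y)" by simp
      also have "\<dots> \<le> 3 * K' * exp (1 - n) * (1 + (norm (f y))\<^sup>2)"
        using K'(1) abs_mult_le_squares[of 1 "norm (f y)"] by (intro mult_left_mono) auto
      finally show "norm (\<phi>' y * (vv m y * f y) + 2 * (\<phi> y * (vv' m y * f y))) \<le> 3 * K' * exp (1 - n) * (1 + (norm (ext0 f y))\<^sup>2)"
        using y1 by simp
    qed
    also have "\<dots> = 3 * K' * exp (1 - n) * (LINT y:{n..n+1}|lborel. 1 + (norm (ext0 f y))\<^sup>2)"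
      by (rule set_integral_mult_right)
    also have "\<dots> \<le> 3 * K' * exp (1 - n) * (1 + ?N)"
    proof (rule mult_left_mono)
      have i: "set_integrable lborel {n..n+1} (\<lambda>y. (norm (ext0 f y))\<^sup>2)"
        using set_integrable_subset[of lborel UNIV "\<lambda>y. (norm (ext0 f y))\<^sup>2" "{n..n+1}"] L2_int[OF f]
        by (simp add: set_integrable_def)
      have i1: "set_integrable lborel {n..n+1} (\<lambda>y. 1::real)" by (auto intro: borel_integrable_atLeastAtMost')
      have "(LINT y:{n..n+1}|lborel. 1 + (norm (ext0 f y))\<^sup>2) = (LINT y:{n..n+1}|lborel. 1) + (LINT y:{n..n+1}|lborel. (norm (ext0 f y))\<^sup>2)"
        by (rule set_integral_add(2)[OF i1 i])
      moreover have "(LINT y:{n..n+1}|lborel. (1::real)) = 1" by (simp add: set_lebesgue_integral_def)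
      moreover have "(LINT y:{n..n+1}|lborel. (norm (ext0 f y))\<^sup>2) \<le> ?N"
        using set_integral_mono_set[of lborel UNIV "\<lambda>y. (norm (ext0 f y))\<^sup>2" "{n..n+1}"] L2_int[OF f]
        by (simp add: set_integrable_def set_lebesgue_integral_def)
      ultimately show "(LINT y:{n..n+1}|lborel. 1 + (norm (ext0 f y))\<^sup>2) \<le> 1 + ?N" by simp
    qed (use K'(1) in simp)
    finally show ?thesis by (simp only: ac_simps)
  qed
  have "norm c1 / 6 \<le> 0"
  proof (rule tendsto_lowerbound)
    have "((\<lambda>n::real. exp (1 - n)) \<longlongrightarrow> 0) at_top" by real_asymp
    then show "((\<lambda>n::real. 3 * K' * (1 + ?N) * exp (1 - n)) \<longlongrightarrow> 0) at_top"
      by (rule tendsto_mult_right_zero)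
    show "\<forall>\<^sub>F n in at_top. norm c1 / 6 \<le> 3 * K' * (1 + ?N) * exp (1 - n)"
      using eventually_ge_at_top[of 1] by eventually_elim (rule small)
  qed auto
  then have c10: "c1 = 0" by simp
  \<comment> \<open>Cramer's rule: \<open>f\<close> and \<open>f'\<close> are recovered from the
    Wronskians with \<open>vv\<close> and \<open>uu\<close>.\<close>
  have f_eq: "f y * w0 m = - c2 * vv m y" "f' y * w0 m = - c2 * vv' m y" if "y > 0" for y
  proof -
    have w: "uu m y * vv' m y - uu' m y * vv m y = w0 m"
      using wron_uu_vv[OF m that] by (simp add: w0_def)
    have "f y * w0 m = uu m y * (f y * vv' m y - f' y * vv m y) - (f y * uu' m y - f' y * uu m y) * vv m y"
      unfolding w[symmetric] by (simp add: algebra_simps)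
    then show "f y * w0 m = - c2 * vv m y" using c1[OF that] c2[OF that] c10 by simp
    have "f' y * w0 m = uu' m y * (f y * vv' m y - f' y * vv m y) - (f y * uu' m y - f' y * uu m y) * vv' m y"
      unfolding w[symmetric] by (simp add: algebra_simps)
    then show "f' y * w0 m = - c2 * vv' m y" using c1[OF that] c2[OF that] c10 by simp
  qed
  have "((\<lambda>y. (pw m y * f' y - pw' m y * f y) * w0 m) \<longlongrightarrow> 0 * w0 m) (at_right 0)"
    by (intro tendsto_intros bc)
  moreover have "\<forall>\<^sub>F y in at_right 0. (pw m y * f' y - pw' m y * f y) * w0 m = - c2 * (vB m y * W m)"
    using eventually_at_right_real[of 0 "1::real", OF zero_less_one]
  proof eventually_elim
    case (elim y)
    then have y: "y > 0" "y \<le> 1" by auto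
    have "(pw m y * f' y - pw' m y * f y) * w0 m = a m y * (f' y * w0 m) - a' m y * (f y * w0 m)"
      using a_pw[OF m y] by (simp add: algebra_simps)
    also have "\<dots> = - c2 * (a m y * vv' m y - a' m y * vv m y)"
      unfolding f_eq[OF y(1)] by (simp add: algebra_simps)
    finally show ?case using wron_a_vv[OF m y(1)] by simp
  qed
  ultimately have "((\<lambda>y. - c2 * (vB m y * W m)) \<longlongrightarrow> 0 * w0 m) (at_right 0)"
    by (rule Lim_transform_eventually)
  moreover have "((\<lambda>y. - c2 * (vB m y * W m)) \<longlongrightarrow> - c2 * (jost m * W m)) (at_right 0)"
    by (intro tendsto_intros vB_lim0[OF m])
  ultimately have "- c2 * (jost m * W m) = 0 * w0 m"
    using tendsto_unique[OF trivial_limit_at_right_real] by blast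
  then have "c2 = 0" using w0_nz[OF m] by (simp add: w0_def)
  then show ?thesis using f_eq(1)[OF x] w0_nz[OF m] by simp
qed

text \<open>The difference solves the homogeneous equation a.e. and inherits the boundary condition.
  The equality holds at every x > 0, since the domain of \<open>Hm\<close> consists of
  differentiable representatives.\<close>

lemma Hm_injective:
  assumes m: "m \<in> S" and H: "Hm Q m f1 h1" "Hm Q m f2 h2"
    and eq: "ae_eq (\<lambda>x. h1 x - (-1) * f1 x) (\<lambda>x. h2 x - (-1) * f2 x)" and x: "x > 0"
  shows "f1 x = f2 x"
proof -
  obtain f1' f1'' where 1: "L2 f1" "AC1_data f1 f1' f1''"
      "AE x in lborel. 0 < x \<longrightarrow> h1 x = - f1'' x + ((m\<^sup>2 - 1/4) / (of_real x)\<^sup>2) * f1 x + Q x * f1 x"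
      "((\<lambda>x. pw m x * f1' x - pw' m x * f1 x) \<longlongrightarrow> 0) (at_right 0)"
    using H(1) unfolding Hm_def by blast
  obtain f2' f2'' where 2: "L2 f2" "AC1_data f2 f2' f2''"
      "AE x in lborel. 0 < x \<longrightarrow> h2 x = - f2'' x + ((m\<^sup>2 - 1/4) / (of_real x)\<^sup>2) * f2 x + Q x * f2 x"
      "((\<lambda>x. pw m x * f2' x - pw' m x * f2 x) \<longlongrightarrow> 0) (at_right 0)"
    using H(2) unfolding Hm_def by blast
  have ac2: "ac f' f''" if "AC1_data f f' f''" for f f' f''
    using that by (intro acI) (auto simp: AC1_data_def loc_int_def)
  have ac1: "ac f f'" if "AC1_data f f' f''" for f f' f''
    using that ac_continuous[OF ac2[OF that]] by (intro ac_C1) (auto simp: AC1_data_def)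
  have "f1 x - f2 x = 0"
  proof (rule homogeneous_trivial[OF m L2_diff[OF 1(1) 2(1)] ac_diff[OF ac1[OF 1(2)] ac1[OF 2(2)]] ac_diff[OF ac2[OF 1(2)] ac2[OF 2(2)]] _ _ x])
    show "AE x in lborel. 0 < x \<longrightarrow> f1'' x - f2'' x = (V m x + R m x) * (f1 x - f2 x)"
      using 1(3) 2(3) eq unfolding ae_eq_def
    proof eventually_elim
      case (elim x)
      show ?case
      proof
        assume x: "0 < x"
        define P where "P = (m\<^sup>2 - 1/4) / (complex_of_real x)\<^sup>2"
        have "h1 x = - f1'' x + P * f1 x + Q x * f1 x" "h2 x = - f2'' x + P * f2 x + Q x * f2 x"
          "h1 x + f1 x = h2 x + f2 x"
          using elim x by (simp_all add: P_def)
        then show "f1'' x - f2'' x = (V m x + R m x) * (f1 x - f2 x)"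
          unfolding total[OF m x] P_def[symmetric] by algebra
      qed
    qed
    have "((\<lambda>x. (pw m x * f1' x - pw' m x * f1 x) - (pw m x * f2' x - pw' m x * f2 x)) \<longlongrightarrow> 0 - 0) (at_right 0)"
      by (intro tendsto_diff 1 2)
    then show "((\<lambda>x. pw m x * (f1' x - f2' x) - pw' m x * (f1 x - f2 x)) \<longlongrightarrow> 0) (at_right 0)"
      by (simp add: algebra_simps)
  qed
  then show ?thesis by simp
qed

lemma Hm_eq_rsol:
  assumes m: "m \<in> S" and g: "L2 g" and H: "Hm Q m f h" and eq: "ae_eq (\<lambda>x. h x - (-1) * f x) g" and x: "x > 0"
  shows "f x = rsol m g x"
proof (rule Hm_injective[OF m H rsol_Hm[OF m g] _ x])
  show "ae_eq (\<lambda>x. h x - (-1) * f x) (\<lambda>x. (g x + (-1) * rsol m g x) - (-1) * rsol m g x)"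
    using eq by (simp add: ae_eq_def)
qed

theorem in_resolvent_Hm:
  assumes m: "m \<in> S" shows "in_resolvent (Hm Q m) (-1)"
  unfolding in_resolvent_def
proof (intro conjI allI impI exI)
  fix g assume "L2 g"
  then show "Hm Q m (rsol m g) (\<lambda>x. g x + (-1) * rsol m g x)" by (rule rsol_Hm[OF m])
next
  fix f1 h1 f2 h2 assume "Hm Q m f1 h1" "Hm Q m f2 h2" "ae_eq (\<lambda>x. h1 x - (-1) * f1 x) (\<lambda>x. h2 x - (-1) * f2 x)"
  from Hm_injective[OF m this] show "ae_eq f1 f2" by (auto simp: ae_eq_def)
next
  fix f h assume H: "Hm Q m f h"
  let ?g = "\<lambda>x. h x - (-1) * f x"
  have L: "L2 f" "L2 h" using H by (auto simp: Hm_def)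
  have g: "L2 ?g" by (intro L2_diff L2_cmult L)
  have "f x = rsol m ?g x" if "x > 0" for x
    by (rule Hm_eq_rsol[OF m g H _ that]) (simp add: ae_eq_def)
  then have "L2norm f = L2norm (rsol m ?g)"
    by (intro L2norm_cong_AE L rsol_L2[OF m g]) (auto simp: ae_eq_def)
  then show "L2norm f \<le> K\<^sup>2 / norm (w0 m) * Cs * L2norm ?g"
    using rsol_L2(2)[OF m g] by simp
qed

lemma ip_resolv:
  assumes m: "m \<in> S" and "L2 f" and g: "L2 g"
  shows "ip f (resolv (Hm Q m) (-1) g) = ip f (rsol m g)"
proof -
  have H: "Hm Q m (resolv (Hm Q m) (-1) g) (\<lambda>x. g x + (-1) * resolv (Hm Q m) (-1) g x)"
    unfolding resolv_def by (rule someI[where P="\<lambda>f. Hm Q m f (\<lambda>x. g x + (-1) * f x)"], rule rsol_Hm[OF m g])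
  have "resolv (Hm Q m) (-1) g x = rsol m g x" if "x > 0" for x
    by (rule Hm_eq_rsol[OF m g H _ that]) (simp add: ae_eq_def)
  moreover have "L2 (resolv (Hm Q m) (-1) g)" using H by (simp add: Hm_def)
  ultimately show ?thesis
    by (intro ip_cong_AE assms rsol_L2[OF m g]) (auto simp: ae_eq_def)
qed

lemma reg_Gk: "reg S (\<lambda>m. Gk m x y)"
  unfolding Gk_def using uu_reg vv_reg
  by (cases "0 < y"; cases "y \<le> x") (simp_all add: reg_mult reg_const)

lemma reg_Top: assumes "L2 g" "x > 0" shows "reg S (\<lambda>m. Top m g x)"
  unfolding Top_def
proof (rule reg_minus, rule reg_integral[where g="\<lambda>y. K\<^sup>2 * (Kk x y * norm (ext0 g y))"])
  show "integrable lborel (\<lambda>y. K\<^sup>2 * (Kk x y * norm (ext0 g y)))"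
    by (intro integrable_mult_right Kk_g_int assms)
  show "norm (Gk m x y * ext0 g y) \<le> K\<^sup>2 * (Kk x y * norm (ext0 g y))" if "m \<in> S" for m y
    using mult_right_mono[OF Gk_bound[OF that assms(2)], of "norm (ext0 g y)" y] by (simp add: norm_mult mult.assoc)
qed (use Gk_int(1)[OF _ assms(2,1)] in \<open>auto intro: reg_mult reg_Gk\<close>)

text \<open>Dominated integration of \<open>Top\<close>, first in y and then in x, followed by
  division by the regular, nonvanishing \<open>w0\<close>; \<open>resolv\<close> enters only through
  uniqueness of the solution.\<close>

lemma reg_ip:
  assumes f: "L2 f" and g: "L2 g"
  shows "reg S (\<lambda>m. ip f (resolv (Hm Q m) (-1) g))"
proof (rule reg_cong)
  have m0: "\<exists>M. (\<lambda>x. cnj (ext0 f x)) \<in> borel_measurable borel"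
    using borel_measurable_continuous_onI[OF continuous_on_cnj[OF continuous_on_id]] measurable_compose[OF L2_meas[OF f], of cnj borel]
    by auto
  have "reg S (\<lambda>m. LINT x|lborel. cnj (ext0 f x) * ext0 (Top m g) x)"
  proof (rule reg_integral[where g="\<lambda>x. K\<^sup>2 * (norm (ext0 f x) * KG g x)"])
    show "reg S (\<lambda>m. cnj (ext0 f x) * ext0 (Top m g) x)" for x
      using reg_Top[OF g, of x] by (cases "x > 0") (auto intro: reg_mult)
    show "integrable lborel (\<lambda>x. K\<^sup>2 * (norm (ext0 f x) * KG g x))"
      by (intro integrable_mult_right KG_f_int f g)
    show "norm (cnj (ext0 f x) * ext0 (Top m g) x) \<le> K\<^sup>2 * (norm (ext0 f x) * KG g x)" if "m \<in> S" for m x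
      using mult_left_mono[OF Gk_int(2)[OF that _ g, of x], of "norm (ext0 f x)"]
      by (cases "x > 0") (auto simp: norm_mult ac_simps)
    show "(\<lambda>x. cnj (ext0 f x) * ext0 (Top m g) x) \<in> borel_measurable lborel" if "m \<in> S" for m
    proof -
      have eq: "ext0 (Top m g) = (\<lambda>x. ext0 (rsol m g) x * w0 m)"
        using rsol_Top[OF that _ g] w0_nz[OF that] by (auto simp: ext0_def fun_eq_iff)
      show ?thesis unfolding eq using m0 rsol_meas[OF that g] by simp
    qed
  qed
  then show "reg S (\<lambda>m. (LINT x|lborel. cnj (ext0 f x) * ext0 (Top m g) x) / w0 m)"
    unfolding w0_def by (intro reg_divide reg_mult reg_jost regW) (use w0_nz in \<open>auto simp: w0_def\<close>)
  show "(LINT x|lborel. cnj (ext0 f x) * ext0 (Top m g) x) / w0 m = ip f (resolv (Hm Q m) (-1) g)" if "m \<in> S" for m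
  proof -
    have "ip f (rsol m g) = (LINT x|lborel. (cnj (ext0 f x) * ext0 (Top m g) x) / w0 m)"
      unfolding ip_def set_lebesgue_integral_def
      by (intro Bochner_Integration.integral_cong) (auto simp: ext0_def indicator_def rsol_Top[OF that _ g])
    then show ?thesis using ip_resolv[OF that f g] by simp
  qed
qed

end

section \<open>The explicit unperturbed pair\<close>

text \<open>This is cosh (m z).\<close>

definition chm :: "complex \<Rightarrow> complex \<Rightarrow> complex" where
  "chm m z = (exp (m * z) + exp (- (m * z))) / 2"

text \<open>This is sinh (m z) / m with its limit z at m = 0, hence entire in
  \<open>m\<close>.\<close>

definition shm :: "complex \<Rightarrow> complex \<Rightarrow> complex" where
  "shm m z = (if m = 0 then z else (exp (m * z) - exp (- (m * z))) / (2 * m))"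

lemma chm_0 [simp]: "chm m 0 = 1" and shm_0 [simp]: "shm m 0 = 0"
  by (auto simp: chm_def shm_def)

lemma chm_deriv: "(chm m has_field_derivative m\<^sup>2 * shm m z) (at z)"
  unfolding chm_def shm_def
  by (auto intro!: derivative_eq_intros simp: power2_eq_square field_simps)

lemma shm_deriv: "(shm m has_field_derivative chm m z) (at z)"
proof (cases "m = 0")
  case True
  then show ?thesis by (auto simp: chm_def shm_def[abs_def] intro!: derivative_eq_intros)
next
  case False
  then show ?thesis unfolding chm_def shm_def
    by (auto intro!: derivative_eq_intros simp: field_simps)
qed

lemma chm_shm_exp: "chm m z + m * shm m z = exp (m * z)"
  by (auto simp: chm_def shm_def field_simps)

lemma chm_shm_identity: "(chm m z)\<^sup>2 - m\<^sup>2 * (shm m z)\<^sup>2 = 1"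
proof -
  have "(chm m z)\<^sup>2 - m\<^sup>2 * (shm m z)\<^sup>2 = (chm m z + m * shm m z) * (chm m z - m * shm m z)"
    by (simp add: power2_eq_square algebra_simps)
  also have "chm m z - m * shm m z = exp (- (m * z))" by (auto simp: chm_def shm_def field_simps)
  finally show ?thesis by (simp add: chm_shm_exp flip: exp_add)
qed

lemma norm_exp_mult_real: "norm (exp (m * complex_of_real t)) \<le> exp (\<bar>Re m\<bar> * \<bar>t\<bar>)"
  by (simp add: norm_exp_eq_Re flip: abs_mult)

lemma chm_bound: "norm (chm m (of_real t)) \<le> exp (\<bar>Re m\<bar> * \<bar>t\<bar>)"
proof -
  have "norm (exp (m * of_real t) + exp (- (m * of_real t))) \<le> exp (\<bar>Re m\<bar> * \<bar>t\<bar>) + exp (\<bar>Re m\<bar> * \<bar>t\<bar>)"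
    using norm_exp_mult_real[of m t] norm_exp_mult_real[of m "-t"]
    by (intro order.trans[OF norm_triangle_ineq] add_mono) auto
  then show ?thesis by (simp add: chm_def norm_divide)
qed

lemma shm_bound_nonzero:
  assumes "m \<noteq> 0" shows "norm (shm m (of_real t)) \<le> (1 / norm m) * exp (\<bar>Re m\<bar> * \<bar>t\<bar>)"
proof -
  have "norm (exp (m * of_real t) - exp (- (m * of_real t))) \<le> exp (\<bar>Re m\<bar> * \<bar>t\<bar>) + exp (\<bar>Re m\<bar> * \<bar>t\<bar>)"
    using norm_exp_mult_real[of m t] norm_exp_mult_real[of m "-t"]
    by (intro order.trans[OF norm_triangle_ineq4] add_mono) auto
  then show ?thesis using assms by (simp add: shm_def norm_divide norm_mult field_simps)
qed

text \<open>Mean value inequality with derivative \<open>chm\<close>. Unlike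
  \<open>shm_bound_nonzero\<close> it is uniform as \<open>m\<close> tends to 0; the price is the
  factor |t|, a logarithm once t = ln x.\<close>

lemma shm_bound: "norm (shm m (of_real t)) \<le> \<bar>t\<bar> * exp (\<bar>Re m\<bar> * \<bar>t\<bar>)"
proof -
  have "norm (shm m (of_real t) - shm m 0) \<le> exp (\<bar>Re m\<bar> * \<bar>t\<bar>) * norm (of_real t - (0::complex))"
  proof (rule field_differentiable_bound[where S="closed_segment 0 (of_real t)" and f'="chm m"])
    fix z :: complex assume "z \<in> closed_segment 0 (of_real t)"
    then obtain r where r: "0 \<le> r" "r \<le> 1" "z = of_real (r * t)"
      by (auto simp: in_segment scaleR_conv_of_real)
    have "\<bar>r * t\<bar> \<le> 1 * \<bar>t\<bar>" unfolding abs_mult using r by (intro mult_right_mono) auto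
    then have "\<bar>Re m\<bar> * \<bar>r * t\<bar> \<le> \<bar>Re m\<bar> * \<bar>t\<bar>" by (intro mult_left_mono) auto
    then show "norm (chm m z) \<le> exp (\<bar>Re m\<bar> * \<bar>t\<bar>)"
      unfolding r(3) using chm_bound[of m "r * t"] by (smt (verit) exp_le_cancel_iff)
    show "(shm m has_field_derivative chm m z) (at z within closed_segment 0 (of_real t))"
      by (rule has_field_derivative_at_within[OF shm_deriv])
  qed auto
  then show ?thesis by (simp add: mult.commute)
qed

lemma reg_chm: "reg S (\<lambda>m. chm m z)"
  unfolding chm_def by (intro reg_holomorphic holomorphic_intros) auto

text \<open>The singularity at m = 0 is removable: there \<open>shm\<close> is the difference
  quotient of sinh (m z) with respect to \<open>m\<close>, completed by the derivative.\<close>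

lemma reg_shm: "reg S (\<lambda>m. shm m z)"
proof (rule reg_holomorphic)
  let ?f = "\<lambda>m. (exp (m * z) - exp (- (m * z))) / 2"
  have "?f holomorphic_on UNIV" by (intro holomorphic_intros) auto
  then have "(\<lambda>w. if w = 0 then deriv ?f 0 else (?f w - ?f 0) / (w - 0)) holomorphic_on UNIV"
    by (rule pole_lemma) auto
  moreover have "deriv ?f 0 = z"
    by (rule DERIV_imp_deriv) (auto intro!: derivative_eq_intros)
  ultimately show "(\<lambda>m. shm m z) holomorphic_on UNIV"
    by (simp add: shm_def if_distrib cong: if_cong)
qed

definition lnc :: "real \<Rightarrow> complex" where "lnc x = of_real (ln x)"

lemma Re_lnc [simp]: "Re (lnc x) = ln x" by (simp add: lnc_def)

lemma exp_lnc: "x > 0 \<Longrightarrow> exp (lnc x) = of_real x"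
  by (simp add: lnc_def exp_of_real)

lemma lnc_chain:
  assumes "\<And>z. (F has_field_derivative f z) (at z)" "x > 0"
  shows "((\<lambda>x. F (lnc x)) has_vector_derivative f (lnc x) / of_real x) (at x)"
proof -
  have "(lnc has_vector_derivative of_real (1/x)) (at x)"
    unfolding lnc_def using assms(2) by (intro has_vector_derivative_of_real DERIV_ln_divide)
  from field_vector_diff_chain_at[OF this assms(1)] show ?thesis by (simp add: comp_def)
qed

lemma lnc_cont: "continuous_on UNIV F \<Longrightarrow> continuous_on {0<..} (\<lambda>x. F (lnc x))"
  unfolding lnc_def
  by (rule continuous_on_compose2[of UNIV F]) (auto intro!: continuous_intros)

text \<open>\<open>fc\<close> and \<open>fs\<close> are the solutions of \<open>y'' = (m\<^sup>2 - 1/4) x\<^sup>-\<^sup>2 y\<close>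
  with \<open>fc m 1 = 1\<close>, \<open>fs m 1 = 0\<close>, entire in \<open>m\<close>; thus \<open>m = 0\<close> is not exceptional.\<close>

definition "fc m x = exp (lnc x / 2) * chm m (lnc x)"
definition "fs m x = exp (lnc x / 2) * shm m (lnc x)"
definition "fc' m x = exp (- (lnc x / 2)) * (chm m (lnc x) / 2 + m\<^sup>2 * shm m (lnc x))"
definition "fs' m x = exp (- (lnc x / 2)) * (shm m (lnc x) / 2 + chm m (lnc x))"

lemma exp_half: "x > 0 \<Longrightarrow> exp (lnc x / 2) / of_real x = exp (- (lnc x / 2))"
  by (simp add: exp_minus field_simps flip: exp_lnc exp_add)

lemma exp_minus_half: "x > 0 \<Longrightarrow> exp (- (lnc x / 2)) / of_real x = exp (lnc x / 2) / (of_real x)\<^sup>2"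
  by (simp add: exp_half[symmetric] power2_eq_square)

lemma ac_fc: "ac (fc m) (fc' m)" "ac (fc' m) (\<lambda>x. (m\<^sup>2 - 1/4) / (of_real x)\<^sup>2 * fc m x)"
proof -
  have c1: "continuous_on A (chm m)" "continuous_on A (shm m)" for A
    by (auto intro!: continuous_at_imp_continuous_on DERIV_isCont[OF chm_deriv] DERIV_isCont[OF shm_deriv])
  show "ac (fc m) (fc' m)"
  proof (rule ac_C1)
    fix x :: real assume x: "x > 0"
    have "((\<lambda>x. (\<lambda>z. exp (z/2) * chm m z) (lnc x)) has_vector_derivative (exp (lnc x/2) * (chm m (lnc x) / 2 + m\<^sup>2 * shm m (lnc x))) / of_real x) (at x)"
      by (rule lnc_chain[OF _ x]) (auto intro!: derivative_eq_intros chm_deriv simp: algebra_simps)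
    then show "(fc m has_vector_derivative fc' m x) (at x)"
      unfolding fc_def[abs_def] fc'_def exp_half[OF x, symmetric] by simp
  next
    show "continuous_on {0<..} (fc' m)"
      unfolding fc'_def by (intro lnc_cont[where F="\<lambda>z. exp (- (z / 2)) * (chm m z / 2 + m\<^sup>2 * shm m z)"] continuous_intros c1) auto
  qed
  show "ac (fc' m) (\<lambda>x. (m\<^sup>2 - 1/4) / (of_real x)\<^sup>2 * fc m x)"
  proof (rule ac_C1)
    fix x :: real assume x: "x > 0"
    have "((\<lambda>x. (\<lambda>z. exp (- (z/2)) * (chm m z / 2 + m\<^sup>2 * shm m z)) (lnc x)) has_vector_derivative (exp (- (lnc x/2)) * ((m\<^sup>2 - 1/4) * chm m (lnc x))) / of_real x) (at x)"
      by (rule lnc_chain[OF _ x]) (auto intro!: derivative_eq_intros chm_deriv shm_deriv simp: field_simps power2_eq_square)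
    then have d: "(fc' m has_vector_derivative (exp (- (lnc x/2)) * ((m\<^sup>2 - 1/4) * chm m (lnc x))) / of_real x) (at x)" unfolding fc'_def[abs_def] .
    have "(exp (- (lnc x/2)) * ((m\<^sup>2 - 1/4) * chm m (lnc x))) / of_real x = (exp (- (lnc x/2)) / of_real x) * ((m\<^sup>2 - 1/4) * chm m (lnc x))" by simp
    also have "\<dots> = (m\<^sup>2 - 1/4) / (of_real x)\<^sup>2 * fc m x"
      unfolding exp_minus_half[OF x] by (simp add: fc_def)
    finally show "(fc' m has_vector_derivative (m\<^sup>2 - 1/4) / (of_real x)\<^sup>2 * fc m x) (at x)"
      using d by (simp only:)
  next
    show "continuous_on {0<..} (\<lambda>x. (m\<^sup>2 - 1/4) / (of_real x)\<^sup>2 * fc m x)"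
      unfolding fc_def by (intro continuous_intros lnc_cont[where F="\<lambda>z. exp (z / 2) * chm m z"] c1) auto
  qed
qed

lemma ac_fs: "ac (fs m) (fs' m)" "ac (fs' m) (\<lambda>x. (m\<^sup>2 - 1/4) / (of_real x)\<^sup>2 * fs m x)"
proof -
  have c1: "continuous_on A (chm m)" "continuous_on A (shm m)" for A
    by (auto intro!: continuous_at_imp_continuous_on DERIV_isCont[OF chm_deriv] DERIV_isCont[OF shm_deriv])
  show "ac (fs m) (fs' m)"
  proof (rule ac_C1)
    fix x :: real assume x: "x > 0"
    have "((\<lambda>x. (\<lambda>z. exp (z/2) * shm m z) (lnc x)) has_vector_derivative (exp (lnc x/2) * (shm m (lnc x) / 2 + chm m (lnc x))) / of_real x) (at x)"
      by (rule lnc_chain[OF _ x]) (auto intro!: derivative_eq_intros shm_deriv simp: algebra_simps)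
    then show "(fs m has_vector_derivative fs' m x) (at x)"
      unfolding fs_def[abs_def] fs'_def exp_half[OF x, symmetric] by simp
  next
    show "continuous_on {0<..} (fs' m)"
      unfolding fs'_def by (intro lnc_cont[where F="\<lambda>z. exp (- (z / 2)) * (shm m z / 2 + chm m z)"] continuous_intros c1) auto
  qed
  show "ac (fs' m) (\<lambda>x. (m\<^sup>2 - 1/4) / (of_real x)\<^sup>2 * fs m x)"
  proof (rule ac_C1)
    fix x :: real assume x: "x > 0"
    have "((\<lambda>x. (\<lambda>z. exp (- (z/2)) * (shm m z / 2 + chm m z)) (lnc x)) has_vector_derivative (exp (- (lnc x/2)) * ((m\<^sup>2 - 1/4) * shm m (lnc x))) / of_real x) (at x)"
      by (rule lnc_chain[OF _ x]) (auto intro!: derivative_eq_intros chm_deriv shm_deriv simp: field_simps power2_eq_square)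
    then have d: "(fs' m has_vector_derivative (exp (- (lnc x/2)) * ((m\<^sup>2 - 1/4) * shm m (lnc x))) / of_real x) (at x)" unfolding fs'_def[abs_def] .
    have "(exp (- (lnc x/2)) * ((m\<^sup>2 - 1/4) * shm m (lnc x))) / of_real x = (exp (- (lnc x/2)) / of_real x) * ((m\<^sup>2 - 1/4) * shm m (lnc x))" by simp
    also have "\<dots> = (m\<^sup>2 - 1/4) / (of_real x)\<^sup>2 * fs m x"
      unfolding exp_minus_half[OF x] by (simp add: fs_def)
    finally show "(fs' m has_vector_derivative (m\<^sup>2 - 1/4) / (of_real x)\<^sup>2 * fs m x) (at x)"
      using d by (simp only:)
  next
    show "continuous_on {0<..} (\<lambda>x. (m\<^sup>2 - 1/4) / (of_real x)\<^sup>2 * fs m x)"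
      unfolding fs_def by (intro continuous_intros lnc_cont[where F="\<lambda>z. exp (z / 2) * shm m z"] c1) auto
  qed
qed

lemma fc_fs_wron: "fc m x * fs' m x - fc' m x * fs m x = 1"
proof -
  have e: "exp (lnc x / 2) * exp (- (lnc x / 2)) = 1" by (simp flip: exp_add)
  have "fc m x * fs' m x - fc' m x * fs m x = exp (lnc x / 2) * exp (- (lnc x / 2)) *
     (chm m (lnc x) * (shm m (lnc x) / 2 + chm m (lnc x)) - (chm m (lnc x) / 2 + m\<^sup>2 * shm m (lnc x)) * shm m (lnc x))"
    unfolding fc_def fs_def fc'_def fs'_def by (simp add: algebra_simps)
  also have "\<dots> = (chm m (lnc x))\<^sup>2 - m\<^sup>2 * (shm m (lnc x))\<^sup>2" unfolding e by (simp add: power2_eq_square algebra_simps)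
  finally show ?thesis by (simp add: chm_shm_identity)
qed

lemma fc_fs_pw: "x > 0 \<Longrightarrow> fc m x + m * fs m x = exp ((1/2 + m) * lnc x)"
  using chm_shm_exp[of m "lnc x"] by (simp add: fc_def fs_def algebra_simps exp_add flip: chm_shm_exp)

lemma fc_fs_pw_pw: "x > 0 \<Longrightarrow> fc m x + m * fs m x = pw m x"
  by (simp add: fc_fs_pw pw_def powr_def lnc_def Ln_of_real)

lemma fc_fs_pw': assumes "x > 0" shows "fc' m x + m * fs' m x = pw' m x"
proof -
  have "fc' m x + m * fs' m x = exp (- (lnc x / 2)) * ((1/2 + m) * (chm m (lnc x) + m * shm m (lnc x)))"
    unfolding fc'_def fs'_def by (simp add: power2_eq_square algebra_simps)
  also have "\<dots> = (1/2 + m) * exp ((m - 1/2) * lnc x)"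
    unfolding chm_shm_exp by (simp add: algebra_simps flip: exp_add)
  finally show ?thesis using assms by (simp add: pw'_def powr_def lnc_def Ln_of_real)
qed

text \<open>\<open>fa m\<close> extends \<open>x\<^sup>1\<^sup>/\<^sup>2\<^sup>+\<^sup>m\<close> from \<open>]0,1]\<close> and \<open>fb m\<close> extends \<open>e\<^sup>1\<^sup>-\<^sup>x\<close> from \<open>]1,\<infinity>[\<close>,
  both continuously differentiable at 1.\<close>

definition "fa m x = (if x \<le> 1 then fc m x + m * fs m x
  else (3/2 + m) / 2 * of_real (exp (x - 1)) + (1/2 - m) / 2 * of_real (exp (1 - x)))"
definition "fa' m x = (if x \<le> 1 then fc' m x + m * fs' m x
  else (3/2 + m) / 2 * of_real (exp (x - 1)) - (1/2 - m) / 2 * of_real (exp (1 - x)))"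
definition "fb m x = (if x \<le> 1 then fc m x - 3/2 * fs m x else of_real (exp (1 - x)))"
definition "fb' m x = (if x \<le> 1 then fc' m x - 3/2 * fs' m x else - of_real (exp (1 - x)))"
text \<open>\<open>fV + fR\<close> is the potential of \<open>L + 1\<close> on the half-line. What
  \<open>fV\<close> lacks on either side of 1 goes into \<open>fR\<close>: the constant 1 near 0 and
  the inverse square near infinity, integrable against \<open>om\<close> there.\<close>

definition "fV m x = (if x \<le> 1 then (m\<^sup>2 - 1/4) / (of_real x)\<^sup>2 else (1::complex))"
definition "fR Q m x = (if x \<le> 1 then 1 else (m\<^sup>2 - 1/4) / (of_real x)\<^sup>2) + ext0 Q x"

text \<open>These values fix the constants above. \<open>fa\<close> has value 1 and slope 1/2 + m at
  1, so its coefficients of the growing and decaying exponential are half of 1 + (1/2 + m) and of 1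
  - (1/2 + m). \<open>fb\<close> has slope -1 = 1/2 - 3/2.\<close>

lemma fc_1: "fc m 1 = 1" "fs m 1 = 0" "fc' m 1 = 1/2" "fs' m 1 = 1"
  by (auto simp: fc_def fs_def fc'_def fs'_def lnc_def)

lemma ac_exp_minus: "ac (\<lambda>x. complex_of_real (exp (1 - x))) (\<lambda>x. - of_real (exp (1 - x)))"
  "ac (\<lambda>x. - complex_of_real (exp (1 - x))) (\<lambda>x. of_real (exp (1 - x)))"
  "ac (\<lambda>x. complex_of_real (exp (x - 1))) (\<lambda>x. of_real (exp (x - 1)))"
  by (rule ac_C1; auto intro!: derivative_eq_intros continuous_intros has_vector_derivative_eq_rhs[OF has_vector_derivative_of_real])+

lemma ac_fa: "ac (fa m) (fa' m)" "ac (fa' m) (\<lambda>x. fV m x * fa m x)"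
proof -
  have 1: "ac (\<lambda>x. (3/2 + m) / 2 * complex_of_real (exp (x - 1)) + (1/2 - m) / 2 * of_real (exp (1 - x)))
     (\<lambda>x. (3/2 + m) / 2 * of_real (exp (x - 1)) - (1/2 - m) / 2 * of_real (exp (1 - x)))"
    using ac_add[OF ac_cmult[OF ac_exp_minus(3), of "(3/2 + m) / 2"] ac_cmult[OF ac_exp_minus(1), of "(1/2 - m) / 2"]]
    by (simp only: mult_minus_right add_uminus_conv_diff)
  have 2: "ac (\<lambda>x. (3/2 + m) / 2 * complex_of_real (exp (x - 1)) - (1/2 - m) / 2 * of_real (exp (1 - x)))
     (\<lambda>x. (3/2 + m) / 2 * of_real (exp (x - 1)) + (1/2 - m) / 2 * of_real (exp (1 - x)))"
    using ac_add[OF ac_cmult[OF ac_exp_minus(3), of "(3/2 + m) / 2"] ac_cmult[OF ac_exp_minus(2), of "(1/2 - m) / 2"]]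
    by (simp only: mult_minus_right add_uminus_conv_diff)
  show "ac (fa m) (fa' m)"
    unfolding fa_def[abs_def] fa'_def[abs_def]
    by (intro ac_glue ac_add ac_fc ac_cmult ac_fs 1) (auto simp: fc_1 field_simps)
  have "ac (fa' m) (\<lambda>x. if x \<le> 1 then (m\<^sup>2 - 1/4) / (of_real x)\<^sup>2 * fc m x + m * ((m\<^sup>2 - 1/4) / (of_real x)\<^sup>2 * fs m x)
     else (3/2 + m) / 2 * of_real (exp (x - 1)) + (1/2 - m) / 2 * of_real (exp (1 - x)))"
    unfolding fa'_def[abs_def]
    by (intro ac_glue ac_add ac_fc ac_cmult ac_fs 2) (auto simp: fc_1 field_simps)
  then show "ac (fa' m) (\<lambda>x. fV m x * fa m x)"
    proof (rule ac_cong)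
    fix x :: real
    show "(if x \<le> 1 then (m\<^sup>2 - 1/4) / (of_real x)\<^sup>2 * fc m x + m * ((m\<^sup>2 - 1/4) / (of_real x)\<^sup>2 * fs m x)
     else (3/2 + m) / 2 * of_real (exp (x - 1)) + (1/2 - m) / 2 * of_real (exp (1 - x))) = fV m x * fa m x"
      unfolding fV_def fa_def by (cases "x \<le> 1") (simp_all only: if_True if_False distrib_left mult.left_commute mult_1)
  qed simp
qed

lemma ac_fb: "ac (fb m) (fb' m)" "ac (fb' m) (\<lambda>x. fV m x * fb m x)"
proof -
  show "ac (fb m) (fb' m)"
    unfolding fb_def[abs_def] fb'_def[abs_def]
    by (intro ac_glue ac_diff ac_fc ac_cmult ac_fs ac_exp_minus) (auto simp: fc_1 field_simps)
  have "ac (fb' m) (\<lambda>x. if x \<le> 1 then (m\<^sup>2 - 1/4) / (of_real x)\<^sup>2 * fc m x - 3/2 * ((m\<^sup>2 - 1/4) / (of_real x)\<^sup>2 * fs m x)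
     else of_real (exp (1 - x)))"
    unfolding fb'_def[abs_def]
    by (intro ac_glue ac_diff ac_fc ac_cmult ac_fs ac_exp_minus) (auto simp: fc_1 field_simps)
  then show "ac (fb' m) (\<lambda>x. fV m x * fb m x)"
    proof (rule ac_cong)
    fix x :: real
    show "(if x \<le> 1 then (m\<^sup>2 - 1/4) / (of_real x)\<^sup>2 * fc m x - 3/2 * ((m\<^sup>2 - 1/4) / (of_real x)\<^sup>2 * fs m x)
     else of_real (exp (1 - x))) = fV m x * fb m x"
      unfolding fV_def fb_def by (cases "x \<le> 1") (simp_all only: if_True if_False right_diff_distrib mult.left_commute mult_1)
  qed simp
qed

text \<open>Evaluated at 1 the Wronskian is -1 - (1/2 + m). Its modulus is at least 1/2 as long as
  \<open>Re m \<ge> -1\<close>.\<close>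

definition "fW m = - (3/2 + m :: complex)"

lemma fab_wron: "fa m x * fb' m x - fa' m x * fb m x = fW m"
proof (cases "x \<le> 1")
  case True
  have "(fc m x + m * fs m x) * (fc' m x - 3/2 * fs' m x) - (fc' m x + m * fs' m x) * (fc m x - 3/2 * fs m x)
     = - (3/2 + m) * (fc m x * fs' m x - fc' m x * fs m x)"
    by (simp add: field_simps)
  then show ?thesis using True by (simp add: fa_def fb_def fa'_def fb'_def fc_fs_wron fW_def)
next
  case False
  have "complex_of_real (exp (x - 1)) * of_real (exp (1 - x)) = 1" by (simp flip: of_real_mult exp_add)
  moreover have "((3/2 + m) / 2 * E + (1/2 - m) / 2 * F) * (- F) - ((3/2 + m) / 2 * E - (1/2 - m) / 2 * F) * F = - (3/2 + m) * (E * F)" for E F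
    by (simp add: field_simps)
  ultimately show ?thesis using False by (simp add: fa_def fb_def fa'_def fb'_def fW_def)
qed

text \<open>The logarithm is only needed near \<open>m = 0\<close>: \<open>\<sigma> = 1\<close> there, and \<open>\<sigma> = 0\<close> elsewhere.\<close>

definition ell :: "real \<Rightarrow> real \<Rightarrow> real" where "ell \<sigma> x = 1 + \<sigma> * \<bar>ln x\<bar>"
definition "fwa m x = (if x \<le> 1 then exp ((1/2 + Re m) * ln x) else exp (x - 1))"
text \<open>Near 0 \<open>fb\<close> contains in general both powers x^(1/2+m) and x^(1/2-m); the
  modulus of \<open>Re m\<close> selects the larger one.\<close>

definition "fwb \<sigma> m x = (if x \<le> 1 then exp ((1/2 - \<bar>Re m\<bar>) * ln x) * ell \<sigma> x else exp (1 - x))"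
text \<open>The exponents of \<open>fwa\<close> and \<open>fwb\<close> add up to 1 + Re m - |Re m|,
  which is at least 1 - \<eta> when \<open>Re m \<ge> -\<eta>/2\<close>.\<close>

definition "om \<eta> \<sigma> x = (if x \<le> 1 then exp ((1 - \<eta>) * ln x) * ell \<sigma> x else 1)"
definition "fRs M Q x = (if x \<le> 1 then 1 else (M\<^sup>2 + 1) / x\<^sup>2) + norm (ext0 Q x)" for M :: real
text \<open>The weight \<open>fwa\<close> in the worst case \<open>Re m = -\<eta>/2\<close>.\<close>

definition "fal \<eta> x = (if x \<le> 1 then exp ((1 - \<eta>) / 2 * ln x) else exp (x - 1))" for \<eta> x :: real
definition "fbe \<eta> \<sigma> x = (if x \<le> 1 then exp ((1 - \<eta>) / 2 * ln x) * ell \<sigma> x else exp (1 - x))"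
text \<open>The Schur weight. For x, y \<le> 1 it makes kernel times weight factor into
  \<open>fsc x\<close> and a bound in y alone, integrable by \<open>om_inner_int\<close>; beyond 1
  the kernel is exp (-|x - y|) and a constant weight suffices.\<close>

definition "fsc \<eta> x = (if x \<le> 1 then exp ((1 - \<eta>) / 2 * ln x) else 1)" for \<eta> x :: real

lemma ell_ge_1: "\<sigma> \<ge> 0 \<Longrightarrow> ell \<sigma> x \<ge> 1" by (simp add: ell_def)

lemma ell_antimono: "\<sigma> \<ge> 0 \<Longrightarrow> 0 < x \<Longrightarrow> x \<le> y \<Longrightarrow> y \<le> 1 \<Longrightarrow> ell \<sigma> y \<le> ell \<sigma> x"
  by (smt (verit) ell_def ln_le_cancel_iff ln_le_zero_iff mult_left_mono)

text \<open>The exponent exceeds -1 by 2 - \<eta> = 2d. Half of this margin absorbs the logarithm,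
  since t \<le> exp (d t) / d, and the other half leaves the integrable x^(d-1).\<close>

lemma om_inner_int: 
  assumes \<eta>: "\<eta> < 2" and \<sigma>: "\<sigma> \<ge> 0"
  shows "set_integrable lborel {0<..1} (\<lambda>x. exp ((1 - \<eta>) * ln x) * ell \<sigma> x)"
proof -
  define d where "d = (2 - \<eta>) / 2"
  have d: "d > 0" using \<eta> by (simp add: d_def)
  have "(\<lambda>x. x powr (d - 1)) integrable_on {0..1}"
    using has_integral_powr_from_0[of "d - 1" 1] d by (auto intro: has_integral_integrable)
  then have "(\<lambda>x. x powr (d - 1)) absolutely_integrable_on {0..1}"
    by (rule nonnegative_absolutely_integrable_1) auto
  then have "set_integrable lborel {0..1} (\<lambda>x. x powr (d - 1))"
    unfolding set_integrable_def by (subst (asm) integrable_completion) auto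
  then have i: "set_integrable lborel {0<..1} (\<lambda>x. (1 + \<sigma> / d) * x powr (d - 1))"
    by (intro set_integrable_mult_right) (auto elim!: set_integrable_subset)
  show ?thesis
  proof (rule set_integrable_boundI[OF i])
    show "(\<lambda>x. indicat_real {0<..1} x *\<^sub>R (exp ((1 - \<eta>) * ln x) * ell \<sigma> x)) \<in> borel_measurable borel"
      unfolding ell_def by measurable
    fix x :: real assume x: "x \<in> {0<..1}"
    define t where "t = - ln x"
    have t: "t \<ge> 0" using x by (simp add: t_def)
    have "d * t \<le> exp (d * t)" using exp_ge_add_one_self[of "d * t"] by linarith
    then have "t \<le> exp (d * t) / d" using d by (simp add: field_simps)
    then have "\<sigma> * t \<le> \<sigma> * (exp (d * t) / d)" using \<sigma> by (intro mult_left_mono) auto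
    moreover have "1 \<le> exp (d * t)" using d t by simp
    moreover have "(1 + \<sigma> / d) * exp (d * t) = exp (d * t) + \<sigma> * (exp (d * t) / d)" by (simp add: distrib_right)
    ultimately have "1 + \<sigma> * t \<le> (1 + \<sigma> / d) * exp (d * t)" by linarith
    then have "exp (- ((1 - \<eta>) * t)) * (1 + \<sigma> * t) \<le> exp (- ((1 - \<eta>) * t)) * ((1 + \<sigma> / d) * exp (d * t))"
      by (intro mult_left_mono) auto
    also have "\<dots> = (1 + \<sigma> / d) * exp (- ((1 - \<eta>) * t) + d * t)" by (simp only: exp_add ac_simps)
    also have "- ((1 - \<eta>) * t) + d * t = (d - 1) * ln x" by (simp add: t_def d_def field_simps)
    finally have "exp (- ((1 - \<eta>) * t)) * (1 + \<sigma> * t) \<le> (1 + \<sigma> / d) * exp ((d - 1) * ln x)" .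
    moreover have "exp ((1 - \<eta>) * ln x) * ell \<sigma> x = exp (- ((1 - \<eta>) * t)) * (1 + \<sigma> * t)"
      using x by (simp add: ell_def t_def)
    moreover have "0 \<le> exp ((1 - \<eta>) * ln x) * ell \<sigma> x" using ell_ge_1[OF \<sigma>, of x] by simp
    ultimately show "norm (exp ((1 - \<eta>) * ln x) * ell \<sigma> x) \<le> (1 + \<sigma> / d) * x powr (d - 1)"
      using x by (simp only: real_norm_def abs_of_nonneg powr_def) simp
  qed
qed

lemma int_inverse_square: "set_integrable lborel {1..} (\<lambda>x::real. c / x\<^sup>2)"
proof -
  have "(\<lambda>x. x powr (-2)) integrable_on {1::real..}"
    using has_integral_powr_to_inf[of "-2" 1] by (auto intro: has_integral_integrable)
  then have "(\<lambda>x. x powr (-2)) absolutely_integrable_on {1::real..}"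
    by (rule nonnegative_absolutely_integrable_1) auto
  then have "set_integrable lborel {1::real..} (\<lambda>x. x powr (-2))"
    unfolding set_integrable_def by (subst (asm) integrable_completion) auto
  then have "set_integrable lborel {1..} (\<lambda>x. c * x powr (-2))" by (rule set_integrable_mult_right)
  then show ?thesis
    by (subst set_integrable_cong[of lborel lborel "{1..}" "{1..}" _ "\<lambda>x. c * x powr (-2)"])
       (auto simp: powr_minus powr_numeral field_simps)
qed

text \<open>\<open>Sshm\<close> unites two regimes: \<open>\<sigma> = 0\<close> with
  \<open>C0\<close> of size 1/|m| away from m = 0, and \<open>\<sigma> = 1\<close>,
  \<open>C0 = 1\<close> around m = 0. \<open>S\<close> is bounded by \<open>M\<close> because the
  constants must be uniform in \<open>m\<close>.\<close>

locale bessel_setup =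
  fixes S :: "complex set" and \<eta> \<sigma> M C0 :: real and Q :: "real \<Rightarrow> complex"
  assumes \<eta>: "0 \<le> \<eta>" "\<eta> < 2" and \<sigma>: "0 \<le> \<sigma>" and C0: "C0 \<ge> 0" and M0: "M \<ge> 0"
    and SM: "\<And>m. m \<in> S \<Longrightarrow> norm m \<le> M" and S\<eta>: "\<And>m. m \<in> S \<Longrightarrow> - (\<eta> / 2) \<le> Re m"
    and Sshm: "\<And>m t. m \<in> S \<Longrightarrow> norm (shm m (of_real t)) \<le> C0 * (1 + \<sigma> * \<bar>t\<bar>) * exp (\<bar>Re m\<bar> * \<bar>t\<bar>)"
    and Qm: "ext0 Q \<in> borel_measurable borel"
    and Qi: "set_integrable lborel {0<..} (\<lambda>x. om \<eta> \<sigma> x * norm (Q x))"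
begin

text \<open>One constant for all bounds: \<open>fa\<close> needs 1 + M, \<open>fb\<close> needs 1 +
  3/2 C0, and at least 2 is needed since the Wronskian is only known to be at least 1/2.\<close>

definition CC :: real where "CC = 3 + M + 2 * C0"

lemma fa_bound:
  assumes m: "m \<in> S" and x: "x > 0" shows "norm (fa m x) \<le> CC * fwa m x"
proof (cases "x \<le> 1")
  case True
  have "norm (fa m x) = fwa m x"
    using True x by (simp add: fa_def fc_fs_pw fwa_def norm_exp_eq_Re lnc_def)
  moreover have "1 * fwa m x \<le> CC * fwa m x"
    using C0 M0 by (intro mult_right_mono) (auto simp: CC_def fwa_def)
  ultimately show ?thesis by simp
next
  case False
  have e: "exp (1 - x) \<le> exp (x - 1)" using False by simp
  have "norm (fa m x) \<le> norm ((3/2 + m) / 2) * exp (x - 1) + norm ((1/2 - m) / 2) * exp (1 - x)"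
    using False by (simp add: fa_def) (rule order.trans[OF norm_triangle_ineq], simp add: norm_mult)
  also have "\<dots> \<le> ((3/2 + M) / 2) * exp (x - 1) + ((1/2 + M) / 2) * exp (x - 1)"
    using SM[OF m] M0 e norm_triangle_ineq[of "3/2" m] norm_triangle_ineq4[of "1/2" m]
    by (intro add_mono mult_mono) (auto simp: norm_divide)
  also have "\<dots> \<le> CC * exp (x - 1)" 
  proof -
    have "((3/2 + M) / 2) * exp (x - 1) + ((1/2 + M) / 2) * exp (x - 1) = (1 + M) * exp (x - 1)" by (simp add: field_simps)
    also have "\<dots> \<le> CC * exp (x - 1)" using C0 M0 by (intro mult_right_mono) (auto simp: CC_def)
    finally show ?thesis .
  qed
  finally show ?thesis using False by (simp add: fwa_def)
qed

lemma fb_bound: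
  assumes m: "m \<in> S" and x: "x > 0" shows "norm (fb m x) \<le> CC * fwb \<sigma> m x"
proof (cases "x \<le> 1")
  case True
  let ?E = "exp (\<bar>Re m\<bar> * \<bar>ln x\<bar>)"
  have e: "norm (exp (lnc x / 2)) = exp (ln x / 2)" by (simp add: lnc_def norm_exp_eq_Re)
  have "norm (fb m x) \<le> exp (ln x / 2) * norm (chm m (lnc x)) + 3/2 * (exp (ln x / 2) * norm (shm m (lnc x)))"
    using True by (simp add: fb_def) (rule order.trans[OF norm_triangle_ineq4], simp add: fc_def fs_def norm_mult e)
  also have "\<dots> \<le> exp (ln x / 2) * (ell \<sigma> x * ?E) + 3/2 * (exp (ln x / 2) * (C0 * ell \<sigma> x * ?E))"
  proof (intro add_mono mult_left_mono)
    have "norm (chm m (lnc x)) \<le> 1 * ?E" using chm_bound[of m "ln x"] by (simp add: lnc_def)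
    also have "1 * ?E \<le> ell \<sigma> x * ?E" by (intro mult_right_mono ell_ge_1 \<sigma>) auto
    finally show "norm (chm m (lnc x)) \<le> ell \<sigma> x * ?E" .
    show "norm (shm m (lnc x)) \<le> C0 * ell \<sigma> x * ?E" using Sshm[OF m, of "ln x"] by (simp add: lnc_def ell_def)
  qed auto
  also have "\<dots> = (1 + 3/2 * C0) * (exp (ln x / 2) * ?E * ell \<sigma> x)" by (simp add: algebra_simps)
  also have "exp (ln x / 2) * ?E = exp ((1/2 - \<bar>Re m\<bar>) * ln x)"
    using True x by (simp add: algebra_simps flip: exp_add)
  also have "(1 + 3/2 * C0) * (exp ((1/2 - \<bar>Re m\<bar>) * ln x) * ell \<sigma> x) \<le> CC * (exp ((1/2 - \<bar>Re m\<bar>) * ln x) * ell \<sigma> x)"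
    using C0 M0 ell_ge_1[OF \<sigma>, of x] by (intro mult_right_mono) (auto simp: CC_def)
  finally show ?thesis using True by (simp add: fwb_def)
next
  case False
  have "1 * exp (1 - x) \<le> CC * exp (1 - x)" using C0 M0 by (intro mult_right_mono) (auto simp: CC_def)
  then show ?thesis using False by (simp add: fb_def fwb_def)
qed

lemma fa'_bound:
  assumes m: "m \<in> S" and x: "x \<ge> 1" shows "norm (fa' m x) \<le> CC * fwa m x"
proof -
  have e: "exp (1 - x) \<le> exp (x - 1)" using x by simp
  have "fa' m x = (3/2 + m) / 2 * of_real (exp (x - 1)) - (1/2 - m) / 2 * of_real (exp (1 - x))"
    using x by (cases "x = 1") (auto simp: fa'_def fc_1 field_simps)
  then have "norm (fa' m x) \<le> norm ((3/2 + m) / 2) * exp (x - 1) + norm ((1/2 - m) / 2) * exp (1 - x)"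
    by simp (rule order.trans[OF norm_triangle_ineq4], simp add: norm_mult)
  also have "\<dots> \<le> ((3/2 + M) / 2) * exp (x - 1) + ((1/2 + M) / 2) * exp (x - 1)"
    using SM[OF m] M0 e norm_triangle_ineq[of "3/2" m] norm_triangle_ineq4[of "1/2" m]
    by (intro add_mono mult_mono) (auto simp: norm_divide)
  also have "\<dots> \<le> CC * exp (x - 1)" 
  proof -
    have "((3/2 + M) / 2) * exp (x - 1) + ((1/2 + M) / 2) * exp (x - 1) = (1 + M) * exp (x - 1)" by (simp add: field_simps)
    also have "\<dots> \<le> CC * exp (x - 1)" using C0 M0 by (intro mult_right_mono) (auto simp: CC_def)
    finally show ?thesis .
  qed
  finally show ?thesis using x by (cases "x = 1") (auto simp: fwa_def)
qed

lemma fb'_bound: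
  assumes m: "m \<in> S" and x: "x \<ge> 1" shows "norm (fb' m x) \<le> CC * fwb \<sigma> m x"
proof -
  have "fb' m x = - of_real (exp (1 - x))"
    using x by (cases "x = 1") (auto simp: fb'_def fc_1 field_simps)
  moreover have "fwb \<sigma> m x = exp (1 - x)" using x by (cases "x = 1") (auto simp: fwb_def ell_def)
  moreover have "1 * exp (1 - x) \<le> CC * exp (1 - x)" using C0 M0 by (intro mult_right_mono) (auto simp: CC_def)
  ultimately show ?thesis by simp
qed

text \<open>On ]0,1] the ratio \<open>fwa / fwb\<close> is x^(Re m + |Re m|) divided by the
  decreasing \<open>ell\<close>. The modulus in \<open>fwb\<close> keeps the exponent nonnegative
  also for \<open>Re m < 0\<close>.\<close>

lemma fw_mono:
  assumes m: "m \<in> S" and xy: "0 < x" "x \<le> y"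
  shows "fwa m x * fwb \<sigma> m y \<le> fwb \<sigma> m x * fwa m y"
proof -
  have l: "0 \<le> ell \<sigma> x" "0 \<le> ell \<sigma> y" using ell_ge_1[OF \<sigma>, of x] ell_ge_1[OF \<sigma>, of y] by auto
  consider "y \<le> 1" | "x \<le> 1" "y > 1" | "x > 1" by linarith
  then show ?thesis
  proof cases
    case 1
    have "(Re m + \<bar>Re m\<bar>) * ln x \<le> (Re m + \<bar>Re m\<bar>) * ln y" using xy by (intro mult_left_mono) auto
    then have "exp ((1/2 + Re m) * ln x + (1/2 - \<bar>Re m\<bar>) * ln y) * ell \<sigma> y
      \<le> exp ((1/2 - \<bar>Re m\<bar>) * ln x + (1/2 + Re m) * ln y) * ell \<sigma> x"
      using ell_antimono[OF \<sigma> xy 1] l by (intro mult_mono) (auto simp: algebra_simps)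
    then show ?thesis using 1 xy by (simp add: fwa_def fwb_def exp_add ac_simps)
  next
    case 2
    have "(Re m + \<bar>Re m\<bar>) * ln x \<le> 0" using xy 2 by (intro mult_nonneg_nonpos) auto
    then have "exp ((1/2 + Re m) * ln x + (1 - y)) * 1 \<le> exp ((1/2 - \<bar>Re m\<bar>) * ln x + (y - 1)) * ell \<sigma> x"
      using ell_ge_1[OF \<sigma>, of x] 2 by (intro mult_mono) (auto simp: algebra_simps)
    then show ?thesis using 2 xy by (simp add: fwa_def fwb_def exp_add ac_simps)
  next
    case 3
    then show ?thesis using xy by (simp add: fwa_def fwb_def flip: exp_add)
  qed
qed

lemma fw_om: assumes m: "m \<in> S" and x: "x > 0" shows "fwa m x * fwb \<sigma> m x \<le> om \<eta> \<sigma> x"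
proof (cases "x \<le> 1")
  case True
  have "(Re m - \<bar>Re m\<bar> + \<eta>) * ln x \<le> 0" using S\<eta>[OF m] \<eta> True x by (intro mult_nonneg_nonpos) auto
  then have "exp ((1/2 + Re m) * ln x + (1/2 - \<bar>Re m\<bar>) * ln x) * ell \<sigma> x \<le> exp ((1 - \<eta>) * ln x) * ell \<sigma> x"
    using ell_ge_1[OF \<sigma>, of x] by (intro mult_right_mono) (auto simp: algebra_simps)
  then show ?thesis using True by (simp add: fwa_def fwb_def om_def exp_add mult.assoc)
next
  case False then show ?thesis by (simp add: fwa_def fwb_def om_def flip: exp_add)
qed

lemma om_fRs_int: "set_integrable lborel {0<..} (\<lambda>x. om \<eta> \<sigma> x * fRs M Q x)"
proof -
  have 1: "set_integrable lborel {0<..1} (\<lambda>x. om \<eta> \<sigma> x * (if x \<le> 1 then 1 else (M\<^sup>2 + 1) / x\<^sup>2))"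
    by (subst set_integrable_cong[of lborel lborel "{0<..1}" "{0<..1}" _ "\<lambda>x. exp ((1 - \<eta>) * ln x) * ell \<sigma> x"])
       (auto simp: om_def intro: om_inner_int \<eta> \<sigma>)
  have "set_integrable lborel {1<..} (\<lambda>x. (M\<^sup>2 + 1) / x\<^sup>2)"
    by (rule set_integrable_subset[OF int_inverse_square]) auto
  then have 2: "set_integrable lborel {1<..} (\<lambda>x. om \<eta> \<sigma> x * (if x \<le> 1 then 1 else (M\<^sup>2 + 1) / x\<^sup>2))"
    by (subst set_integrable_cong[of lborel lborel "{1<..}" "{1<..}" _ "\<lambda>x. (M\<^sup>2 + 1) / x\<^sup>2"])
       (auto simp: om_def)
  have un: "{0<..} = {0<..1} \<union> {1::real<..}" by auto
  have "set_integrable lborel {0<..} (\<lambda>x. om \<eta> \<sigma> x * (if x \<le> 1 then 1 else (M\<^sup>2 + 1) / x\<^sup>2))"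
    unfolding un by (rule set_integrable_Un[OF 1 2]) auto
  from set_integral_add(1)[OF this Qi]
  show ?thesis
    by (subst set_integrable_cong[of lborel lborel "{0<..}" "{0<..}" _ "\<lambda>x. om \<eta> \<sigma> x * (if x \<le> 1 then 1 else (M\<^sup>2 + 1) / x\<^sup>2) + om \<eta> \<sigma> x * norm (Q x)"])
       (auto simp: fRs_def algebra_simps)
qed

lemma reg_fcs: "reg T (\<lambda>m. fc m x)" "reg T (\<lambda>m. fs m x)"
  unfolding fc_def fs_def by (intro reg_mult reg_const reg_chm reg_shm)+

sublocale volterra S fa fa' fb fb' fV "fR Q" fW fwa "fwb \<sigma>" "om \<eta> \<sigma>" "fRs M Q" CC
proof
  fix m assume m: "m \<in> S"
  show "ac (fa m) (fa' m)" "ac (fa' m) (\<lambda>x. fV m x * fa m x)" "ac (fb m) (fb' m)" "ac (fb' m) (\<lambda>x. fV m x * fb m x)"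
    by (rule ac_fa ac_fb)+
  show "fa m x * fb' m x - fa' m x * fb m x = fW m" for x by (rule fab_wron)
  have "1/2 \<le> Re (3/2 + m)" using S\<eta>[OF m] \<eta> by simp
  then have "1/2 \<le> norm (fW m)" unfolding fW_def norm_minus_cancel using complex_Re_le_cmod order.trans by blast
  then show "1 \<le> CC * norm (fW m)" using C0 M0 mult_mono[of 2 CC "1/2" "norm (fW m)"] by (simp add: CC_def)
  show "norm (fa m x) \<le> CC * fwa m x" "norm (fb m x) \<le> CC * fwb \<sigma> m x" if "x > 0" for x
    using fa_bound fb_bound m that by auto
  show "fwa m x > 0" "fwb \<sigma> m x > 0" if "x > 0" for x
    using ell_ge_1[OF \<sigma>, of x] by (auto simp: fwa_def fwb_def intro!: mult_pos_pos)
  show "fwa m x * fwb \<sigma> m y \<le> fwb \<sigma> m x * fwa m y" if "0 < x" "x \<le> y" for x y by (rule fw_mono[OF m that])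
  show "fwa m x * fwb \<sigma> m x \<le> om \<eta> \<sigma> x" if "x > 0" for x by (rule fw_om[OF m that])
  show "fR Q m \<in> borel_measurable borel" unfolding fR_def using Qm by measurable
  show "norm (fR Q m x) \<le> fRs M Q x" if "x > 0" for x
  proof -
    have "norm (m\<^sup>2 - 1/4) \<le> (norm m)\<^sup>2 + 1" using norm_triangle_ineq4[of "m\<^sup>2" "1/4"] by (simp add: norm_power)
    also have "\<dots> \<le> M\<^sup>2 + 1" using SM[OF m] by (simp add: power_mono)
    finally have "norm ((m\<^sup>2 - 1/4) / (of_real x)\<^sup>2) \<le> (M\<^sup>2 + 1) / x\<^sup>2"
      by (simp add: norm_divide norm_power divide_right_mono)
    then have "norm (if x \<le> 1 then 1 else (m\<^sup>2 - 1/4) / (of_real x)\<^sup>2) \<le> (if x \<le> 1 then 1 else (M\<^sup>2 + 1) / x\<^sup>2)" by simp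
    then show ?thesis unfolding fR_def fRs_def by (intro order.trans[OF norm_triangle_ineq] add_right_mono)
  qed
  show "fwa m \<in> borel_measurable borel" "fwb \<sigma> m \<in> borel_measurable borel"
    unfolding fwa_def fwb_def ell_def by measurable
  show "norm (fa' m x) \<le> CC * fwa m x" "norm (fb' m x) \<le> CC * fwb \<sigma> m x" if "x \<ge> 1" for x
    using fa'_bound fb'_bound m that by auto
next
  show "CC \<ge> 1" using C0 M0 by (simp add: CC_def)
  show "set_integrable lborel {0<..} (\<lambda>x. om \<eta> \<sigma> x * fRs M Q x)" by (rule om_fRs_int)
  show "reg S (\<lambda>m. fa m x)" for x
    unfolding fa_def
    by (cases "x \<le> 1") (auto intro!: reg_add reg_mult reg_fcs reg_divide reg_diff)
  show "reg S (\<lambda>m. fb m x)" for x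
    unfolding fb_def
    by (cases "x \<le> 1") (auto intro!: reg_add reg_mult reg_fcs reg_divide reg_diff)
  show "reg S (\<lambda>m. fR Q m x)" if "x > 0" for x
    unfolding fR_def power2_eq_square using that
    by (cases "x \<le> 1") (auto intro!: reg_add reg_mult reg_divide reg_diff)
  show "reg S fW" unfolding fW_def[abs_def] by (intro reg_minus reg_add) auto
  have b: "Re m * ln x \<le> M * \<bar>ln x\<bar>" "- (\<bar>Re m\<bar> * ln x) \<le> M * \<bar>ln x\<bar>" if "m \<in> S" for m x
  proof -
    have "\<bar>Re m\<bar> * \<bar>ln x\<bar> \<le> M * \<bar>ln x\<bar>" 
      using SM[OF that] abs_Re_le_cmod[of m] by (intro mult_right_mono) auto
    then show "Re m * ln x \<le> M * \<bar>ln x\<bar>" "- (\<bar>Re m\<bar> * ln x) \<le> M * \<bar>ln x\<bar>"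
      using abs_ge_self[of "Re m * ln x"] abs_ge_minus_self[of "\<bar>Re m\<bar> * ln x"] by (auto simp: abs_mult)
  qed
  show "\<exists>B. \<forall>m\<in>S. fwa m x \<le> B" for x
  proof (cases "x \<le> 1")
    case True
    then have "\<forall>m\<in>S. fwa m x \<le> exp (1/2 * ln x + M * \<bar>ln x\<bar>)" using b(1) by (auto simp: fwa_def distrib_right)
    then show ?thesis by blast
  qed (auto simp: fwa_def)
  show "\<exists>B. \<forall>m\<in>S. fwb \<sigma> m x \<le> B" for x
  proof (cases "x \<le> 1")
    case True
    have "fwb \<sigma> m x \<le> exp (1/2 * ln x + M * \<bar>ln x\<bar>) * ell \<sigma> x" if "m \<in> S" for m
      using True b(2)[OF that, of x] ell_ge_1[OF \<sigma>, of x] by (auto simp: fwb_def left_diff_distrib intro!: mult_right_mono)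
    then show ?thesis by blast
  qed (auto simp: fwb_def)
qed

end

section \<open>Nonvanishing of the Jost function\<close>

text \<open>Solutions of the free equation at -1 that satisfy the boundary condition and decay.
  Growth bound, boundary form and decay of the derivative are listed because together they survive
  the ladder operator, which mixes \<open>f\<close> and \<open>f'\<close>.\<close>

definition bessel_decaying :: "complex \<Rightarrow> (real \<Rightarrow> complex) \<Rightarrow> (real \<Rightarrow> complex) \<Rightarrow> bool" where
  "bessel_decaying m f f' \<longleftrightarrow>
     (\<forall>x>0. (f has_vector_derivative f' x) (at x)) \<and>
     (\<forall>x>0. (f' has_vector_derivative ((m\<^sup>2 - 1/4) / (of_real x)\<^sup>2 + 1) * f x) (at x)) \<and>
     (\<exists>C. \<forall>x. 0 < x \<longrightarrow> x \<le> 1 \<longrightarrow> norm (f x) \<le> C * x powr (1/2 + Re m)) \<and>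
     ((\<lambda>x. pw m x * f' x - pw' m x * f x) \<longlongrightarrow> 0) (at_right 0) \<and>
     (f \<longlongrightarrow> 0) at_top \<and> (f' \<longlongrightarrow> 0) at_top"

text \<open>For \<open>Re (m\<^sup>2) \<ge> 1/4\<close> the potential has nonnegative real part, so \<open>\<bar>f\<bar>\<^sup>2\<close> is convex.\<close>

lemma bessel_decaying_zero_base:
  assumes b: "bessel_decaying m f f'" and m: "Re (m\<^sup>2) \<ge> 1/4" "Re m > -1/2" and x: "x > 0"
  shows "f x = 0"
proof (rule ccontr)
  assume nz: "f x \<noteq> 0"
  have d1: "(f has_vector_derivative f' y) (at y)"
    and d2: "(f' has_vector_derivative ((m\<^sup>2 - 1/4) / (of_real y)\<^sup>2 + 1) * f y) (at y)" if "y > 0" for y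
    using b that by (auto simp: bessel_decaying_def)
  define \<phi> where "\<phi> y = (Re (f y))\<^sup>2 + (Im (f y))\<^sup>2" for y
  define \<phi>' where "\<phi>' y = 2 * (Re (f y) * Re (f' y) + Im (f y) * Im (f' y))" for y
  define v where "v y = Re ((m\<^sup>2 - 1/4) / (of_real y)\<^sup>2 + 1)" for y :: real
  define \<phi>'' where "\<phi>'' y = 2 * ((Re (f' y))\<^sup>2 + (Im (f' y))\<^sup>2 + v y * \<phi> y)" for y
  have n\<phi>: "\<phi> y = (norm (f y))\<^sup>2" for y by (simp add: \<phi>_def cmod_power2)
  have vnn: "v y \<ge> 0" if "y > 0" for y
  proof -
    have "v y = (Re (m\<^sup>2) - 1/4) / y\<^sup>2 + 1"
      by (simp add: v_def flip: of_real_power)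
    then show ?thesis using m by simp
  qed
  have D1: "(\<phi> has_real_derivative \<phi>' y) (at y)" if "y > 0" for y
    unfolding \<phi>_def \<phi>'_def
    by (auto intro!: derivative_eq_intros d1[OF that] simp: algebra_simps)
  have D2: "(\<phi>' has_real_derivative \<phi>'' y) (at y)" if "y > 0" for y
  proof -
    define V where "V = (m\<^sup>2 - 1/4) / (complex_of_real y)\<^sup>2 + 1"
    note d2' = d2[OF that, folded V_def]
    note r = has_field_derivative_Re[OF d1[OF that]] has_field_derivative_Im[OF d1[OF that]]
      has_field_derivative_Re[OF d2'] has_field_derivative_Im[OF d2']
    have "2 * (Re (f' y) * Re (f' y) + Re (V * f y) * Re (f y) + (Im (f' y) * Im (f' y) + Im (V * f y) * Im (f y))) = \<phi>'' y"
      unfolding \<phi>''_def \<phi>_def v_def V_def[symmetric] by (simp add: algebra_simps power2_eq_square)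
    then show ?thesis
      unfolding \<phi>'_def
      by (rule DERIV_cong[OF DERIV_cmult[OF DERIV_add[OF DERIV_mult[OF r(1,3)] DERIV_mult[OF r(2,4)]]]])
  qed
  have mono': "\<phi>' y \<le> \<phi>' z" if "0 < y" "y \<le> z" for y z
    using that by (intro DERIV_nonneg_imp_nondecreasing[where f=\<phi>']) (auto intro!: exI D2 simp: \<phi>''_def vnn n\<phi>)
  have \<phi>x: "\<phi> x > 0" using nz by (simp add: n\<phi>)
  \<comment> \<open>Since \<open>Re m > -1/2\<close>, \<open>f\<close> tends to 0 at 0, so
    \<open>\<phi>\<close> is smaller than \<open>\<phi> x\<close> somewhere to the left. The mean
    value theorem gives a positive slope before x, convexity keeps it, and \<open>\<phi>\<close>
    cannot tend to 0 at infinity.\<close>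
  have "\<exists>s. 0 < s \<and> s < x \<and> \<phi> s < \<phi> x"
  proof -
    obtain C where C: "\<And>y. 0 < y \<Longrightarrow> y \<le> 1 \<Longrightarrow> norm (f y) \<le> C * y powr (1/2 + Re m)"
      using b unfolding bessel_decaying_def by blast
    have "((\<lambda>y::real. y powr (1/2 + Re m)) \<longlongrightarrow> 0) (at_right 0)"
      using m by real_asymp
    then have "((\<lambda>y. C * y powr (1/2 + Re m)) \<longlongrightarrow> 0) (at_right 0)" by (rule tendsto_mult_right_zero)
    moreover have "\<forall>\<^sub>F y in at_right 0. norm (f y) \<le> C * y powr (1/2 + Re m)"
      using eventually_at_right_real[of 0 "1::real", OF zero_less_one] by eventually_elim (auto intro: C)
    ultimately have "(f \<longlongrightarrow> 0) (at_right 0)" by (rule Lim_null_comparison[rotated])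
    then have "(\<phi> \<longlongrightarrow> 0) (at_right 0)"
      using tendsto_power[OF tendsto_norm, of f 0 _ 2] by (simp add: n\<phi>[abs_def])
    then have "\<forall>\<^sub>F y in at_right 0. \<phi> y < \<phi> x" using \<phi>x by (rule order_tendstoD)
    then have "\<forall>\<^sub>F y in at_right 0. 0 < y \<and> y < x \<and> \<phi> y < \<phi> x"
      using eventually_at_right_real[OF x] by eventually_elim auto
    then show ?thesis using eventually_happens' trivial_limit_at_right_real by blast
  qed
  then obtain s where s: "0 < s" "s < x" "\<phi> s < \<phi> x" by blast
  obtain \<xi> where \<xi>: "s < \<xi>" "\<xi> < x" "\<phi> x - \<phi> s = (x - s) * \<phi>' \<xi>"
    using MVT2[OF s(2), of \<phi> \<phi>'] D1 s by auto
  then have pos: "\<phi>' \<xi> > 0" using s by (metis diff_gt_0_iff_gt zero_less_mult_pos)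
  have "\<phi> x \<le> \<phi> t" if "x \<le> t" for t
    using that
  proof (rule DERIV_nonneg_imp_nondecreasing)
    fix y assume "x \<le> y" "y \<le> t"
    then show "\<exists>d. (\<phi> has_real_derivative d) (at y) \<and> 0 \<le> d"
      using D1[of y] mono'[of \<xi> y] pos x \<xi> s by (intro exI[of _ "\<phi>' y"]) auto
  qed
  moreover have "(\<phi> \<longlongrightarrow> 0) at_top"
    using b tendsto_power[OF tendsto_norm, of f 0 at_top 2] by (simp add: n\<phi>[abs_def] bessel_decaying_def)
  then have "\<forall>\<^sub>F t in at_top. \<phi> t < \<phi> x" using \<phi>x by (rule order_tendstoD)
  then have "\<forall>\<^sub>F t in at_top. x \<le> t \<and> \<phi> t < \<phi> x"
    using eventually_ge_at_top[of x] by eventually_elim auto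
  then obtain t where "x \<le> t" "\<phi> t < \<phi> x" using eventually_happens' trivial_limit_at_top_linorder by blast
  ultimately show False by fastforce
qed

section \<open>The ladder from m to m + 1\<close>

lemma pw_exp: "x > 0 \<Longrightarrow> pw m x = exp ((1/2 + m) * lnc x)"
  by (simp add: pw_def powr_def lnc_def Ln_of_real)

lemma pw'_eq: assumes "x > 0" shows "pw' m x = (1/2 + m) / of_real x * pw m x"
proof -
  have "(m - 1/2) * lnc x = (1/2 + m) * lnc x - lnc x" by (simp add: algebra_simps)
  then have "exp ((m - 1/2) * lnc x) = pw m x / of_real x"
    using assms by (simp add: pw_exp exp_diff exp_lnc)
  then show ?thesis using assms by (simp add: pw'_def powr_def lnc_def Ln_of_real)
qed

lemma pw_Suc: "x > 0 \<Longrightarrow> pw (m + 1) x = of_real x * pw m x"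
proof -
  assume x: "x > 0"
  have "(1/2 + (m + 1)) * lnc x = lnc x + (1/2 + m) * lnc x" by (simp add: algebra_simps)
  then show ?thesis using x by (simp only: pw_exp exp_add exp_lnc)
qed

lemma norm_pw: "x > 0 \<Longrightarrow> norm (pw m x) = x powr (1/2 + Re m)"
  by (simp add: pw_exp norm_exp_eq_Re powr_def) (simp add: lnc_def)

lemma ac_pw: "ac (pw m) (pw' m)" "ac (pw' m) (\<lambda>x. (m\<^sup>2 - 1/4) / (of_real x)\<^sup>2 * pw m x)"
proof -
  have 1: "ac (\<lambda>x. fc m x + m * fs m x) (\<lambda>x. fc' m x + m * fs' m x)"
    by (intro ac_add ac_cmult ac_fc ac_fs)
  show "ac (pw m) (pw' m)" by (rule ac_cong[OF 1]) (simp_all add: fc_fs_pw_pw fc_fs_pw')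
  have 2: "ac (\<lambda>x. fc' m x + m * fs' m x) (\<lambda>x. (m\<^sup>2 - 1/4) / (of_real x)\<^sup>2 * fc m x + m * ((m\<^sup>2 - 1/4) / (of_real x)\<^sup>2 * fs m x))"
    by (intro ac_add ac_cmult ac_fc ac_fs)
  show "ac (pw' m) (\<lambda>x. (m\<^sup>2 - 1/4) / (of_real x)\<^sup>2 * pw m x)"
    by (rule ac_cong[OF 2])
      (simp_all only: fc_fs_pw_pw[symmetric] fc_fs_pw' distrib_left mult.left_commute)
qed

text \<open>With a = 1/2 + m the coefficients are m^2 - 1/4 = a^2 - a and (m+1)^2 - 1/4 = a^2 + a.
  The two equations are thus the two orderings of one factorization into the first-order operators
  d/dx - a/x and -(d/dx + a/x).\<close>

lemma ladder_identities:
  fixes m X p q :: complex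
  shows "((m\<^sup>2 - 1/4) / X\<^sup>2 + 1) * p - ((1/2 + m) / X * q + - ((1/2 + m) / X\<^sup>2) * p) = p - (1/2 + m) / X * (q - (1/2 + m) / X * p)"
    and "(q + (1/2 + m) / X * p) - ((1/2 + m) / X * (p - (1/2 + m) / X * q) + - ((1/2 + m) / X\<^sup>2) * q) = (((m + 1)\<^sup>2 - 1/4) / X\<^sup>2 + 1) * q"
proof -
  define a r where "a = 1/2 + m" and "r = inverse X"
  have m: "m\<^sup>2 - 1/4 = a\<^sup>2 - a" "(m + 1)\<^sup>2 - 1/4 = a\<^sup>2 + a" by (simp_all add: a_def power2_eq_square field_simps)
  have d: "z / X = z * r" "z / X\<^sup>2 = z * r\<^sup>2" for z by (simp_all add: r_def field_simps power2_eq_square)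
  show "((m\<^sup>2 - 1/4) / X\<^sup>2 + 1) * p - ((1/2 + m) / X * q + - ((1/2 + m) / X\<^sup>2) * p) = p - (1/2 + m) / X * (q - (1/2 + m) / X * p)"
    unfolding m a_def[symmetric] d by algebra
  show "(q + (1/2 + m) / X * p) - ((1/2 + m) / X * (p - (1/2 + m) / X * q) + - ((1/2 + m) / X\<^sup>2) * q) = (((m + 1)\<^sup>2 - 1/4) / X\<^sup>2 + 1) * q"
    unfolding m a_def[symmetric] d by algebra
qed

text \<open>The ladder operator \<open>f \<mapsto> f' - (1/2 + m) f / x\<close> maps solutions for \<open>m\<close> to solutions for \<open>m + 1\<close>.\<close>

lemma bessel_ladder:
  assumes b: "bessel_decaying m f f'" and m: "Re m > -1"
  defines "h \<equiv> (\<lambda>x. f' x - (1/2 + m) / of_real x * f x)"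
  defines "h' \<equiv> (\<lambda>x. f x - (1/2 + m) / of_real x * h x)"
  shows "bessel_decaying (m + 1) h h'"
proof -
  obtain C where C: "\<And>y. 0 < y \<Longrightarrow> y \<le> 1 \<Longrightarrow> norm (f y) \<le> C * y powr (1/2 + Re m)"
    using b unfolding bessel_decaying_def by blast
  have C0: "C \<ge> 0" using C[of 1] norm_ge_zero[of "f 1"] by (simp del: norm_ge_zero)
  have d1: "(f has_vector_derivative f' y) (at y)"
    and d2: "(f' has_vector_derivative ((m\<^sup>2 - 1/4) / (of_real y)\<^sup>2 + 1) * f y) (at y)" if "y > 0" for y
    using b that by (auto simp: bessel_decaying_def)
  have inv: "((\<lambda>x. (1/2 + m) / of_real x) has_vector_derivative - ((1/2 + m) / (of_real x)\<^sup>2)) (at x)" if "x > 0" for x :: real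
  proof -
    have "((\<lambda>x. (1/2 + m) * complex_of_real (1 / x)) has_vector_derivative (1/2 + m) * of_real (- (1 / x\<^sup>2))) (at x)"
      using that by (intro has_vector_derivative_mult_right has_vector_derivative_of_real)
        (auto intro!: derivative_eq_intros simp: power2_eq_square)
    then show ?thesis by simp
  qed
  have h1: "(h has_vector_derivative h' x) (at x)" if x: "x > 0" for x
    unfolding h_def
  proof (rule has_vector_derivative_eq_rhs[OF has_vector_derivative_diff[OF d2[OF x] has_vector_derivative_mult[OF inv[OF x] d1[OF x]]]])
    show "((m\<^sup>2 - 1/4) / (of_real x)\<^sup>2 + 1) * f x - ((1/2 + m) / of_real x * f' x + - ((1/2 + m) / (of_real x)\<^sup>2) * f x) = h' x"
      unfolding h'_def h_def by (rule ladder_identities)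
  qed
  have h2: "(h' has_vector_derivative (((m + 1)\<^sup>2 - 1/4) / (of_real x)\<^sup>2 + 1) * h x) (at x)" if x: "x > 0" for x
    unfolding h'_def
  proof (rule has_vector_derivative_eq_rhs[OF has_vector_derivative_diff[OF d1[OF x] has_vector_derivative_mult[OF inv[OF x] h1[OF x]]]])
    have f': "f' x = h x + (1/2 + m) / of_real x * f x" by (simp add: h_def)
    show "f' x - ((1/2 + m) / of_real x * h' x + - ((1/2 + m) / (of_real x)\<^sup>2) * h x) = (((m + 1)\<^sup>2 - 1/4) / (of_real x)\<^sup>2 + 1) * h x"
      unfolding h'_def f' by (rule ladder_identities)
  qed
  \<comment> \<open>The boundary form of \<open>f\<close> is \<open>pw m * h\<close>, and its
    derivative is \<open>pw m * f\<close>. Integrating the growth bound of \<open>f\<close> from 0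
    gives w = O(x^(2 + 2 Re m)), which is the growth bound of \<open>h\<close> for m + 1.\<close>
  define w where "w x = pw m x * h x" for x
  have w_eq: "w x = pw m x * f' x - pw' m x * f x" if "x > 0" for x
    using that by (simp add: w_def h_def pw'_eq algebra_simps)
  have w0: "(w \<longlongrightarrow> 0) (at_right 0)"
  proof -
    have "\<forall>\<^sub>F x in at_right 0. pw m x * f' x - pw' m x * f x = w x"
      using eventually_at_right_less[of "0::real"] by eventually_elim (simp add: w_eq)
    moreover have "((\<lambda>x. pw m x * f' x - pw' m x * f x) \<longlongrightarrow> 0) (at_right 0)"
      using b by (simp only: bessel_decaying_def)
    ultimately show ?thesis by (simp add: tendsto_cong)
  qed
  have cf: "continuous_on {0<..} f" "continuous_on {0<..} f'"
    using d1 d2 by (auto intro!: continuous_at_imp_continuous_on has_vector_derivative_continuous)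
  have acf: "ac f f'" using cf by (intro ac_C1 d1)
  have acf': "ac f' (\<lambda>x. ((m\<^sup>2 - 1/4) / (of_real x)\<^sup>2 + 1) * f x)"
    using cf by (intro ac_C1 d2) (auto intro!: continuous_intros)
  have acw: "ac w (\<lambda>x. pw m x * f x)"
    by (rule ac_cong[OF ac_wronskian[OF ac_pw acf acf']]) (auto simp: w_eq algebra_simps)
  let ?e = "2 + 2 * Re m"
  have e: "?e > 0" using m by simp
  have wb: "norm (w x) \<le> C / ?e * x powr ?e" if x: "0 < x" "x \<le> 1" for x
  proof -
    have acG: "ac (\<lambda>x. C / ?e * x powr ?e) (\<lambda>x. C * x powr (?e - 1))"
      using e by (intro ac_C1) (auto intro!: derivative_eq_intros continuous_intros simp: has_real_derivative_iff_has_vector_derivative[symmetric])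
    have inc: "norm (w x - w s) \<le> C / ?e * x powr ?e" if s: "0 < s" "s < x" for s
    proof -
      have "norm (w x - w s) \<le> (LINT y:{s..x}|lborel. C * y powr (?e - 1))"
        unfolding ac_eq[OF acw s(1) less_imp_le[OF s(2)]]
      proof (rule set_integral_norm_boundI[OF ac_integrable[OF acG s(1)] ac_integrable[OF acw s(1)]])
        fix y assume y: "y \<in> {s..x}"
        then have y1: "0 < y" "y \<le> 1" using s x by auto
        have "norm (pw m y * f y) \<le> y powr (1/2 + Re m) * (C * y powr (1/2 + Re m))"
          unfolding norm_mult norm_pw[OF y1(1)] using C[OF y1] by (intro mult_left_mono) auto
        also have "\<dots> = C * y powr ((1/2 + Re m) + (1/2 + Re m))" by (simp only: powr_add ac_simps)
        also have "(1/2 + Re m) + (1/2 + Re m) = ?e - 1" by simp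
        finally show "norm (pw m y * f y) \<le> C * y powr (?e - 1)" .
      qed
      also have "\<dots> = C / ?e * x powr ?e - C / ?e * s powr ?e"
        using ac_eq[OF acG s(1), of x] s by simp
      also have "\<dots> \<le> C / ?e * x powr ?e" using C0 e by simp
      finally show ?thesis .
    qed
    show ?thesis
    proof (rule tendsto_upperbound)
      have "((\<lambda>s. norm (w x - w s)) \<longlongrightarrow> norm (w x - 0)) (at_right 0)" by (intro tendsto_intros w0)
      then show "((\<lambda>s. norm (w x - w s)) \<longlongrightarrow> norm (w x)) (at_right 0)" by simp
      show "\<forall>\<^sub>F s in at_right 0. norm (w x - w s) \<le> C / ?e * x powr ?e"
        using eventually_at_right_real[OF x(1)] by eventually_elim (rule inc; simp)
    qed auto
  qed
  have hb: "norm (h x) \<le> C / ?e * x powr (1/2 + Re (m + 1))" if x: "0 < x" "x \<le> 1" for x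
  proof -
    have "x powr (1/2 + Re m) * norm (h x) \<le> C / ?e * x powr ?e"
      using wb[OF x] unfolding w_def norm_mult norm_pw[OF x(1)] .
    moreover have "x powr ?e = x powr (1/2 + Re m) * x powr (1/2 + Re (m + 1))"
      by (simp flip: powr_add)
    ultimately have "x powr (1/2 + Re m) * norm (h x) \<le> x powr (1/2 + Re m) * (C / ?e * x powr (1/2 + Re (m + 1)))"
      by (simp only: ac_simps)
    then show ?thesis by (rule mult_left_le_imp_le) (use x in simp)
  qed
  have W: "((\<lambda>x. pw (m + 1) x * h' x - pw' (m + 1) x * h x) \<longlongrightarrow> 0) (at_right 0)"
  proof -
    have t1: "((\<lambda>x. of_real x * (pw m x * f x)) \<longlongrightarrow> 0) (at_right 0)"
    proof (rule Lim_null_comparison)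
      show "\<forall>\<^sub>F x in at_right 0. norm (of_real x * (pw m x * f x)) \<le> C * x powr ?e"
        using eventually_at_right_real[of 0 "1::real", OF zero_less_one]
      proof eventually_elim
        case (elim x)
        then have x: "0 < x" "x \<le> 1" by auto
        have "norm (of_real x * (pw m x * f x)) = x * (x powr (1/2 + Re m) * norm (f x))"
          using x by (simp add: norm_mult norm_pw)
        also have "\<dots> \<le> x * (x powr (1/2 + Re m) * (C * x powr (1/2 + Re m)))"
          using C[OF x] x by (intro mult_left_mono) auto
        also have "\<dots> = C * (x powr 1 * x powr (1/2 + Re m) * x powr (1/2 + Re m))" using x by simp
        also have "\<dots> = C * x powr (1 + (1/2 + Re m) + (1/2 + Re m))" by (simp only: powr_add)
        also have "1 + (1/2 + Re m) + (1/2 + Re m) = ?e" by simp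
        finally show ?case .
      qed
      have "((\<lambda>x::real. x powr ?e) \<longlongrightarrow> 0) (at_right 0)" using e by real_asymp
      then show "((\<lambda>x. C * x powr ?e) \<longlongrightarrow> 0) (at_right 0)" by (rule tendsto_mult_right_zero)
    qed
    \<comment> \<open>The factor 2m + 2 is the sum of 1/2 + m from \<open>h'\<close> and 3/2 + m
      from \<open>pw' (m + 1)\<close>.\<close>
    have "((\<lambda>x. of_real x * (pw m x * f x) - (2 * m + 2) * w x) \<longlongrightarrow> 0 - (2 * m + 2) * 0) (at_right 0)"
      by (intro tendsto_intros t1 w0)
    moreover have "\<forall>\<^sub>F x in at_right 0. of_real x * (pw m x * f x) - (2 * m + 2) * w x = pw (m + 1) x * h' x - pw' (m + 1) x * h x"
      using eventually_at_right_less[of "0::real"]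
    proof eventually_elim
      case (elim x)
      then show ?case unfolding pw'_eq[OF elim] pw_Suc[OF elim] w_def h'_def by (simp add: field_simps)
    qed
    ultimately show ?thesis by (simp add: tendsto_cong)
  qed
  have inv0: "((\<lambda>x. (1/2 + m) / of_real x) \<longlongrightarrow> 0) at_top"
  proof (rule Lim_null_comparison)
    show "\<forall>\<^sub>F x in at_top. norm ((1/2 + m) / complex_of_real x) \<le> norm (1/2 + m) / x"
      using eventually_gt_at_top[of 0] by eventually_elim (simp add: norm_divide)
    show "((\<lambda>x. norm (1/2 + m) / x) \<longlongrightarrow> 0) at_top" by real_asymp
  qed
  have f0: "(f \<longlongrightarrow> 0) at_top" "(f' \<longlongrightarrow> 0) at_top" using b by (auto simp: bessel_decaying_def)
  have "(h \<longlongrightarrow> 0 - 0 * 0) at_top" unfolding h_def by (intro tendsto_intros f0 inv0)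
  then have hl: "(h \<longlongrightarrow> 0) at_top" by simp
  have "(h' \<longlongrightarrow> 0 - 0 * 0) at_top" unfolding h'_def by (intro tendsto_intros f0 inv0 hl)
  then have hl': "(h' \<longlongrightarrow> 0) at_top" by simp
  show ?thesis unfolding bessel_decaying_def using h1 h2 hb W hl hl' by blast
qed

text \<open>Descent along the ladder: if \<open>h\<close> vanishes identically then so does its
  derivative \<open>h'\<close>, and \<open>f = h' + (1/2 + m) / x * h\<close>.\<close>

lemma bessel_decaying_zero_ind:
  assumes "bessel_decaying m f f'" "Re m > -1" "Re ((m + of_nat n)\<^sup>2) \<ge> 1/4" "Re (m + of_nat n) > -1/2" "x > 0"
  shows "f x = 0"
  using assms
proof (induction n arbitrary: m f f' x)
  case 0
  then show ?case using bessel_decaying_zero_base by simp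
next
  case (Suc n)
  define h where "h = (\<lambda>x. f' x - (1/2 + m) / of_real x * f x)"
  define h' where "h' = (\<lambda>x. f x - (1/2 + m) / of_real x * h x)"
  have bh: "bessel_decaying (m + 1) h h'"
    unfolding h'_def h_def by (rule bessel_ladder[OF Suc.prems(1,2)])
  have h0: "h y = 0" if "y > 0" for y
    by (rule Suc.IH[OF bh _ _ _ that]) (use Suc.prems in \<open>auto simp: add.assoc\<close>)
  have "(h has_vector_derivative h' x) (at x)" using bh Suc.prems(5) by (simp add: bessel_decaying_def)
  moreover have "(h has_vector_derivative 0) (at x)"
    using Suc.prems(5) h0
    by (intro has_vector_derivative_transform_within_open[of "\<lambda>_. 0" 0 x "{0<..}" h]) auto
  ultimately have "h' x = 0" by (metis vector_derivative_at)
  then show ?case using h0[OF Suc.prems(5)] by (simp add: h'_def)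
qed

lemma bessel_decaying_zero:
  assumes "bessel_decaying m f f'" "Re m > -1" "x > 0"
  shows "f x = 0"
proof -
  \<comment> \<open>Makes Re m + n at least |Im m| + 1, so that Re ((m + n)^2), the difference of
    the two squares, is at least 1.\<close>
  obtain n :: nat where n: "of_nat n \<ge> \<bar>Im m\<bar> + 2" using real_arch_simple by blast
  then have r: "Re m + real n \<ge> \<bar>Im m\<bar> + 1" using assms(2) by linarith
  then have "(Re m + real n)\<^sup>2 \<ge> (\<bar>Im m\<bar> + 1)\<^sup>2" by (intro power_mono) auto
  then have "(Re m + real n)\<^sup>2 \<ge> (Im m)\<^sup>2 + 1" by (simp add: power2_sum)
  then have "Re ((m + of_nat n)\<^sup>2) \<ge> 1/4" by (simp add: power2_eq_square)
  then show ?thesis using r assms by (intro bessel_decaying_zero_ind[where n=n]) auto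
qed

text \<open>A zero of the Jost function makes \<open>uu\<close> and \<open>vv\<close> dependent, so
  \<open>uu\<close> decays at infinity; at 0 it satisfies growth bound and boundary condition
  anyway. Then \<open>bessel_decaying_zero\<close> gives uu = 0, against its normalization at
  0.\<close>

lemma jost_free_nonzero:
  assumes B: "bessel_setup S \<eta> \<sigma> M C0 (\<lambda>_. 0)" and m: "m \<in> S"
  shows "volterra.jost S fa fb (fR (\<lambda>_. 0)) fW fwa (om \<eta> \<sigma>) (fRs M (\<lambda>_. 0)) (bessel_setup.CC M C0) m \<noteq> 0"
proof
  interpret bessel_setup S \<eta> \<sigma> M C0 "\<lambda>_. 0" by (rule B)
  assume j: "jost m = 0"
  have \<mu>: "Re m > -1" using S\<eta>[OF m] \<eta> by simp
  have V: "fV m x + fR (\<lambda>_. 0) m x = (m\<^sup>2 - 1/4) / (of_real x)\<^sup>2 + 1" for x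
    by (auto simp: fV_def fR_def ext0_def)
  note au = ac_uu[OF m, unfolded V] and av = ac_vv[OF m, unfolded V]
  note cu = ac_continuous[OF au(1)] ac_continuous[OF au(2)] and cv = ac_continuous[OF av(1)] ac_continuous[OF av(2)]
  have du: "(uu m has_vector_derivative uu' m x) (at x)" if "x > 0" for x
    by (rule ac_has_derivative[OF au(1) cu(2) that])
  have du': "(uu' m has_vector_derivative ((m\<^sup>2 - 1/4) / (of_real x)\<^sup>2 + 1) * uu m x) (at x)" if "x > 0" for x
    using cu by (intro ac_has_derivative[OF au(2) _ that]) (auto intro!: continuous_intros)
  have dv: "(vv m has_vector_derivative vv' m x) (at x)" if "x > 0" for x
    by (rule ac_has_derivative[OF av(1) cv(2) that])
  have w: "uu m x * vv' m x = uu' m x * vv m x" if "x > 0" for x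
    using wron_uu_vv[OF m that] j by simp
  \<comment> \<open>The exact exponential asymptotics of \<open>vv\<close> are needed to know that
    it has no zeros far out, so that dividing by it is possible.\<close>
  have vlim: "((\<lambda>x. of_real (exp (x - 1)) * vv m x) \<longlongrightarrow> 1) at_top"
  proof -
    have "((\<lambda>x. of_real (exp (x - 1)) * (vA m x * fa m x)) \<longlongrightarrow> 0) at_top"
    proof (rule Lim_null_comparison)
      show "\<forall>\<^sub>F x in at_top. norm (of_real (exp (x - 1)) * (vA m x * fa m x)) \<le> CC * k1 x"
        using eventually_gt_at_top[of 1]
      proof eventually_elim
        case (elim x)
        then have x: "x > 0" by simp
        have "norm (of_real (exp (x - 1)) * (vA m x * fa m x)) = exp (x - 1) * (norm (vA m x) * norm (fa m x))"
          by (simp add: norm_mult)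
        also have "\<dots> \<le> exp (x - 1) * ((fwb \<sigma> m x / fwa m x * k1 x) * (CC * fwa m x))"
          using vA_bound[OF m x] ab[OF m x] by (intro mult_left_mono mult_mono) (auto intro: order.trans[OF norm_ge_zero])
        also have "\<dots> = CC * k1 x * (exp (x - 1) * fwb \<sigma> m x)" using wapos[OF m x] by simp
        also have "exp (x - 1) * fwb \<sigma> m x = 1" using elim by (simp add: fwb_def flip: exp_add)
        finally show ?case by simp
      qed
      show "((\<lambda>x. CC * k1 x) \<longlongrightarrow> 0) at_top" by (rule tendsto_mult_right_zero[OF k1_lim])
    qed
    from tendsto_add[OF this vB_lim[OF m]]
    have "((\<lambda>x. of_real (exp (x - 1)) * (vA m x * fa m x) + vB m x) \<longlongrightarrow> 1) at_top" by simp
    moreover have "\<forall>\<^sub>F x in at_top. of_real (exp (x - 1)) * (vA m x * fa m x) + vB m x = of_real (exp (x - 1)) * vv m x"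
      using eventually_gt_at_top[of 1]
    proof eventually_elim
      case (elim x)
      have "complex_of_real (exp (x - 1)) * of_real (exp (1 - x)) = 1" by (simp flip: of_real_mult exp_add)
      then show ?case using elim vv_eq[OF m, of x] by (simp add: fb_def algebra_simps)
    qed
    ultimately show ?thesis by (simp add: tendsto_cong)
  qed
  have "\<forall>\<^sub>F x in at_top. of_real (exp (x - 1)) * vv m x \<noteq> 0"
    by (rule tendsto_imp_eventually_ne[OF vlim]) simp
  then obtain X where X: "\<And>x. x \<ge> X \<Longrightarrow> vv m x \<noteq> 0"
    unfolding eventually_at_top_linorder by auto
  \<comment> \<open>Beyond \<open>X\<close> there are no zeros of \<open>vv\<close>, and the maximum
    with 1 keeps the ray in the half-line; the constancy of \<open>uu / vv\<close> is used on this
    ray only.\<close>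
  define Y where "Y = max X 1"
  define c where "c = uu m Y / vv m Y"
  have uc: "uu m x = c * vv m x" "uu' m x = c * vv' m x" if x: "x \<ge> Y" for x
  proof -
    have "((\<lambda>x. uu m x * inverse (vv m x)) has_vector_derivative 0) (at y within {Y..})" if "y \<in> {Y..}" for y
    proof -
      have y: "y > 0" "vv m y \<noteq> 0" using that X by (auto simp: Y_def)
      have "((inverse \<circ> vv m) has_vector_derivative vv' m y * - (inverse (vv m y) * inverse (vv m y))) (at y)"
        by (rule field_vector_diff_chain_at[OF dv[OF y(1)]]) (auto intro!: derivative_eq_intros y simp: power2_eq_square)
      then have "((\<lambda>x. inverse (vv m x)) has_vector_derivative vv' m y * - (inverse (vv m y) * inverse (vv m y))) (at y)"
        by (simp add: comp_def)
      from has_vector_derivative_mult[OF du[OF y(1)] this]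
      have "((\<lambda>x. uu m x * inverse (vv m x)) has_vector_derivative 0) (at y)"
        by (rule has_vector_derivative_eq_rhs) (use w[OF y(1)] y(2) in \<open>simp add: field_simps\<close>)
      then show ?thesis by (rule has_vector_derivative_at_within)
    qed
    then obtain c' where c': "\<And>y. y \<in> {Y..} \<Longrightarrow> uu m y * inverse (vv m y) = c'"
      using has_vector_derivative_zero_constant[of "{Y..}" "\<lambda>x. uu m x * inverse (vv m x)"] by auto
    have "vv m x \<noteq> 0" "x > 0" using x X by (auto simp: Y_def)
    moreover have "uu m x * inverse (vv m x) = c" using c'[of x] c'[of Y] x by (simp add: c_def divide_inverse)
    ultimately show "uu m x = c * vv m x" by (simp add: field_simps)
    then have "c * vv m x * vv' m x = uu' m x * vv m x" using w[OF \<open>x > 0\<close>] by simp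
    then show "uu' m x = c * vv' m x" using \<open>vv m x \<noteq> 0\<close> by simp
  qed
  have el: "((\<lambda>x. c * exp (1 - x)) \<longlongrightarrow> 0) at_top" for c :: real
  proof (rule tendsto_mult_right_zero)
    show "((\<lambda>x::real. exp (1 - x)) \<longlongrightarrow> 0) at_top" by real_asymp
  qed
  have wbe: "fwb \<sigma> m x = exp (1 - x)" if "x > 1" for x using that by (simp add: fwb_def)
  have vl: "(vv m \<longlongrightarrow> 0) at_top"
    by (rule Lim_null_comparison[OF _ el[of K]])
       (use eventually_gt_at_top[of 1] in eventually_elim, metis vv_bound[OF m] wbe less_trans zero_less_one)
  have vl': "(vv' m \<longlongrightarrow> 0) at_top"
    by (rule Lim_null_comparison[OF _ el[of "CC * (1 + 2 * (LINT y:{0<..}|lborel. \<kappa> y))"]])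
       (use eventually_gt_at_top[of 1] in eventually_elim, metis vv'_bound[OF m] wbe less_imp_le)
  have ul: "(uu m \<longlongrightarrow> 0) at_top"
  proof (rule Lim_transform_eventually[OF tendsto_mult_right_zero[OF vl, of c]])
    show "\<forall>\<^sub>F x in at_top. c * vv m x = uu m x"
      using eventually_ge_at_top[of Y] by eventually_elim (simp add: uc)
  qed
  have ul': "(uu' m \<longlongrightarrow> 0) at_top"
  proof (rule Lim_transform_eventually[OF tendsto_mult_right_zero[OF vl', of c]])
    show "\<forall>\<^sub>F x in at_top. c * vv' m x = uu' m x"
      using eventually_ge_at_top[of Y] by eventually_elim (simp add: uc)
  qed
  have ub: "norm (uu m x) \<le> K * x powr (1/2 + Re m)" if "0 < x" "x \<le> 1" for x
    using uu_bound[OF m that(1)] that by (simp add: fwa_def powr_def)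
  \<comment> \<open>The boundary form is \<open>uB * fW\<close>. On ]0,1] \<open>fwa / fwb\<close>
    is at most 1, so \<open>uB\<close> is bounded by \<open>k0\<close>.\<close>
  have uW: "((\<lambda>x. pw m x * uu' m x - pw' m x * uu m x) \<longlongrightarrow> 0) (at_right 0)"
  proof -
    have "((\<lambda>x. uB m x * fW m) \<longlongrightarrow> 0) (at_right 0)"
    proof (rule Lim_null_comparison)
      show "\<forall>\<^sub>F x in at_right 0. norm (uB m x * fW m) \<le> k0 x * norm (fW m)"
        using eventually_at_right_real[of 0 "1::real", OF zero_less_one]
      proof eventually_elim
        case (elim x)
        then have x: "0 < x" "x \<le> 1" by auto
        have "exp ((1/2 + Re m) * ln x) * 1 \<le> exp ((1/2 - \<bar>Re m\<bar>) * ln x) * ell \<sigma> x"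
        proof (rule mult_mono)
          have "(Re m + \<bar>Re m\<bar>) * ln x \<le> 0" using x by (intro mult_nonneg_nonpos) auto
          then show "exp ((1/2 + Re m) * ln x) \<le> exp ((1/2 - \<bar>Re m\<bar>) * ln x)" by (simp add: algebra_simps)
        qed (use ell_ge_1[OF \<sigma>, of x] in auto)
        then have "fwa m x / fwb \<sigma> m x \<le> 1" using x wbpos[OF m x(1)] by (simp add: fwa_def fwb_def)
        then have "fwa m x / fwb \<sigma> m x * k0 x \<le> k0 x"
          using k_bounds[OF m x(1)] mult_right_mono[of "fwa m x / fwb \<sigma> m x" 1 "k0 x"] by simp
        then have "norm (uB m x) \<le> k0 x" using uB_bound[OF m x(1)] by linarith
        then show ?case by (simp add: norm_mult mult_right_mono)
      qed
      show "((\<lambda>x. k0 x * norm (fW m)) \<longlongrightarrow> 0) (at_right 0)" by (rule tendsto_mult_left_zero[OF k0_lim])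
    qed
    moreover have "\<forall>\<^sub>F x in at_right 0. uB m x * fW m = pw m x * uu' m x - pw' m x * uu m x"
      using eventually_at_right_real[of 0 "1::real", OF zero_less_one]
    proof eventually_elim
      case (elim x)
      then show ?case using wron_a_uu[OF m, of x] by (simp add: fa_def fa'_def fc_fs_pw_pw fc_fs_pw')
    qed
    ultimately show ?thesis by (simp add: tendsto_cong)
  qed
  have "bessel_decaying m (uu m) (uu' m)"
    unfolding bessel_decaying_def using du du' ub uW ul ul' by blast
  then have u0: "uu m x = 0" if "x > 0" for x using bessel_decaying_zero[OF _ \<mu> that] by blast
  \<comment> \<open>With uu = 0 the coefficients keep their initial values 1 and 0, so
    \<open>uu m 1\<close> would equal \<open>fa m 1\<close>, which is 1.\<close>
  have "(LINT y:{0<..1}|lborel. fb m y * (fR (\<lambda>_. 0) m y * uu m y / fW m)) = (LINT y:{0<..1::real}|lborel. 0)"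
    using u0 by (intro set_lebesgue_integral_cong) auto
  moreover have "(LINT y:{0<..1}|lborel. fa m y * (fR (\<lambda>_. 0) m y * uu m y / fW m)) = (LINT y:{0<..1::real}|lborel. 0)"
    using u0 by (intro set_lebesgue_integral_cong) auto
  ultimately have "uA m 1 = 1" "uB m 1 = 0" by (simp_all add: uA_def uB_def)
  then have "uu m 1 = fa m 1" using uu_eq[OF m zero_less_one] by simp
  then show False using u0[OF zero_less_one] by (simp add: fa_def fc_1)
qed

locale bessel_resolvent = bessel_setup +
  assumes jz: "\<And>m. m \<in> S \<Longrightarrow> jost m \<noteq> 0"
begin

lemma nn_integral_two_sided_exp:
  assumes "z \<ge> 1"
  shows "(\<integral>\<^sup>+y. ennreal (indicat_real {1<..} y * exp (- \<bar>y - z\<bar>)) \<partial>lborel) \<le> ennreal 2"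
proof -
  have 1: "(\<integral>\<^sup>+y. ennreal (exp (y - z)) * indicator {1..z} y \<partial>lborel) = ennreal (exp (z - z) - exp (1 - z))"
    using assms by (intro nn_integral_FTC_Icc) (auto intro!: derivative_eq_intros)
  have 2: "(\<integral>\<^sup>+y. ennreal (exp (z - y)) * indicator {z..} y \<partial>lborel) = ennreal (0 - (- exp (z - z)))"
  proof (rule nn_integral_FTC_atLeast[where F="\<lambda>y. - exp (z - y)"])
    show "((\<lambda>y. - exp (z - y)) \<longlongrightarrow> 0) at_top" by real_asymp
  qed (auto intro!: derivative_eq_intros)
  have "(\<integral>\<^sup>+y. ennreal (indicat_real {1<..} y * exp (- \<bar>y - z\<bar>)) \<partial>lborel)
     \<le> (\<integral>\<^sup>+y. ennreal (exp (y - z)) * indicator {1..z} y + ennreal (exp (z - y)) * indicator {z..} y \<partial>lborel)"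
    by (intro nn_integral_mono) (auto simp: indicator_def abs_if)
  also have "\<dots> = ennreal (exp (z - z) - exp (1 - z)) + ennreal (0 - (- exp (z - z)))"
    by (subst nn_integral_add) (auto simp: 1 2)
  also have "\<dots> \<le> ennreal 1 + ennreal 1" by (intro add_mono ennreal_leI) auto
  also have "\<dots> = ennreal 2" by (simp flip: ennreal_plus)
  finally show ?thesis .
qed

definition Cschur :: real where
  "Cschur = (LINT y:{0<..1}|lborel. exp ((1 - \<eta>) * ln y) * ell \<sigma> y) + 2"

text \<open>Separates the variables up to the factor \<open>fsc \<eta> x\<close>: the part y \<le> 1
  does not involve x, and the part y > 1 decays exponentially away from \<open>max x 1\<close>. For
  x \<le> 1 the decay starts at 1, whence the maximum.\<close>

lemma schur_pointwise:
  assumes "x > 0" "y > 0"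
  shows "fal \<eta> (min x y) * fbe \<eta> \<sigma> (max x y) * fsc \<eta> y
    \<le> fsc \<eta> x * (indicat_real {0<..1} y * (exp ((1 - \<eta>) * ln y) * ell \<sigma> y) + indicat_real {1<..} y * exp (- \<bar>y - max x 1\<bar>))"
proof -
  let ?p = "\<lambda>x::real. exp ((1 - \<eta>) / 2 * ln x)"
  have pp: "?p y * ?p y = exp ((1 - \<eta>) * ln y)" by (simp flip: exp_add)
  have l: "ell \<sigma> z \<ge> 1" for z by (rule ell_ge_1[OF \<sigma>])
  consider "x \<le> 1" "y \<le> 1" "y \<le> x" | "x \<le> 1" "y \<le> 1" "x < y" | "x \<le> 1" "y > 1" | "x > 1" "y \<le> 1" | "x > 1" "y > 1" "y \<le> x" | "x > 1" "y > 1" "x < y"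
    by linarith
  then show ?thesis
  proof cases
    case 1
    have "?p y * (?p x * ell \<sigma> x) * ?p y \<le> ?p y * (?p x * ell \<sigma> y) * ?p y"
      using ell_antimono[OF \<sigma> assms(2) 1(3,1)] by (intro mult_right_mono mult_left_mono) auto
    also have "\<dots> = ?p x * (?p y * ?p y * ell \<sigma> y)" by simp
    also have "\<dots> = ?p x * (exp ((1 - \<eta>) * ln y) * ell \<sigma> y)" by (simp only: pp)
    finally show ?thesis using 1 assms by (simp add: fal_def fbe_def fsc_def)
  next
    case 2
    have "?p x * (?p y * ell \<sigma> y) * ?p y = ?p x * (?p y * ?p y * ell \<sigma> y)" by simp
    also have "\<dots> = ?p x * (exp ((1 - \<eta>) * ln y) * ell \<sigma> y)" by (simp only: pp)
    finally have "?p x * (?p y * ell \<sigma> y) * ?p y \<le> ?p x * (exp ((1 - \<eta>) * ln y) * ell \<sigma> y)" by (rule eq_refl)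
    moreover have "min x y = x" "max x y = y" using 2 by auto
    ultimately show ?thesis unfolding fal_def fbe_def fsc_def using 2 assms
      by (simp only: if_True indicator_simps greaterThanAtMost_iff greaterThan_iff simp_thms not_less mult_1 mult_zero_left add_0_right)
  next
    case 3
    then show ?thesis using assms by (simp add: fal_def fbe_def fsc_def)
  next
    case 4
    have "?p y * exp (1 - x) * ?p y = (?p y * ?p y) * exp (1 - x)" by simp
    also have "\<dots> \<le> (?p y * ?p y) * ell \<sigma> y" using 4 l[of y] by (intro mult_left_mono) (auto intro: order.trans[of _ 1])
    also have "\<dots> = exp ((1 - \<eta>) * ln y) * ell \<sigma> y" by (simp only: pp)
    finally show ?thesis using 4 assms by (simp add: fal_def fbe_def fsc_def)
  next
    case 5
    then show ?thesis using assms by (cases "x = y") (auto simp: fal_def fbe_def fsc_def min_def max_def simp flip: exp_add)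
  next
    case 6
    then show ?thesis using assms by (auto simp: fal_def fbe_def fsc_def min_def max_def simp flip: exp_add)
  qed
qed

sublocale resolvent S fa fa' fb fb' fV "fR Q" fW fwa "fwb \<sigma>" "om \<eta> \<sigma>" "fRs M Q" CC Q "fal \<eta>" "fbe \<eta> \<sigma>" "fsc \<eta>" Cschur
proof
  show "fV m x + fR Q m x = (m\<^sup>2 - 1/4) / (of_real x)\<^sup>2 + Q x + 1" if "x > 0" for m x
    using that by (simp add: fV_def fR_def)
  show "fa m x = pw m x" "fa' m x = pw' m x" if "0 < x" "x \<le> 1" for m x
    using that by (auto simp: fa_def fa'_def fc_fs_pw_pw fc_fs_pw')
  show "jost m \<noteq> 0" if "m \<in> S" for m by (rule jz[OF that])
  show "fwa m x * fwb \<sigma> m y \<le> fal \<eta> x * fbe \<eta> \<sigma> y" if m: "m \<in> S" and xy: "0 < x" "x \<le> y" for m x y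
  proof -
    have n\<eta>: "0 \<le> Re m + \<eta>/2" using S\<eta>[OF m] by simp
    have le: "(1/2 + Re m) * ln x \<le> (1 - \<eta>) / 2 * ln x" if "x \<le> 1"
    proof -
      have "(Re m + \<eta>/2) * ln x \<le> 0" using that xy n\<eta> by (intro mult_nonneg_nonpos) auto
      then show ?thesis by (simp add: field_simps)
    qed
    consider "y \<le> 1" | "x \<le> 1" "y > 1" | "x > 1" by linarith
    then show ?thesis
    proof cases
      case 1
      have l: "ln x \<le> ln y" "ln y \<le> 0" using 1 xy by auto
      \<comment> \<open>For \<open>Re m \<ge> 0\<close> the order of x and y is used; for
        \<open>Re m < 0\<close> both exponents are 1/2 + Re m and only
        \<open>Re m \<ge> -\<eta>/2\<close> matters.\<close>
      have "(1/2 + Re m) * ln x + (1/2 - \<bar>Re m\<bar>) * ln y \<le> (1 - \<eta>) / 2 * ln x + (1 - \<eta>) / 2 * ln y"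
      proof (cases "Re m \<ge> 0")
        case True
        have "Re m * ln x \<le> Re m * ln y" "\<eta> / 2 * (ln x + ln y) \<le> 0" using True l \<eta> by (auto intro: mult_left_mono mult_nonneg_nonpos)
        then show ?thesis using True by (simp add: algebra_simps add_divide_distrib diff_divide_distrib)
      next
        case False
        have "(Re m + \<eta>/2) * (ln x + ln y) \<le> 0" using l n\<eta> by (intro mult_nonneg_nonpos) auto
        then show ?thesis using False by (simp add: algebra_simps add_divide_distrib diff_divide_distrib)
      qed
      then have "exp ((1/2 + Re m) * ln x + (1/2 - \<bar>Re m\<bar>) * ln y) * ell \<sigma> y \<le> exp ((1 - \<eta>) / 2 * ln x + (1 - \<eta>) / 2 * ln y) * ell \<sigma> y"
        using ell_ge_1[OF \<sigma>, of y] by (intro mult_right_mono) auto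
      then show ?thesis using 1 xy by (simp add: fwa_def fwb_def fal_def fbe_def exp_add mult.assoc)
    next
      case 2
      then show ?thesis using le by (simp add: fwa_def fwb_def fal_def fbe_def)
    next
      case 3
      then show ?thesis using xy by (simp add: fwa_def fwb_def fal_def fbe_def)
    qed
  qed
  show "fwa m x \<le> fal \<eta> x" if m: "m \<in> S" and x: "0 < x" for m x
  proof (cases "x \<le> 1")
    case True
    have "(Re m + \<eta>/2) * ln x \<le> 0" using True x S\<eta>[OF m] by (intro mult_nonneg_nonpos) auto
    then have "(1/2 + Re m) * ln x \<le> (1 - \<eta>) / 2 * ln x" by (simp add: field_simps)
    then show ?thesis using True by (simp add: fwa_def fal_def)
  qed (simp add: fwa_def fal_def)
  show "0 < fal \<eta> x" "0 < fbe \<eta> \<sigma> x" for x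
    using ell_ge_1[OF \<sigma>, of x] by (auto simp: fal_def fbe_def intro!: mult_pos_pos)
  show "0 < fsc \<eta> x" for x by (simp add: fsc_def)
  show [measurable]: "fal \<eta> \<in> borel_measurable borel" "fbe \<eta> \<sigma> \<in> borel_measurable borel" "fsc \<eta> \<in> borel_measurable borel"
    unfolding fal_def fbe_def fsc_def ell_def by measurable
  show "fwb \<sigma> m x = exp (1 - x)" if "x \<ge> 1" for m x
    using that by (cases "x = 1") (auto simp: fwb_def ell_def)
  show "set_integrable lborel {0<..x} (\<lambda>y. (fal \<eta> y)\<^sup>2)" if "x > 0" for x
  proof -
    have 1: "set_integrable lborel {0<..1} (\<lambda>y. (fal \<eta> y)\<^sup>2)"
    proof (rule set_integrable_boundI[OF om_inner_int[OF \<eta>(2) \<sigma>]])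
      show "(\<lambda>x. indicat_real {0<..1} x *\<^sub>R (fal \<eta> x)\<^sup>2) \<in> borel_measurable borel" by measurable
      fix y :: real assume y: "y \<in> {0<..1}"
      have "(fal \<eta> y)\<^sup>2 = exp ((1 - \<eta>) * ln y) * 1" using y by (simp add: fal_def power2_eq_square flip: exp_add)
      also have "\<dots> \<le> exp ((1 - \<eta>) * ln y) * ell \<sigma> y" using ell_ge_1[OF \<sigma>] by (intro mult_left_mono) auto
      finally show "norm ((fal \<eta> y)\<^sup>2) \<le> exp ((1 - \<eta>) * ln y) * ell \<sigma> y" by simp
    qed
    have "set_integrable lborel {1<..x} (\<lambda>y::real. (exp (y - 1))\<^sup>2)"
      by (rule set_integrable_subset[of _ "{1..x}"]) (auto intro!: borel_integrable_atLeastAtMost' continuous_intros)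
    then have 2: "set_integrable lborel {1<..x} (\<lambda>y. (fal \<eta> y)\<^sup>2)"
      by (subst set_integrable_cong[of lborel lborel "{1<..x}" "{1<..x}" _ "\<lambda>y. (exp (y - 1))\<^sup>2"]) (auto simp: fal_def)
    show ?thesis
      by (rule set_integrable_subset[OF set_integrable_Un[OF 1 2]]) auto
  qed
  show "set_integrable lborel {x..} (\<lambda>y. (fbe \<eta> \<sigma> y)\<^sup>2)" if "x > 0" for x
  proof -
    have "set_integrable lborel {x..1} (\<lambda>y. (exp ((1 - \<eta>) / 2 * ln y) * ell \<sigma> y)\<^sup>2)"
      unfolding ell_def using that by (intro borel_integrable_atLeastAtMost' continuous_intros) auto
    then have 1: "set_integrable lborel {x..1} (\<lambda>y. (fbe \<eta> \<sigma> y)\<^sup>2)"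
      by (subst set_integrable_cong[of lborel lborel "{x..1}" "{x..1}" _ "\<lambda>y. (exp ((1 - \<eta>) / 2 * ln y) * ell \<sigma> y)\<^sup>2"]) (auto simp: fbe_def)
    have "set_integrable lborel {1..} (\<lambda>y::real. (exp (1 - y))\<^sup>2)"
    proof (rule set_integrable_boundI[OF int_inverse_square[of 1]])
      fix y :: real assume y: "y \<in> {1..}"
      have "y \<le> exp (y - 1)" using exp_ge_add_one_self[of "y - 1"] by simp
      then have "1 / exp (y - 1) \<le> 1 / y" using y by (intro divide_left_mono) auto
      then have "exp (1 - y) \<le> 1 / y" by (simp add: exp_diff)
      then have "(exp (1 - y))\<^sup>2 \<le> (1 / y)\<^sup>2" by (intro power_mono) auto
      then show "norm ((exp (1 - y))\<^sup>2) \<le> 1 / y\<^sup>2" by (simp add: power_divide)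
    qed measurable
    then have "set_integrable lborel {1<..} (\<lambda>y::real. (exp (1 - y))\<^sup>2)" by (rule set_integrable_subset) auto
    then have 2: "set_integrable lborel {1<..} (\<lambda>y. (fbe \<eta> \<sigma> y)\<^sup>2)"
      by (subst set_integrable_cong[of lborel lborel "{1<..}" "{1<..}" _ "\<lambda>y. (exp (1 - y))\<^sup>2"]) (auto simp: fbe_def)
    show ?thesis by (rule set_integrable_subset[OF set_integrable_Un[OF 1 2]]) auto
  qed
  let ?I = "LINT y:{0<..1}|lborel. exp ((1 - \<eta>) * ln y) * ell \<sigma> y"
  have e0: "0 \<le> exp ((1 - \<eta>) * ln y) * ell \<sigma> y" for y using ell_ge_1[OF \<sigma>, of y] by simp
  have I0: "0 \<le> ?I" by (intro set_integral_nonneg' e0)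
  then show "Cschur \<ge> 0" by (simp add: Cschur_def)
  show "(\<integral>\<^sup>+y. ennreal (indicat_real {0<..} y * (fal \<eta> (min x y) * fbe \<eta> \<sigma> (max x y)) * fsc \<eta> y) \<partial>lborel) \<le> ennreal (Cschur * fsc \<eta> x)"
    if x: "x > 0" for x
  proof -
    have fs0: "0 \<le> fsc \<eta> x" by (simp add: fsc_def)
    have [measurable]: "ell \<sigma> \<in> borel_measurable borel" unfolding ell_def by measurable
    have "(\<integral>\<^sup>+y. ennreal (indicat_real {0<..} y * (fal \<eta> (min x y) * fbe \<eta> \<sigma> (max x y)) * fsc \<eta> y) \<partial>lborel)
      \<le> (\<integral>\<^sup>+y. ennreal (fsc \<eta> x) * (ennreal (indicat_real {0<..1} y * (exp ((1 - \<eta>) * ln y) * ell \<sigma> y)) + ennreal (indicat_real {1<..} y * exp (- \<bar>y - max x 1\<bar>))) \<partial>lborel)"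
    proof (rule nn_integral_mono)
      fix y
      have "indicat_real {0<..} y * (fal \<eta> (min x y) * fbe \<eta> \<sigma> (max x y)) * fsc \<eta> y
        \<le> fsc \<eta> x * (indicat_real {0<..1} y * (exp ((1 - \<eta>) * ln y) * ell \<sigma> y) + indicat_real {1<..} y * exp (- \<bar>y - max x 1\<bar>))"
        using schur_pointwise[OF x, of y] by (cases "y > 0") (auto simp: fsc_def)
      moreover have "0 \<le> indicat_real {0<..1} y * (exp ((1 - \<eta>) * ln y) * ell \<sigma> y)" "0 \<le> indicat_real {1<..} y * exp (- \<bar>y - max x 1\<bar>)"
        using e0 by (auto intro: mult_nonneg_nonneg)
      ultimately show "ennreal (indicat_real {0<..} y * (fal \<eta> (min x y) * fbe \<eta> \<sigma> (max x y)) * fsc \<eta> y)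
        \<le> ennreal (fsc \<eta> x) * (ennreal (indicat_real {0<..1} y * (exp ((1 - \<eta>) * ln y) * ell \<sigma> y)) + ennreal (indicat_real {1<..} y * exp (- \<bar>y - max x 1\<bar>)))"
        using fs0 by (simp flip: ennreal_plus ennreal_mult' add: ennreal_leI)
    qed
    also have "\<dots> = ennreal (fsc \<eta> x) * ((\<integral>\<^sup>+y. ennreal (indicat_real {0<..1} y * (exp ((1 - \<eta>) * ln y) * ell \<sigma> y)) \<partial>lborel)
        + (\<integral>\<^sup>+y. ennreal (indicat_real {1<..} y * exp (- \<bar>y - max x 1\<bar>)) \<partial>lborel))"
      by (subst nn_integral_cmult, measurable, subst nn_integral_add) auto
    also have "(\<integral>\<^sup>+y. ennreal (indicat_real {0<..1} y * (exp ((1 - \<eta>) * ln y) * ell \<sigma> y)) \<partial>lborel) = ennreal ?I"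
      using om_inner_int[OF \<eta>(2) \<sigma>] e0 unfolding set_integrable_def set_lebesgue_integral_def real_scaleR_def
      by (intro nn_integral_eq_integral) (auto intro!: mult_nonneg_nonneg)
    also have "ennreal (fsc \<eta> x) * (ennreal ?I + (\<integral>\<^sup>+y. ennreal (indicat_real {1<..} y * exp (- \<bar>y - max x 1\<bar>)) \<partial>lborel)) \<le> ennreal (fsc \<eta> x) * (ennreal ?I + ennreal 2)"
      by (intro mult_left_mono add_left_mono nn_integral_two_sided_exp) auto
    also have "\<dots> = ennreal (Cschur * fsc \<eta> x)"
    proof -
      have "ennreal ?I + ennreal 2 = ennreal Cschur" unfolding Cschur_def using I0 by (subst ennreal_plus) auto
      moreover have "ennreal (fsc \<eta> x) * ennreal Cschur = ennreal (fsc \<eta> x * Cschur)"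
        using fs0 by (rule ennreal_mult'[symmetric])
      ultimately show ?thesis by (simp only: mult.commute)
    qed
    finally show ?thesis .
  qed
qed

end

section \<open>Dilations and the main theorem\<close>

lemma AE_dilate:
  assumes "AE x in lborel. P (x::real)" "k \<noteq> 0" shows "AE x in lborel. P (k * x)"
proof -
  obtain N where N: "{x. \<not> P x} \<subseteq> N" "N \<in> null_sets lborel"
    using assms(1) unfolding eventually_ae_filter by auto
  then have "AE x in lborel. x \<notin> N" by (rule_tac AE_not_in)
  then have "AE x in lborel. 0 + k * x \<notin> N"
    using N assms(2) by (intro AE_borel_affine[where P="\<lambda>x. x \<notin> N"]) auto
  then show ?thesis using N by (auto elim: eventually_mono)
qed

lemma integrable_dilate:
  fixes f :: "real \<Rightarrow> 'a::{banach,second_countable_topology}"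
  assumes "k \<noteq> 0"
  shows "integrable lborel (\<lambda>x. f (k * x)) \<longleftrightarrow> integrable lborel f"
  using lborel_integrable_real_affine_iff[OF assms, of f 0] by simp

lemma integral_dilate:
  fixes f :: "real \<Rightarrow> 'a::{banach,second_countable_topology}"
  assumes "k > 0"
  shows "(LINT x|lborel. f (k * x)) = (LINT x|lborel. f x) /\<^sub>R k"
  using lborel_integral_real_affine[of k f 0] assms by simp

lemma ext0_dilate: "k > 0 \<Longrightarrow> ext0 (\<lambda>x. f (k * x)) x = ext0 f (k * x)"
  by (simp add: ext0_def zero_less_mult_iff)

lemma L2_dilate:
  assumes "L2 f" "k > 0" shows "L2 (\<lambda>x. f (k * x))"
proof -
  have eq: "ext0 (\<lambda>x. f (k * x)) = (\<lambda>x. ext0 f (k * x))" using ext0_dilate[OF assms(2)] by auto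
  note [measurable] = L2_meas[OF assms(1)]
  have "(\<lambda>x. ext0 f (k * x)) \<in> borel_measurable borel" by measurable
  moreover have "integrable lborel (\<lambda>x. (norm (ext0 f (k * x)))\<^sup>2)"
    using integrable_dilate[of k "\<lambda>x. (norm (ext0 f x))\<^sup>2"] L2_int[OF assms(1)] assms(2) by simp
  ultimately show ?thesis by (simp add: L2_iff eq)
qed

lemma L2norm_dilate:
  assumes "k > 0" shows "L2norm (\<lambda>x. f (k * x)) = L2norm f / sqrt k"
proof -
  have "(LINT x|lborel. (norm (ext0 f (k * x)))\<^sup>2) = (LINT x|lborel. (norm (ext0 f x))\<^sup>2) / k"
    using integral_dilate[OF assms, of "\<lambda>x. (norm (ext0 f x))\<^sup>2"] by (simp add: divide_inverse_commute)
  then show ?thesis by (simp add: L2norm_eq ext0_dilate[OF assms] real_sqrt_divide)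
qed

lemma L2norm_cmult: "L2norm (\<lambda>x. c * f x) = norm c * L2norm f"
proof -
  have "(\<lambda>x. (norm (ext0 (\<lambda>x. c * f x) x))\<^sup>2) = (\<lambda>x. (norm c)\<^sup>2 * (norm (ext0 f x))\<^sup>2)"
    by (auto simp: fun_eq_iff ext0_def norm_mult power_mult_distrib)
  then show ?thesis by (simp add: L2norm_eq real_sqrt_mult)
qed

lemma ip_dilate:
  assumes "k > 0" shows "ip (\<lambda>x. f (k * x)) (\<lambda>x. g (k * x)) = ip f g / of_real k"
proof -
  have "ip f g = (LINT x|lborel. indicat_real {0<..} x *\<^sub>R (cnj (f x) * g x))" for f g
    by (simp add: ip_def set_lebesgue_integral_def)
  moreover have "indicat_real {0<..} x = indicat_real {0<..} (k * x)" for x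
    using assms by (simp add: indicator_def zero_less_mult_iff)
  ultimately have "ip (\<lambda>x. f (k * x)) (\<lambda>x. g (k * x)) = (LINT x|lborel. indicat_real {0<..} (k * x) *\<^sub>R (cnj (f (k * x)) * g (k * x)))"
    by simp
  also have "\<dots> = ip f g / of_real k"
    using integral_dilate[OF assms, of "\<lambda>x. indicat_real {0<..} x *\<^sub>R (cnj (f x) * g x)"]
    by (simp add: ip_def set_lebesgue_integral_def scaleR_conv_of_real divide_inverse_commute)
  finally show ?thesis .
qed

lemma ae_eq_dilate:
  assumes "ae_eq f g" "k > 0" shows "ae_eq (\<lambda>x. f (k * x)) (\<lambda>x. g (k * x))"
  using AE_dilate[OF assms(1)[unfolded ae_eq_def], of k] assms(2) unfolding ae_eq_def
  by (auto elim!: eventually_mono simp: zero_less_mult_iff)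

lemma ac_dilate:
  fixes F :: "real \<Rightarrow> complex"
  assumes "ac F f" "k > 0" shows "ac (\<lambda>x. F (k * x)) (\<lambda>x. of_real k * f (k * x))"
proof (rule acI)
  fix a b :: real assume ab: "0 < a" "a \<le> b"
  have kab: "0 < k * a" "k * a \<le> k * b" using ab assms(2) by (auto intro: mult_left_mono)
  have ind: "indicat_real {a..b} x = indicat_real {k * a..k * b} (k * x)" for x
    using assms(2) by (simp add: indicator_def mult_le_cancel_left)
  have eq: "(\<lambda>x. indicat_real {a..b} x *\<^sub>R (of_real k * f (k * x))) = (\<lambda>x. of_real k * (indicat_real {k * a..k * b} (k * x) *\<^sub>R f (k * x)))"
    by (auto simp: ind fun_eq_iff)
  have i: "integrable lborel (\<lambda>x. indicat_real {k * a..k * b} (k * x) *\<^sub>R f (k * x))"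
    using ac_integrable[OF assms(1) kab(1), of "k * b"] assms(2)
      integrable_dilate[of k "\<lambda>x. indicat_real {k * a..k * b} x *\<^sub>R f x"] by (simp add: set_integrable_def)
  then show "set_integrable lborel {a..b} (\<lambda>x. of_real k * f (k * x))"
    unfolding set_integrable_def eq by (rule integrable_mult_right)
  have "(LINT x:{a..b}|lborel. of_real k * f (k * x)) = of_real k * (LINT x|lborel. indicat_real {k * a..k * b} (k * x) *\<^sub>R f (k * x))"
    unfolding set_lebesgue_integral_def eq by (rule integral_mult_right_zero)
  also have "\<dots> = (LINT x:{k * a..k * b}|lborel. f x)"
    using integral_dilate[OF assms(2), of "\<lambda>x. indicat_real {k * a..k * b} x *\<^sub>R f x"] assms(2)
    by (simp add: set_lebesgue_integral_def scaleR_conv_of_real)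
  also have "\<dots> = F (k * b) - F (k * a)" using ac_eq[OF assms(1) kab] by simp
  finally show "F (k * b) - F (k * a) = (LINT x:{a..b}|lborel. of_real k * f (k * x))" by simp
qed

lemma AC1_data_iff: "AC1_data f f' f'' \<longleftrightarrow> (\<forall>x>0. (f has_vector_derivative f' x) (at x)) \<and> ac f' f''"
  by (auto simp: AC1_data_def loc_int_def ac_def)

text \<open>The inverse square term is homogeneous of degree -2, so a dilation alters only
  \<open>Q\<close>, and the boundary form merely acquires a constant factor.\<close>

lemma Hm_dilate:
  assumes H: "Hm Q m f h" and k: "k > 0"
  shows "Hm (\<lambda>x. of_real (k\<^sup>2) * Q (k * x)) m (\<lambda>x. f (k * x)) (\<lambda>x. of_real (k\<^sup>2) * h (k * x))"
proof -
  obtain f' f'' where 1: "L2 f" "L2 h" "AC1_data f f' f''"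
      "AE x in lborel. 0 < x \<longrightarrow> h x = - f'' x + ((m\<^sup>2 - 1/4) / (of_real x)\<^sup>2) * f x + Q x * f x"
      "((\<lambda>x. pw m x * f' x - pw' m x * f x) \<longlongrightarrow> 0) (at_right 0)"
    using H unfolding Hm_def by blast
  have d: "((\<lambda>x. f (k * x)) has_vector_derivative of_real k * f' (k * x)) (at x)" if x: "x > 0" for x
  proof -
    have "(f has_vector_derivative f' (k * x)) (at (k * x))" using 1(3) k x by (simp add: AC1_data_def)
    moreover have "((\<lambda>x. k * x) has_vector_derivative k) (at x)"
      by (auto intro!: derivative_eq_intros)
    ultimately have "((f \<circ> (\<lambda>x. k * x)) has_vector_derivative k *\<^sub>R f' (k * x)) (at x)"
      by (intro vector_diff_chain_at)
    then show ?thesis by (simp add: comp_def scaleR_conv_of_real)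
  qed
  have a2: "ac (\<lambda>x. of_real k * f' (k * x)) (\<lambda>x. of_real k * (of_real k * f'' (k * x)))"
    using 1(3) k by (intro ac_cmult ac_dilate) (simp_all add: AC1_data_iff)
  have lim: "((\<lambda>x. pw m x * (of_real k * f' (k * x)) - pw' m x * f (k * x)) \<longlongrightarrow> 0) (at_right 0)"
  proof -
    \<comment> \<open>c = k^(1/2 - m), the factor for which
      \<open>c * pw m (k x) = k * pw m x\<close> and
      \<open>c * pw' m (k x) = pw' m x\<close>.\<close>
    define c where "c = exp ((1/2 - m) * lnc k)"
    have "filterlim (\<lambda>x. k * x) (at_right 0) (at_right 0)"
      using k by real_asymp
    from filterlim_compose[OF 1(5) this]
    have "((\<lambda>x. c * (pw m (k * x) * f' (k * x) - pw' m (k * x) * f (k * x))) \<longlongrightarrow> 0) (at_right 0)"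
      by (rule tendsto_mult_right_zero)
    moreover have "\<forall>\<^sub>F x in at_right 0. c * (pw m (k * x) * f' (k * x) - pw' m (k * x) * f (k * x)) = pw m x * (of_real k * f' (k * x)) - pw' m x * f (k * x)"
      using eventually_at_right_less[of "0::real"]
    proof eventually_elim
      case (elim x)
      have l: "lnc (k * x) = lnc k + lnc x" using k elim by (simp add: lnc_def ln_mult)
      have "c * pw m (k * x) = exp ((1/2 - m) * lnc k + (1/2 + m) * (lnc k + lnc x))"
        using k elim by (simp add: c_def pw_exp l exp_add)
      also have "(1/2 - m) * lnc k + (1/2 + m) * (lnc k + lnc x) = lnc k + (1/2 + m) * lnc x"
        by (simp add: field_simps)
      finally have p: "c * pw m (k * x) = of_real k * pw m x" using k elim by (simp add: exp_add exp_lnc pw_exp)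
      have "c * pw' m (k * x) = (1/2 + m) / of_real (k * x) * (c * pw m (k * x))"
        using k elim pw'_eq[of "k * x" m] by simp
      also have "\<dots> = pw' m x" unfolding p using k elim pw'_eq[of x m] by simp
      finally have p': "c * pw' m (k * x) = pw' m x" .
      have "c * (pw m (k * x) * f' (k * x) - pw' m (k * x) * f (k * x)) = (c * pw m (k * x)) * f' (k * x) - (c * pw' m (k * x)) * f (k * x)"
        by (simp add: algebra_simps)
      then show ?case unfolding p p' by simp
    qed
    ultimately show ?thesis by (simp add: tendsto_cong)
  qed
  have ae: "AE x in lborel. 0 < x \<longrightarrow> of_real (k\<^sup>2) * h (k * x) = - (of_real k * (of_real k * f'' (k * x)))
      + ((m\<^sup>2 - 1/4) / (of_real x)\<^sup>2) * f (k * x) + of_real (k\<^sup>2) * Q (k * x) * f (k * x)"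
  proof -
    have "AE x in lborel. 0 < k * x \<longrightarrow> h (k * x) = - f'' (k * x) + ((m\<^sup>2 - 1/4) / (of_real (k * x))\<^sup>2) * f (k * x) + Q (k * x) * f (k * x)"
      using AE_dilate[OF 1(4), of k] k by simp
    then show ?thesis
    proof eventually_elim
      case (elim x)
      show ?case
      proof
        assume x: "0 < x"
        have "of_real (k\<^sup>2) * ((m\<^sup>2 - 1/4) / (of_real (k * x))\<^sup>2) = (m\<^sup>2 - 1/4) / (complex_of_real x)\<^sup>2"
          using k by (simp add: power_mult_distrib)
        then have "of_real (k\<^sup>2) * (- f'' (k * x) + ((m\<^sup>2 - 1/4) / (of_real (k * x))\<^sup>2) * f (k * x) + Q (k * x) * f (k * x))
          = - (of_real (k\<^sup>2) * f'' (k * x)) + ((m\<^sup>2 - 1/4) / (of_real x)\<^sup>2) * f (k * x) + of_real (k\<^sup>2) * Q (k * x) * f (k * x)"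
          by (simp only: distrib_left mult_minus_right mult.assoc[symmetric])
        then show "of_real (k\<^sup>2) * h (k * x) = - (of_real k * (of_real k * f'' (k * x)))
          + ((m\<^sup>2 - 1/4) / (of_real x)\<^sup>2) * f (k * x) + of_real (k\<^sup>2) * Q (k * x) * f (k * x)"
          using elim k x by (simp add: power2_eq_square)
      qed
    qed
  qed
  have A: "AC1_data (\<lambda>x. f (k * x)) (\<lambda>x. of_real k * f' (k * x)) (\<lambda>x. of_real k * (of_real k * f'' (k * x)))"
    unfolding AC1_data_iff using d a2 by simp
  show ?thesis
    unfolding Hm_def
    by (intro conjI exI) (rule L2_dilate[OF 1(1) k] L2_cmult[OF L2_dilate[OF 1(2) k]] A ae lim)+
qed

definition Qs :: "real \<Rightarrow> (real \<Rightarrow> complex) \<Rightarrow> real \<Rightarrow> complex" where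
  "Qs k Q x = of_real (1 / k\<^sup>2) * Q (x / k)"

lemma Hm_Qs_D:
  assumes "Hm (Qs k Q) m f h" "k > 0"
  shows "Hm Q m (\<lambda>x. f (k * x)) (\<lambda>x. of_real (k\<^sup>2) * h (k * x))"
proof -
  have "(\<lambda>x. of_real (k\<^sup>2) * Qs k Q (k * x)) = Q" using assms(2) by (auto simp: Qs_def fun_eq_iff)
  then show ?thesis using Hm_dilate[OF assms] by simp
qed

lemma Hm_Qs_I:
  assumes "Hm Q m f h" "k > 0"
  shows "Hm (Qs k Q) m (\<lambda>x. f (x / k)) (\<lambda>x. of_real (1 / k\<^sup>2) * h (x / k))"
proof -
  have "(\<lambda>x. of_real ((1 / k)\<^sup>2) * Q (1 / k * x)) = Qs k Q" by (auto simp: Qs_def fun_eq_iff power_divide)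
  then show ?thesis using Hm_dilate[OF assms(1), of "1 / k"] assms(2) by (simp add: power_divide)
qed

text \<open>The dilation conjugates \<open>Hm (Qs k Q) m + 1\<close> to \<open>Hm Q m + k^2\<close>
  divided by k^2. It scales the norms on both sides by the same factor, so the resolvent bound
  \<open>C\<close> becomes \<open>C / k^2\<close>.\<close>

lemma in_resolvent_Qs:
  assumes R: "in_resolvent (Hm (Qs k Q) m) (-1)" and k: "k > 0"
  shows "in_resolvent (Hm Q m) (- of_real (k\<^sup>2))"
  unfolding in_resolvent_def
proof (intro conjI allI impI)
  fix g assume "L2 g"
  then have "L2 (\<lambda>x. of_real (1 / k\<^sup>2) * g (1 / k * x))" using k by (intro L2_cmult L2_dilate) auto
  then obtain f where f: "Hm (Qs k Q) m f (\<lambda>x. of_real (1 / k\<^sup>2) * g (1 / k * x) + (-1) * f x)"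
    using R unfolding in_resolvent_def by meson
  have "(\<lambda>x. of_real (k\<^sup>2) * (of_real (1 / k\<^sup>2) * g (1 / k * (k * x)) + (-1) * f (k * x))) = (\<lambda>x. g x + - of_real (k\<^sup>2) * f (k * x))"
    using k by (auto simp: fun_eq_iff algebra_simps)
  then show "\<exists>f. Hm Q m f (\<lambda>x. g x + - of_real (k\<^sup>2) * f x)"
    using Hm_Qs_D[OF f k] by (intro exI[of _ "\<lambda>x. f (k * x)"]) simp
next
  fix f1 h1 f2 h2
  assume H: "Hm Q m f1 h1" "Hm Q m f2 h2" "ae_eq (\<lambda>x. h1 x - - of_real (k\<^sup>2) * f1 x) (\<lambda>x. h2 x - - of_real (k\<^sup>2) * f2 x)"
  have "ae_eq (\<lambda>x. of_real (1 / k\<^sup>2) * h1 (x / k) - (-1) * f1 (x / k)) (\<lambda>x. of_real (1 / k\<^sup>2) * h2 (x / k) - (-1) * f2 (x / k))"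
    using ae_eq_dilate[OF H(3), of "1 / k"] k unfolding ae_eq_def
    by (auto elim!: eventually_mono simp: field_simps)
  then have "ae_eq (\<lambda>x. f1 (x / k)) (\<lambda>x. f2 (x / k))"
    using R Hm_Qs_I[OF H(1) k] Hm_Qs_I[OF H(2) k] unfolding in_resolvent_def by meson
  from ae_eq_dilate[OF this k] show "ae_eq f1 f2" using k by simp
next
  obtain C where C: "\<And>f h. Hm (Qs k Q) m f h \<Longrightarrow> L2norm f \<le> C * L2norm (\<lambda>x. h x - (-1) * f x)"
    using R unfolding in_resolvent_def by meson
  show "\<exists>C. \<forall>f h. Hm Q m f h \<longrightarrow> L2norm f \<le> C * L2norm (\<lambda>x. h x - - of_real (k\<^sup>2) * f x)"
  proof (intro exI allI impI)
    fix f h assume H: "Hm Q m f h"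
    have "(\<lambda>x. of_real (1 / k\<^sup>2) * h (x / k) - (-1) * f (x / k)) = (\<lambda>x. of_real (1 / k\<^sup>2) * (h (1 / k * x) - - of_real (k\<^sup>2) * f (1 / k * x)))"
      using k by (auto simp: fun_eq_iff field_simps)
    then have "L2norm (\<lambda>x. of_real (1 / k\<^sup>2) * h (x / k) - (-1) * f (x / k)) = 1 / k\<^sup>2 * (L2norm (\<lambda>x. h x - - of_real (k\<^sup>2) * f x) / sqrt (1 / k))"
      using L2norm_dilate[of "1 / k" "\<lambda>x. h x - - of_real (k\<^sup>2) * f x"] k by (simp only: L2norm_cmult) (simp add: norm_divide norm_power)
    moreover have "L2norm f / sqrt (1 / k) \<le> C * L2norm (\<lambda>x. of_real (1 / k\<^sup>2) * h (x / k) - (-1) * f (x / k))"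
      using C[OF Hm_Qs_I[OF H k]] L2norm_dilate[of "1 / k" f] k by simp
    ultimately have "L2norm f / sqrt (1 / k) \<le> (C / k\<^sup>2 * L2norm (\<lambda>x. h x - - of_real (k\<^sup>2) * f x)) / sqrt (1 / k)"
      by simp
    then show "L2norm f \<le> C / k\<^sup>2 * L2norm (\<lambda>x. h x - - of_real (k\<^sup>2) * f x)"
      using k by (simp only: divide_le_cancel) simp
  qed
qed

text \<open>\<open>resolv\<close> is a choice, so the two resolvents are matched through the
  uniqueness clause at -k^2. The final division by k is the Jacobian of the dilation.\<close>

lemma ip_resolv_Qs:
  assumes R: "in_resolvent (Hm (Qs k Q) m) (-1)" and k: "k > 0" and f: "L2 f" and g: "L2 g"
  shows "ip f (resolv (Hm Q m) (- of_real (k\<^sup>2)) g)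
    = ip (\<lambda>x. f (1 / k * x)) (resolv (Hm (Qs k Q) m) (-1) (\<lambda>x. of_real (1 / k\<^sup>2) * g (1 / k * x))) / of_real k"
proof -
  let ?g = "\<lambda>x. of_real (1 / k\<^sup>2) * g (1 / k * x)"
  let ?r = "resolv (Hm (Qs k Q) m) (-1) ?g" and ?F = "resolv (Hm Q m) (- of_real (k\<^sup>2)) g"
  note R' = in_resolvent_Qs[OF R k]
  have g': "L2 ?g" using g k by (intro L2_cmult L2_dilate) auto
  have H1: "Hm (Qs k Q) m ?r (\<lambda>x. ?g x + (-1) * ?r x)"
    using R g' someI_ex[of "\<lambda>f. Hm (Qs k Q) m f (\<lambda>x. ?g x + (-1) * f x)"] unfolding in_resolvent_def resolv_def by blast
  have H2: "Hm Q m ?F (\<lambda>x. g x + - of_real (k\<^sup>2) * ?F x)"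
    using R' g someI_ex[of "\<lambda>f. Hm Q m f (\<lambda>x. g x + - of_real (k\<^sup>2) * f x)"] unfolding in_resolvent_def resolv_def by blast
  have "(\<lambda>x. of_real (k\<^sup>2) * (?g (k * x) + (-1) * ?r (k * x))) = (\<lambda>x. g x + - of_real (k\<^sup>2) * ?r (k * x))"
    using k by (auto simp: fun_eq_iff algebra_simps)
  then have H3: "Hm Q m (\<lambda>x. ?r (k * x)) (\<lambda>x. g x + - of_real (k\<^sup>2) * ?r (k * x))"
    using Hm_Qs_D[OF H1 k] by simp
  have "ae_eq (\<lambda>x. (g x + - of_real (k\<^sup>2) * ?F x) - - of_real (k\<^sup>2) * ?F x) (\<lambda>x. (g x + - of_real (k\<^sup>2) * ?r (k * x)) - - of_real (k\<^sup>2) * ?r (k * x))"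
    by (simp add: ae_eq_def)
  then have ae: "ae_eq ?F (\<lambda>x. ?r (k * x))"
    using R' H2 H3 unfolding in_resolvent_def by meson
  have "ip f ?F = ip f (\<lambda>x. ?r (k * x))"
    using H2 H3 by (intro ip_cong_AE f ae) (auto simp: Hm_def)
  also have "\<dots> = ip (\<lambda>x. (\<lambda>x. f (1 / k * x)) (k * x)) (\<lambda>x. ?r (k * x))" using k by simp
  also have "\<dots> = ip (\<lambda>x. f (1 / k * x)) ?r / of_real k"
    by (rule ip_dilate[OF k])
  finally show ?thesis .
qed

section \<open>Smallness of the dilated potential\<close>

lemma ext0_meas_loc_int:
  assumes "loc_int Q" shows "ext0 Q \<in> borel_measurable borel"
proof (rule borel_measurable_LIMSEQ_metric)
  fix n :: nat
  have "set_integrable lborel {1 / real (Suc n)..real (Suc n)} Q"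
    using assms unfolding loc_int_def by (auto simp: field_simps)
  then show "(\<lambda>x. indicat_real {1 / real (Suc n)..real (Suc n)} x *\<^sub>R Q x) \<in> borel_measurable borel"
    using borel_measurable_integrable unfolding set_integrable_def by fastforce
next
  fix x :: real
  show "(\<lambda>n. indicat_real {1 / real (Suc n)..real (Suc n)} x *\<^sub>R Q x) \<longlonglongrightarrow> ext0 Q x"
  proof (cases "x > 0")
    case True
    obtain N1 :: nat where "real N1 \<ge> x" using real_arch_simple by blast
    moreover obtain N2 :: nat where "real N2 \<ge> 1 / x" using real_arch_simple by blast
    ultimately have N: "x \<le> real (N1 + N2)" "1 / x \<le> real (N1 + N2)" by auto
    have "\<forall>\<^sub>F n in sequentially. indicat_real {1 / real (Suc n)..real (Suc n)} x *\<^sub>R Q x = ext0 Q x"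
      using eventually_ge_at_top[of "N1 + N2"]
    proof eventually_elim
      case (elim n)
      then have "real (N1 + N2) \<le> real n" by (simp only: of_nat_le_iff)
      then have "x \<le> real (Suc n)" "1 / x \<le> real (Suc n)" using N by auto
      then have "x \<in> {1 / real (Suc n)..real (Suc n)}" using True by (simp add: field_simps)
      then show ?case using True by simp
    qed
    then show ?thesis by (rule tendsto_eventually)
  next
    case False
    then have "x \<notin> {1 / real (Suc n)..real (Suc n)}" for n
      by (auto simp: not_le intro: order.strict_trans1[of x 0])
    then show ?thesis using False by simp
  qed
qed

text \<open>After the substitution x = k y the weighted integral of \<open>Qs k Q\<close> has weight
  \<open>om (k y) / k\<close>; this bound is the majorant independent of k.\<close>

lemma om_dilate_le:
  assumes "0 \<le> \<eta>" "0 \<le> \<sigma>" "k \<ge> 1" "y > 0"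
  shows "om \<eta> \<sigma> (k * y) / k \<le> om \<eta> \<sigma> y"
proof -
  have l: "ell \<sigma> z \<ge> 1" for z by (rule ell_ge_1[OF assms(2)])
  consider "y > 1" | "y \<le> 1" "k * y > 1" | "y \<le> 1" "k * y \<le> 1" by linarith
  then show ?thesis
  proof cases
    case 1
    have "1 * 1 < k * y" using 1 assms by (intro mult_le_less_imp_less) auto
    then show ?thesis using 1 assms by (simp add: om_def)
  next
    case 2
    have "\<eta> * ln y \<le> 0" using 2 assms by (intro mult_nonneg_nonpos) auto
    then have "ln y \<le> (1 - \<eta>) * ln y" by (simp add: algebra_simps)
    then have "exp (ln y) * 1 \<le> exp ((1 - \<eta>) * ln y) * ell \<sigma> y" using l[of y] by (intro mult_mono) auto
    moreover have "1 / k \<le> y" using 2 assms by (simp add: field_simps)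
    ultimately show ?thesis using 2 assms by (simp add: om_def)
  next
    case 3
    have y: "ln (k * y) = ln k + ln y" using assms by (simp add: ln_mult)
    have "\<eta> * ln k \<ge> 0" using assms by simp
    then have "(1 - \<eta>) * ln (k * y) \<le> ln k + (1 - \<eta>) * ln y" unfolding y by (simp add: algebra_simps)
    then have "exp ((1 - \<eta>) * ln (k * y)) \<le> k * exp ((1 - \<eta>) * ln y)"
      using assms by (metis exp_add exp_le_cancel_iff exp_ln order.strict_trans2 zero_less_one)
    moreover have "ell \<sigma> (k * y) \<le> ell \<sigma> y" using 3 assms by (intro ell_antimono) auto
    ultimately have "exp ((1 - \<eta>) * ln (k * y)) * ell \<sigma> (k * y) \<le> k * exp ((1 - \<eta>) * ln y) * ell \<sigma> y"
      using l[of "k * y"] assms(3) by (intro mult_mono) auto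
    then show ?thesis using 3 assms by (simp add: om_def field_simps)
  qed
qed

lemma om_nn: "0 \<le> \<sigma> \<Longrightarrow> 0 \<le> om \<eta> \<sigma> x"
  using ell_ge_1[of \<sigma> x] by (simp add: om_def)

text \<open>For fixed y the substituted weight is 1 / k as soon as k y > 1, so the integrand tends
  to 0 pointwise and dominated convergence applies. No rate is obtained, hence no positive power of
  x has to be spared.\<close>

lemma Qs_small:
  assumes \<eta>: "0 \<le> \<eta>" and \<sigma>: "0 \<le> \<sigma>" and Qm: "ext0 Q \<in> borel_measurable borel"
    and Qi: "set_integrable lborel {0<..} (\<lambda>x. om \<eta> \<sigma> x * norm (Q x))"
  defines "I \<equiv> \<lambda>k. LINT x:{0<..}|lborel. om \<eta> \<sigma> x * norm (Qs k Q x)"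
  shows "k \<ge> 1 \<Longrightarrow> set_integrable lborel {0<..} (\<lambda>x. om \<eta> \<sigma> x * norm (Qs k Q x))"
    and "(\<lambda>n. I (real (Suc n))) \<longlonglongrightarrow> 0"
proof -
  let ?J = "\<lambda>k y. om \<eta> \<sigma> (k * y) / k * norm (ext0 Q y)"
  note [measurable] = Qm
  have [measurable]: "om \<eta> \<sigma> \<in> borel_measurable borel" unfolding om_def ell_def by measurable
  have Q0: "integrable lborel (\<lambda>y. om \<eta> \<sigma> y * norm (ext0 Q y))"
  proof -
    have "(\<lambda>x. indicat_real {0<..} x *\<^sub>R (om \<eta> \<sigma> x * norm (Q x))) = (\<lambda>y. om \<eta> \<sigma> y * norm (ext0 Q y))"
      by (auto simp: fun_eq_iff indicator_def ext0_def)
    then show ?thesis using Qi by (simp add: set_integrable_def)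
  qed
  have bd: "norm (?J k y) \<le> om \<eta> \<sigma> y * norm (ext0 Q y)" if "k \<ge> 1" for k y
  proof (cases "y > 0")
    case True
    have "0 \<le> om \<eta> \<sigma> (k * y) / k" using om_nn[OF \<sigma>] that by simp
    then show ?thesis using mult_right_mono[OF om_dilate_le[OF \<eta> \<sigma> that True], of "norm (ext0 Q y)"] that by (simp add: abs_mult om_nn[OF \<sigma>])
  qed simp
  have Ji: "integrable lborel (?J k)" if "k \<ge> 1" for k
    by (rule Bochner_Integration.integrable_bound[OF Q0]) (measurable, use bd[OF that] in \<open>auto intro!: AE_I2 intro: order.trans[OF _ abs_ge_self]\<close>)
  have eq: "indicat_real {0<..} (k * y) *\<^sub>R (om \<eta> \<sigma> (k * y) * norm (Qs k Q (k * y))) = ?J k y / k" if "k \<ge> 1" for k y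
    using that by (auto simp: Qs_def norm_mult norm_divide norm_power indicator_def zero_less_mult_iff ext0_def power2_eq_square field_simps)
  have sub: "integrable lborel (\<lambda>x. indicat_real {0<..} x *\<^sub>R (om \<eta> \<sigma> x * norm (Qs k Q x)))
     \<and> (LINT x|lborel. indicat_real {0<..} x *\<^sub>R (om \<eta> \<sigma> x * norm (Qs k Q x))) = (LINT y|lborel. ?J k y)" if k: "k \<ge> 1" for k
  proof -
    let ?f = "\<lambda>x. indicat_real {0<..} x *\<^sub>R (om \<eta> \<sigma> x * norm (Qs k Q x))"
    have fe: "(\<lambda>y. ?f (k * y)) = (\<lambda>y. ?J k y / k)" using eq[OF k] by (simp add: fun_eq_iff)
    have "integrable lborel (\<lambda>y. ?f (k * y))" unfolding fe by (rule integrable_divide_zero[OF Ji[OF k]])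
    then have 1: "integrable lborel ?f" using integrable_dilate[of k ?f] k by simp
    have "(LINT y|lborel. ?f (k * y)) = (LINT y|lborel. ?J k y) / k" unfolding fe by (rule integral_divide_zero)
    then have 2: "(LINT x|lborel. ?f x) = (LINT y|lborel. ?J k y)"
      using integral_dilate[of k ?f] k by (simp add: field_simps)
    show ?thesis using 1 2 by blast
  qed
  show "set_integrable lborel {0<..} (\<lambda>x. om \<eta> \<sigma> x * norm (Qs k Q x))" if "k \<ge> 1"
    using sub[OF that] by (simp add: set_integrable_def)
  have "(\<lambda>n. LINT y|lborel. ?J (real (Suc n)) y) \<longlonglongrightarrow> (LINT y::real|lborel. (0::real))"
  proof (rule integral_dominated_convergence[OF _ _ Q0])
    show "AE y in lborel. (\<lambda>n. ?J (real (Suc n)) y) \<longlonglongrightarrow> 0"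
    proof (rule AE_I2)
      fix y :: real
      show "(\<lambda>n. ?J (real (Suc n)) y) \<longlonglongrightarrow> 0"
      proof (cases "y > 0")
        case True
        obtain N :: nat where N: "real N \<ge> 1 / y" using real_arch_simple by blast
        have "\<forall>\<^sub>F n in sequentially. 1 / real (Suc n) * norm (ext0 Q y) = ?J (real (Suc n)) y"
          using eventually_ge_at_top[of N]
        proof eventually_elim
          case (elim n)
          then have "real N \<le> real n" by simp
          then have "1 / y < real (Suc n)" using N by linarith
          then have "1 < real (Suc n) * y" using True by (simp add: field_simps)
          then show ?case by (simp add: om_def)
        qed
        moreover have "(\<lambda>n. 1 / real (Suc n) * norm (ext0 Q y)) \<longlonglongrightarrow> 0"
          using LIMSEQ_inverse_real_of_nat by (intro tendsto_mult_left_zero) (simp add: inverse_eq_divide)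
        ultimately show ?thesis by (rule Lim_transform_eventually[rotated])
      qed simp
    qed
    show "AE y in lborel. norm (?J (real (Suc n)) y) \<le> om \<eta> \<sigma> y * norm (ext0 Q y)" for n
      by (intro AE_I2 bd) simp
  qed measurable
  moreover have "I (real (Suc n)) = (LINT y|lborel. ?J (real (Suc n)) y)" for n
    using sub[of "real (Suc n)"] by (simp add: I_def set_lebesgue_integral_def)
  ultimately show "(\<lambda>n. I (real (Suc n))) \<longlonglongrightarrow> 0" by simp
qed

text \<open>One spectral point and one relative ball around \<open>m0\<close> serve both continuity
  on \<open>\<Omega>\<close> and holomorphy in its interior. The spectral point may depend on
  \<open>m0\<close>, as k does.\<close>

definition locally_regular :: "(complex \<Rightarrow> graph) \<Rightarrow> complex set \<Rightarrow> complex \<Rightarrow> bool" where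
  "locally_regular H \<Omega> m0 \<longleftrightarrow> (\<exists>lam e. e > 0 \<and> (\<forall>z\<in>\<Omega> \<inter> ball m0 e. in_resolvent (H z) lam) \<and>
     (\<forall>f g. L2 f \<longrightarrow> L2 g \<longrightarrow> reg (\<Omega> \<inter> ball m0 e) (\<lambda>z. ip f (resolv (H z) lam g))))"

lemma regular_familyI:
  assumes "\<And>m0. m0 \<in> \<Omega> \<Longrightarrow> locally_regular H \<Omega> m0"
  shows "regular_family H \<Omega>"
  unfolding regular_family_def
proof
  show "continuous_family H \<Omega>"
    unfolding continuous_family_def
  proof
    fix z0 assume "z0 \<in> \<Omega>"
    then show "\<exists>lam e. e > 0 \<and> (\<forall>z\<in>\<Omega> \<inter> ball z0 e. in_resolvent (H z) lam) \<and>
        (\<forall>f g. L2 f \<longrightarrow> L2 g \<longrightarrow> continuous_on (\<Omega> \<inter> ball z0 e) (\<lambda>z. ip f (resolv (H z) lam g)))"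
      using assms[of z0] unfolding locally_regular_def reg_def by blast
  qed
  show "holomorphic_family H (interior \<Omega>)"
    unfolding holomorphic_family_def
  proof
    fix z0 assume z0: "z0 \<in> interior \<Omega>"
    then have "z0 \<in> \<Omega>" using interior_subset by blast
    then obtain lam e where e: "e > 0" "\<And>z. z \<in> \<Omega> \<inter> ball z0 e \<Longrightarrow> in_resolvent (H z) lam"
      "\<And>f g. L2 f \<Longrightarrow> L2 g \<Longrightarrow> reg (\<Omega> \<inter> ball z0 e) (\<lambda>z. ip f (resolv (H z) lam g))"
      using assms[of z0] unfolding locally_regular_def by blast
    let ?T = "interior \<Omega> \<inter> ball z0 e"
    have sub: "?T \<subseteq> \<Omega> \<inter> ball z0 e" using interior_subset by blast
    have subi: "?T \<subseteq> interior (\<Omega> \<inter> ball z0 e)" by (simp add: interior_Int)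
    show "\<exists>lam \<Theta>0. open \<Theta>0 \<and> z0 \<in> \<Theta>0 \<and> \<Theta>0 \<subseteq> interior \<Omega> \<and> (\<forall>z\<in>\<Theta>0. in_resolvent (H z) lam) \<and>
        (\<forall>f g. L2 f \<longrightarrow> L2 g \<longrightarrow> (\<lambda>z. ip f (resolv (H z) lam g)) holomorphic_on \<Theta>0)"
    proof (intro exI[of _ lam] exI[of _ ?T] conjI ballI allI impI)
      show "in_resolvent (H z) lam" if "z \<in> ?T" for z using e(2) sub that by blast
      show "(\<lambda>z. ip f (resolv (H z) lam g)) holomorphic_on ?T" if "L2 f" "L2 g" for f g
        using e(3)[OF that] subi unfolding reg_def by (blast intro: holomorphic_on_subset)
    qed (use z0 e in auto)
  qed
qed

text \<open>k is chosen so large that the Jost function at \<open>m0\<close> is closer to the free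
  one than the size of the latter; continuity in \<open>m\<close> then gives a smaller ball without
  zeros. \<open>\<eta>\<close>, \<open>\<sigma>\<close> and \<open>C0\<close> stay free so that each
  case of the theorem is an instance.\<close>

lemma Hm_locally_regular:
  assumes Q: "loc_int Q" "Linf0 Q" and \<eta>: "0 \<le> \<eta>" "\<eta> < 2" and \<sigma>: "0 \<le> \<sigma>" and C0: "0 \<le> C0"
    and Q0: "set_integrable lborel {0<..1} (\<lambda>x. exp ((1 - \<eta>) * ln x) * ell \<sigma> x * norm (Q x))"
    and m0: "m0 \<in> \<Omega>" and e0: "e0 > 0"
    and S\<eta>: "\<And>m. m \<in> \<Omega> \<inter> ball m0 e0 \<Longrightarrow> - (\<eta> / 2) \<le> Re m"
    and Sshm: "\<And>m t. m \<in> \<Omega> \<inter> ball m0 e0 \<Longrightarrow> norm (shm m (of_real t)) \<le> C0 * (1 + \<sigma> * \<bar>t\<bar>) * exp (\<bar>Re m\<bar> * \<bar>t\<bar>)"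
  shows "locally_regular (Hm Q) \<Omega> m0"
proof -
  define M where "M = norm m0 + e0"
  let ?S = "\<Omega> \<inter> ball m0 e0"
  have SM: "norm m \<le> M" if "m \<in> ?S" for m
    using that norm_triangle_sub[of m m0] by (auto simp: M_def dist_norm norm_minus_commute)
  have Qm: "ext0 Q \<in> borel_measurable borel" by (rule ext0_meas_loc_int[OF Q(1)])
  have Qi: "set_integrable lborel {0<..} (\<lambda>x. om \<eta> \<sigma> x * norm (Q x))"
  proof -
    have 1: "set_integrable lborel {0<..1} (\<lambda>x. om \<eta> \<sigma> x * norm (Q x))"
      using Q0 by (subst set_integrable_cong[of lborel lborel "{0<..1}" "{0<..1}" _ "\<lambda>x. exp ((1 - \<eta>) * ln x) * ell \<sigma> x * norm (Q x)"]) (auto simp: om_def)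
    have "set_integrable lborel {1<..} (\<lambda>x. norm (Q x))"
    proof (rule set_integrable_subset[of _ "{1..}"])
      have "integrable lborel (\<lambda>x. norm (indicat_real {1..} x *\<^sub>R Q x))"
        using Q(2) unfolding Linf0_def set_integrable_def by (rule integrable_norm)
      then show "set_integrable lborel {1..} (\<lambda>x. norm (Q x))" by (simp add: set_integrable_def)
    qed auto
    then have 2: "set_integrable lborel {1<..} (\<lambda>x. om \<eta> \<sigma> x * norm (Q x))"
      by (subst set_integrable_cong[of lborel lborel "{1<..}" "{1<..}" _ "\<lambda>x. norm (Q x)"]) (auto simp: om_def)
    have un: "{0<..} = {0<..1} \<union> {1::real<..}" by auto
    show ?thesis unfolding un by (rule set_integrable_Un[OF 1 2]) auto
  qed
  have Qkm: "ext0 (Qs k Q) \<in> borel_measurable borel" if "k > 0" for k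
  proof -
    note [measurable] = Qm
    have "ext0 (Qs k Q) = (\<lambda>x. of_real (1 / k\<^sup>2) * ext0 Q (x / k))"
      using that by (auto simp: ext0_def Qs_def fun_eq_iff zero_less_divide_iff)
    then show ?thesis by simp
  qed
  have scaled: "bessel_setup T \<eta> \<sigma> M C0 (Qs k Q)" if "T \<subseteq> ?S" "k \<ge> 1" for T k
  proof
    show "ext0 (Qs k Q) \<in> borel_measurable borel" using that by (intro Qkm) simp
    show "set_integrable lborel {0<..} (\<lambda>x. om \<eta> \<sigma> x * norm (Qs k Q x))"
      by (rule Qs_small(1)[OF \<eta>(1) \<sigma> Qm Qi that(2)])
    show "M \<ge> 0" using e0 by (simp add: M_def)
  qed (use \<eta> \<sigma> C0 SM S\<eta> Sshm that(1) in blast)+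
  have free: "bessel_setup ?S \<eta> \<sigma> M C0 (\<lambda>_. 0)"
  proof
    show "ext0 (\<lambda>_. 0) \<in> borel_measurable borel" by (simp add: ext0_def)
    show "set_integrable lborel {0<..} (\<lambda>x. om \<eta> \<sigma> x * norm (0::complex))" by (simp add: set_integrable_def)
    show "M \<ge> 0" using e0 by (simp add: M_def)
  qed (use \<eta> \<sigma> C0 SM S\<eta> Sshm in blast)+
  interpret F: bessel_setup ?S \<eta> \<sigma> M C0 "\<lambda>_. 0" by (rule free)
  have m0S: "m0 \<in> ?S" using m0 e0 by simp
  have j0: "F.jost m0 \<noteq> 0" by (rule jost_free_nonzero[OF free m0S])
  define I where "I k = (LINT x:{0<..}|lborel. om \<eta> \<sigma> x * norm (Qs k Q x))" for k
  define I0 where "I0 = (LINT x:{0<..}|lborel. om \<eta> \<sigma> x * fRs M (\<lambda>_. 0) x)"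
  \<comment> \<open>Bounds the solution constant \<open>X.K\<close> independently of k as soon as
    the weighted integral of the dilated \<open>Q\<close> is below 1, whence the summand 1 beside
    the free part \<open>I0\<close>.\<close>
  define Kc where "Kc = 2 * F.CC * exp (2 * (2 * F.CC^3 * (I0 + 1)))"
  have CC1: "F.CC \<ge> 1" by (rule F.C1)
  have Kpos: "Kc > 0" "F.K > 0" using CC1 F.K_pos by (auto simp: Kc_def)
  \<comment> \<open>The 1 makes \<open>Kc\<close> applicable; the other entry is the threshold at
    which \<open>jost_diff\<close> excludes a zero at \<open>m0\<close>.\<close>
  define b where "b = min 1 (norm (F.jost m0) * norm (fW m0) / (Kc * F.K))"
  have "b > 0" using j0 F.Wnz[OF m0S] Kpos by (simp add: b_def)
  then have "\<forall>\<^sub>F n in sequentially. I (real (Suc n)) < b"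
    unfolding I_def by (rule order_tendstoD(2)[OF Qs_small(2)[OF \<eta>(1) \<sigma> Qm Qi]])
  then obtain n where n: "I (real (Suc n)) < b" by (auto simp: eventually_sequentially)
  define k where "k = real (Suc n)"
  have k: "k \<ge> 1" "k > 0" by (auto simp: k_def)
  have Ik: "I k < 1" "I k < norm (F.jost m0) * norm (fW m0) / (Kc * F.K)" using n by (auto simp: k_def b_def)
  interpret X: bessel_setup ?S \<eta> \<sigma> M C0 "Qs k Q" by (rule scaled[OF order.refl k(1)])
  have Qki: "set_integrable lborel {0<..} (\<lambda>x. om \<eta> \<sigma> x * norm (Qs k Q x))"
    by (rule Qs_small(1)[OF \<eta>(1) \<sigma> Qm Qi k(1)])
  have "X.jost m0 \<noteq> 0"
  proof
    assume j: "X.jost m0 = 0"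
    have XK: "X.K \<le> Kc"
    proof -
      have "(LINT x:{0<..}|lborel. om \<eta> \<sigma> x * fRs M (Qs k Q) x) = (LINT x:{0<..}|lborel. om \<eta> \<sigma> x * fRs M (\<lambda>_. 0) x + om \<eta> \<sigma> x * norm (Qs k Q x))"
        by (intro set_lebesgue_integral_cong) (auto simp: fRs_def ext0_def algebra_simps)
      also have "\<dots> = I0 + I k"
        unfolding I0_def I_def by (rule set_integral_add(2)[OF F.omR Qki])
      finally have "(LINT x:{0<..}|lborel. om \<eta> \<sigma> x * fRs M (Qs k Q) x) \<le> I0 + 1" using Ik by simp
      moreover have "(LINT y:{0<..}|lborel. X.\<rho> y) = 2 * F.CC^3 * (LINT x:{0<..}|lborel. om \<eta> \<sigma> x * fRs M (Qs k Q) x)"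
        unfolding X.\<rho>_def by (rule set_integral_mult_right)
      ultimately have "(LINT y:{0<..}|lborel. X.\<rho> y) \<le> 2 * F.CC^3 * (I0 + 1)" using CC1 by simp
      then show ?thesis unfolding X.K_def Kc_def using CC1
        by (intro mult_left_mono exp_le_cancel_iff[THEN iffD2]) auto
    qed
    have "norm (X.jost m0 - F.jost m0) * norm (fW m0) \<le> X.K * F.K * (LINT x:{0<..}|lborel. om \<eta> \<sigma> x * norm (Qs k Q x))"
      by (rule jost_diff[OF X.volterra_axioms F.volterra_axioms m0S m0S _ Qki]) (simp add: fR_def ext0_def)
    also have "\<dots> \<le> Kc * F.K * I k"
      unfolding I_def using XK Kpos om_nn[OF \<sigma>] by (intro mult_right_mono set_integral_nonneg') auto
    also have "\<dots> < norm (F.jost m0) * norm (fW m0)"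
      using Ik(2) Kpos by (simp add: field_simps)
    finally show False using j by simp
  qed
  moreover have "continuous_on ?S X.jost" using X.reg_jost by (simp add: reg_def)
  \<comment> \<open>The estimate above holds at \<open>m0\<close> only; regularity of the Jost
    function in \<open>m\<close> extends nonvanishing to a relative neighbourhood.\<close>
  ultimately obtain d where d: "d > 0" "\<And>m. m \<in> ?S \<Longrightarrow> dist m0 m < d \<Longrightarrow> X.jost m \<noteq> 0"
    using continuous_on_avoid[of ?S X.jost m0 0] m0S by blast
  define e where "e = min e0 d"
  let ?T = "\<Omega> \<inter> ball m0 e"
  have T: "?T \<subseteq> ?S" by (auto simp: e_def)
  interpret Y: bessel_setup ?T \<eta> \<sigma> M C0 "Qs k Q" by (rule scaled[OF T k(1)])
  interpret Z: bessel_resolvent ?T \<eta> \<sigma> M C0 "Qs k Q"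
  proof
    fix m assume m: "m \<in> ?T"
    have mS: "m \<in> ?S" using m T by blast
    \<comment> \<open>On the smaller set the solution is chosen anew. Taking \<open>q = 0\<close> in
      \<open>jost_diff\<close> identifies its Jost function with the one known to be
      nonzero.\<close>
    have "norm (Y.jost m - X.jost m) * norm (fW m) \<le> Y.K * X.K * (LINT x:{0<..}|lborel. om \<eta> \<sigma> x * norm (0::complex))"
      by (rule jost_diff[OF Y.volterra_axioms X.volterra_axioms m mS]) (auto simp: set_integrable_def)
    then have "norm (Y.jost m - X.jost m) * norm (fW m) \<le> 0" by simp
    then have "Y.jost m = X.jost m" using X.Wnz[OF mS] by (simp add: mult_le_0_iff)
    then show "Y.jost m \<noteq> 0" using d(2)[OF mS] m by (simp add: e_def)
  qed
  show ?thesis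
    unfolding locally_regular_def
  proof (intro exI conjI ballI allI impI)
    show "e > 0" using e0 d by (simp add: e_def)
    show "in_resolvent (Hm Q m) (- of_real (k\<^sup>2))" if "m \<in> ?T" for m
      by (rule in_resolvent_Qs[OF Z.in_resolvent_Hm[OF that] k(2)])
    fix f g assume fg: "L2 f" "L2 g"
    let ?f = "\<lambda>x. f (1 / k * x)" and ?g = "\<lambda>x. of_real (1 / k\<^sup>2) * g (1 / k * x)"
    have "L2 ?f" "L2 ?g" using fg k by (intro L2_cmult L2_dilate; simp)+
    then have "reg ?T (\<lambda>m. ip ?f (resolv (Hm (Qs k Q) m) (-1) ?g))" by (rule Z.reg_ip)
    then have "reg ?T (\<lambda>m. ip ?f (resolv (Hm (Qs k Q) m) (-1) ?g) / of_real k)"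
      using k by (intro reg_divide) auto
    then show "reg ?T (\<lambda>m. ip f (resolv (Hm Q m) (- of_real (k\<^sup>2)) g))"
      by (rule reg_cong) (rule ip_resolv_Qs[OF Z.in_resolvent_Hm k(2) fg, symmetric])
  qed
qed

lemma shm_bound_ball:
  assumes "m0 \<noteq> 0" "m \<in> ball m0 (norm m0 / 2)"
  shows "norm (shm m (of_real t)) \<le> 2 / norm m0 * (1 + 0 * \<bar>t\<bar>) * exp (\<bar>Re m\<bar> * \<bar>t\<bar>)"
proof -
  have "norm (m0 - m) < norm m0 / 2" using assms(2) by (simp add: dist_norm)
  then have n: "norm m > norm m0 / 2" using norm_triangle_sub[of m0 m] by linarith
  then have "m \<noteq> 0" by auto
  have "1 / norm m \<le> 1 / (norm m0 / 2)" using n assms(1) \<open>m \<noteq> 0\<close> by (intro divide_left_mono) auto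
  then have "1 / norm m * exp (\<bar>Re m\<bar> * \<bar>t\<bar>) \<le> 2 / norm m0 * exp (\<bar>Re m\<bar> * \<bar>t\<bar>)" by (intro mult_right_mono) auto
  then show ?thesis using shm_bound_nonzero[OF \<open>m \<noteq> 0\<close>, of t] by simp
qed

lemma shm_bound_log: "norm (shm m (of_real t)) \<le> 1 * (1 + 1 * \<bar>t\<bar>) * exp (\<bar>Re m\<bar> * \<bar>t\<bar>)"
proof -
  note shm_bound[of m t]
  also have "\<bar>t\<bar> * exp (\<bar>Re m\<bar> * \<bar>t\<bar>) \<le> (1 + \<bar>t\<bar>) * exp (\<bar>Re m\<bar> * \<bar>t\<bar>)" by (intro mult_right_mono) auto
  finally show ?thesis by simp
qed

section \<open>Integrability hypotheses in terms of the weights, and the conclusion\<close>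

lemma L0eps_powr:
  assumes "L0eps \<epsilon> Q"
  shows "set_integrable lborel {0<..1} (\<lambda>x. exp ((1 - \<epsilon>) * ln x) * norm (Q x))"
proof -
  have "integrable lborel (\<lambda>x. norm (indicat_real {0<..1} x *\<^sub>R (of_real (x powr (1 - \<epsilon>)) * Q x)))"
    using assms unfolding L0eps_def set_integrable_def by (rule integrable_norm)
  then have "set_integrable lborel {0<..1} (\<lambda>x. x powr (1 - \<epsilon>) * norm (Q x))"
    by (simp add: set_integrable_def norm_mult)
  then show ?thesis
    by (subst set_integrable_cong[of lborel lborel "{0<..1}" "{0<..1}" _ "\<lambda>x. x powr (1 - \<epsilon>) * norm (Q x)"]) (auto simp: powr_def)
qed

lemma weighted_int_meas:
  assumes "loc_int Q"
  shows "(\<lambda>x. indicat_real {0<..1} x *\<^sub>R (exp ((1 - \<eta>) * ln x) * ell \<sigma> x * norm (Q x))) \<in> borel_measurable borel"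
proof -
  note [measurable] = ext0_meas_loc_int[OF assms]
  have [measurable]: "ell \<sigma> \<in> borel_measurable borel" unfolding ell_def by measurable
  have "(\<lambda>x. indicat_real {0<..1} x *\<^sub>R (exp ((1 - \<eta>) * ln x) * ell \<sigma> x * norm (ext0 Q x))) \<in> borel_measurable borel" by measurable
  then show ?thesis by (rule back_subst[where P="\<lambda>f. f \<in> _"]) (auto simp: fun_eq_iff indicator_def)
qed

theorem theorem6p11:
  fixes Q :: "real \<Rightarrow> complex"
  assumes "loc_int Q" and "Linf0 Q"
  shows "(\<forall>\<epsilon>::real. 0 < \<epsilon> \<longrightarrow> \<epsilon> < 2 \<longrightarrow> L0eps \<epsilon> Q \<longrightarrow>
            regular_family (Hm Q) {m. - \<epsilon> / 2 \<le> Re m})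
       \<and> (L0eps 0 Q \<longrightarrow> regular_family (Hm Q) {m. 0 \<le> Re m \<and> m \<noteq> 0})
       \<and> (L0eps 0 Q \<longrightarrow> L0ln2 Q \<longrightarrow> regular_family (Hm Q) {m. 0 \<le> Re m})"
proof (intro conjI allI impI)
  have nonzero: "locally_regular (Hm Q) \<Omega> m0"
    if "m0 \<in> \<Omega>" "m0 \<noteq> 0" "\<And>m. m \<in> \<Omega> \<Longrightarrow> - (\<eta> / 2) \<le> Re m" "L0eps \<eta> Q" "0 \<le> \<eta>" "\<eta> < 2" for \<Omega> m0 \<eta>
  proof (rule Hm_locally_regular[OF assms that(5,6) order.refl[of 0], where ?C0.0="2 / norm m0" and ?e0.0="norm m0 / 2"])
    show "set_integrable lborel {0<..1} (\<lambda>x. exp ((1 - \<eta>) * ln x) * ell 0 x * norm (Q x))"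
      using L0eps_powr[OF that(4)] by (simp add: ell_def)
    show "norm (shm m (of_real t)) \<le> 2 / norm m0 * (1 + 0 * \<bar>t\<bar>) * exp (\<bar>Re m\<bar> * \<bar>t\<bar>)" if "m \<in> \<Omega> \<inter> ball m0 (norm m0 / 2)" for m t
      using that by (intro shm_bound_ball \<open>m0 \<noteq> 0\<close>) auto
  qed (use that in auto)
  show "regular_family (Hm Q) {m. - \<epsilon> / 2 \<le> Re m}" if \<epsilon>: "0 < \<epsilon>" "\<epsilon> < 2" "L0eps \<epsilon> Q" for \<epsilon>
  proof (rule regular_familyI)
    fix m0 assume m0: "m0 \<in> {m. - \<epsilon> / 2 \<le> Re m}"
    show "locally_regular (Hm Q) {m. - \<epsilon> / 2 \<le> Re m} m0"
    proof (cases "m0 = 0")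
      case False
      show ?thesis by (rule nonzero[OF m0 False _ \<epsilon>(3)]) (use \<epsilon> in auto)
    next
      case True
      have i: "set_integrable lborel {0<..1} (\<lambda>x. (1 + 2 / \<epsilon>) * (exp ((1 - \<epsilon>) * ln x) * norm (Q x)))"
        using L0eps_powr[OF \<epsilon>(3)] by (rule set_integrable_mult_right)
      show ?thesis
      \<comment> \<open>At 0 half of \<open>\<epsilon>\<close> is spent on the logarithm, leaving
        \<open>\<eta> = \<epsilon> / 2\<close>; the ball of radius \<open>\<epsilon> / 4\<close>
        then ensures \<open>Re m \<ge> -\<eta>/2\<close>.\<close>
      proof (rule Hm_locally_regular[OF assms _ _ zero_le_one zero_le_one _ m0, where ?\<eta>="\<epsilon> / 2" and ?e0.0="\<epsilon> / 4"])
        show "set_integrable lborel {0<..1} (\<lambda>x. exp ((1 - \<epsilon> / 2) * ln x) * ell 1 x * norm (Q x))"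
        proof (rule set_integrable_boundI[OF i weighted_int_meas[OF assms(1)]])
          fix x :: real assume x: "x \<in> {0<..1}"
          define t where "t = - ln x"
          have t: "t \<ge> 0" "ln x = - t" using x by (auto simp: t_def)
          have "\<epsilon> / 2 * t \<le> exp (\<epsilon> / 2 * t)" using exp_ge_add_one_self[of "\<epsilon> / 2 * t"] by linarith
          then have "t \<le> 2 / \<epsilon> * exp (\<epsilon> / 2 * t)" using \<epsilon> by (simp add: field_simps)
          moreover have "1 \<le> exp (\<epsilon> / 2 * t)" using \<epsilon> t by simp
          moreover have "(1 + 2 / \<epsilon>) * exp (\<epsilon> / 2 * t) = exp (\<epsilon> / 2 * t) + 2 / \<epsilon> * exp (\<epsilon> / 2 * t)" by (simp add: distrib_right)
          ultimately have "ell 1 x \<le> (1 + 2 / \<epsilon>) * exp (\<epsilon> / 2 * t)"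
            unfolding ell_def t(2) using t(1) by linarith
          then have "exp ((1 - \<epsilon> / 2) * ln x) * ell 1 x \<le> exp ((1 - \<epsilon> / 2) * ln x) * ((1 + 2 / \<epsilon>) * exp (\<epsilon> / 2 * t))"
            by (intro mult_left_mono) auto
          also have "\<dots> = (1 + 2 / \<epsilon>) * exp ((1 - \<epsilon> / 2) * ln x + \<epsilon> / 2 * t)" by (simp only: exp_add ac_simps)
          also have "(1 - \<epsilon> / 2) * ln x + \<epsilon> / 2 * t = (1 - \<epsilon>) * ln x" by (simp add: t_def field_simps)
          finally have "exp ((1 - \<epsilon> / 2) * ln x) * ell 1 x * norm (Q x) \<le> (1 + 2 / \<epsilon>) * exp ((1 - \<epsilon>) * ln x) * norm (Q x)"
            by (intro mult_right_mono) auto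
          then show "norm (exp ((1 - \<epsilon> / 2) * ln x) * ell 1 x * norm (Q x)) \<le> (1 + 2 / \<epsilon>) * (exp ((1 - \<epsilon>) * ln x) * norm (Q x))"
            using ell_ge_1[of 1 x] by (simp add: abs_mult mult.assoc)
        qed
        show "- (\<epsilon> / 2 / 2) \<le> Re m" if "m \<in> {m. - \<epsilon> / 2 \<le> Re m} \<inter> ball m0 (\<epsilon> / 4)" for m
        proof -
          have "norm m < \<epsilon> / 4" using that True by simp
          then show ?thesis using abs_Re_le_cmod[of m] by linarith
        qed
      qed (use \<epsilon> shm_bound_log in auto)
    qed
  qed
  show "regular_family (Hm Q) {m. 0 \<le> Re m \<and> m \<noteq> 0}" if "L0eps 0 Q"
    by (rule regular_familyI, rule nonzero[OF _ _ _ that]) auto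
  show "regular_family (Hm Q) {m. 0 \<le> Re m}" if Q: "L0eps 0 Q" "L0ln2 Q"
  proof (rule regular_familyI)
    fix m0 assume m0: "m0 \<in> {m. 0 \<le> Re m}"
    show "locally_regular (Hm Q) {m. 0 \<le> Re m} m0"
    proof (cases "m0 = 0")
      case False
      show ?thesis by (rule nonzero[OF m0 False _ Q(1)]) auto
    next
      case True
      have "integrable lborel (\<lambda>x. norm (indicat_real {0<..1} x *\<^sub>R (of_real (x * (1 + (ln x)\<^sup>2)) * Q x)))"
        using Q(2) unfolding L0ln2_def set_integrable_def by (rule integrable_norm)
      then have "set_integrable lborel {0<..1} (\<lambda>x. norm (of_real (x * (1 + (ln x)\<^sup>2)) * Q x))"
        by (simp add: set_integrable_def)
      then have i: "set_integrable lborel {0<..1} (\<lambda>x. 2 * norm (of_real (x * (1 + (ln x)\<^sup>2)) * Q x))"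
        by (rule set_integrable_mult_right)
      show ?thesis
      \<comment> \<open>On \<open>Re m \<ge> 0\<close> no exponent is lost, so
        \<open>\<eta> = 0\<close>; the logarithmic bound on \<open>shm\<close> holds for all
        \<open>m\<close>, and the radius 1 is arbitrary.\<close>
      proof (rule Hm_locally_regular[OF assms order.refl[of 0] _ zero_le_one zero_le_one _ m0, where ?e0.0=1])
        show "set_integrable lborel {0<..1} (\<lambda>x. exp ((1 - 0) * ln x) * ell 1 x * norm (Q x))"
        proof (rule set_integrable_boundI[OF i weighted_int_meas[OF assms(1)]])
          fix x :: real assume x: "x \<in> {0<..1}"
          \<comment> \<open>From |ln x| \<le> 1 + (ln x)^2; this 2 is the factor put into the
            majorant \<open>i\<close>.\<close>
          have "ell 1 x \<le> 2 * (1 + (ln x)\<^sup>2)"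
          proof -
            have "\<bar>ln x\<bar> \<le> 1 + (ln x)\<^sup>2" using abs_mult_le_squares[of 1 "ln x"] by simp
            moreover have "1 + 1 * a \<le> 2 * (1 + b)" if "a \<le> 1 + b" "0 \<le> b" for a b :: real using that by simp
            ultimately show ?thesis unfolding ell_def by (metis zero_le_power2)
          qed
          then have "x * ell 1 x * norm (Q x) \<le> x * (2 * (1 + (ln x)\<^sup>2)) * norm (Q x)"
            using x by (intro mult_right_mono mult_left_mono) auto
          moreover have "norm (of_real (x * (1 + (ln x)\<^sup>2)) * Q x) = x * (1 + (ln x)\<^sup>2) * norm (Q x)"
            using x by (simp only: norm_mult norm_of_real) (simp add: abs_mult)
          moreover have "norm (exp ((1 - 0) * ln x) * ell 1 x * norm (Q x)) = x * ell 1 x * norm (Q x)"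
            using x ell_ge_1[of 1 x] by (simp add: abs_mult)
          ultimately show "norm (exp ((1 - 0) * ln x) * ell 1 x * norm (Q x)) \<le> 2 * norm (of_real (x * (1 + (ln x)\<^sup>2)) * Q x)"
            by (simp only: ac_simps)
        qed
        show "norm (shm m (of_real t)) \<le> 1 * (1 + 1 * \<bar>t\<bar>) * exp (\<bar>Re m\<bar> * \<bar>t\<bar>)" for m t by (rule shm_bound_log)
      qed auto
    qed
  qed
qed

end
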